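(* There exists a universal constant $C>0$ such that, for the class $\mathcal{F}$ of linear halfspaces in $\mathbb{R}^d$ in the realizable case, there exists a learning algorithm with polynomial running time which, given an i.i.d. sample of size $n$, has an output $\hat f$ such that for every $\delta\in(0,1)$, with probability at least $1-\delta$, $$R(\hat f)\le C\left(\frac{d\log(d)}{n}+\frac{\log(\frac1\delta)}{n}\right).$$
   Context: Linear halfspaces in $\mathbb{R}^d$ are $\{1,-1\}$-valued classifiers given by (not necessarily homogeneous) hyperplanes in $\mathbb{R}^d$. Realizable case: the sample consists of i.i.d. pairs $(X_i,Y_i)$ distributed as $(X,Y)$ on $\mathbb{R}^d\times\{1,-1\}$ with an unknown distribution such that $Y=f^*(X)$ for some $f^*\in\mathcal{F}$. The risk is $R(f)=P(f(X)\ne Y)$. $\log(x)$ denotes the truncated logarithm $\ln(\max(x,e))$. *)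

theory Defs
  imports "HOL-Probability.Probability" "HOL-Library.Log_Nat"
    "HOL-Computational_Algebra.Polynomial"
begin

type_synonym point = "nat \<Rightarrow> real"
type_synonym classifier = "point \<Rightarrow> int"
type_synonym sample = "nat \<Rightarrow> point \<times> int"

abbreviation labels :: "int set" where "labels \<equiv> {1, -1}"

text \<open>The dimension varies inside the main statement, so \<open>\<real>\<^sup>d\<close> is the product of \<open>d\<close> copies
  of the Borel line, indexed by \<open>{..<d}\<close>.\<close>

definition Rd :: "nat \<Rightarrow> point measure" where
  "Rd d = Pi\<^sub>M {..<d} (\<lambda>_. borel)"

definition halfspace :: "nat \<Rightarrow> point \<Rightarrow> real \<Rightarrow> classifier" where
  "halfspace d w b x = (if (\<Sum>j<d. w j * x j) + b \<ge> 0 then 1 else -1)"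

text \<open>The normal vector must be nonzero: a classifier in the class is given by a hyperplane.\<close>

definition halfspaces :: "nat \<Rightarrow> classifier set" where
  "halfspaces d = {halfspace d w b | w b. \<exists>j<d. w j \<noteq> 0}"

definition example_space :: "nat \<Rightarrow> (point \<times> int) measure" where
  "example_space d = Rd d \<Otimes>\<^sub>M count_space labels"

definition realizable_by :: "nat \<Rightarrow> (point \<times> int) measure \<Rightarrow> classifier \<Rightarrow> bool" where
  "realizable_by d P f \<longleftrightarrow>
     prob_space P \<and> sets P = sets (example_space d) \<and> (AE z in P. snd z = f (fst z))"

definition risk :: "(point \<times> int) measure \<Rightarrow> classifier \<Rightarrow> real" where
  "risk P f = measure P {z \<in> space P. f (fst z) \<noteq> snd z}"

definition tlog :: "real \<Rightarrow> real" where
  "tlog x = ln (max x (exp 1))"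

text \<open>Algorithms are while-programs of a real-number random access machine: counters hold natural
  numbers and serve as array indices, array cells hold real numbers and are subject to exact field
  arithmetic and comparison.  There is no rounding operation, and the only constants are integers,
  so no information can be hidden in a program.  One and the same program is run on arbitrary real
  data; its running time is measured in the bit model, which makes sense on rational data.\<close>

datatype nexp =
    NConst nat
  | NVar string
  | NPlus nexp nexp
  | NMinus nexp nexp
  | NTimes nexp nexp

datatype rexp =
    RConst int
  | RNat nexp
  | RCell string nexp
  | RPlus rexp rexp
  | RMinus rexp rexp
  | RTimes rexp rexp
  | RDivide rexp rexp

datatype bexp =
    NLess nexp nexp
  | RLess rexp rexp
  | BNot bexp
  | BAnd bexp bexp

datatype com =
    Skip
  | NAssign string nexp
  | RAssign string nexp rexp
  | Seq com com
  | If bexp com com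
  | While bexp com

record state =
  counter :: "string \<Rightarrow> nat"
  cell :: "string \<Rightarrow> nat \<Rightarrow> real"

fun nval :: "state \<Rightarrow> nexp \<Rightarrow> nat" where
  "nval s (NConst k) = k"
| "nval s (NVar v) = counter s v"
| "nval s (NPlus a b) = nval s a + nval s b"
| "nval s (NMinus a b) = nval s a - nval s b"
| "nval s (NTimes a b) = nval s a * nval s b"

fun rval :: "state \<Rightarrow> rexp \<Rightarrow> real" where
  "rval s (RConst k) = of_int k"
| "rval s (RNat a) = real (nval s a)"
| "rval s (RCell v a) = cell s v (nval s a)"
| "rval s (RPlus a b) = rval s a + rval s b"
| "rval s (RMinus a b) = rval s a - rval s b"
| "rval s (RTimes a b) = rval s a * rval s b"
| "rval s (RDivide a b) = rval s a / rval s b"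

fun bval :: "state \<Rightarrow> bexp \<Rightarrow> bool" where
  "bval s (NLess a b) = (nval s a < nval s b)"
| "bval s (RLess a b) = (rval s a < rval s b)"
| "bval s (BNot a) = (\<not> bval s a)"
| "bval s (BAnd a b) = (bval s a \<and> bval s b)"

definition nat_bits :: "nat \<Rightarrow> nat" where
  "nat_bits m = 1 + floorlog 2 m"

text \<open>Numerator and denominator of a rational number are taken in lowest terms.  The value on
  irrational numbers is a dummy: running times are only bounded on rational data, and from such
  data a program never leaves the rational numbers.\<close>

definition real_bits :: "real \<Rightarrow> nat" where
  "real_bits x =
     (if x \<in> \<rat>
      then let (p, q) = quotient_of (THE r. of_rat r = x)
           in nat_bits (nat \<bar>p\<bar>) + nat_bits (nat q)
      else 1)"

text \<open>An expression costs the total bit length of the values of all its subexpressions; this is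
  polynomially related to the time a Turing machine needs to evaluate it.\<close>

fun ncost :: "state \<Rightarrow> nexp \<Rightarrow> nat" where
  "ncost s (NConst k) = nat_bits k"
| "ncost s (NVar v) = nat_bits (counter s v)"
| "ncost s (NPlus a b) = ncost s a + ncost s b + nat_bits (nval s (NPlus a b))"
| "ncost s (NMinus a b) = ncost s a + ncost s b + nat_bits (nval s (NMinus a b))"
| "ncost s (NTimes a b) = ncost s a + ncost s b + nat_bits (nval s (NTimes a b))"

fun rcost :: "state \<Rightarrow> rexp \<Rightarrow> nat" where
  "rcost s (RConst k) = real_bits (of_int k)"
| "rcost s (RNat a) = ncost s a + real_bits (rval s (RNat a))"
| "rcost s (RCell v a) = ncost s a + real_bits (rval s (RCell v a))"
| "rcost s (RPlus a b) = rcost s a + rcost s b + real_bits (rval s (RPlus a b))"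
| "rcost s (RMinus a b) = rcost s a + rcost s b + real_bits (rval s (RMinus a b))"
| "rcost s (RTimes a b) = rcost s a + rcost s b + real_bits (rval s (RTimes a b))"
| "rcost s (RDivide a b) = rcost s a + rcost s b + real_bits (rval s (RDivide a b))"

fun bcost :: "state \<Rightarrow> bexp \<Rightarrow> nat" where
  "bcost s (NLess a b) = ncost s a + ncost s b"
| "bcost s (RLess a b) = rcost s a + rcost s b"
| "bcost s (BNot a) = 1 + bcost s a"
| "bcost s (BAnd a b) = 1 + bcost s a + bcost s b"

definition set_counter :: "string \<Rightarrow> nat \<Rightarrow> state \<Rightarrow> state" where
  "set_counter v k s = s\<lparr>counter := (counter s)(v := k)\<rparr>"

definition set_cell :: "string \<Rightarrow> nat \<Rightarrow> real \<Rightarrow> state \<Rightarrow> state" where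
  "set_cell v i r s = s\<lparr>cell := (cell s)(v := (cell s v)(i := r))\<rparr>"

text \<open>\<open>exec c s t s'\<close>: started in \<open>s\<close>, program \<open>c\<close> halts in \<open>s'\<close> after time \<open>t\<close>.\<close>

inductive exec :: "com \<Rightarrow> state \<Rightarrow> nat \<Rightarrow> state \<Rightarrow> bool" where
  Skip: "exec Skip s 1 s"
| NAssign: "exec (NAssign v a) s (1 + ncost s a) (set_counter v (nval s a) s)"
| RAssign: "exec (RAssign v a e) s (1 + ncost s a + rcost s e)
              (set_cell v (nval s a) (rval s e) s)"
| Seq: "exec c1 s1 t1 s2 \<Longrightarrow> exec c2 s2 t2 s3 \<Longrightarrow> exec (Seq c1 c2) s1 (t1 + t2) s3"
| IfTrue: "bval s b \<Longrightarrow> exec c1 s t s' \<Longrightarrow> exec (If b c1 c2) s (1 + bcost s b + t) s'"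
| IfFalse: "\<not> bval s b \<Longrightarrow> exec c2 s t s' \<Longrightarrow> exec (If b c1 c2) s (1 + bcost s b + t) s'"
| WhileFalse: "\<not> bval s b \<Longrightarrow> exec (While b c) s (1 + bcost s b) s"
| WhileTrue: "bval s1 b \<Longrightarrow> exec c s1 t1 s2 \<Longrightarrow> exec (While b c) s2 t2 s3 \<Longrightarrow>
    exec (While b c) s1 (1 + bcost s1 b + t1 + t2) s3"

inductive_cases exec_elims:
  "exec Skip s t s'"
  "exec (NAssign v a) s t s'"
  "exec (RAssign v a e) s t s'"
  "exec (Seq c1 c2) s t s'"
  "exec (If b c1 c2) s t s'"
  "exec (While b c) s t s'"

lemma exec_deterministic:
  "exec c s t s' \<Longrightarrow> exec c s u r \<Longrightarrow> u = t \<and> r = s'"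
proof (induction arbitrary: u r rule: exec.induct)
  case (Seq c1 s1 t1 s2 c2 t2 s3)
  from Seq.prems obtain u1 u2 r2
    where 1: "exec c1 s1 u1 r2" and 2: "exec c2 r2 u2 r" and u: "u = u1 + u2"
    by (rule exec_elims(4))
  from Seq.IH(1)[OF 1] have r2: "u1 = t1" "r2 = s2" by simp_all
  from Seq.IH(2)[OF 2[unfolded r2]] r2 u show ?case by simp
next
  case (WhileTrue s1 b c t1 s2 t2 s3)
  from WhileTrue.prems obtain u1 u2 r2
    where 1: "exec c s1 u1 r2" and 2: "exec (While b c) r2 u2 r"
      and u: "u = 1 + bcost s1 b + u1 + u2"
    by (rule exec_elims(6)) (use WhileTrue.hyps(1) in simp_all)
  from WhileTrue.IH(1)[OF 1] have r2: "u1 = t1" "r2 = s2" by simp_all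
  from WhileTrue.IH(2)[OF 2[unfolded r2]] r2 u show ?case by simp
next
  case (IfTrue s b c1 t s' c2)
  from IfTrue.prems obtain u1
    where 1: "exec c1 s u1 r" and u: "u = 1 + bcost s b + u1"
    by (rule exec_elims(5)) (use IfTrue.hyps(1) in simp_all)
  from IfTrue.IH[OF 1] u show ?case by simp
next
  case (IfFalse s b c2 t s' c1)
  from IfFalse.prems obtain u1
    where 1: "exec c2 s u1 r" and u: "u = 1 + bcost s b + u1"
    by (rule exec_elims(5)) (use IfFalse.hyps(1) in simp_all)
  from IfFalse.IH[OF 1] u show ?case by simp
next
  case (WhileFalse s b c)
  from WhileFalse.prems show ?case
    by (rule exec_elims(6)) (use WhileFalse.hyps(1) in simp_all)
qed (erule exec_elims(1-3); simp)+

text \<open>A learning algorithm consists of a training program, which turns the sample into a memory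
  state representing the output classifier, and a program that evaluates this classifier at a given
  point.  The output need not be a halfspace.  The same two programs serve all dimensions and all
  sample sizes.\<close>

record learner =
  training :: com
  prediction :: com

text \<open>Coordinate \<open>j\<close> of the \<open>i\<close>-th sample point is stored in cell \<open>i * d + j\<close>.\<close>

definition load_sample :: "nat \<Rightarrow> nat \<Rightarrow> sample \<Rightarrow> state" where
  "load_sample d n S =
     \<lparr>counter = (\<lambda>_. 0)(''d'' := d, ''n'' := n),
      cell = (\<lambda>_ _. 0)
        (''X'' := \<lambda>k. if k < n * d then fst (S (k div d)) (k mod d) else 0,
         ''Y'' := \<lambda>i. if i < n then of_int (snd (S i)) else 0)\<rparr>"

definition load_point :: "nat \<Rightarrow> point \<Rightarrow> state \<Rightarrow> state" where
  "load_point d x s = s\<lparr>cell := (cell s)(''x'' := \<lambda>j. if j < d then x j else 0)\<rparr>"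

definition outputs :: "learner \<Rightarrow> nat \<Rightarrow> nat \<Rightarrow> sample \<Rightarrow> classifier \<Rightarrow> bool" where
  "outputs A d n S f \<longleftrightarrow>
     f \<in> Rd d \<rightarrow>\<^sub>M count_space labels \<and>
     (\<exists>t s. exec (training A) (load_sample d n S) t s \<and>
        (\<forall>x\<in>space (Rd d). \<exists>t' s'. exec (prediction A) (load_point d x s) t' s' \<and>
           cell s' ''label'' 0 = of_int (f x)))"

definition samples :: "nat \<Rightarrow> nat \<Rightarrow> sample set" where
  "samples d n = space (Pi\<^sub>M {..<n} (\<lambda>_. example_space d))"

definition realizable_sample :: "nat \<Rightarrow> nat \<Rightarrow> sample \<Rightarrow> bool" where
  "realizable_sample d n S \<longleftrightarrow>
     S \<in> samples d n \<and> (\<exists>f\<in>halfspaces d. \<forall>i<n. snd (S i) = f (fst (S i)))"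

definition realizable_learner :: "learner \<Rightarrow> bool" where
  "realizable_learner A \<longleftrightarrow>
     (\<forall>d\<ge>1. \<forall>n S. realizable_sample d n S \<longrightarrow> (\<exists>f. outputs A d n S f))"

definition rational_point :: "nat \<Rightarrow> point \<Rightarrow> bool" where
  "rational_point d x \<longleftrightarrow> (\<forall>j<d. x j \<in> \<rat>)"

definition point_size :: "nat \<Rightarrow> point \<Rightarrow> nat" where
  "point_size d x = (\<Sum>j<d. real_bits (x j))"

definition sample_size :: "nat \<Rightarrow> nat \<Rightarrow> sample \<Rightarrow> nat" where
  "sample_size d n S = d + n + (\<Sum>i<n. point_size d (fst (S i)))"

text \<open>Training takes time polynomial in the bit length of the sample, and so does every evaluation
  of the output classifier in the bit length of sample and point together.  The polynomial does not
  depend on the dimension.\<close>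

definition polynomial_time :: "learner \<Rightarrow> bool" where
  "polynomial_time A \<longleftrightarrow>
     (\<exists>p :: nat poly. \<forall>d\<ge>1. \<forall>n S.
        realizable_sample d n S \<and> (\<forall>i<n. rational_point d (fst (S i))) \<longrightarrow>
        (\<exists>t s. exec (training A) (load_sample d n S) t s \<and>
           t \<le> poly p (sample_size d n S) \<and>
           (\<forall>x\<in>space (Rd d). rational_point d x \<longrightarrow>
              (\<exists>t' s'. exec (prediction A) (load_point d x s) t' s' \<and>
                 t' \<le> poly p (sample_size d n S + point_size d x)))))"

end

theory Submission
  imports Defs "Jordan_Normal_Form.Determinant"
begin

text \<open>A consistent halfspace is not enough for the bound without a factor \<open>ln n\<close>; the output has to be
  stable.  Write an example as a vector \<open>a\<^sub>i = y\<^sub>i (x\<^sub>i, 1) / c\<^sub>i\<close> and let \<open>z\<close> be the point of minimum norm in the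
  convex hull of the \<open>a\<^sub>i\<close>, which is the direction of maximal margin.  With \<open>m = d + 1\<close>, the point \<open>z\<close> is
  already determined by at most \<open>m\<close> of the examples.  Sort the indices \<open>i\<close> into the \<open>2 m\<close> classes modulo
  \<open>2 m\<close>: at least half of the classes avoid these examples, so a classifier computed from \<open>z\<close> is
  determined by some classes and consistent with at least a quarter of the sample independent of them.  A union
  bound over the sets of classes gives risk \<open>O((m + ln (1 / \<delta>)) / n)\<close>.

  The point \<open>z\<close> itself need not be computed.  An ellipsoid method with rounding yields \<open>w\<close> within
  \<open>2\<^sup>-\<^sup>K\<close> of \<open>z\<close>, for \<open>K = 0, 1, \<dots>\<close> until \<open>2\<^sup>-\<^sup>K\<close> is comparable with \<open>\<bar>z\<bar>\<^sup>2\<close>.  Rounding \<open>w\<close> to the grid of mesh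
  \<open>2\<^sup>-\<^sup>K\<close> gives a consistent halfspace that is one of \<open>5 \<cdot> 3\<^sup>m\<close> functions of \<open>z\<close>, and a union bound over
  these functions is affordable.  On rational data \<open>\<bar>z\<bar>\<close> is bounded below by Cramer's rule, hence \<open>K\<close>
  remains polynomial in the bit length.\<close>

section \<open>Running time and bit length of programs\<close>

text \<open>The union bound is the reason for the residue classes: there are at most 4^m sets of
  classes, whatever \<open>n\<close> is, while choosing the determining examples themselves would
  cost about n^m and bring \<open>ln n\<close> back. It also dictates the rounding: the iterates of
  a numerical method depend on every example, so the output has to be tied to \<open>z\<close> up to
  a number of alternatives exponential in \<open>m\<close> only. A candidate has rational
  coordinates and hence countably many possible values; summing over these values replaces
  conditioning on the sample. On arbitrary real data \<open>z\<close> can be arbitrarily short, so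
  no precision fixed in advance works and \<open>K\<close> must be searched for. Programs have field
  arithmetic but neither square roots nor rounding; hence ellipsoids enter through support
  functions, roots are replaced by powers of two, and rounding is a binary search. The risk bound
  obtained is of order (d + ln (1 / \<delta>)) / n, which implies the stated one because
  \<open>tlog\<close> is at least 1.\<close>

definition fits :: "nat \<Rightarrow> real \<Rightarrow> bool" where
  "fits b x \<longleftrightarrow> (\<exists>p q :: int. x = of_int p / of_int q \<and> 0 < q \<and> \<bar>p\<bar> < 2 ^ b \<and> q \<le> 2 ^ b)"

lemma fitsI: "x = of_int p / of_int q \<Longrightarrow> 0 < q \<Longrightarrow> \<bar>p\<bar> < 2 ^ b \<Longrightarrow> q \<le> 2 ^ b \<Longrightarrow> fits b x"
  unfolding fits_def by blast

lemma fits_mono: "fits b x \<Longrightarrow> b \<le> c \<Longrightarrow> fits c x"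
proof -
  assume a: "fits b x" "b \<le> c"
  have le: "(2::int) ^ b \<le> 2 ^ c" using a(2) by (intro power_increasing) auto
  from a(1) obtain p q where "x = of_int p / of_int q" "0 < q" "\<bar>p\<bar> < 2 ^ b" "q \<le> 2 ^ b"
    unfolding fits_def by auto
  with le show ?thesis by (intro fitsI[where p = p and q = q]) linarith+
qed

lemma fits_rat: "fits b x \<Longrightarrow> x \<in> \<rat>"
  unfolding fits_def by auto

lemma fits_uminus: "fits b x \<Longrightarrow> fits b (- x)"
  unfolding fits_def by (metis abs_minus_cancel minus_divide_left of_int_minus)

text \<open>Fractions need not be in lowest terms, so arithmetic is bounded without cancelling. Only
  the numerator is bounded strictly: the denominator may be 1 or \<open>2 ^ b\<close>, so that 0
  fits for every \<open>b\<close> and, for positive \<open>b\<close>, the mesh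
  \<open>1 / 2 ^ b\<close> costs no extra bit.\<close>

lemma fits_add:
  assumes "fits b x" "fits c y"
  shows "fits (b + c + 1) (x + y)"
proof -
  obtain p q where 1: "x = of_int p / of_int q" "0 < q" "\<bar>p\<bar> < 2 ^ b" "q \<le> 2 ^ b"
    using assms unfolding fits_def by auto
  obtain r t where 2: "y = of_int r / of_int t" "0 < t" "\<bar>r\<bar> < 2 ^ c" "t \<le> 2 ^ c"
    using assms unfolding fits_def by auto
  have "\<bar>p * t\<bar> < 2 ^ b * 2 ^ c"
    unfolding abs_mult using 1 2 by (intro mult_less_le_imp_less) auto
  moreover have "\<bar>q * r\<bar> < 2 ^ b * 2 ^ c"
    unfolding abs_mult using 1 2 by (intro mult_le_less_imp_less) auto
  ultimately have "\<bar>p * t + q * r\<bar> < 2 * (2 ^ b * 2 ^ c)" by linarith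
  hence "\<bar>p * t + r * q\<bar> < 2 ^ (b + c + 1)" by (simp add: power_add mult_ac)
  moreover have "q * t \<le> 2 ^ b * 2 ^ c"
    using 1 2 by (intro mult_mono) auto
  ultimately show ?thesis using 1 2
    by (intro fitsI[where p = "p * t + r * q" and q = "q * t"]) (auto simp: field_simps power_add)
qed

lemma fits_diff: "fits b x \<Longrightarrow> fits c y \<Longrightarrow> fits (b + c + 1) (x - y)"
  using fits_add[of b x c "- y"] fits_uminus[of c y] by simp

lemma fits_mult:
  assumes "fits b x" "fits c y"
  shows "fits (b + c) (x * y)"
proof -
  obtain p q where 1: "x = of_int p / of_int q" "0 < q" "\<bar>p\<bar> < 2 ^ b" "q \<le> 2 ^ b"
    using assms unfolding fits_def by auto
  obtain r t where 2: "y = of_int r / of_int t" "0 < t" "\<bar>r\<bar> < 2 ^ c" "t \<le> 2 ^ c"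
    using assms unfolding fits_def by auto
  have "\<bar>p * r\<bar> < 2 ^ b * 2 ^ c"
    unfolding abs_mult using 1 2 by (intro mult_strict_mono) auto
  moreover have "q * t \<le> 2 ^ b * 2 ^ c"
    using 1 2 by (intro mult_mono) auto
  ultimately show ?thesis using 1 2
    by (intro fitsI[where p = "p * r" and q = "q * t"]) (auto simp: power_add)
qed

lemma fits_divide:
  assumes "fits b x" "fits c y"
  shows "fits (b + c) (x / y)"
proof -
  obtain p q where 1: "x = of_int p / of_int q" "0 < q" "\<bar>p\<bar> < 2 ^ b" "q \<le> 2 ^ b"
    using assms unfolding fits_def by auto
  obtain r t where 2: "y = of_int r / of_int t" "0 < t" "\<bar>r\<bar> < 2 ^ c" "t \<le> 2 ^ c"
    using assms unfolding fits_def by auto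
  show ?thesis
  proof (cases "r = 0")
    \<comment> \<open>Here \<open>y = 0\<close>, and the quotient is 0 by convention.\<close>
    case True
    then show ?thesis using 2 by (intro fitsI[where p = 0 and q = 1]) auto
  next
    case False
    have "\<bar>p * t\<bar> < 2 ^ b * 2 ^ c"
      unfolding abs_mult using 1 2 by (intro mult_less_le_imp_less) auto
    hence "\<bar>p * t * sgn r\<bar> < 2 ^ (b + c)"
      using False by (simp add: abs_mult abs_sgn_eq power_add)
    moreover have "q * \<bar>r\<bar> \<le> 2 ^ b * 2 ^ c"
      using 1 2 by (intro mult_mono) auto
    hence "q * \<bar>r\<bar> \<le> 2 ^ (b + c)" by (simp add: power_add)
    moreover have "x / y = of_int (p * t * sgn r) / of_int (q * \<bar>r\<bar>)"
      unfolding 1(1) 2(1) using False by (cases "r > 0") auto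
    moreover have "0 < q * \<bar>r\<bar>" using 1 False by simp
    ultimately show ?thesis by (intro fitsI)
  qed
qed

lemma fits_0 [simp]: "fits b 0"
  by (rule fitsI[where p = 0 and q = 1]) auto

lemma fits_of_int: "\<bar>k\<bar> < 2 ^ b \<Longrightarrow> fits b (of_int k)"
  by (rule fitsI[where p = k and q = 1]) auto

lemma fits_of_nat: "k < 2 ^ b \<Longrightarrow> fits b (real k)"
  using fits_of_int[of "int k" b] by (simp flip: of_nat_power)

lemma fits_numeral: "numeral k < (2::nat) ^ b \<Longrightarrow> fits b (numeral k)"
  using fits_of_nat[of "numeral k" b] by simp

lemma fits_1: "1 \<le> b \<Longrightarrow> fits b 1"
  by (rule fitsI[where p = 1 and q = 1]) auto

lemma fits_sum:
  assumes "\<And>i. i < n \<Longrightarrow> fits b (f i)"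
  shows "fits (n * (b + 1)) (\<Sum>i<n. f i)"
  using assms
proof (induction n)
  case (Suc n)
  have "fits (n * (b + 1) + b + 1) ((\<Sum>i<n. f i) + f n)"
    using Suc by (intro fits_add) auto
  then show ?case by (simp add: add_ac)
qed auto

section \<open>Bit lengths of fractions in lowest terms\<close>

lemma nat_bits_less: "m < 2 ^ b \<Longrightarrow> nat_bits m \<le> b + 1"
  unfolding nat_bits_def by (simp add: floorlog_le_iff)

lemma less_nat_bits: "m < 2 ^ nat_bits m"
  using floorlog_leD[of 2 m "nat_bits m"] unfolding nat_bits_def by auto

text \<open>The reduced denominator is coprime to the reduced numerator and so divides every other
  denominator. Lowest terms therefore minimise numerator and denominator at once, and any
  representation bounds \<open>real_bits\<close>.\<close>

lemma quotient_of_minimal: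
  fixes x :: real
  assumes "x = of_int p / of_int q" "0 < q"
  obtains p' q' where "quotient_of (THE r. of_rat r = x) = (p', q')"
    "\<bar>p'\<bar> \<le> \<bar>p\<bar>" "0 < q'" "q' \<le> q" "x = of_int p' / of_int q'"
proof -
  define r where "r = (of_int p / of_int q :: rat)"
  have x: "x = of_rat r" using assms by (simp add: r_def of_rat_divide)
  have the: "(THE r. of_rat r = x) = r" unfolding x by (rule the_equality) auto
  obtain p' q' where pq: "quotient_of r = (p', q')" by (cases "quotient_of r")
  have q': "0 < q'" using quotient_of_denom_pos[OF pq] .
  have r: "r = of_int p' / of_int q'" using quotient_of_div[OF pq] .
  have cop: "coprime p' q'" using quotient_of_coprime[OF pq] .
  have "(of_int p :: rat) * of_int q' = of_int p' * of_int q"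
    using r q' assms by (simp add: r_def field_simps)
  hence eq: "p * q' = p' * q" by (metis of_int_eq_iff of_int_mult)
  have "q' dvd p' * q" using eq by (metis dvd_triv_right)
  hence "q' dvd q" using cop by (metis coprime_commute coprime_dvd_mult_right_iff)
  then obtain k where k: "q = q' * k" by auto
  hence kpos: "k \<ge> 1" using assms q' by (smt (verit) zero_less_mult_iff)
  have "p = p' * k" using eq k q' by auto
  hence "\<bar>p'\<bar> \<le> \<bar>p\<bar>" using kpos by (simp add: abs_mult mult_le_cancel_left1)
  moreover have "q' \<le> q" using k kpos q' by (simp add: mult_le_cancel_left1)
  moreover have "x = of_int p' / of_int q'" unfolding x r by (simp add: of_rat_divide)
  ultimately show ?thesis using that the pq q' by auto
qed

lemma real_bits_fits: "fits b x \<Longrightarrow> real_bits x \<le> 2 * b + 3"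
proof -
  assume f: "fits b x"
  then obtain p q where 1: "x = of_int p / of_int q" "0 < q" "\<bar>p\<bar> < 2 ^ b" "q \<le> 2 ^ b"
    unfolding fits_def by auto
  obtain p' q' where 2: "quotient_of (THE r. of_rat r = x) = (p', q')"
    "\<bar>p'\<bar> \<le> \<bar>p\<bar>" "0 < q'" "q' \<le> q" using quotient_of_minimal[OF 1(1,2)] by metis
  have "int (nat \<bar>p'\<bar>) < 2 ^ b" "int (nat q') < 2 ^ (b + 1)" using 1 2 by auto
  hence "nat \<bar>p'\<bar> < 2 ^ b" "nat q' < 2 ^ (b + 1)"
    by (metis of_nat_less_iff of_nat_numeral of_nat_power)+
  note this[THEN nat_bits_less]
  with 2 fits_rat[OF f] show ?thesis unfolding real_bits_def by simp
qed

lemma fits_real_bits: "x \<in> \<rat> \<Longrightarrow> fits (real_bits x) x"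
proof -
  assume x: "x \<in> \<rat>"
  then obtain p q where 1: "x = of_int p / of_int q" "0 < q"
    by (metis Rats_cases')
  obtain p' q' where 2: "quotient_of (THE r. of_rat r = x) = (p', q')"
    "0 < q'" "x = of_int p' / of_int q'" using quotient_of_minimal[OF 1] by metis
  have rb: "real_bits x = nat_bits (nat \<bar>p'\<bar>) + nat_bits (nat q')"
    using x 2 by (simp add: real_bits_def)
  have "int (nat \<bar>p'\<bar>) < 2 ^ nat_bits (nat \<bar>p'\<bar>)" "int (nat q') < 2 ^ nat_bits (nat q')"
    using less_nat_bits[of "nat \<bar>p'\<bar>"] less_nat_bits[of "nat q'"]
    by (metis of_nat_less_iff of_nat_numeral of_nat_power)+
  moreover have "(2::int) ^ nat_bits (nat \<bar>p'\<bar>) \<le> 2 ^ real_bits x" "(2::int) ^ nat_bits (nat q') \<le> 2 ^ real_bits x"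
    by (intro power_increasing; simp add: rb)+
  ultimately have "\<bar>p'\<bar> < 2 ^ real_bits x" "q' \<le> 2 ^ real_bits x" using 2(2) by linarith+
  thus ?thesis using 2 by (intro fitsI[where p = p' and q = q'])
qed

text \<open>Syntactic factors: if all stored numbers have \<open>b\<close> bits, the value of an
  expression has at most \<open>nsz\<close> or \<open>rsz\<close> times \<open>b + 1\<close> bits,
  and evaluating it costs at most \<open>nwt\<close>, \<open>rwt\<close> or \<open>bwt\<close> times
  \<open>b + 1\<close>. The unit is \<open>b + 1\<close> rather than \<open>b\<close> so that
  constants are covered when \<open>b = 0\<close>.\<close>

fun nsz :: "nexp \<Rightarrow> nat" where
  "nsz (NConst k) = nat_bits k"
| "nsz (NVar v) = 1"
| "nsz (NPlus a b) = nsz a + nsz b"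
| "nsz (NMinus a b) = nsz a + nsz b"
| "nsz (NTimes a b) = nsz a + nsz b"

fun nwt :: "nexp \<Rightarrow> nat" where
  "nwt (NConst k) = nat_bits k"
| "nwt (NVar v) = 1"
| "nwt (NPlus a b) = nwt a + nwt b + nsz a + nsz b + 1"
| "nwt (NMinus a b) = nwt a + nwt b + nsz a + nsz b + 1"
| "nwt (NTimes a b) = nwt a + nwt b + nsz a + nsz b + 1"

text \<open>The summand 1 pays for the carry in \<open>fits_add\<close>; products and quotients of
  fractions need only the sum of the lengths.\<close>

fun rsz :: "rexp \<Rightarrow> nat" where
  "rsz (RConst k) = nat_bits (nat \<bar>k\<bar>)"
| "rsz (RNat a) = nsz a"
| "rsz (RCell v a) = 1"
| "rsz (RPlus a b) = rsz a + rsz b + 1"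
| "rsz (RMinus a b) = rsz a + rsz b + 1"
| "rsz (RTimes a b) = rsz a + rsz b + 1"
| "rsz (RDivide a b) = rsz a + rsz b + 1"

fun rwt :: "rexp \<Rightarrow> nat" where
  "rwt (RConst k) = 2 * nat_bits (nat \<bar>k\<bar>) + 3"
| "rwt (RNat a) = nwt a + 2 * nsz a + 3"
| "rwt (RCell v a) = nwt a + 5"
| "rwt (RPlus a b) = rwt a + rwt b + 2 * (rsz a + rsz b + 1) + 3"
| "rwt (RMinus a b) = rwt a + rwt b + 2 * (rsz a + rsz b + 1) + 3"
| "rwt (RTimes a b) = rwt a + rwt b + 2 * (rsz a + rsz b + 1) + 3"
| "rwt (RDivide a b) = rwt a + rwt b + 2 * (rsz a + rsz b + 1) + 3"

fun bwt :: "bexp \<Rightarrow> nat" where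
  "bwt (NLess a b) = nwt a + nwt b"
| "bwt (RLess a b) = rwt a + rwt b"
| "bwt (BNot a) = bwt a + 1"
| "bwt (BAnd a b) = bwt a + bwt b + 1"

definition state_fits :: "nat \<Rightarrow> state \<Rightarrow> bool" where
  "state_fits b s \<longleftrightarrow> (\<forall>v i. fits b (cell s v i)) \<and> (\<forall>v. counter s v < 2 ^ b)"

lemma nat_bits_pos [simp]: "0 < nat_bits m" "Suc 0 \<le> nat_bits m"
  by (simp_all add: nat_bits_def)

lemma nsz_pos [simp]: "0 < nsz a"
  by (induction a) auto

lemma power2_le_nat: "a \<le> b \<Longrightarrow> (2::nat) ^ a \<le> 2 ^ b"
  by (rule power_increasing) auto

text \<open>For u, v at least 2, u + v is at most u v; hence even sums only add bit lengths, as long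
  as these are positive.\<close>

lemma add_less_power2:
  assumes "x < (2::nat) ^ a" "y < 2 ^ b" "0 < a" "0 < b"
  shows "x + y < 2 ^ (a + b)"
proof -
  have "(2::nat) ^ a \<ge> 2" "(2::nat) ^ b \<ge> 2"
    using power2_le_nat[of 1 a] power2_le_nat[of 1 b] assms by auto
  then obtain u v where uv: "(2::nat) ^ a = 2 + u" "(2::nat) ^ b = 2 + v" by (metis le_iff_add)
  have "(2::nat) ^ a + 2 ^ b \<le> 2 ^ a * 2 ^ b" unfolding uv by (simp add: algebra_simps)
  thus ?thesis using assms by (simp add: power_add)
qed

lemma nval_bound: "state_fits b s \<Longrightarrow> nval s a < 2 ^ (nsz a * (b + 1))"
proof (induction a)
  case (NConst k)
  have "nat_bits k \<le> nat_bits k * (b + 1)" by simp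
  from order.strict_trans2[OF less_nat_bits power2_le_nat[OF this]]
  show ?case by (simp only: nval.simps nsz.simps)
next
  case (NVar v)
  then have "counter s v < 2 ^ b" by (simp add: state_fits_def)
  then show ?case by simp
next
  case (NPlus a1 a2)
  then show ?case
    using add_less_power2[of "nval s a1" "nsz a1 * (b + 1)" "nval s a2" "nsz a2 * (b + 1)"]
    by (simp add: add_mult_distrib add_ac)
next
  case (NMinus a1 a2)
  have "nval s (NMinus a1 a2) \<le> nval s a1" by simp
  also have "\<dots> < 2 ^ (nsz a1 * (b + 1))" by (rule NMinus.IH(1)[OF NMinus.prems])
  also have "\<dots> \<le> 2 ^ (nsz (NMinus a1 a2) * (b + 1))" by (intro power2_le_nat mult_le_mono1) simp
  finally show ?case .
next
  case (NTimes a1 a2)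
  show ?case unfolding nval.simps nsz.simps add_mult_distrib power_add
    by (rule mult_strict_mono) (use NTimes in auto)
qed

lemma ncost_bound: "state_fits b s \<Longrightarrow> ncost s a \<le> nwt a * (b + 1)"
proof (induction a)
  case (NVar v)
  then show ?case using nat_bits_less[of "counter s v" b] by (simp add: state_fits_def)
next
  case (NPlus a1 a2)
  then show ?case using nat_bits_less[OF nval_bound[OF NPlus.prems, of "NPlus a1 a2"]]
    by (simp add: algebra_simps)
next
  case (NMinus a1 a2)
  then show ?case using nat_bits_less[OF nval_bound[OF NMinus.prems, of "NMinus a1 a2"]]
    by (simp add: algebra_simps)
next
  case (NTimes a1 a2)
  then show ?case using nat_bits_less[OF nval_bound[OF NTimes.prems, of "NTimes a1 a2"]]
    by (simp add: algebra_simps)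
qed simp

lemma fits_const: "fits (nat_bits (nat \<bar>k\<bar>)) (of_int k)"
proof (rule fits_of_int)
  have "int (nat \<bar>k\<bar>) < 2 ^ nat_bits (nat \<bar>k\<bar>)"
    using less_nat_bits[of "nat \<bar>k\<bar>"] by (metis of_nat_less_iff of_nat_numeral of_nat_power)
  thus "\<bar>k\<bar> < 2 ^ nat_bits (nat \<bar>k\<bar>)" by simp
qed

lemma rval_fits: "state_fits b s \<Longrightarrow> fits (rsz e * (b + 1)) (rval s e)"
proof (induction e)
  case (RConst k)
  show ?case using fits_mono[OF fits_const, of k "nat_bits (nat \<bar>k\<bar>) * (b + 1)"] by simp
next
  case (RNat a)
  show ?case using fits_of_nat[OF nval_bound[OF RNat.prems, of a]] by simp
next
  case (RCell v a)
  then show ?case using fits_mono[of b "cell s v (nval s a)" "b + 1"] by (simp add: state_fits_def)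
next
  case (RPlus a1 a2)
  then show ?case
    using fits_mono[OF fits_add, of "rsz a1 * (b + 1)" "rval s a1" "rsz a2 * (b + 1)" "rval s a2"
        "(rsz a1 + rsz a2 + 1) * (b + 1)"] by (simp add: algebra_simps)
next
  case (RMinus a1 a2)
  then show ?case
    using fits_mono[OF fits_diff, of "rsz a1 * (b + 1)" "rval s a1" "rsz a2 * (b + 1)" "rval s a2"
        "(rsz a1 + rsz a2 + 1) * (b + 1)"] by (simp add: algebra_simps)
next
  case (RTimes a1 a2)
  then show ?case
    using fits_mono[OF fits_mult, of "rsz a1 * (b + 1)" "rval s a1" "rsz a2 * (b + 1)" "rval s a2"
        "(rsz a1 + rsz a2 + 1) * (b + 1)"] by (simp add: algebra_simps)
next
  case (RDivide a1 a2)
  then show ?case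
    using fits_mono[OF fits_divide, of "rsz a1 * (b + 1)" "rval s a1" "rsz a2 * (b + 1)" "rval s a2"
        "(rsz a1 + rsz a2 + 1) * (b + 1)"] by (simp add: algebra_simps)
qed

lemma rcost_bound: "state_fits b s \<Longrightarrow> rcost s e \<le> rwt e * (b + 1)"
proof (induction e)
  case (RConst k)
  show ?case using real_bits_fits[OF fits_const, of k] by simp
next
  case (RNat a)
  then show ?case using real_bits_fits[OF rval_fits[OF RNat.prems, of "RNat a"]] ncost_bound[OF RNat.prems, of a]
    by (simp add: algebra_simps)
next
  case (RCell v a)
  then show ?case using real_bits_fits[of b "cell s v (nval s a)"] ncost_bound[OF RCell.prems, of a]
    by (simp add: algebra_simps state_fits_def)
next
  case (RPlus a1 a2)
  then show ?case using real_bits_fits[OF rval_fits[OF RPlus.prems, of "RPlus a1 a2"]]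
    by (simp add: algebra_simps)
next
  case (RMinus a1 a2)
  then show ?case using real_bits_fits[OF rval_fits[OF RMinus.prems, of "RMinus a1 a2"]]
    by (simp add: algebra_simps)
next
  case (RTimes a1 a2)
  then show ?case using real_bits_fits[OF rval_fits[OF RTimes.prems, of "RTimes a1 a2"]]
    by (simp add: algebra_simps)
next
  case (RDivide a1 a2)
  then show ?case using real_bits_fits[OF rval_fits[OF RDivide.prems, of "RDivide a1 a2"]]
    by (simp add: algebra_simps)
qed

lemma bcost_bound: "state_fits b s \<Longrightarrow> bcost s e \<le> bwt e * (b + 1)"
proof (induction e)
  case (NLess a1 a2)
  then show ?case using ncost_bound[OF NLess.prems, of a1] ncost_bound[OF NLess.prems, of a2]
    by (simp add: algebra_simps)
next
  case (RLess a1 a2)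
  then show ?case using rcost_bound[OF RLess.prems, of a1] rcost_bound[OF RLess.prems, of a2]
    by (simp add: algebra_simps)
qed (auto simp: algebra_simps)

section \<open>A program logic with frames and costs\<close>

fun cvars :: "com \<Rightarrow> string set" where
  "cvars (NAssign v a) = {v}"
| "cvars (Seq c1 c2) = cvars c1 \<union> cvars c2"
| "cvars (If b c1 c2) = cvars c1 \<union> cvars c2"
| "cvars (While b c) = cvars c"
| "cvars _ = {}"

fun rvars :: "com \<Rightarrow> string set" where
  "rvars (RAssign v a e) = {v}"
| "rvars (Seq c1 c2) = rvars c1 \<union> rvars c2"
| "rvars (If b c1 c2) = rvars c1 \<union> rvars c2"
| "rvars (While b c) = rvars c"
| "rvars _ = {}"

text \<open>Arrays are tracked as wholes: a program that writes one cell may have changed the entire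
  array. Untouched variables come for free from \<open>exec_frame\<close>.\<close>

definition frame :: "com \<Rightarrow> state \<Rightarrow> state \<Rightarrow> bool" where
  "frame c s s' \<longleftrightarrow> (\<forall>v. v \<notin> cvars c \<longrightarrow> counter s' v = counter s v) \<and>
     (\<forall>v. v \<notin> rvars c \<longrightarrow> cell s' v = cell s v)"

lemma counter_set_counter [simp]: "counter (set_counter v k s) = (counter s)(v := k)"
  and cell_set_counter [simp]: "cell (set_counter v k s) = cell s"
  and counter_set_cell [simp]: "counter (set_cell v i r s) = counter s"
  and cell_set_cell [simp]: "cell (set_cell v i r s) = (cell s)(v := (cell s v)(i := r))"
  by (simp_all add: set_counter_def set_cell_def)

lemma exec_frame: "exec c s t s' \<Longrightarrow> frame c s s'"
  by (induction rule: exec.induct) (auto simp: frame_def)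

text \<open>Data are rational exactly when the flag \<open>fl\<close> is set; only then time and bit lengths are
  bounded.  A step of weight one costs \<open>b + 1\<close>, where \<open>b\<close> bounds the bit length of all stored
  numbers.\<close>

definition runs :: "bool \<Rightarrow> nat \<Rightarrow> com \<Rightarrow> state \<Rightarrow> nat \<Rightarrow> (state \<Rightarrow> bool) \<Rightarrow> bool" where
  "runs fl b c s n Q \<longleftrightarrow> ((fl \<longrightarrow> state_fits b s) \<longrightarrow>
     (\<exists>t s'. exec c s t s' \<and> (fl \<longrightarrow> state_fits b s') \<and> (fl \<longrightarrow> t \<le> n * (b + 1)) \<and> Q s'))"

text \<open>Weakening hands over the frame of the run, so a specification has to describe only what
  its program writes.\<close>

lemma runs_weaken:
  assumes "runs fl b c s n Q" "\<And>s'. frame c s s' \<Longrightarrow> Q s' \<Longrightarrow> Q' s'" "n \<le> n'"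
  shows "runs fl b c s n' Q'"
proof -
  have "n * (b + 1) \<le> n' * (b + 1)" using assms(3) by (rule mult_le_mono1)
  with assms(1,2) show ?thesis
    unfolding runs_def by (meson exec_frame order_trans)
qed

lemma runs_time: "runs fl b c s n Q \<Longrightarrow> n \<le> n' \<Longrightarrow> runs fl b c s n' Q"
  by (rule runs_weaken) auto

text \<open>The bit bound may be assumed of the initial state. Loop bounds are themselves stored in
  counters, so this yields that loop counters fit in \<open>b\<close> bits.\<close>

lemma runs_fits: "((fl \<Longrightarrow> state_fits b s) \<Longrightarrow> runs fl b c s n Q) \<Longrightarrow> runs fl b c s n Q"
  unfolding runs_def by blast

lemma runs_Skip: "Q s \<Longrightarrow> runs fl b Skip s 1 Q"
  unfolding runs_def using exec.Skip by fastforce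

lemma runs_NAssign:
  assumes "fl \<Longrightarrow> nval s a < 2 ^ b" "Q (set_counter v (nval s a) s)"
  shows "runs fl b (NAssign v a) s (1 + nwt a) Q"
  unfolding runs_def
proof
  assume ok: "fl \<longrightarrow> state_fits b s"
  have "fl \<longrightarrow> state_fits b (set_counter v (nval s a) s)"
    using ok assms(1) by (auto simp: state_fits_def)
  moreover have "fl \<longrightarrow> 1 + ncost s a \<le> (1 + nwt a) * (b + 1)"
    using ok ncost_bound[of b s a] by auto
  ultimately show "\<exists>t s'. exec (NAssign v a) s t s' \<and> (fl \<longrightarrow> state_fits b s') \<and>
      (fl \<longrightarrow> t \<le> (1 + nwt a) * (b + 1)) \<and> Q s'"
    using exec.NAssign assms(2) by blast
qed

lemma runs_RAssign:
  assumes "fl \<Longrightarrow> fits b (rval s e)" "Q (set_cell v (nval s a) (rval s e) s)"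
  shows "runs fl b (RAssign v a e) s (1 + nwt a + rwt e) Q"
  unfolding runs_def
proof
  assume ok: "fl \<longrightarrow> state_fits b s"
  have "fl \<longrightarrow> state_fits b (set_cell v (nval s a) (rval s e) s)"
    using ok assms(1) by (auto simp: state_fits_def)
  moreover have "fl \<longrightarrow> 1 + ncost s a + rcost s e \<le> (1 + nwt a + rwt e) * (b + 1)"
    using ok ncost_bound[of b s a] rcost_bound[of b s e] by (auto simp: algebra_simps)
  ultimately show "\<exists>t s'. exec (RAssign v a e) s t s' \<and> (fl \<longrightarrow> state_fits b s') \<and>
      (fl \<longrightarrow> t \<le> (1 + nwt a + rwt e) * (b + 1)) \<and> Q s'"
    using exec.RAssign assms(2) by blast
qed

lemma runs_Seq:
  assumes "runs fl b c1 s n1 (\<lambda>s'. runs fl b c2 s' n2 Q)"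
  shows "runs fl b (Seq c1 c2) s (n1 + n2) Q"
  unfolding runs_def
proof
  assume "fl \<longrightarrow> state_fits b s"
  then obtain t1 s1 t2 s2 where "exec c1 s t1 s1" "fl \<longrightarrow> t1 \<le> n1 * (b + 1)"
    and "exec c2 s1 t2 s2" "fl \<longrightarrow> state_fits b s2" "fl \<longrightarrow> t2 \<le> n2 * (b + 1)" "Q s2"
    using assms unfolding runs_def by blast
  thus "\<exists>t s'. exec (Seq c1 c2) s t s' \<and> (fl \<longrightarrow> state_fits b s') \<and>
      (fl \<longrightarrow> t \<le> (n1 + n2) * (b + 1)) \<and> Q s'"
    by (intro exI[of _ "t1 + t2"] exI[of _ s2]) (auto intro: exec.Seq simp: algebra_simps)
qed

lemma runs_If:
  assumes "bval s e \<Longrightarrow> runs fl b c1 s n Q" "\<not> bval s e \<Longrightarrow> runs fl b c2 s n Q"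
  shows "runs fl b (If e c1 c2) s (1 + bwt e + n) Q"
  unfolding runs_def
proof
  assume ok: "fl \<longrightarrow> state_fits b s"
  have c: "fl \<longrightarrow> bcost s e \<le> bwt e * (b + 1)" using ok bcost_bound by auto
  show "\<exists>t s'. exec (If e c1 c2) s t s' \<and> (fl \<longrightarrow> state_fits b s') \<and>
      (fl \<longrightarrow> t \<le> (1 + bwt e + n) * (b + 1)) \<and> Q s'"
  proof (cases "bval s e")
    case True
    then obtain t s' where "exec c1 s t s'" "fl \<longrightarrow> state_fits b s'" "fl \<longrightarrow> t \<le> n * (b + 1)" "Q s'"
      using assms(1) ok unfolding runs_def by blast
    thus ?thesis using exec.IfTrue[OF True, of c1 t s' c2] c
      by (intro exI[of _ "1 + bcost s e + t"] exI[of _ s']) (auto simp: algebra_simps)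
  next
    case False
    then obtain t s' where "exec c2 s t s'" "fl \<longrightarrow> state_fits b s'" "fl \<longrightarrow> t \<le> n * (b + 1)" "Q s'"
      using assms(2) ok unfolding runs_def by blast
    thus ?thesis using exec.IfFalse[OF False, of c2 t s' c1] c
      by (intro exI[of _ "1 + bcost s e + t"] exI[of _ s']) (auto simp: algebra_simps)
  qed
qed

text \<open>\<open>k\<close> counts the finished rounds; the loop ends at the latest after \<open>N\<close> of them.\<close>

lemma runs_While:
  assumes I0: "I 0 s"
    and step: "\<And>k s'. I k s' \<Longrightarrow> frame (While e c) s s' \<Longrightarrow> bval s' e \<Longrightarrow>
      k < N \<and> runs fl b c s' n (I (Suc k))"
    and exit: "\<And>k s'. I k s' \<Longrightarrow> frame (While e c) s s' \<Longrightarrow> \<not> bval s' e \<Longrightarrow> Q s'"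
  shows "runs fl b (While e c) s (N * (1 + bwt e + n) + 1 + bwt e) Q"
proof -
  have "runs fl b (While e c) s' ((N - k) * (1 + bwt e + n) + 1 + bwt e) Q"
    if "I k s'" "frame (While e c) s s'" for k s'
    using that
  proof (induction "N - k" arbitrary: k s' rule: less_induct)
    case less
    show ?case
      unfolding runs_def
    proof
      assume ok: "fl \<longrightarrow> state_fits b s'"
      have c: "fl \<longrightarrow> bcost s' e \<le> bwt e * (b + 1)" using ok bcost_bound by auto
      show "\<exists>t s''. exec (While e c) s' t s'' \<and> (fl \<longrightarrow> state_fits b s'') \<and>
        (fl \<longrightarrow> t \<le> ((N - k) * (1 + bwt e + n) + 1 + bwt e) * (b + 1)) \<and> Q s''"
      proof (cases "bval s' e")
        case True
        with step less.prems have kN: "k < N" and r: "runs fl b c s' n (I (Suc k))" by auto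
        from r ok obtain t1 s1 where 1: "exec c s' t1 s1" "fl \<longrightarrow> state_fits b s1"
          "fl \<longrightarrow> t1 \<le> n * (b + 1)" "I (Suc k) s1" unfolding runs_def by blast
        have fr: "frame (While e c) s s1"
          using less.prems(2) exec_frame[OF 1(1)] by (auto simp: frame_def)
        from less.hyps[of "Suc k" s1] kN 1(4) fr
        have "runs fl b (While e c) s1 ((N - Suc k) * (1 + bwt e + n) + 1 + bwt e) Q" by auto
        then obtain t2 s2 where 2: "exec (While e c) s1 t2 s2" "fl \<longrightarrow> state_fits b s2"
          "fl \<longrightarrow> t2 \<le> ((N - Suc k) * (1 + bwt e + n) + 1 + bwt e) * (b + 1)" "Q s2"
          using 1 unfolding runs_def by blast
        obtain M where M: "N - Suc k = M" "N - k = Suc M" using kN by auto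
        have "fl \<longrightarrow> 1 + bcost s' e + t1 + t2 \<le> ((N - k) * (1 + bwt e + n) + 1 + bwt e) * (b + 1)"
          using 1(3) 2(3) c unfolding M by (auto simp: algebra_simps)
        thus ?thesis using True exec.WhileTrue[OF True 1(1) 2(1)] 2 by blast
      next
        case False
        have "fl \<longrightarrow> 1 + bcost s' e \<le> ((N - k) * (1 + bwt e + n) + 1 + bwt e) * (b + 1)"
          using c by (auto simp: algebra_simps)
        thus ?thesis using False exec.WhileFalse[OF False] ok exit[OF less.prems False] by blast
      qed
    qed
  qed
  from this[of 0 s] I0 show ?thesis by (simp add: frame_def)
qed

definition For :: "string \<Rightarrow> string \<Rightarrow> com \<Rightarrow> com" where
  "For i v c = Seq (NAssign i (NConst 0))
     (While (NLess (NVar i) (NVar v)) (Seq c (NAssign i (NPlus (NVar i) (NConst 1)))))"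

lemma cvars_For [simp]: "cvars (For i v c) = insert i (cvars c)"
  and rvars_For [simp]: "rvars (For i v c) = rvars c"
  by (auto simp: For_def)

lemma nat_bits_0 [simp]: "nat_bits 0 = 1" and nat_bits_1 [simp]: "nat_bits (Suc 0) = 2"
  by (simp_all add: nat_bits_def floorlog_def)

text \<open>The invariant is insensitive to the loop counter because the counter advances after the
  body; the body receives its value separately. Each round adds 3 for the test and 8 for the
  increment to the cost of the body.\<close>

lemma runs_For:
  assumes N: "counter s v = N" and iv: "i \<noteq> v" "i \<notin> cvars c" "v \<notin> cvars c"
    and I0: "I 0 s"
    and I_counter: "\<And>k s x. I k s \<Longrightarrow> I k (set_counter i x s)"
    and step: "\<And>k s'. k < N \<Longrightarrow> I k s' \<Longrightarrow> counter s' i = k \<Longrightarrow> frame (For i v c) s s' \<Longrightarrow>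
      runs fl b c s' n (I (Suc k))"
    and post: "\<And>s'. I N s' \<Longrightarrow> frame (For i v c) s s' \<Longrightarrow> Q s'"
  shows "runs fl b (For i v c) s (N * (n + 11) + 6) Q"
proof (rule runs_fits)
  assume ok: "fl \<Longrightarrow> state_fits b s"
  let ?c = "Seq c (NAssign i (NPlus (NVar i) (NConst 1)))"
  let ?e = "NLess (NVar i) (NVar v)"
  let ?s = "set_counter i 0 s"
  have Nb: "fl \<Longrightarrow> N < 2 ^ b" using ok N by (auto simp: state_fits_def)
  have fr: "frame (For i v c) s s'" if "frame (While ?e ?c) ?s s'" for s'
    using that by (auto simp: frame_def)
  define J where "J k s' \<longleftrightarrow> I k s' \<and> counter s' i = k \<and> k \<le> N" for k s'
  have cv: "counter s' v = N" if "frame (While ?e ?c) ?s s'" for s'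
    using that N iv by (auto simp: frame_def)
  have *: "runs fl b (While ?e ?c) ?s (N * (1 + bwt ?e + (n + (1 + nwt (NPlus (NVar i) (NConst 1))))) + 1 + bwt ?e) Q"
  proof (rule runs_While[where I = J])
    show "J 0 ?s" using I0 I_counter by (auto simp: J_def)
    show "k < N \<and> runs fl b ?c s' (n + (1 + nwt (NPlus (NVar i) (NConst 1)))) (J (Suc k))"
      if "J k s'" "frame (While ?e ?c) ?s s'" "bval s' ?e" for k s'
    proof -
      have k: "I k s'" "counter s' i = k" "k < N" using that cv[of s'] by (auto simp: J_def)
      have "runs fl b c s' n (I (Suc k))" using step[OF k(3,1,2)] fr that by auto
      hence "runs fl b ?c s' (n + (1 + nwt (NPlus (NVar i) (NConst 1)))) (J (Suc k))"
      proof (intro runs_Seq, elim runs_weaken)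
        fix s'' assume s'': "frame c s' s''" "I (Suc k) s''"
        have "counter s'' i = k" using s'' k iv by (auto simp: frame_def)
        thus "runs fl b (NAssign i (NPlus (NVar i) (NConst 1))) s'' (1 + nwt (NPlus (NVar i) (NConst 1))) (J (Suc k))"
          using k Nb s'' by (intro runs_NAssign) (auto simp: J_def intro: I_counter)
      qed auto
      thus ?thesis using k by auto
    qed
    show "Q s'" if "J k s'" "frame (While ?e ?c) ?s s'" "\<not> bval s' ?e" for k s'
    proof -
      have "k = N" using that cv[of s'] by (auto simp: J_def)
      thus ?thesis using post that fr by (auto simp: J_def)
    qed
  qed
  show "runs fl b (For i v c) s (N * (n + 11) + 6) Q"
    unfolding For_def
    by (rule runs_time, rule runs_Seq, rule runs_NAssign) (use * in \<open>auto simp: algebra_simps\<close>)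
qed

section \<open>Inner products and determinants\<close>

definition ip :: "nat \<Rightarrow> (nat \<Rightarrow> real) \<Rightarrow> (nat \<Rightarrow> real) \<Rightarrow> real" where
  "ip m u v = (\<Sum>j<m. u j * v j)"

abbreviation nrm2 :: "nat \<Rightarrow> (nat \<Rightarrow> real) \<Rightarrow> real" where
  "nrm2 m u \<equiv> ip m u u"

definition qf :: "nat \<Rightarrow> (nat \<Rightarrow> nat \<Rightarrow> real) \<Rightarrow> (nat \<Rightarrow> real) \<Rightarrow> real" where
  "qf m P u = (\<Sum>i<m. \<Sum>j<m. u i * P i j * u j)"

definition fmat :: "nat \<Rightarrow> (nat \<Rightarrow> nat \<Rightarrow> real) \<Rightarrow> real mat" where
  "fmat m P = Matrix.mat m m (\<lambda>(i, j). P i j)"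

lemma ip_commute: "ip m u v = ip m v u"
  by (simp add: ip_def mult.commute)

lemma ip_add: "ip m u (\<lambda>j. v j + w j) = ip m u v + ip m u w"
  and ip_diff: "ip m u (\<lambda>j. v j - w j) = ip m u v - ip m u w"
  and ip_scale: "ip m u (\<lambda>j. c * v j) = c * ip m u v"
  and ip_add_left: "ip m (\<lambda>j. v j + w j) u = ip m v u + ip m w u"
  and ip_diff_left: "ip m (\<lambda>j. v j - w j) u = ip m v u - ip m w u"
  and ip_scale_left: "ip m (\<lambda>j. c * v j) u = c * ip m v u"
  by (simp_all add: ip_def sum.distrib sum_subtractf sum_distrib_left algebra_simps)

lemmas ip_linear = ip_add ip_diff ip_scale ip_add_left ip_diff_left ip_scale_left

lemma ip_cong: "(\<And>j. j < m \<Longrightarrow> u j = u' j) \<Longrightarrow> (\<And>j. j < m \<Longrightarrow> v j = v' j) \<Longrightarrow> ip m u v = ip m u' v'"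
  by (simp add: ip_def)

lemma ip_sum: "ip m u (\<lambda>j. \<Sum>i\<in>I. l i * a i j) = (\<Sum>i\<in>I. l i * ip m u (a i))"
  unfolding ip_def by (simp add: sum_distrib_left mult_ac) (rule sum.swap)

lemma nrm2_nonneg [simp]: "0 \<le> nrm2 m u"
  by (simp add: ip_def sum_nonneg)

lemma nrm2_eq_0: "nrm2 m u = 0 \<longleftrightarrow> (\<forall>j<m. u j = 0)"
  by (auto simp: ip_def sum_nonneg_eq_0_iff)

lemma coord_le_nrm2: "j < m \<Longrightarrow> (u j)\<^sup>2 \<le> nrm2 m u"
  unfolding ip_def power2_eq_square by (rule member_le_sum) auto

lemma ip_cauchy_schwarz: "(ip m u v)\<^sup>2 \<le> nrm2 m u * nrm2 m v"
proof -
  have "(ip m u v)\<^sup>2 \<le> (\<Sum>j<m. (u j)\<^sup>2) * (\<Sum>j<m. (v j)\<^sup>2)"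
    unfolding ip_def by (rule Cauchy_Schwarz_ineq_sum)
  thus ?thesis by (simp add: ip_def power2_eq_square)
qed

section \<open>Bounds on determinants and their behaviour under perturbation\<close>

lemma det_row_sum_bound:
  assumes A: "(A :: real mat) \<in> carrier_mat n n"
  shows "\<bar>Determinant.det A\<bar> \<le> (\<Prod>i<n. \<Sum>j<n. \<bar>A $$ (i, j)\<bar>)"
proof -
  let ?S = "{0..<n}"
  have "\<bar>Determinant.det A\<bar> \<le> (\<Sum>p | p permutes ?S. \<bar>signof p * (\<Prod>i = 0..<n. A $$ (i, p i))\<bar>)"
    unfolding det_def'[OF A] by (rule sum_abs)
  also have "\<dots> = (\<Sum>p | p permutes ?S. (\<Prod>i = 0..<n. \<bar>A $$ (i, p i)\<bar>))"
    by (intro sum.cong refl) (simp add: abs_mult abs_prod sign_def)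
  \<comment> \<open>Restriction turns permutations into elements of \<open>PiE\<close> and is
    injective, since permutations are the identity outside the index range.\<close>
  also have "\<dots> = (\<Sum>p \<in> (\<lambda>p. restrict p ?S) ` {p. p permutes ?S}. (\<Prod>i = 0..<n. \<bar>A $$ (i, p i)\<bar>))"
  proof (subst sum.reindex)
    show "inj_on (\<lambda>p. restrict p ?S) {p. p permutes ?S}"
    proof (rule inj_onI)
      fix p q assume "p \<in> {p. p permutes ?S}" "q \<in> {p. p permutes ?S}" and e: "restrict p ?S = restrict q ?S"
      then show "p = q" by (intro ext) (metis mem_Collect_eq permutes_def restrict_apply)
    qed
  qed (auto intro!: sum.cong prod.cong)
  \<comment> \<open>Leibniz's formula runs over permutations only; admitting all functions gives the
    expanded product of the row sums.\<close>
  also have "\<dots> \<le> (\<Sum>p \<in> PiE ?S (\<lambda>_. ?S). (\<Prod>i = 0..<n. \<bar>A $$ (i, p i)\<bar>))"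
  proof (rule sum_mono2)
    show "(\<lambda>p. restrict p ?S) ` {p. p permutes ?S} \<subseteq> PiE ?S (\<lambda>_. ?S)"
      by (auto simp: PiE_def Pi_def permutes_in_image extensional_def)
  qed (auto intro!: finite_PiE prod_nonneg)
  also have "\<dots> = (\<Prod>i\<in>?S. \<Sum>j\<in>?S. \<bar>A $$ (i, j)\<bar>)"
    by (rule prod_sum_PiE[symmetric]) auto
  finally show ?thesis by (simp add: atLeast0LessThan)
qed

text \<open>The matrix determinant lemma for a column U and a row V. Unit triangular factors on both
  sides turn the block triangular matrix with diagonal 1 + U V, 1 into the one with diagonal 1, 1 +
  V U.\<close>

lemma det_one_plus_rank_one:
  assumes U: "(U :: real mat) \<in> carrier_mat n 1" and V: "V \<in> carrier_mat 1 n"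
  shows "Determinant.det (1\<^sub>m n + U * V) = 1 + (V * U) $$ (0, 0)"
proof -
  let ?M1 = "four_block_mat (1\<^sub>m n) (0\<^sub>m n 1) V (1\<^sub>m 1)"
  let ?M2 = "four_block_mat (1\<^sub>m n + U * V) U (0\<^sub>m 1 n) (1\<^sub>m 1)"
  let ?M3 = "four_block_mat (1\<^sub>m n) (0\<^sub>m n 1) (- V) (1\<^sub>m 1)"
  let ?N = "four_block_mat (1\<^sub>m n) U (0\<^sub>m 1 n) (1\<^sub>m 1 + V * U)"
  have UV: "U * V \<in> carrier_mat n n" and VU: "V * U \<in> carrier_mat 1 1" using U V by auto
  have c: "?M1 \<in> carrier_mat (n + 1) (n + 1)" "?M2 \<in> carrier_mat (n + 1) (n + 1)"
    "?M3 \<in> carrier_mat (n + 1) (n + 1)" using U V UV by auto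
  have "?M1 * ?M2 = four_block_mat (1\<^sub>m n * (1\<^sub>m n + U * V) + 0\<^sub>m n 1 * 0\<^sub>m 1 n) (1\<^sub>m n * U + 0\<^sub>m n 1 * 1\<^sub>m 1)
      (V * (1\<^sub>m n + U * V) + 1\<^sub>m 1 * 0\<^sub>m 1 n) (V * U + 1\<^sub>m 1 * 1\<^sub>m 1)"
    by (rule mult_four_block_mat) (use U V UV in auto)
  also have "\<dots> = four_block_mat (1\<^sub>m n + U * V) U (V * (1\<^sub>m n + U * V)) (V * U + 1\<^sub>m 1)"
    using U V UV VU by (intro cong_four_block_mat) auto
  finally have 1: "?M1 * ?M2 = \<dots>" .
  have "(?M1 * ?M2) * ?M3 = four_block_mat ((1\<^sub>m n + U * V) * 1\<^sub>m n + U * (- V)) ((1\<^sub>m n + U * V) * 0\<^sub>m n 1 + U * 1\<^sub>m 1)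
      (V * (1\<^sub>m n + U * V) * 1\<^sub>m n + (V * U + 1\<^sub>m 1) * (- V)) (V * (1\<^sub>m n + U * V) * 0\<^sub>m n 1 + (V * U + 1\<^sub>m 1) * 1\<^sub>m 1)"
    unfolding 1 by (rule mult_four_block_mat) (use U V UV VU in auto)
  also have "\<dots> = ?N"
  proof (intro cong_four_block_mat)
    show "(1\<^sub>m n + U * V) * 1\<^sub>m n + U * (- V) = 1\<^sub>m n"
      using U V UV by (intro eq_matI) auto
    show "(1\<^sub>m n + U * V) * 0\<^sub>m n 1 + U * 1\<^sub>m 1 = U"
      using U V UV by (intro eq_matI) auto
    have "V * (1\<^sub>m n + U * V) = V + V * U * V"
      using U V UV by (subst mult_add_distrib_mat[of _ 1 n]) (auto simp: assoc_mult_mat[of _ 1 n _ 1 _ n])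
    moreover have "(V * U + 1\<^sub>m 1) * (- V) = - (V * U * V) + - V"
      using U V VU by (subst add_mult_distrib_mat[of _ 1 1]) auto
    ultimately show "V * (1\<^sub>m n + U * V) * 1\<^sub>m n + (V * U + 1\<^sub>m 1) * (- V) = 0\<^sub>m 1 n"
      using U V VU by (intro eq_matI) (auto)
    show "V * (1\<^sub>m n + U * V) * 0\<^sub>m n 1 + (V * U + 1\<^sub>m 1) * 1\<^sub>m 1 = 1\<^sub>m 1 + V * U"
      using U V UV VU by (intro eq_matI) auto
  qed
  finally have N: "(?M1 * ?M2) * ?M3 = ?N" .
  have "Determinant.det ?M1 = 1" "Determinant.det ?M3 = 1"
    using U V det_four_block_mat_upper_right_zero[of "1\<^sub>m n" n "0\<^sub>m n 1" 1 V "1\<^sub>m 1"]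
      det_four_block_mat_upper_right_zero[of "1\<^sub>m n" n "0\<^sub>m n 1" 1 "- V" "1\<^sub>m 1"] by auto
  moreover have "Determinant.det ?M2 = Determinant.det (1\<^sub>m n + U * V)"
    using U V UV det_four_block_mat_lower_left_zero[of "1\<^sub>m n + U * V" n U 1 "0\<^sub>m 1 n" "1\<^sub>m 1"] by auto
  moreover have "Determinant.det ?N = Determinant.det (1\<^sub>m 1 + V * U)"
    using U V VU det_four_block_mat_lower_left_zero[of "1\<^sub>m n" n U 1 "0\<^sub>m 1 n" "1\<^sub>m 1 + V * U"] by auto
  moreover have "Determinant.det (1\<^sub>m 1 + V * U) = 1 + (V * U) $$ (0, 0)"
    using U V VU by (subst det_single) auto
  moreover have "Determinant.det ((?M1 * ?M2) * ?M3) = Determinant.det ?M1 * Determinant.det ?M2 * Determinant.det ?M3"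
    using c by (simp add: det_mult[of _ "n + 1"])
  ultimately show ?thesis using N by simp
qed

text \<open>As \<open>p\<close> is \<open>P\<close> applied to \<open>g\<close>, the updated matrix
  is the product of \<open>P\<close> with 1 - k g p, where \<open>g\<close> is a column and
  \<open>p\<close> a row.\<close>

lemma det_rank_one_downdate:
  assumes sym: "\<And>i j. i < m \<Longrightarrow> j < m \<Longrightarrow> P i j = P j i"
    and p: "\<And>i. i < m \<Longrightarrow> p i = (\<Sum>j<m. P i j * g j)"
  shows "Determinant.det (fmat m (\<lambda>i j. P i j - k * p i * p j)) = Determinant.det (fmat m P) * (1 - k * ip m g p)"
proof -
  define U where "U = Matrix.mat m 1 (\<lambda>(i, _). - k * g i)"
  define V where "V = Matrix.mat 1 m (\<lambda>(_, j). p j)"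
  have c: "U \<in> carrier_mat m 1" "V \<in> carrier_mat 1 m" "fmat m P \<in> carrier_mat m m"
    by (auto simp: U_def V_def fmat_def)
  have "fmat m (\<lambda>i j. P i j - k * p i * p j) = fmat m P * (1\<^sub>m m + U * V)"
  proof (rule eq_matI)
    fix i j assume "i < dim_row (fmat m P * (1\<^sub>m m + U * V))" "j < dim_col (fmat m P * (1\<^sub>m m + U * V))"
    hence ij: "i < m" "j < m" using c by auto
    have "(fmat m P * (1\<^sub>m m + U * V)) $$ (i, j) = (\<Sum>l<m. P i l * ((if l = j then 1 else 0) - k * g l * p j))"
      using ij c by (auto simp: scalar_prod_def fmat_def U_def V_def atLeast0LessThan intro!: sum.cong)
    also have "\<dots> = (\<Sum>l<m. (if l = j then P i l else 0) - k * p j * (P i l * g l))"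
      by (rule sum.cong) (simp_all add: right_diff_distrib)
    also have "\<dots> = (\<Sum>l<m. if l = j then P i l else 0) - k * p j * (\<Sum>l<m. P i l * g l)"
      by (simp only: sum_subtractf sum_distrib_left)
    also have "\<dots> = P i j - k * p i * p j" using ij p by simp
    finally show "fmat m (\<lambda>i j. P i j - k * p i * p j) $$ (i, j) = (fmat m P * (1\<^sub>m m + U * V)) $$ (i, j)"
      using ij by (simp add: fmat_def)
  qed (use c in \<open>auto simp: fmat_def\<close>)
  also have "Determinant.det \<dots> = Determinant.det (fmat m P) * (1 + (V * U) $$ (0, 0))"
    using c by (subst det_mult[of _ m]) (auto simp: det_one_plus_rank_one)
  also have "(V * U) $$ (0, 0) = - k * ip m g p"
    by (auto simp: U_def V_def scalar_prod_def ip_def atLeast0LessThan sum_distrib_left mult_ac intro!: sum.cong)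
  finally show ?thesis by simp
qed

text \<open>A column y of the inverse solves P y = e_j, so r |y|^2 is at most y . P y = y_j. Hence
  y_j is at most 1 / r, and then so is |y|.\<close>

lemma qf_mat_inverse:
  assumes r: "0 < r" and P: "\<And>u. r * nrm2 m u \<le> qf m P u"
  obtains Q where "Q \<in> carrier_mat m m" "fmat m P * Q = 1\<^sub>m m"
    "\<And>i j. i < m \<Longrightarrow> j < m \<Longrightarrow> \<bar>Q $$ (i, j)\<bar> \<le> 1 / r"
proof -
  have c: "fmat m P \<in> carrier_mat m m" by (simp add: fmat_def)
  have qf: "qf m P u = (\<Sum>i<m. u i * (\<Sum>j<m. P i j * u j))" for u
    by (simp add: qf_def sum_distrib_left mult_ac)
  have "Determinant.det (fmat m P) \<noteq> 0"
  proof
    assume "Determinant.det (fmat m P) = 0"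
    then obtain v where v: "v \<in> carrier_vec m" "v \<noteq> 0\<^sub>v m" "fmat m P *\<^sub>v v = 0\<^sub>v m"
      using det_0_iff_vec_prod_zero[OF c] by auto
    have "(\<Sum>j<m. P i j * v $ j) = 0" if "i < m" for i
      using arg_cong[OF v(3), of "\<lambda>x. x $ i"] that v(1)
      by (simp add: fmat_def scalar_prod_def atLeast0LessThan)
    hence "qf m P (\<lambda>j. v $ j) = 0" by (simp add: qf)
    with P[of "\<lambda>j. v $ j"] r have "nrm2 m (\<lambda>j. v $ j) = 0"
      using nrm2_nonneg[of m "\<lambda>j. v $ j"] by (smt (verit) mult_pos_pos)
    hence "v = 0\<^sub>v m" using v(1) by (intro eq_vecI) (auto simp: nrm2_eq_0)
    with v show False by simp
  qed
  from det_non_zero_imp_unit[OF c this] obtain Q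
    where Q: "Q \<in> carrier_mat m m" "fmat m P * Q = 1\<^sub>m m"
    by (auto simp: Units_def ring_mat_def)
  have "\<bar>Q $$ (i, j)\<bar> \<le> 1 / r" if ij: "i < m" "j < m" for i j
  proof -
    let ?y = "\<lambda>i. Q $$ (i, j)"
    have e: "(\<Sum>l<m. P i l * ?y l) = (if i = j then 1 else 0)" if "i < m" for i
      using arg_cong[OF Q(2), of "\<lambda>x. x $$ (i, j)"] that ij Q(1)
      by (simp add: fmat_def scalar_prod_def atLeast0LessThan)
    have "qf m P ?y = (\<Sum>i<m. if i = j then ?y i else 0)"
      unfolding qf by (intro sum.cong refl) (simp add: e)
    hence "qf m P ?y = ?y j" using ij by simp
    hence 1: "r * nrm2 m ?y \<le> ?y j" using P[of ?y] by simp
    have 2: "(?y j)\<^sup>2 \<le> nrm2 m ?y" "(?y i)\<^sup>2 \<le> nrm2 m ?y" using ij coord_le_nrm2[of _ m ?y] by auto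
    have y0: "0 \<le> ?y j" using 1 r nrm2_nonneg[of m ?y] by (smt (verit) mult_nonneg_nonneg)
    have "r * (?y j)\<^sup>2 \<le> ?y j" using 1 2 r by (smt (verit) mult_left_mono)
    hence "r * ?y j \<le> 1" using y0 by (cases "?y j = 0") (auto simp: power2_eq_square)
    hence "r * (r * nrm2 m ?y) \<le> 1" using 1 r by (smt (verit) mult_left_mono)
    moreover have "r * (r * (?y i)\<^sup>2) \<le> r * (r * nrm2 m ?y)"
      using 2(2) r by (intro mult_left_mono) auto
    ultimately have "(r * ?y i)\<^sup>2 \<le> 1" by (simp add: power2_eq_square mult_ac)
    hence "\<bar>r * ?y i\<bar> \<le> 1" by (simp add: abs_square_le_1)
    thus ?thesis using r by (simp add: abs_mult field_simps)
  qed
  with Q that show ?thesis by blast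
qed

text \<open>Takes the place of the volume argument of the ellipsoid method: an ellipsoid that
  contains a ball cannot have a small determinant, because the inverse matrix has bounded entries
  and so a bounded determinant.\<close>

lemma det_lower_bound:
  assumes r: "0 < r" and P: "\<And>u. r * nrm2 m u \<le> qf m P u"
  shows "1 \<le> \<bar>Determinant.det (fmat m P)\<bar> * (real m / r) ^ m"
proof -
  obtain Q where Q: "Q \<in> carrier_mat m m" "fmat m P * Q = 1\<^sub>m m"
    and b: "\<And>i j. i < m \<Longrightarrow> j < m \<Longrightarrow> \<bar>Q $$ (i, j)\<bar> \<le> 1 / r"
    using qf_mat_inverse[OF r P] by blast
  have "Determinant.det (fmat m P) * Determinant.det Q = 1"
    using Q det_mult[of "fmat m P" m Q] by (simp add: fmat_def)
  hence 1: "1 = \<bar>Determinant.det (fmat m P)\<bar> * \<bar>Determinant.det Q\<bar>" by (simp flip: abs_mult)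
  have "\<bar>Determinant.det Q\<bar> \<le> (\<Prod>i<m. \<Sum>j<m. \<bar>Q $$ (i, j)\<bar>)" by (rule det_row_sum_bound[OF Q(1)])
  also have "\<dots> \<le> (\<Prod>i<m. \<Sum>j<m. 1 / r)"
    by (intro prod_mono conjI sum_nonneg sum_mono) (auto intro: b)
  also have "\<dots> = (real m / r) ^ m" by simp
  finally show ?thesis using 1 by (smt (verit) abs_ge_zero mult_left_mono)
qed

text \<open>The effect of rounding a shape matrix: P' = P (1 + Q (P' - P)) with Q the inverse of P,
  and each row of the second factor has l1-norm at most 1 + m^2 e / r.\<close>

lemma det_perturbation:
  assumes r: "0 < r" and P: "\<And>u. r * nrm2 m u \<le> qf m P u"
    and D: "\<And>i j. i < m \<Longrightarrow> j < m \<Longrightarrow> \<bar>P' i j - P i j\<bar> \<le> e"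
  shows "\<bar>Determinant.det (fmat m P')\<bar> \<le> \<bar>Determinant.det (fmat m P)\<bar> * (1 + real m * real m * e / r) ^ m"
proof -
  obtain Q where Q: "Q \<in> carrier_mat m m" "fmat m P * Q = 1\<^sub>m m"
    and b: "\<And>i j. i < m \<Longrightarrow> j < m \<Longrightarrow> \<bar>Q $$ (i, j)\<bar> \<le> 1 / r"
    using qf_mat_inverse[OF r P] by blast
  define E where "E = fmat m (\<lambda>i j. P' i j - P i j)"
  have c: "fmat m P \<in> carrier_mat m m" "E \<in> carrier_mat m m" "Q * E \<in> carrier_mat m m"
    using Q by (auto simp: fmat_def E_def)
  have "fmat m P * (1\<^sub>m m + Q * E) = fmat m P + (fmat m P * Q) * E"
  proof -
    have "fmat m P * (1\<^sub>m m + Q * E) = fmat m P * 1\<^sub>m m + fmat m P * (Q * E)"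
      by (rule mult_add_distrib_mat) (use c in auto)
    also have "fmat m P * 1\<^sub>m m = fmat m P" by (rule right_mult_one_mat[OF c(1)])
    also have "fmat m P * (Q * E) = (fmat m P * Q) * E"
      by (rule assoc_mult_mat[OF c(1) Q(1) c(2), symmetric])
    finally show ?thesis .
  qed
  also have "\<dots> = fmat m P'"
    unfolding Q(2) using c by (intro eq_matI) (auto simp: E_def fmat_def)
  finally have "Determinant.det (fmat m P') = Determinant.det (fmat m P) * Determinant.det (1\<^sub>m m + Q * E)"
    using det_mult[of "fmat m P" m "1\<^sub>m m + Q * E"] c by simp
  moreover have "\<bar>Determinant.det (1\<^sub>m m + Q * E)\<bar> \<le> (1 + real m * real m * e / r) ^ m"
  proof -
    have "\<bar>Determinant.det (1\<^sub>m m + Q * E)\<bar> \<le> (\<Prod>i<m. \<Sum>j<m. \<bar>(1\<^sub>m m + Q * E) $$ (i, j)\<bar>)"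
      using c by (intro det_row_sum_bound) auto
    also have "\<dots> \<le> (\<Prod>i<m. 1 + real m * real m * e / r)"
    proof (intro prod_mono conjI sum_nonneg)
      fix i assume i: "i \<in> {..<m}"
      have QE: "\<bar>(Q * E) $$ (i, j)\<bar> \<le> real m * e / r" if j: "j < m" for j
      proof -
        have "(Q * E) $$ (i, j) = (\<Sum>l<m. Q $$ (i, l) * E $$ (l, j))"
          using i j c Q(1) by (simp add: scalar_prod_def atLeast0LessThan)
        hence "\<bar>(Q * E) $$ (i, j)\<bar> \<le> (\<Sum>l<m. \<bar>Q $$ (i, l)\<bar> * \<bar>E $$ (l, j)\<bar>)"
          by (simp add: sum_abs flip: abs_mult)
        also have "\<dots> \<le> (\<Sum>l<m. 1 / r * e)"
          using i j D r b by (intro sum_mono mult_mono) (auto simp: E_def fmat_def)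
        finally show ?thesis by simp
      qed
      have "(\<Sum>j<m. \<bar>(1\<^sub>m m + Q * E) $$ (i, j)\<bar>) \<le> (\<Sum>j<m. (if j = i then 1 else 0) + real m * e / r)"
      proof (rule sum_mono)
        fix j assume "j \<in> {..<m}"
        hence j: "j < m" by simp
        have "(1\<^sub>m m + Q * E) $$ (i, j) = 1\<^sub>m m $$ (i, j) + (Q * E) $$ (i, j)"
          by (rule index_add_mat(1)) (use i j c(3) in auto)
        also have "1\<^sub>m m $$ (i, j) = (if j = i then 1 else (0::real))" using i j by simp
        finally show "\<bar>(1\<^sub>m m + Q * E) $$ (i, j)\<bar> \<le> (if j = i then 1 else 0) + real m * e / r"
          using QE[OF j] by (simp split: if_splits)
      qed
      also have "\<dots> = 1 + real m * real m * e / r"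
        using i by (simp add: sum.distrib)
      finally show "(\<Sum>j<m. \<bar>(1\<^sub>m m + Q * E) $$ (i, j)\<bar>) \<le> 1 + real m * real m * e / r" .
    qed auto
    finally show ?thesis by simp
  qed
  ultimately show ?thesis by (simp add: abs_mult mult_left_mono)
qed

section \<open>Minimum-norm points\<close>

text \<open>The minimum-norm point of the convex hull, given by its variational inequality: all
  points lie beyond the hyperplane through \<open>z\<close> orthogonal to \<open>z\<close>.
  Coordinates from \<open>m\<close> on are set to 0 so that \<open>z\<close> is unique as a
  function.\<close>

definition mnp :: "nat \<Rightarrow> nat set \<Rightarrow> (nat \<Rightarrow> nat \<Rightarrow> real) \<Rightarrow> (nat \<Rightarrow> real) \<Rightarrow> bool" where
  "mnp m I a z \<longleftrightarrow>
     (\<exists>l. (\<forall>i\<in>I. 0 \<le> l i) \<and> sum l I = 1 \<and> z = (\<lambda>j. if j < m then \<Sum>i\<in>I. l i * a i j else 0)) \<and>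
     (\<forall>i\<in>I. nrm2 m z \<le> ip m (a i) z)"

lemma ip_comb:
  assumes "z = (\<lambda>j. if j < m then \<Sum>i\<in>I. l i * a i j else 0)"
  shows "ip m w z = (\<Sum>i\<in>I. l i * ip m (a i) w)"
proof -
  have "ip m w z = ip m w (\<lambda>j. \<Sum>i\<in>I. l i * a i j)" using assms by (intro ip_cong) auto
  thus ?thesis unfolding ip_sum by (simp add: ip_commute)
qed

text \<open>Averaging the inequality of one point with the weights of the other shows that the inner
  product of both is at least either squared norm, so their distance is 0.\<close>

lemma mnp_unique:
  assumes "mnp m I a z" "mnp m I a z'"
  shows "z = z'"
proof -
  have *: "nrm2 m y \<le> ip m y x" if "mnp m I a x" "mnp m I a y" for x y
  proof -
    from that obtain l where l: "\<forall>i\<in>I. 0 \<le> l i" "sum l I = 1"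
      and x: "x = (\<lambda>j. if j < m then \<Sum>i\<in>I. l i * a i j else 0)" unfolding mnp_def by blast
    have "nrm2 m y = (\<Sum>i\<in>I. l i * nrm2 m y)" using l by (simp flip: sum_distrib_right)
    also have "\<dots> \<le> (\<Sum>i\<in>I. l i * ip m (a i) y)"
      using l that by (intro sum_mono mult_left_mono) (auto simp: mnp_def)
    finally show ?thesis unfolding ip_comb[OF x] .
  qed
  have "nrm2 m (\<lambda>j. z j - z' j) = 0"
    using *[OF assms] *[OF assms(2,1)] nrm2_nonneg[of m "\<lambda>j. z j - z' j"]
    by (simp add: ip_linear ip_commute[of m z' z])
  hence "z j = z' j" if "j < m" for j using that by (auto simp: nrm2_eq_0)
  moreover have "z j = z' j" if "\<not> j < m" for j using that assms by (auto simp: mnp_def)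
  ultimately show ?thesis by blast
qed

text \<open>The source of stability: further points beyond the hyperplane of \<open>z\<close> can be
  given weight 0 and do not move the minimum-norm point.\<close>

lemma mnp_superset:
  assumes "mnp m B a z" "B \<subseteq> I" "finite I" "\<And>i. i \<in> I \<Longrightarrow> nrm2 m z \<le> ip m (a i) z"
  shows "mnp m I a z"
proof -
  from assms(1) obtain l where l: "\<forall>i\<in>B. 0 \<le> l i" "sum l B = 1"
    and z: "z = (\<lambda>j. if j < m then \<Sum>i\<in>B. l i * a i j else 0)" unfolding mnp_def by blast
  let ?l = "\<lambda>i. if i \<in> B then l i else 0"
  have "sum ?l I = sum ?l B" using assms by (intro sum.mono_neutral_right) auto
  hence "sum ?l I = 1" using l by simp
  moreover have "(\<Sum>i\<in>I. ?l i * a i j) = (\<Sum>i\<in>B. l i * a i j)" for j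
  proof -
    have "(\<Sum>i\<in>I. ?l i * a i j) = (\<Sum>i\<in>B. ?l i * a i j)"
      using assms by (intro sum.mono_neutral_right) auto
    thus ?thesis by simp
  qed
  ultimately show ?thesis unfolding mnp_def using l z assms(4)
    by (intro conjI exI[of _ ?l]) auto
qed

lemma quadratic_slope_nonneg:
  fixes A B :: real
  assumes "\<And>t. 0 < t \<Longrightarrow> t \<le> 1 \<Longrightarrow> 0 \<le> t * A + t\<^sup>2 * B"
  shows "0 \<le> A"
proof (rule ccontr)
  assume A: "\<not> 0 \<le> A"
  define t where "t = min 1 (- A / (\<bar>B\<bar> + 1) / 2)"
  have t: "0 < t" "t \<le> 1" using A divide_neg_pos[of A "\<bar>B\<bar> * 2 + 2"] by (auto simp: t_def)
  have "t * (\<bar>B\<bar> + 1) \<le> - A / 2"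
    using min.cobounded2[of 1 "- A / (\<bar>B\<bar> + 1) / 2"] unfolding t_def[symmetric]
    by (simp add: field_simps)
  moreover have "t * B \<le> t * (\<bar>B\<bar> + 1)" using t by (intro mult_left_mono) auto
  ultimately have "A + t * B < 0" using A by simp
  hence "t * (A + t * B) < 0" using t by (simp add: mult_pos_neg)
  with assms[OF t] show False by (simp add: power2_eq_square algebra_simps)
qed

text \<open>The norm attains its minimum on the compact simplex of weights; the variational
  inequality says that its derivative towards each vertex is nonnegative.\<close>

lemma mnp_exists:
  assumes fin: "finite I" and ne: "I \<noteq> {}"
  shows "\<exists>z. mnp m I a z"
proof -
  \<comment> \<open>Weights vanish off \<open>I\<close>, which places the simplex in a compact
    product of intervals.\<close>
  define S :: "(nat \<Rightarrow> real) set" where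
    "S = {l. (\<forall>i\<in>I. 0 \<le> l i) \<and> sum l I = 1 \<and> (\<forall>i. i \<notin> I \<longrightarrow> l i = 0)}"
  define Z where "Z l = (\<lambda>j. if j < m then \<Sum>i\<in>I. l i * a i j else 0)" for l :: "nat \<Rightarrow> real"
  define X where "X i = (if i \<in> I then {0..1::real} else {0})" for i
  have cpt: "compact (PiE UNIV X)"
  proof -
    have "compactin (product_topology (\<lambda>i. euclidean) UNIV) (PiE UNIV X)"
      unfolding compactin_PiE by (auto simp: X_def)
    thus ?thesis by (simp add: euclidean_product_topology)
  qed
  have co: "continuous_on A (\<lambda>l. l i)" for A :: "(nat \<Rightarrow> real) set" and i
    by (rule continuous_on_subset[OF continuous_on_product_coordinates]) auto
  have "S = PiE UNIV X \<inter> {l. sum l I = 1}"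
  proof (intro equalityI subsetI)
    fix l assume l: "l \<in> S"
    have "l i \<le> 1" if "i \<in> I" for i
      using member_le_sum[of i I l] that fin l by (auto simp: S_def)
    with l show "l \<in> PiE UNIV X \<inter> {l. sum l I = 1}" by (auto simp: S_def X_def)
  next
    fix l assume "l \<in> PiE UNIV X \<inter> {l. sum l I = 1}"
    hence "\<And>i. l i \<in> X i" "sum l I = 1" by auto
    thus "l \<in> S" unfolding S_def X_def by (auto split: if_splits) (metis atLeastAtMost_iff, metis singletonD)
  qed
  moreover have "closed {l. sum l I = (1::real)}"
    by (intro closed_Collect_eq continuous_on_sum co continuous_on_const)
  ultimately have cS: "compact S" using cpt by (metis compact_Int_closed)
  obtain i0 where i0: "i0 \<in> I" using ne by auto
  have "(\<lambda>i. if i = i0 then 1 else 0) \<in> S"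
    using i0 fin by (auto simp: S_def sum.delta)
  hence "S \<noteq> {}" by auto
  have cN: "continuous_on S (\<lambda>l. nrm2 m (Z l))"
    unfolding ip_def Z_def
    by (intro continuous_on_sum continuous_on_mult) (auto intro!: continuous_on_sum continuous_on_mult co)
  from continuous_attains_inf[OF cS \<open>S \<noteq> {}\<close> cN] obtain l where l: "l \<in> S"
    and min: "\<And>l'. l' \<in> S \<Longrightarrow> nrm2 m (Z l) \<le> nrm2 m (Z l')" by blast
  have "nrm2 m (Z l) \<le> ip m (a k) (Z l)" if k: "k \<in> I" for k
  proof -
    \<comment> \<open>This is the linear coefficient of the squared norm along the segment from the
      minimiser to \<open>a k\<close>.\<close>
    have "0 \<le> 2 * (ip m (a k) (Z l) - nrm2 m (Z l))"
    proof (rule quadratic_slope_nonneg)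
      fix t :: real assume t: "0 < t" "t \<le> 1"
      let ?l = "\<lambda>i. (1 - t) * l i + (if i = k then t else 0)"
      have "?l \<in> S" using l t k fin by (auto simp: S_def sum.distrib sum.delta simp flip: sum_distrib_left)
      hence "nrm2 m (Z l) \<le> nrm2 m (Z ?l)" by (rule min)
      also have "nrm2 m (Z ?l) = nrm2 m (\<lambda>j. Z l j + t * (a k j - Z l j))"
      proof (rule ip_cong)
        fix j assume "j < m"
        have "(\<Sum>i\<in>I. ((1 - t) * l i + (if i = k then t else 0)) * a i j)
           = (1 - t) * (\<Sum>i\<in>I. l i * a i j) + (\<Sum>i\<in>I. (if i = k then t * a i j else 0))"
          unfolding sum_distrib_left sum.distrib[symmetric] by (intro sum.cong) (auto simp: algebra_simps)
        thus "Z ?l j = Z l j + t * (a k j - Z l j)"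
          using \<open>j < m\<close> k fin by (simp add: Z_def sum.delta algebra_simps)
        thus "Z ?l j = Z l j + t * (a k j - Z l j)" .
      qed
      also have "\<dots> = nrm2 m (Z l) + t * (2 * (ip m (a k) (Z l) - nrm2 m (Z l)))
          + t\<^sup>2 * nrm2 m (\<lambda>j. a k j - Z l j)"
        by (simp add: ip_linear ip_commute[of m "Z l" "a k"] power2_eq_square algebra_simps)
      finally show "0 \<le> t * (2 * (ip m (a k) (Z l) - nrm2 m (Z l))) + t\<^sup>2 * nrm2 m (\<lambda>j. a k j - Z l j)"
        by simp
    qed
    thus ?thesis by simp
  qed
  hence "mnp m I a (Z l)" unfolding mnp_def using l by (auto simp: S_def Z_def)
  thus ?thesis by blast
qed

text \<open>A representation of the minimum-norm point with as few points as possible uses linearly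
  independent points, since all its points lie on the hyperplane \<open>a \<bullet> z = \<parallel>z\<parallel>\<^sup>2\<close>, which misses
  the origin.\<close>

lemma mnp_basis:
  assumes z: "mnp m I a z" and fin: "finite I" and pos: "0 < nrm2 m z"
  obtains B l where "B \<subseteq> I" "mnp m B a z" "\<forall>i\<in>B. ip m (a i) z = nrm2 m z"
    "sum l B = 1" "z = (\<lambda>j. if j < m then \<Sum>i\<in>B. l i * a i j else 0)"
    "\<And>\<mu>. (\<And>j. j < m \<Longrightarrow> (\<Sum>i\<in>B. \<mu> i * a i j) = 0) \<Longrightarrow> \<forall>i\<in>B. \<mu> i = 0"
proof -
  define R where "R B l \<longleftrightarrow> B \<subseteq> I \<and> (\<forall>i\<in>B. 0 \<le> l i) \<and> sum l B = 1 \<and>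
    z = (\<lambda>j. if j < m then \<Sum>i\<in>B. l i * a i j else 0)" for B and l :: "nat \<Rightarrow> real"
  have "\<exists>l. R I l" using z unfolding mnp_def R_def by blast
  hence "\<exists>k B l. R B l \<and> card B = k" by blast
  then obtain B l where BR: "R B l" and min: "\<And>B' l'. R B' l' \<Longrightarrow> card B \<le> card B'"
    using exists_least_iff[of "\<lambda>k. \<exists>B l. R B l \<and> card B = k"] by (metis not_le)
  have BI: "B \<subseteq> I" and finB: "finite B" using BR fin finite_subset by (auto simp: R_def)
  have l0: "\<And>i. i \<in> B \<Longrightarrow> 0 \<le> l i" and l1: "sum l B = 1"
    and zB: "z = (\<lambda>j. if j < m then \<Sum>i\<in>B. l i * a i j else 0)" using BR by (auto simp: R_def)
  \<comment> \<open>By minimality, no representation of \<open>z\<close> on \<open>B\<close> has a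
    zero weight. This is applied twice: to the weights \<open>l\<close> themselves and to those
    shifted along a linear dependence.\<close>
  have drop: "\<not> (i0 \<in> B \<and> l' i0 = 0 \<and> (\<forall>i\<in>B. 0 \<le> l' i) \<and> sum l' B = 1 \<and>
      (\<forall>j<m. (\<Sum>i\<in>B. l' i * a i j) = (\<Sum>i\<in>B. l i * a i j)))" for i0 l'
  proof
    assume h: "i0 \<in> B \<and> l' i0 = 0 \<and> (\<forall>i\<in>B. 0 \<le> l' i) \<and> sum l' B = 1 \<and>
      (\<forall>j<m. (\<Sum>i\<in>B. l' i * a i j) = (\<Sum>i\<in>B. l i * a i j))"
    have "R (B - {i0}) l'"
      unfolding R_def using h BI finB zB by (auto simp: sum.remove[of B i0] fun_eq_iff)
    from min[OF this] show False using h finB by (metis card_Diff1_less not_le)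
  qed
  have lpos: "0 < l i" if "i \<in> B" for i
    using drop[of i l] that l0 l1 by (metis order_le_imp_less_or_eq)
  have act: "ip m (a i) z = nrm2 m z" if i: "i \<in> B" for i
  proof -
    have ge: "\<And>i. i \<in> B \<Longrightarrow> 0 \<le> ip m (a i) z - nrm2 m z" using z BI by (auto simp: mnp_def)
    \<comment> \<open>A vanishing sum of nonnegative terms with positive weights forces equality in
      each variational inequality.\<close>
    have "(\<Sum>i\<in>B. l i * (ip m (a i) z - nrm2 m z)) = 0"
      using l1 ip_comb[OF zB, of z] by (simp add: algebra_simps sum_subtractf flip: sum_distrib_right)
    hence "\<forall>i\<in>B. l i * (ip m (a i) z - nrm2 m z) = 0"
      using finB l0 ge by (subst (asm) sum_nonneg_eq_0_iff) auto
    thus ?thesis using lpos[OF i] i by auto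
  qed
  have indep: "\<forall>i\<in>B. \<mu> i = 0" if \<mu>: "\<And>j. j < m \<Longrightarrow> (\<Sum>i\<in>B. \<mu> i * a i j) = 0" for \<mu>
  proof (rule ccontr)
    assume ne: "\<not> (\<forall>i\<in>B. \<mu> i = 0)"
    \<comment> \<open>All points of \<open>B\<close> have the same positive inner product with
      \<open>z\<close>, so pairing a dependence with \<open>z\<close> shows that its coefficients
      sum to 0; a nonzero one has a positive coefficient.\<close>
    have "(\<Sum>i\<in>B. \<mu> i * ip m (a i) z) = ip m z (\<lambda>j. \<Sum>i\<in>B. \<mu> i * a i j)"
      by (simp add: ip_sum ip_commute)
    also have "\<dots> = 0" unfolding ip_def using \<mu> by (intro sum.neutral) auto
    finally have "(\<Sum>i\<in>B. \<mu> i) * nrm2 m z = 0" using act by (simp add: sum_distrib_right)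
    hence s0: "(\<Sum>i\<in>B. \<mu> i) = 0" using pos by simp
    have "\<exists>i\<in>B. 0 < \<mu> i"
    proof (rule ccontr)
      assume "\<not> (\<exists>i\<in>B. 0 < \<mu> i)"
      hence "\<forall>i\<in>B. 0 \<le> - \<mu> i" by auto
      moreover have "(\<Sum>i\<in>B. - \<mu> i) = 0" using s0 by (simp add: sum_negf)
      ultimately have "\<forall>i\<in>B. - \<mu> i = 0" using finB by (subst (asm) sum_nonneg_eq_0_iff) auto
      with ne show False by simp
    qed
    hence P: "finite {i\<in>B. 0 < \<mu> i}" "{i\<in>B. 0 < \<mu> i} \<noteq> {}" using finB by auto
    \<comment> \<open>Ratio test: shifting along the dependence until the first weight reaches 0
      changes neither the represented point nor the total weight.\<close>
    define i0 where "i0 = arg_min_on (\<lambda>i. l i / \<mu> i) {i\<in>B. 0 < \<mu> i}"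
    have i0: "i0 \<in> B" "0 < \<mu> i0"
      and m0: "\<And>i. i \<in> B \<Longrightarrow> 0 < \<mu> i \<Longrightarrow> l i0 / \<mu> i0 \<le> l i / \<mu> i"
      using arg_min_if_finite[OF P, of "\<lambda>i. l i / \<mu> i"] unfolding i0_def[symmetric]
      by (auto simp: not_less)
    define t where "t = l i0 / \<mu> i0"
    have t: "0 \<le> t" using l0 i0 by (simp add: t_def)
    have "0 \<le> l i - t * \<mu> i" if "i \<in> B" for i
    proof (cases "0 < \<mu> i")
      case True then show ?thesis using m0[OF that True] by (simp add: t_def field_simps)
    next
      case False then show ?thesis using l0[OF that] t by (smt (verit) mult_nonneg_nonpos)
    qed
    moreover have "(\<Sum>i\<in>B. l i - t * \<mu> i) = 1"
      using s0 l1 by (simp add: sum_subtractf flip: sum_distrib_left)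
    moreover have "(\<Sum>i\<in>B. (l i - t * \<mu> i) * a i j) = (\<Sum>i\<in>B. l i * a i j)" if "j < m" for j
    proof -
      have "(\<Sum>i\<in>B. (l i - t * \<mu> i) * a i j) = (\<Sum>i\<in>B. l i * a i j) - t * (\<Sum>i\<in>B. \<mu> i * a i j)"
        by (simp add: sum_subtractf sum_distrib_left algebra_simps)
      thus ?thesis using \<mu>[OF that] by simp
    qed
    moreover have "l i0 - t * \<mu> i0 = 0" using i0 by (simp add: t_def)
    ultimately show False using drop[of i0 "\<lambda>i. l i - t * \<mu> i"] i0 by blast
  qed
  have "mnp m B a z" unfolding mnp_def using l0 l1 zB act by auto
  show ?thesis
    by (rule that[OF BI \<open>mnp m B a z\<close> _ l1 zB]) (use act indep in auto)
qed

lemma ip_bound1: "(\<And>j. j < m \<Longrightarrow> \<bar>u j\<bar> \<le> c) \<Longrightarrow> \<bar>ip m u v\<bar> \<le> c * (\<Sum>j<m. \<bar>v j\<bar>)"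
proof -
  assume "\<And>j. j < m \<Longrightarrow> \<bar>u j\<bar> \<le> c"
  hence "(\<Sum>j<m. \<bar>u j * v j\<bar>) \<le> (\<Sum>j<m. c * \<bar>v j\<bar>)"
    by (intro sum_mono) (auto simp: abs_mult intro: mult_right_mono)
  thus ?thesis unfolding ip_def by (simp add: sum_distrib_left order_trans[OF sum_abs])
qed

text \<open>The weights of an independent representation solve a linear system with the Gram matrix;
  the size of its determinant and of its cofactors bounds \<open>\<parallel>z\<parallel>\<^sup>2\<close> from below.\<close>

lemma mnp_basis_gram:
  fixes B :: "nat set"
  assumes fin: "finite B" and act: "\<forall>i\<in>B. ip m (a i) z = nrm2 m z"
    and l1: "sum l B = 1" and z: "z = (\<lambda>j. if j < m then \<Sum>i\<in>B. l i * a i j else 0)"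
    and indep: "\<And>\<mu>. (\<And>j. j < m \<Longrightarrow> (\<Sum>i\<in>B. \<mu> i * a i j) = 0) \<Longrightarrow> \<forall>i\<in>B. \<mu> i = (0::real)"
    and a1: "\<And>i. i \<in> B \<Longrightarrow> (\<Sum>j<m. \<bar>a i j\<bar>) \<le> 1"
  shows "card B \<le> m"
    and "\<And>q :: int. 0 < q \<Longrightarrow> (\<And>i j. i \<in> B \<Longrightarrow> j < m \<Longrightarrow> of_int q * a i j \<in> \<int>) \<Longrightarrow>
      1 \<le> nrm2 m z * real m ^ (m + 2) * of_int q ^ (2 * m)"
proof -
  define k where "k = card B"
  obtain h where h: "bij_betw h {..<k} B"
    using ex_bij_betw_nat_finite[OF fin] by (auto simp: k_def atLeast0LessThan)
  have hB: "h i \<in> B" if "i < k" for i using h that by (auto simp: bij_betw_def)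
  have sumh: "(\<Sum>i\<in>B. f i) = (\<Sum>i<k. f (h i))" for f :: "nat \<Rightarrow> real"
    using sum.reindex_bij_betw[OF h, of f] by simp
  define G where "G = fmat k (\<lambda>i j. ip m (a (h i)) (a (h j)))"
  have G: "G \<in> carrier_mat k k" by (simp add: G_def fmat_def)
  have det0: "Determinant.det G \<noteq> 0"
  proof
    assume "Determinant.det G = 0"
    then obtain v where v: "v \<in> carrier_vec k" "v \<noteq> 0\<^sub>v k" "G *\<^sub>v v = 0\<^sub>v k"
      using det_0_iff_vec_prod_zero[OF G] by auto
    have e: "(\<Sum>j<k. ip m (a (h i)) (a (h j)) * v $ j) = 0" if "i < k" for i
      using arg_cong[OF v(3), of "\<lambda>x. x $ i"] that v(1)
      by (simp add: G_def fmat_def scalar_prod_def atLeast0LessThan)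
    \<comment> \<open>A kernel vector of the Gram matrix gives a combination orthogonal to all the
      points, hence to itself.\<close>
    define y where "y j = (\<Sum>i<k. v $ i * a (h i) j)" for j
    have yy: "y = (\<lambda>j. \<Sum>i<k. v $ i * a (h i) j)" by (simp add: y_def fun_eq_iff)
    note ip_y = ip_sum[where I = "{..<k}" and l = "\<lambda>i. v $ i" and a = "\<lambda>i. a (h i)", folded yy]
    have z0: "ip m (a (h i)) y = 0" if "i < k" for i
      using e[OF that] unfolding ip_y by (simp add: mult_ac)
    have "nrm2 m y = (\<Sum>i<k. v $ i * ip m y (a (h i)))" by (rule ip_y)
    also have "\<dots> = 0" by (intro sum.neutral ballI) (simp add: ip_commute[of m y] z0)
    finally have "nrm2 m y = 0" .
    hence y0: "y j = 0" if "j < m" for j using that by (auto simp: nrm2_eq_0)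
    define \<mu> where "\<mu> x = v $ (inv_into {..<k} h x)" for x
    have \<mu>h: "\<mu> (h i) = v $ i" if "i < k" for i
      using h that by (simp add: \<mu>_def bij_betw_def inv_into_f_f)
    have "\<forall>i\<in>B. \<mu> i = 0"
    proof (rule indep)
      fix j assume "j < m"
      show "(\<Sum>i\<in>B. \<mu> i * a i j) = 0"
        using y0[OF \<open>j < m\<close>] unfolding sumh y_def by (simp add: \<mu>h)
    qed
    hence "v $ i = 0" if "i < k" for i using \<mu>h[OF that] hB[OF that] by auto
    hence "v = 0\<^sub>v k" using v(1) by (intro eq_vecI) auto
    with v show False by simp
  qed
  show km: "card B \<le> m"
  proof (rule ccontr)
    assume "\<not> card B \<le> m"
    hence mk: "m < k" by (simp add: k_def)
    \<comment> \<open>Padded by zero columns to a square matrix, \<open>W\<close> is singular as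
      soon as there are more than \<open>m\<close> points, and the Gram matrix is \<open>W\<close>
      times its transpose.\<close>
    define W where "W = fmat k (\<lambda>i j. if j < m then a (h i) j else 0)"
    have W: "W \<in> carrier_mat k k" by (simp add: W_def fmat_def)
    have "W *\<^sub>v unit_vec k (k - 1) = 0\<^sub>v k"
      using mk by (intro eq_vecI) (auto simp: W_def fmat_def scalar_prod_def unit_vec_def intro!: sum.neutral)
    moreover have "unit_vec k (k - 1) \<noteq> (0\<^sub>v k :: real Matrix.vec)"
    proof
      assume "unit_vec k (k - 1) = (0\<^sub>v k :: real Matrix.vec)"
      from arg_cong[OF this, of "\<lambda>x. x $ (k - 1)"] mk show False by simp
    qed
    ultimately have "Determinant.det W = 0"
      using det_0_iff_vec_prod_zero[OF W] by (metis unit_vec_carrier)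
    moreover have "G = W * transpose_mat W"
    proof (rule eq_matI)
      fix i j assume "i < dim_row (W * transpose_mat W)" "j < dim_col (W * transpose_mat W)"
      hence ij: "i < k" "j < k" using W by auto
      have "(W * transpose_mat W) $$ (i, j) = (\<Sum>l<k. (if l < m then a (h i) l else 0) * (if l < m then a (h j) l else 0))"
        using ij by (simp add: W_def fmat_def scalar_prod_def atLeast0LessThan)
      also have "\<dots> = (\<Sum>l<m. a (h i) l * a (h j) l)"
        using mk by (intro sum.mono_neutral_cong_right) auto
      finally show "G $$ (i, j) = (W * transpose_mat W) $$ (i, j)"
        using ij by (simp add: G_def fmat_def ip_def)
    qed (use W G in auto)
    ultimately show False using det0 W by (simp add: det_mult[of _ k])
  qed
  show "1 \<le> nrm2 m z * real m ^ (m + 2) * of_int q ^ (2 * m)"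
    if q: "0 < q" and qa: "\<And>i j. i \<in> B \<Longrightarrow> j < m \<Longrightarrow> of_int q * a i j \<in> \<int>" for q :: int
  proof -
    have Gle: "\<bar>G $$ (i, j)\<bar> \<le> 1" if "i < k" "j < k" for i j
    proof -
      have "\<bar>a (h i) j'\<bar> \<le> 1" if "j' < m" for j'
        using member_le_sum[of j' "{..<m}" "\<lambda>j. \<bar>a (h i) j\<bar>"] a1[OF hB[OF \<open>i < k\<close>]] that by auto
      hence "\<bar>ip m (a (h i)) (a (h j))\<bar> \<le> 1 * (\<Sum>j'<m. \<bar>a (h j) j'\<bar>)" by (rule ip_bound1)
      also have "\<dots> \<le> 1" using a1[OF hB[OF \<open>j < k\<close>]] by simp
      finally show ?thesis using that by (simp add: G_def fmat_def)
    qed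
    have kpos: "0 < k" using l1 fin by (cases "B = {}") (auto simp: k_def card_gt_0_iff)
    define A where "A = adj_mat G"
    have A: "A \<in> carrier_mat k k" "A * G = Determinant.det G \<cdot>\<^sub>m 1\<^sub>m k"
      using adj_mat[OF G] by (auto simp: A_def)
    have Ale: "\<bar>A $$ (i, j)\<bar> \<le> real k ^ k" if "i < k" "j < k" for i j
    proof -
      have md: "mat_delete G j i \<in> carrier_mat (k - 1) (k - 1)" using G by (rule mat_delete_carrier)
      have ent: "\<bar>mat_delete G j i $$ (x, y)\<bar> \<le> 1" if "x < k - 1" "y < k - 1" for x y
        using that G by (auto simp: mat_delete_def intro!: Gle)
      have "\<bar>A $$ (i, j)\<bar> = \<bar>Determinant.det (mat_delete G j i)\<bar>"
        using that G by (simp add: A_def adj_mat_def cofactor_def abs_mult power_abs)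
      also have "\<dots> \<le> (\<Prod>x<k - 1. \<Sum>y<k - 1. \<bar>mat_delete G j i $$ (x, y)\<bar>)"
        by (rule det_row_sum_bound[OF md])
      also have "\<dots> \<le> (\<Prod>x<k - 1. \<Sum>y<k - 1. 1)"
        by (intro prod_mono conjI sum_nonneg sum_mono) (auto intro: ent)
      also have "\<dots> = real (k - 1) ^ (k - 1)"
        by (simp only: sum_constant prod_constant card_lessThan mult_1_right)
      also have "\<dots> \<le> real k ^ (k - 1)" by (intro power_mono) auto
      also have "\<dots> \<le> real k ^ k" using kpos by (intro power_increasing) auto
      finally show ?thesis .
    qed
    define lv where "lv = Matrix.vec k (\<lambda>i. l (h i))"
    have Gl: "G *\<^sub>v lv = Matrix.vec k (\<lambda>i. nrm2 m z)"
    proof (rule eq_vecI)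
      fix i assume "i < dim_vec (Matrix.vec k (\<lambda>i. nrm2 m z))"
      hence i: "i < k" by simp
      have "(G *\<^sub>v lv) $ i = (\<Sum>j<k. l (h j) * ip m (a (h j)) (a (h i)))"
        using i by (simp add: G_def fmat_def lv_def scalar_prod_def atLeast0LessThan ip_commute mult_ac)
      also have "\<dots> = ip m (a (h i)) z" unfolding ip_comb[OF z] sumh ..
      finally show "(G *\<^sub>v lv) $ i = Matrix.vec k (\<lambda>i. nrm2 m z) $ i"
        using act hB[OF i] i by simp
    qed (use G in auto)
    have "A *\<^sub>v (G *\<^sub>v lv) = (A * G) *\<^sub>v lv"
      by (rule assoc_mult_mat_vec[symmetric, of _ k k _ k]) (use A G in \<open>auto simp: lv_def\<close>)
    hence eq: "A *\<^sub>v Matrix.vec k (\<lambda>i. nrm2 m z) = Determinant.det G \<cdot>\<^sub>v lv"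
      unfolding A(2) Gl by (intro eq_vecI) (auto simp: lv_def)
    \<comment> \<open>Applying the adjugate to the system with right-hand side |z|^2 in every row
      isolates each weight up to the determinant. Summing over \<open>i\<close>, with total weight
      1, leaves the determinant alone.\<close>
    have each: "(\<Sum>j<k. A $$ (i, j)) * nrm2 m z = Determinant.det G * l (h i)" if "i < k" for i
      using arg_cong[OF eq, of "\<lambda>x. x $ i"] that A(1)
      by (simp add: scalar_prod_def atLeast0LessThan lv_def sum_distrib_right)
    have "Determinant.det G = (\<Sum>i<k. Determinant.det G * l (h i))"
      using l1 unfolding sumh by (simp flip: sum_distrib_left)
    also have "\<dots> = (\<Sum>i<k. \<Sum>j<k. A $$ (i, j)) * nrm2 m z"
      using each by (simp add: sum_distrib_right)
    finally have "\<bar>Determinant.det G\<bar> = \<bar>\<Sum>i<k. \<Sum>j<k. A $$ (i, j)\<bar> * nrm2 m z"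
      by (metis abs_mult abs_of_nonneg nrm2_nonneg)
    also have "\<bar>\<Sum>i<k. \<Sum>j<k. A $$ (i, j)\<bar> \<le> (\<Sum>i<k. \<Sum>j<k. real k ^ k)"
      by (rule order_trans[OF sum_abs], intro sum_mono order_trans[OF sum_abs]) (auto intro: Ale)
    also have "\<dots> = real k ^ (k + 2)" by (simp add: power_add power2_eq_square)
    also have "\<dots> \<le> real m ^ (k + 2)" using km by (intro power_mono) (auto simp: k_def)
    also have "\<dots> \<le> real m ^ (m + 2)" using km kpos by (intro power_increasing) (auto simp: k_def)
    finally have up: "\<bar>Determinant.det G\<bar> \<le> real m ^ (m + 2) * nrm2 m z"
      by (simp add: mult_right_mono)
    \<comment> \<open>Scaling the coordinates by the common denominator makes the Gram matrix
      integral; its nonzero determinant is then an integer of absolute value at least 1.\<close>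
    have "\<exists>g. real_of_int g = of_int q ^ 2 * G $$ (i, j)" if "i < k" "j < k" for i j
    proof -
      have "of_int q ^ 2 * G $$ (i, j) = (\<Sum>j'<m. (of_int q * a (h i) j') * (of_int q * a (h j) j'))"
        using that by (simp add: G_def fmat_def ip_def sum_distrib_left power2_eq_square mult_ac)
      also have "\<dots> \<in> \<int>" by (rule Ints_sum, rule Ints_mult[OF qa qa]) (use hB that in auto)
      finally show ?thesis by (metis Ints_cases)
    qed
    then obtain g where g: "\<And>i j. i < k \<Longrightarrow> j < k \<Longrightarrow> real_of_int (g i j) = of_int q ^ 2 * G $$ (i, j)" by metis
    define Gi where "Gi = Matrix.mat k k (\<lambda>(i, j). g i j)"
    have "map_mat real_of_int Gi = (of_int q ^ 2) \<cdot>\<^sub>m G"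
      using G by (intro eq_matI) (auto simp: Gi_def g)
    hence "real_of_int (Determinant.det Gi) = (of_int q ^ 2) ^ k * Determinant.det G"
      using G by (simp flip: of_int_hom.hom_det)
    moreover from this have "Determinant.det Gi \<noteq> 0" using det0 q by auto
    hence "1 \<le> \<bar>real_of_int (Determinant.det Gi)\<bar>" by linarith
    ultimately have "1 \<le> of_int q ^ (2 * k) * \<bar>Determinant.det G\<bar>"
      using q by (simp add: abs_mult power_mult)
    also have "\<dots> \<le> of_int q ^ (2 * m) * (real m ^ (m + 2) * nrm2 m z)"
      using q km up by (intro mult_mono power_increasing) (auto simp: k_def)
    finally show ?thesis by (simp add: mult_ac)
  qed
qed

section \<open>Risk of hypotheses determined by part of the sample\<close>

text \<open>The example \<open>(x, y)\<close> as the vector \<open>y (x, 1)\<close>, scaled to \<open>l\<^sub>1\<close>-norm at most \<open>1\<close> by a rational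
  function, so that rational data remain rational.\<close>

definition avec :: "nat \<Rightarrow> point \<times> int \<Rightarrow> nat \<Rightarrow> real" where
  "avec d z j = of_int (snd z) * (if j < d then fst z j else 1) / (real (d + 1) + (\<Sum>l<d. (fst z l)\<^sup>2))"

definition zp :: "nat \<Rightarrow> nat set \<Rightarrow> sample \<Rightarrow> nat \<Rightarrow> real" where
  "zp d I S = (THE z. mnp (d + 1) I (\<lambda>i. avec d (S i)) z)"

lemma avec_denom_pos: "0 < real (d + 1) + (\<Sum>l<d. (x l)\<^sup>2)"
  by (intro add_pos_nonneg sum_nonneg) auto

lemma avec_l1:
  assumes "snd z \<in> labels"
  shows "(\<Sum>j<d + 1. \<bar>avec d z j\<bar>) \<le> 1"
proof -
  let ?D = "real (d + 1) + (\<Sum>l<d. (fst z l)\<^sup>2)"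
  note D = avec_denom_pos[where d = d and x = "fst z"]
  have y: "\<bar>real_of_int (snd z)\<bar> = 1" using assms by auto
  have "(\<Sum>j<d + 1. \<bar>avec d z j\<bar>) = (\<Sum>j<d + 1. (if j < d then \<bar>fst z j\<bar> else 1) / ?D)"
    by (intro sum.cong refl) (use D y in \<open>auto simp: avec_def abs_mult\<close>)
  also have "\<dots> = ((\<Sum>j<d. \<bar>fst z j\<bar>) + 1) / ?D" by (simp add: sum_divide_distrib add_divide_distrib)
  also have "\<dots> \<le> 1"
  proof -
    \<comment> \<open>Summed over the \<open>d\<close> coordinates, this inequality accounts for the
      constant \<open>d + 1\<close> in the denominator of \<open>avec\<close>.\<close>
    have "\<bar>fst z j\<bar> \<le> 1 + (fst z j)\<^sup>2" for j
      using zero_le_power2[of "\<bar>fst z j\<bar> - 1"] by (simp add: power2_eq_square algebra_simps abs_if split: if_splits)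
    hence "(\<Sum>j<d. \<bar>fst z j\<bar>) \<le> (\<Sum>j<d. 1 + (fst z j)\<^sup>2)" by (intro sum_mono)
    thus ?thesis using D by (simp add: sum.distrib)
  qed
  finally show ?thesis .
qed

lemma ip_avec:
  "ip (d + 1) (avec d z) w = of_int (snd z) * ((\<Sum>j<d. w j * fst z j) + w d) / (real (d + 1) + (\<Sum>l<d. (fst z l)\<^sup>2))"
proof -
  let ?D = "real (d + 1) + (\<Sum>l<d. (fst z l)\<^sup>2)"
  have "(\<Sum>j<d. avec d z j * w j) = of_int (snd z) / ?D * (\<Sum>j<d. w j * fst z j)"
    unfolding sum_distrib_left by (intro sum.cong refl) (simp add: avec_def)
  moreover have "ip (d + 1) (avec d z) w = (\<Sum>j<d. avec d z j * w j) + avec d z d * w d" by (simp add: ip_def)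
  moreover have "avec d z d * w d = of_int (snd z) / ?D * w d" by (simp add: avec_def)
  ultimately have "ip (d + 1) (avec d z) w = of_int (snd z) / ?D * ((\<Sum>j<d. w j * fst z j) + w d)"
    by (simp only: distrib_left)
  thus ?thesis by (simp only: times_divide_eq_left)
qed

text \<open>Strict positivity treats both labels alike, although the classifier itself resolves ties
  in favour of 1.\<close>

lemma halfspace_consistent:
  assumes "0 < ip (d + 1) (avec d z) w" "snd z \<in> labels"
  shows "halfspace d w (w d) (fst z) = snd z"
proof -
  have "0 < of_int (snd z) * ((\<Sum>j<d. w j * fst z j) + w d)"
    using assms(1) avec_denom_pos[where d = d and x = "fst z"] unfolding ip_avec by (simp add: zero_less_divide_iff)
  thus ?thesis using assms(2) by (auto simp: halfspace_def)
qed

lemma zp_mnp: "finite I \<Longrightarrow> I \<noteq> {} \<Longrightarrow> mnp (d + 1) I (\<lambda>i. avec d (S i)) (zp d I S)"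
proof -
  assume I: "finite I" "I \<noteq> {}"
  obtain z where z: "mnp (d + 1) I (\<lambda>i. avec d (S i)) z" using mnp_exists[OF I] by blast
  show ?thesis unfolding zp_def by (rule theI[where P = "mnp (d + 1) I (\<lambda>i. avec d (S i))", OF z mnp_unique[OF _ z]])
qed

lemma zp_eqI: "mnp (d + 1) I (\<lambda>i. avec d (S i)) z \<Longrightarrow> zp d I S = z"
proof -
  assume z: "mnp (d + 1) I (\<lambda>i. avec d (S i)) z"
  show ?thesis
    unfolding zp_def by (rule the_equality[where P = "mnp (d + 1) I (\<lambda>i. avec d (S i))", OF z mnp_unique[OF _ z]])
qed

text \<open>The point sees only the examples in \<open>I\<close>; the independence of the remaining
  examples rests on this.\<close>

lemma zp_cong: "(\<And>i. i \<in> I \<Longrightarrow> S i = S' i) \<Longrightarrow> zp d I S = zp d I S'"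
proof -
  assume a: "\<And>i. i \<in> I \<Longrightarrow> S i = S' i"
  have "mnp (d + 1) I (\<lambda>i. avec d (S i)) z = mnp (d + 1) I (\<lambda>i. avec d (S' i)) z" for z
  proof -
    have "(\<lambda>j. if j < d + 1 then \<Sum>i\<in>I. l i * avec d (S i) j else 0) =
      (\<lambda>j. if j < d + 1 then \<Sum>i\<in>I. l i * avec d (S' i) j else 0)" for l
      using a by (intro ext) (auto intro!: sum.cong)
    thus ?thesis unfolding mnp_def using a by simp
  qed
  thus ?thesis by (simp add: zp_def)
qed

section \<open>Measurability of the minimum-norm point and of the candidates\<close>

lemma measurable_avec:
  assumes P: "sets P = sets (example_space d)" and i: "i \<in> I" and j: "j \<le> d"
  shows "(\<lambda>S. avec d (S i) j) \<in> borel_measurable (Pi\<^sub>M I (\<lambda>_. P))"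
proof -
  have f: "(\<lambda>z. fst z l) \<in> borel_measurable (example_space d)" if "l < d" for l
    unfolding example_space_def Rd_def
    using measurable_compose[OF measurable_fst measurable_component_singleton[of l "{..<d}" "\<lambda>_. borel :: real measure"]] that by simp
  have s: "(\<lambda>z. real_of_int (snd z)) \<in> borel_measurable (example_space d)"
    unfolding example_space_def by (rule measurable_compose[OF measurable_snd]) simp
  have "(\<lambda>z. avec d z j) \<in> borel_measurable (example_space d)"
    unfolding avec_def using f s
    by (cases "j < d") (auto intro!: borel_measurable_divide borel_measurable_times borel_measurable_add borel_measurable_sum borel_measurable_power)
  hence "(\<lambda>z. avec d z j) \<in> borel_measurable P" by (simp add: measurable_cong_sets[OF P refl])
  from measurable_compose[OF measurable_component_singleton[OF i] this] show ?thesis .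
qed

text \<open>By duality, the supremum over \<open>w\<close> is the minimum of |y + t e_j|^2 over the
  convex hull, with e_j the unit vector of coordinate \<open>j\<close>: for fixed y, the maximum of
  2 (y + t e_j) . w - |w|^2 over w is |y + t e_j|^2, and a linear function attains its minimum over
  the hull at an example.\<close>

definition dual :: "nat \<Rightarrow> nat set \<Rightarrow> sample \<Rightarrow> nat \<Rightarrow> real \<Rightarrow> (nat \<Rightarrow> real) \<Rightarrow> real" where
  "dual d I S j t w = 2 * (INF i\<in>I. ip (d + 1) (avec d (S i)) w) - nrm2 (d + 1) w + 2 * t * w j"

text \<open>A countable set with two uses: as a dense domain for the dual supremum and as the range
  of the candidates in \<open>bad_measure\<close>.\<close>

definition ratvecs :: "nat \<Rightarrow> (nat \<Rightarrow> real) set" where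
  "ratvecs m = (\<Pi>\<^sub>E j\<in>{..<m}. \<rat>)"

lemma countable_ratvecs: "countable (ratvecs m)"
  unfolding ratvecs_def by (intro countable_PiE) (auto intro: countable_rat)

text \<open>Weak duality, tested against the hull point \<open>z\<close>; the bound is |z + t
  e_j|^2.\<close>

lemma dual_le:
  assumes fin: "finite I" "I \<noteq> {}" and j: "j \<le> d"
  shows "dual d I S j t w \<le> nrm2 (d + 1) (zp d I S) + 2 * t * zp d I S j + t\<^sup>2"
proof -
  let ?z = "zp d I S" and ?a = "\<lambda>i. avec d (S i)"
  let ?\<mu> = "INF i\<in>I. ip (d + 1) (?a i) w"
  obtain l where l: "\<forall>i\<in>I. 0 \<le> l i" "sum l I = 1"
    and z: "?z = (\<lambda>j. if j < d + 1 then \<Sum>i\<in>I. l i * ?a i j else 0)"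
    using zp_mnp[OF fin, of d S] unfolding mnp_def by blast
  have "?\<mu> = (\<Sum>i\<in>I. l i * ?\<mu>)" using l by (simp flip: sum_distrib_right)
  also have "\<dots> \<le> (\<Sum>i\<in>I. l i * ip (d + 1) (?a i) w)"
    using l fin by (intro sum_mono mult_left_mono cINF_lower) auto
  also have "\<dots> = ip (d + 1) w ?z" unfolding ip_comb[OF z] ..
  finally have 1: "?\<mu> \<le> ip (d + 1) w ?z" .
  have "(w j - ?z j)\<^sup>2 \<le> nrm2 (d + 1) (\<lambda>j. w j - ?z j)" using coord_le_nrm2[of j "d + 1" "\<lambda>j. w j - ?z j"] j by simp
  also have "\<dots> = nrm2 (d + 1) w - 2 * ip (d + 1) w ?z + nrm2 (d + 1) ?z"
    by (simp add: ip_linear ip_commute[of _ "zp d I S" w])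
  finally have "2 * ip (d + 1) w ?z - nrm2 (d + 1) w \<le> nrm2 (d + 1) ?z - (w j - ?z j)\<^sup>2" by simp
  moreover have "0 \<le> (w j - ?z j - t)\<^sup>2" by simp
  ultimately show ?thesis using 1 unfolding dual_def by (simp add: power2_eq_square algebra_simps)
qed

text \<open>The lower bound that matches \<open>dual_le\<close> up to t^2: a rational vector near
  \<open>z\<close> nearly reaches the dual value of \<open>z\<close>.\<close>

lemma dual_dense:
  assumes fin: "finite I" "I \<noteq> {}" and j: "j \<le> d" and t: "0 \<le> t"
    and lab: "\<And>i. i \<in> I \<Longrightarrow> snd (S i) \<in> labels" and eta: "0 < eta"
  shows "\<exists>w\<in>ratvecs (d + 1). nrm2 (d + 1) (zp d I S) + 2 * t * zp d I S j - eta \<le> dual d I S j t w"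
proof -
  let ?z = "zp d I S" and ?a = "\<lambda>i. avec d (S i)" and ?m = "d + 1"
  have mz: "mnp ?m I ?a ?z" by (rule zp_mnp[OF fin])
  have a1: "(\<Sum>j<?m. \<bar>?a i j\<bar>) \<le> 1" if "i \<in> I" for i using avec_l1[OF lab[OF that]] .
  have z1: "\<bar>?z l\<bar> \<le> 1" for l
  proof (cases "l < ?m")
    case True
    from mz obtain c where c: "\<forall>i\<in>I. 0 \<le> c i" "sum c I = 1"
      and z: "?z = (\<lambda>j. if j < ?m then \<Sum>i\<in>I. c i * ?a i j else 0)" unfolding mnp_def by blast
    have "\<bar>?z l\<bar> \<le> (\<Sum>i\<in>I. c i * \<bar>?a i l\<bar>)"
      using True c z sum_abs[of "\<lambda>i. c i * ?a i l" I] by (simp add: abs_mult)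
    also have "\<dots> \<le> (\<Sum>i\<in>I. c i * 1)"
    proof (intro sum_mono mult_left_mono)
      fix i assume i: "i \<in> I"
      show "\<bar>?a i l\<bar> \<le> 1"
        using member_le_sum[of l "{..<?m}" "\<lambda>j. \<bar>?a i j\<bar>"] a1[OF i] True by auto
    qed (use c in auto)
    finally show ?thesis using c by simp
  next
    case False thus ?thesis using mz by (auto simp: mnp_def)
  qed
  \<comment> \<open>Replacing \<open>z\<close> by a vector within \<open>x\<close> in each
    coordinate loses at most 2 x in the infimum term, 3 m x in the norm and 2 t x in the last
    term.\<close>
  define x where "x = min 1 (eta / (2 + 3 * real ?m + 2 * t))"
  have den: "0 < 2 + 3 * real ?m + 2 * t" using t by simp
  have x: "0 < x" "x \<le> 1" using eta den by (simp_all add: x_def)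
  have "x \<le> eta / (2 + 3 * real ?m + 2 * t)" unfolding x_def by (rule min.cobounded2)
  hence x3: "(2 + 3 * real ?m + 2 * t) * x \<le> eta" using den by (simp only: pos_le_divide_eq mult.commute)
  have "\<exists>r\<in>\<rat>. \<bar>r - ?z l\<bar> \<le> x" for l
  proof -
    obtain q where q: "q \<in> \<rat>" "?z l - x < q" "q < ?z l + x"
      using Rats_dense_in_real[of "?z l - x" "?z l + x"] x(1) by auto
    hence "\<bar>q - ?z l\<bar> \<le> x" by linarith
    with q(1) show ?thesis by blast
  qed
  then obtain r where r: "\<And>l. r l \<in> \<rat>" "\<And>l. \<bar>r l - ?z l\<bar> \<le> x" by metis
  define w where "w = restrict r {..<?m}"
  have wl: "\<bar>w l - ?z l\<bar> \<le> x" if "l < ?m" for l using r(2)[of l] that by (simp add: w_def)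
  have "w \<in> ratvecs ?m" using r(1) by (auto simp: w_def ratvecs_def)
  moreover have "nrm2 ?m ?z + 2 * t * ?z j - eta \<le> dual d I S j t w"
  proof -
    have 1: "nrm2 ?m ?z - x \<le> (INF i\<in>I. ip ?m (?a i) w)"
    proof (rule cINF_greatest[OF fin(2)])
      fix i assume i: "i \<in> I"
      have "\<bar>ip ?m (\<lambda>l. w l - ?z l) (?a i)\<bar> \<le> x * (\<Sum>l<?m. \<bar>?a i l\<bar>)" by (rule ip_bound1) (rule wl)
      also have "\<dots> \<le> x * 1" using x a1[OF i] by (intro mult_left_mono) auto
      finally have "\<bar>ip ?m (?a i) w - ip ?m (?a i) ?z\<bar> \<le> x" by (simp add: ip_linear ip_commute)
      moreover have "nrm2 ?m ?z \<le> ip ?m (?a i) ?z" using mz i by (auto simp: mnp_def)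
      ultimately show "nrm2 ?m ?z - x \<le> ip ?m (?a i) w" by linarith
    qed
    have 2: "nrm2 ?m w \<le> nrm2 ?m ?z + 3 * real ?m * x"
    proof -
      have "w l * w l \<le> ?z l * ?z l + 3 * x" if l: "l < ?m" for l
      proof -
        define e where "e = w l - ?z l"
        have e: "\<bar>e\<bar> \<le> x" using wl[OF l] by (simp add: e_def)
        have "w l * w l = ?z l * ?z l + 2 * (?z l * e) + e * e" by (simp add: e_def algebra_simps)
        moreover have "\<bar>?z l * e\<bar> \<le> 1 * x" unfolding abs_mult using z1[of l] e by (intro mult_mono) auto
        moreover have "\<bar>e * e\<bar> \<le> x * 1" unfolding abs_mult using e x by (intro mult_mono) auto
        ultimately show ?thesis by linarith
      qed
      hence "nrm2 ?m w \<le> (\<Sum>l<?m. ?z l * ?z l + 3 * x)" unfolding ip_def by (intro sum_mono) auto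
      thus ?thesis by (simp add: ip_def sum.distrib algebra_simps)
    qed
    have 3: "2 * t * ?z j - 2 * t * x \<le> 2 * t * w j"
      using wl[of j] j t mult_left_mono[of "?z j - x" "w j" "2 * t"] by (simp add: algebra_simps)
    show ?thesis unfolding dual_def using 1 2 3 x3 by (simp add: algebra_simps)
  qed
  ultimately show ?thesis by blast
qed

text \<open>The coordinates of the minimum-norm point are the derivatives at \<open>t = 0\<close> of the optimal
  value of a perturbed dual problem, a supremum over countably many vectors.\<close>

lemma measurable_zp:
  assumes P: "sets P = sets (example_space d)" and fin: "finite I" "I \<noteq> {}" and j: "j \<le> d"
  shows "(\<lambda>S. zp d I S j) \<in> borel_measurable (Pi\<^sub>M I (\<lambda>_. P))"
proof -
  let ?M = "Pi\<^sub>M I (\<lambda>_. P)"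
  define F where "F t S = (SUP w\<in>ratvecs (d + 1). dual d I S j t w)" for t S
  have lab: "snd (S i) \<in> labels" if "S \<in> space ?M" "i \<in> I" for S i
  proof -
    have "space P = space (example_space d)" by (rule sets_eq_imp_space_eq[OF P])
    hence "S i \<in> space (example_space d)" using that by (auto simp: space_PiM)
    thus ?thesis by (auto simp: example_space_def space_pair_measure)
  qed
  have up: "bdd_above ((\<lambda>w. dual d I S j t w) ` ratvecs (d + 1))" for t S
    using dual_le[OF fin j] by (auto simp: bdd_above_def)
  have ne: "ratvecs (d + 1) \<noteq> {}" by (auto simp: ratvecs_def PiE_eq_empty_iff)
  have Fub: "F t S \<le> nrm2 (d + 1) (zp d I S) + 2 * t * zp d I S j + t\<^sup>2" for t S
    unfolding F_def using ne dual_le[OF fin j] by (intro cSUP_least) auto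
  have Flb: "nrm2 (d + 1) (zp d I S) + 2 * t * zp d I S j \<le> F t S" if S: "S \<in> space ?M" and t: "0 \<le> t" for t S
  proof (rule field_le_epsilon)
    fix eta :: real assume "0 < eta"
    then obtain w where "w \<in> ratvecs (d + 1)"
      "nrm2 (d + 1) (zp d I S) + 2 * t * zp d I S j - eta \<le> dual d I S j t w"
      using dual_dense[OF fin j t, of S eta] lab[OF S] by blast
    moreover from this have "dual d I S j t w \<le> F t S" unfolding F_def using up by (intro cSUP_upper) auto
    ultimately show "nrm2 (d + 1) (zp d I S) + 2 * t * zp d I S j \<le> F t S + eta" by simp
  qed
  have mF: "F t \<in> borel_measurable ?M" for t
    unfolding F_def[abs_def]
  proof (rule borel_measurable_cSUP[OF countable_ratvecs])
    fix w
    have "(\<lambda>S. INF i\<in>I. ip (d + 1) (avec d (S i)) w) \<in> borel_measurable ?M"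
    proof (rule borel_measurable_cINF)
      show "(\<lambda>S. ip (d + 1) (avec d (S i)) w) \<in> borel_measurable ?M" if "i \<in> I" for i
        unfolding ip_def using that
        by (intro borel_measurable_sum borel_measurable_times measurable_avec[OF P]) auto
    qed (use fin in \<open>auto intro: countable_finite bdd_below_finite\<close>)
    thus "(\<lambda>S. dual d I S j t w) \<in> borel_measurable ?M" unfolding dual_def by simp
  qed (use up in auto)
  \<comment> \<open>The optimal value lies between |z|^2 + 2 t z_j and the same plus t^2, so half
    the difference quotient at t = 1 / (N + 1) exceeds z_j by at most 1 / (2 (N + 1)).\<close>
  have lim: "(\<lambda>N. (F (1 / real (Suc N)) S - F 0 S) * real (Suc N) / 2) \<longlonglongrightarrow> zp d I S j" if S: "S \<in> space ?M" for S
  proof (rule real_tendsto_sandwich)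
    have F0: "F 0 S = nrm2 (d + 1) (zp d I S)" using Fub[of 0 S] Flb[OF S, of 0] by simp
    show "\<forall>\<^sub>F N in sequentially. zp d I S j \<le> (F (1 / real (Suc N)) S - F 0 S) * real (Suc N) / 2"
      using Flb[OF S, of "1 / real (Suc N)" for N] by (intro always_eventually allI) (simp add: F0 field_simps)
    show "\<forall>\<^sub>F N in sequentially. (F (1 / real (Suc N)) S - F 0 S) * real (Suc N) / 2 \<le> zp d I S j + 1 / real (Suc N) / 2"
    proof (intro always_eventually allI)
      fix N
      have "F (1 / real (Suc N)) S - F 0 S \<le> 2 / real (Suc N) * zp d I S j + (1 / real (Suc N))\<^sup>2"
        using Fub[of "1 / real (Suc N)" S] by (simp add: F0)
      hence "(F (1 / real (Suc N)) S - F 0 S) * (real (Suc N) / 2) \<le> (2 / real (Suc N) * zp d I S j + (1 / real (Suc N))\<^sup>2) * (real (Suc N) / 2)"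
        by (rule mult_right_mono) simp
      also have "\<dots> = zp d I S j + 1 / real (Suc N) / 2"
        by (simp add: field_simps power2_eq_square del: of_nat_Suc)
      finally show "(F (1 / real (Suc N)) S - F 0 S) * real (Suc N) / 2 \<le> zp d I S j + 1 / real (Suc N) / 2" by simp
    qed
    have "(\<lambda>N. zp d I S j + 1 / real (Suc N) / 2) \<longlonglongrightarrow> zp d I S j + 0 / 2"
      by (intro tendsto_intros LIMSEQ_Suc[OF lim_1_over_n]) simp
    thus "(\<lambda>N. zp d I S j + 1 / real (Suc N) / 2) \<longlonglongrightarrow> zp d I S j" by simp
  qed simp
  show ?thesis
    by (rule borel_measurable_LIMSEQ_real[OF lim]) (use mF in auto)
qed

text \<open>The vectors within \<open>2 / 2 ^ K\<close> of \<open>z\<close> on the grid of mesh \<open>1 / 2 ^ K\<close>, for the few \<open>K\<close> at which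
  the program may stop.\<close>

definition kz :: "nat \<Rightarrow> (nat \<Rightarrow> real) \<Rightarrow> nat" where
  "kz m z = nat \<lceil>log 2 (4 / nrm2 m z)\<rceil>"

definition cnd :: "nat \<Rightarrow> nat \<times> (nat \<Rightarrow> int) \<Rightarrow> (nat \<Rightarrow> real) \<Rightarrow> nat \<Rightarrow> real" where
  "cnd m c z j = of_int (\<lfloor>z j * 2 ^ (kz m z + fst c)\<rfloor> + snd c j) / 2 ^ (kz m z + fst c)"

definition codes :: "nat \<Rightarrow> (nat \<times> (nat \<Rightarrow> int)) set" where
  "codes m = {..<5} \<times> (\<Pi>\<^sub>E j\<in>{..<m}. {-1, 0, 1})"

lemma codes_card: "finite (codes m)" "card (codes m) = 5 * 3 ^ m"
proof -
  show "finite (codes m)" by (auto simp: codes_def intro!: finite_PiE)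
  have "card {-1, 0, 1::int} = 3" by simp
  thus "card (codes m) = 5 * 3 ^ m"
    by (simp only: codes_def card_cartesian_product card_PiE finite_lessThan card_lessThan prod_constant)
qed

text \<open>\<open>kz\<close> is the least exponent K for which 4 / 2 ^ K is at most |z|^2. The
  window for \<open>K\<close> spans a factor 32 and so leaves 5 exponents, and a coordinate within
  one mesh width of \<open>z\<close> has a floor that differs by at most 1.\<close>

lemma cnd_exists:
  assumes g: "0 < nrm2 m z" and K: "1 / 2 ^ K \<le> nrm2 m z / 4" "nrm2 m z / 128 < 1 / 2 ^ K"
    and B: "\<And>j. j < m \<Longrightarrow> \<bar>B j - z j\<bar> \<le> 1 / 2 ^ K"
  shows "\<exists>c\<in>codes m. \<forall>j<m. of_int \<lfloor>B j * 2 ^ K\<rfloor> / 2 ^ K = cnd m c z j"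
proof -
  let ?g = "nrm2 m z"
  have le: "kz m z \<le> K"
  proof -
    have "4 / ?g \<le> 2 ^ K" using K(1) g by (simp add: field_simps)
    hence "log 2 (4 / ?g) \<le> real K" using g by (subst log_le_iff) (auto simp: powr_realpow)
    thus ?thesis unfolding kz_def by (simp add: ceiling_le_iff nat_le_iff)
  qed
  have ge: "4 / ?g \<le> 2 ^ kz m z"
  proof -
    have "log 2 (4 / ?g) \<le> real (kz m z)" unfolding kz_def by linarith
    hence "4 / ?g \<le> 2 powr real (kz m z)" using g by (subst (asm) log_le_iff) auto
    thus ?thesis by (simp add: powr_realpow)
  qed
  obtain e where e: "K = kz m z + e" using le by (metis le_iff_add)
  have "e < 5"
  proof (rule ccontr)
    assume "\<not> e < 5"
    hence "(2::real) ^ 5 \<le> 2 ^ e" by (intro power_increasing) auto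
    hence "4 / ?g * 2 ^ 5 \<le> 2 ^ kz m z * 2 ^ e" using ge g by (intro mult_mono) auto
    hence "4 / ?g * 2 ^ 5 \<le> 2 ^ K" by (simp add: e power_add)
    with K(2) g show False by (simp add: field_simps)
  qed
  define f where "f j = (if j < m then \<lfloor>B j * 2 ^ K\<rfloor> - \<lfloor>z j * 2 ^ K\<rfloor> else undefined)" for j
  have "f j \<in> {-1, 0, 1}" if j: "j < m" for j
  proof -
    have "\<bar>B j - z j\<bar> * 2 ^ K \<le> 1" using B[OF j] by (simp add: field_simps)
    hence "\<bar>B j * 2 ^ K - z j * 2 ^ K\<bar> \<le> 1" by (simp add: abs_mult left_diff_distrib[symmetric])
    hence "\<lfloor>B j * 2 ^ K\<rfloor> - \<lfloor>z j * 2 ^ K\<rfloor> \<le> 1" "-1 \<le> \<lfloor>B j * 2 ^ K\<rfloor> - \<lfloor>z j * 2 ^ K\<rfloor>" by linarith+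
    thus ?thesis using j by (auto simp: f_def)
  qed
  hence "(e, f) \<in> codes m" using \<open>e < 5\<close> by (auto simp: codes_def f_def PiE_def extensional_def)
  moreover have "of_int \<lfloor>B j * 2 ^ K\<rfloor> / 2 ^ K = cnd m (e, f) z j" if "j < m" for j
    using that by (simp add: cnd_def f_def e)
  ultimately show ?thesis by blast
qed

lemma measurable_cnd:
  assumes P: "sets P = sets (example_space d)" and fin: "finite I" "I \<noteq> {}" and j: "j \<le> d"
  shows "(\<lambda>S. cnd (d + 1) c (zp d I S) j) \<in> borel_measurable (Pi\<^sub>M I (\<lambda>_. P))"
proof -
  let ?M = "Pi\<^sub>M I (\<lambda>_. P)"
  have z: "(\<lambda>S. zp d I S j) \<in> borel_measurable ?M" if "j \<le> d" for j by (rule measurable_zp[OF P fin that])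
  have "(\<lambda>S. nrm2 (d + 1) (zp d I S)) \<in> borel_measurable ?M"
    unfolding ip_def by (intro borel_measurable_sum borel_measurable_times z) auto
  hence "(\<lambda>S. log 2 (4 / nrm2 (d + 1) (zp d I S))) \<in> borel_measurable ?M" by simp
  hence "(\<lambda>S. \<lceil>log 2 (4 / nrm2 (d + 1) (zp d I S))\<rceil>) \<in> ?M \<rightarrow>\<^sub>M count_space UNIV" by simp
  hence k: "(\<lambda>S. kz (d + 1) (zp d I S)) \<in> ?M \<rightarrow>\<^sub>M count_space UNIV"
    unfolding kz_def by (rule measurable_compose) simp
  have "(\<lambda>S. 2 ^ (kz (d + 1) (zp d I S) + fst c) :: real) \<in> borel_measurable ?M"
    by (rule measurable_compose[OF k]) simp
  with z[OF j] show ?thesis unfolding cnd_def by simp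
qed

section \<open>Independent blocks of the sample and the union bound\<close>

lemma measurable_halfspace: "halfspace d w b \<in> Rd d \<rightarrow>\<^sub>M count_space labels"
proof -
  have "(\<lambda>x. (\<Sum>j<d. w j * x j) + b) \<in> borel_measurable (Rd d)"
    unfolding Rd_def by (intro borel_measurable_add borel_measurable_sum borel_measurable_times) auto
  hence "{x \<in> space (Rd d). (\<Sum>j<d. w j * x j) + b \<ge> 0} \<in> sets (Rd d)" by simp
  thus ?thesis unfolding halfspace_def[abs_def] by (intro measurable_If) auto
qed

lemma sets_halfspace_error:
  assumes P: "sets P = sets (example_space d)"
  shows "{z \<in> space P. halfspace d w b (fst z) \<noteq> snd z} \<in> sets P"
proof -
  have sp: "space P = space (example_space d)" by (rule sets_eq_imp_space_eq[OF P])
  have f: "(\<lambda>z. halfspace d w b (fst z)) \<in> example_space d \<rightarrow>\<^sub>M count_space UNIV"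
    unfolding example_space_def
    by (rule measurable_compose[OF measurable_compose[OF measurable_fst measurable_halfspace]]) simp
  have s: "snd \<in> example_space d \<rightarrow>\<^sub>M count_space UNIV"
    unfolding example_space_def by (rule measurable_compose[OF measurable_snd]) simp
  have "{z \<in> space (example_space d). halfspace d w b (fst z) = snd z} \<in> sets (example_space d)"
    using measurable_equality_set[of "\<lambda>z. real_of_int (halfspace d w b (fst z))" "example_space d" "\<lambda>z. real_of_int (snd z)"]
      measurable_compose[OF f, of real_of_int borel] measurable_compose[OF s, of real_of_int borel] by simp
  from sets.sets_Collect_neg[OF this] show ?thesis unfolding sp P .
qed

text \<open>Independence of two blocks: the product measure on their union is the image of the pair
  measure under \<open>merge\<close>, and the event pulls back to a rectangle.\<close>

lemma emeasure_PiM_split: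
  assumes P: "prob_space P" and fin: "finite I" "finite J" and disj: "I \<inter> J = {}"
    and A: "A \<in> sets (Pi\<^sub>M I (\<lambda>_. P))" and B: "B \<in> sets (Pi\<^sub>M J (\<lambda>_. P))"
  defines "X \<equiv> {S \<in> space (Pi\<^sub>M (I \<union> J) (\<lambda>_. P)). restrict S I \<in> A \<and> restrict S J \<in> B}"
  shows "X \<in> sets (Pi\<^sub>M (I \<union> J) (\<lambda>_. P))"
    and "emeasure (Pi\<^sub>M (I \<union> J) (\<lambda>_. P)) X = emeasure (Pi\<^sub>M I (\<lambda>_. P)) A * emeasure (Pi\<^sub>M J (\<lambda>_. P)) B"
proof -
  interpret P: prob_space P by fact
  interpret pp: product_prob_space "\<lambda>_. P" UNIV by unfold_locales
  let ?M = "\<lambda>I. Pi\<^sub>M I (\<lambda>_. P)"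
  interpret J: prob_space "?M J" by (rule prob_space_PiM) (rule P)
  have rI: "(\<lambda>S. restrict S I) \<in> ?M (I \<union> J) \<rightarrow>\<^sub>M ?M I" by (rule measurable_restrict_subset) auto
  have rJ: "(\<lambda>S. restrict S J) \<in> ?M (I \<union> J) \<rightarrow>\<^sub>M ?M J" by (rule measurable_restrict_subset) auto
  have "X = ((\<lambda>S. restrict S I) -` A \<inter> space (?M (I \<union> J))) \<inter> ((\<lambda>S. restrict S J) -` B \<inter> space (?M (I \<union> J)))"
    by (auto simp: X_def)
  thus X: "X \<in> sets (?M (I \<union> J))"
    using measurable_sets[OF rI A] measurable_sets[OF rJ B] by auto
  have "emeasure (?M (I \<union> J)) X = emeasure (distr (?M I \<Otimes>\<^sub>M ?M J) (?M (I \<union> J)) (merge I J)) X"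
    using pp.distr_merge[OF disj fin] by simp
  also have "\<dots> = emeasure (?M I \<Otimes>\<^sub>M ?M J) (merge I J -` X \<inter> space (?M I \<Otimes>\<^sub>M ?M J))"
    by (rule emeasure_distr[OF measurable_merge X])
  also have "merge I J -` X \<inter> space (?M I \<Otimes>\<^sub>M ?M J) = A \<times> B"
  proof (intro equalityI subsetI)
    fix p assume p: "p \<in> merge I J -` X \<inter> space (?M I \<Otimes>\<^sub>M ?M J)"
    obtain x y where xy: "p = (x, y)" by (cases p)
    have "x \<in> space (?M I)" "y \<in> space (?M J)" using p by (auto simp: xy space_pair_measure)
    hence "restrict (merge I J (x, y)) I = x" "restrict (merge I J (x, y)) J = y"
      using disj by (auto simp: space_PiM PiE_def extensional_restrict)
    thus "p \<in> A \<times> B" using p by (auto simp: xy X_def)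
  next
    fix p assume p: "p \<in> A \<times> B"
    obtain x y where xy: "p = (x, y)" by (cases p)
    have s: "x \<in> space (?M I)" "y \<in> space (?M J)"
      using p sets.sets_into_space[OF A] sets.sets_into_space[OF B] by (auto simp: xy)
    hence "restrict (merge I J (x, y)) I = x" "restrict (merge I J (x, y)) J = y"
      using disj by (auto simp: space_PiM PiE_def extensional_restrict)
    moreover have "(x, y) \<in> space (?M I \<Otimes>\<^sub>M ?M J)" using s by (simp add: space_pair_measure)
    moreover from this have "merge I J (x, y) \<in> space (?M (I \<union> J))" by (rule measurable_space[OF measurable_merge])
    ultimately show "p \<in> merge I J -` X \<inter> space (?M I \<Otimes>\<^sub>M ?M J)"
      using p by (auto simp: xy X_def)
  qed
  also have "emeasure (?M I \<Otimes>\<^sub>M ?M J) (A \<times> B) = emeasure (?M I) A * emeasure (?M J) B"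
    by (rule J.emeasure_pair_measure_Times[OF A B])
  finally show "emeasure (?M (I \<union> J)) X = emeasure (?M I) A * emeasure (?M J) B" .
qed

lemma halfspace_cong: "(\<And>j. j < d \<Longrightarrow> v j = w j) \<Longrightarrow> halfspace d v b = halfspace d w b"
  by (simp add: halfspace_def fun_eq_iff)

text \<open>\<open>I\<close> is the block that determines the candidate and \<open>T\<close> the
  block that tests it.\<close>

definition bad :: "nat \<Rightarrow> (point \<times> int) measure \<Rightarrow> nat set \<Rightarrow> nat set \<Rightarrow> nat \<times> (nat \<Rightarrow> int) \<Rightarrow> real \<Rightarrow> sample set" where
  "bad d P I T c ep = {S \<in> space (Pi\<^sub>M (I \<union> T) (\<lambda>_. P)).
     let v = cnd (d + 1) c (zp d I S); h = halfspace d v (v d) in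
     (\<forall>i\<in>T. h (fst (S i)) = snd (S i)) \<and> ep < risk P h}"

lemma cnd_in_ratvecs: "restrict (cnd m c z) {..<m} \<in> ratvecs m"
  by (auto simp: ratvecs_def cnd_def intro!: Rats_divide Rats_power)

text \<open>Once the value of the candidate is fixed, the test examples are still independent of it,
  and a value of risk above \<open>ep\<close> passes with probability at most (1 - ep)^card T.
  Candidates are rational, so the event is a countable disjoint union of rectangles, one for each
  value.\<close>

lemma bad_measure:
  assumes pP: "prob_space P" and P: "sets P = sets (example_space d)"
    and fin: "finite I" "I \<noteq> {}" "finite T" and disj: "I \<inter> T = {}"
  shows "bad d P I T c ep \<in> sets (Pi\<^sub>M (I \<union> T) (\<lambda>_. P))"
    and "emeasure (Pi\<^sub>M (I \<union> T) (\<lambda>_. P)) (bad d P I T c ep) \<le> ennreal (exp (- ep * real (card T)))"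
proof -
  interpret P: prob_space P by fact
  interpret pp: product_prob_space "\<lambda>_. P" UNIV by unfold_locales
  let ?M = "\<lambda>I. Pi\<^sub>M I (\<lambda>_. P)"
  interpret I: prob_space "?M I" by (rule prob_space_PiM) (rule pP)
  define h where "h v = halfspace d v (v d)" for v :: "nat \<Rightarrow> real"
  define Z where "Z S = restrict (cnd (d + 1) c (zp d I S)) {..<d + 1}" for S
  define A where "A v = {S \<in> space (?M I). Z S = v}" for v
  define G where "G v = {z \<in> space P. h v (fst z) = snd z}" for v
  define V where "V = {v \<in> ratvecs (d + 1). ep < risk P (h v)}"
  define X where "X v = {S \<in> space (?M (I \<union> T)). restrict S I \<in> A v \<and> restrict S T \<in> (\<Pi>\<^sub>E i\<in>T. G v)}" for v
  have cV: "countable V" unfolding V_def by (rule countable_subset[OF _ countable_ratvecs[of "d + 1"]]) auto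
  have err: "{z \<in> space P. h v (fst z) \<noteq> snd z} \<in> sets P" for v
    unfolding h_def by (rule sets_halfspace_error[OF P])
  have Gc: "G v = space P - {z \<in> space P. h v (fst z) \<noteq> snd z}" for v by (auto simp: G_def)
  have Gs: "G v \<in> sets P" for v unfolding Gc using err by auto
  have Gm: "measure P (G v) = 1 - risk P (h v)" for v
    unfolding Gc risk_def by (rule P.prob_compl[OF err])
  have As: "A v \<in> sets (?M I)" if "v \<in> ratvecs (d + 1)" for v
  proof -
    have "A v = {S \<in> space (?M I). \<forall>j\<in>{..<d + 1}. cnd (d + 1) c (zp d I S) j = v j}"
    proof -
      have "Z S = v \<longleftrightarrow> (\<forall>j\<in>{..<d + 1}. cnd (d + 1) c (zp d I S) j = v j)" for S
        using that by (auto simp: Z_def ratvecs_def PiE_def extensional_def fun_eq_iff)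
      thus ?thesis by (simp add: A_def)
    qed
    also have "\<dots> \<in> sets (?M I)"
    proof (rule sets.sets_Collect_finite_All)
      fix j assume "j \<in> {..<d + 1}"
      hence "(\<lambda>S. cnd (d + 1) c (zp d I S) j) \<in> borel_measurable (?M I)"
        by (intro measurable_cnd[OF P fin(1,2)]) auto
      thus "{S \<in> space (?M I). cnd (d + 1) c (zp d I S) j = v j} \<in> sets (?M I)" by simp
    qed auto
    finally show ?thesis .
  qed
  have Bs: "(\<Pi>\<^sub>E i\<in>T. G v) \<in> sets (?M T)" for v using fin Gs by (intro sets_PiM_I_finite) auto
  have Z_restrict: "Z (restrict S I) = Z S" for S
    unfolding Z_def using zp_cong[of I "restrict S I" S d] by simp
  have hZ: "h (Z S) = h (cnd (d + 1) c (zp d I S))" for S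
  proof -
    have "restrict (cnd (d + 1) c (zp d I S)) {..<d + 1} d = cnd (d + 1) c (zp d I S) d" by simp
    moreover have "halfspace d (restrict (cnd (d + 1) c (zp d I S)) {..<d + 1}) r = halfspace d (cnd (d + 1) c (zp d I S)) r" for r
      by (rule halfspace_cong) simp
    ultimately show ?thesis unfolding h_def Z_def by simp
  qed
  have bad: "bad d P I T c ep = (\<Union>v\<in>V. X v)"
  proof (intro equalityI subsetI)
    fix S assume S: "S \<in> bad d P I T c ep"
    have sp: "S \<in> space (?M (I \<union> T))" using S by (simp add: bad_def)
    have e: "ep < risk P (h (Z S))" and cons: "\<forall>i\<in>T. h (Z S) (fst (S i)) = snd (S i)"
      using S unfolding hZ by (auto simp: bad_def h_def Let_def)
    have "Z S \<in> V" using e cnd_in_ratvecs by (simp add: V_def Z_def)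
    moreover have "S \<in> X (Z S)"
      using sp cons by (auto simp: X_def A_def G_def Z_restrict space_PiM)
    ultimately show "S \<in> (\<Union>v\<in>V. X v)" by blast
  next
    fix S assume "S \<in> (\<Union>v\<in>V. X v)"
    then obtain v where v: "v \<in> V" "S \<in> X v" by blast
    have "v = Z S" using v by (auto simp: X_def A_def Z_restrict)
    with v show "S \<in> bad d P I T c ep"
      unfolding bad_def Let_def h_def[symmetric] hZ[symmetric] by (auto simp: X_def V_def G_def PiE_iff)
  qed
  have Xs: "X v \<in> sets (?M (I \<union> T))" and Xe: "emeasure (?M (I \<union> T)) (X v) = emeasure (?M I) (A v) * emeasure (?M T) (\<Pi>\<^sub>E i\<in>T. G v)"
    if "v \<in> V" for v
    using emeasure_PiM_split[OF pP fin(1,3) disj As Bs, of v v] that by (auto simp: X_def V_def)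
  show "bad d P I T c ep \<in> sets (?M (I \<union> T))" unfolding bad using cV Xs by (intro sets.countable_UN') auto
  have Te: "emeasure (?M T) (\<Pi>\<^sub>E i\<in>T. G v) \<le> ennreal (exp (- ep * real (card T)))" if v: "v \<in> V" for v
  proof -
    have r: "ep < risk P (h v)" "risk P (h v) \<le> 1" using v by (auto simp: V_def risk_def)
    have "emeasure (?M T) (\<Pi>\<^sub>E i\<in>T. G v) = (\<Prod>i\<in>T. emeasure P (G v))"
      using fin Gs by (intro pp.emeasure_PiM) auto
    also have "\<dots> = ennreal ((1 - risk P (h v)) ^ card T)"
      by (simp add: P.emeasure_eq_measure Gm r ennreal_power)
    also have "\<dots> \<le> ennreal (exp (- ep * real (card T)))"
    proof (rule ennreal_leI)
      have "(1 - risk P (h v)) ^ card T \<le> exp (- ep) ^ card T"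
        using r exp_ge_add_one_self[of "- ep"] by (intro power_mono) linarith+
      also have "exp (- ep) ^ card T = exp (- ep * real (card T))" by (rule exp_of_nat2_mult[symmetric])
      finally show "(1 - risk P (h v)) ^ card T \<le> exp (- ep * real (card T))" .
    qed
    finally show ?thesis .
  qed
  have "emeasure (?M (I \<union> T)) (\<Union>v\<in>V. X v) = (\<integral>\<^sup>+v. emeasure (?M (I \<union> T)) (X v) \<partial>count_space V)"
  proof (rule emeasure_UN_countable[OF Xs cV])
    show "disjoint_family_on X V" by (auto simp: disjoint_family_on_def X_def A_def)
  qed
  \<comment> \<open>The probabilities of the values of the candidate sum to at most 1, so the bound
    for a single value is the bound for all together.\<close>
  also have "\<dots> \<le> (\<integral>\<^sup>+v. emeasure (?M I) (A v) * ennreal (exp (- ep * real (card T))) \<partial>count_space V)"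
    using Te by (intro nn_integral_mono) (auto simp: Xe intro!: mult_left_mono)
  also have "\<dots> = (\<integral>\<^sup>+v. emeasure (?M I) (A v) \<partial>count_space V) * ennreal (exp (- ep * real (card T)))"
    by (rule nn_integral_multc) simp
  also have "(\<integral>\<^sup>+v. emeasure (?M I) (A v) \<partial>count_space V) = emeasure (?M I) (\<Union>v\<in>V. A v)"
    by (rule emeasure_UN_countable[symmetric, OF _ cV]) (auto simp: disjoint_family_on_def A_def[abs_def] V_def intro!: As[unfolded A_def])
  also have "\<dots> * ennreal (exp (- ep * real (card T))) \<le> 1 * ennreal (exp (- ep * real (card T)))"
    by (intro mult_right_mono I.measure_le_1) auto
  finally show "emeasure (?M (I \<union> T)) (bad d P I T c ep) \<le> ennreal (exp (- ep * real (card T)))"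
    unfolding bad by simp
qed

text \<open>Examples labelled 1 may lie on the hyperplane. Moving it by less than the gap to the
  finitely many examples on the other side makes all examples strictly positive, so 0 is not in the
  hull.\<close>

lemma realizable_margin:
  assumes n: "0 < n" and lab: "\<And>i. i < n \<Longrightarrow> snd (S i) \<in> labels"
    and f: "f \<in> halfspaces d" "\<And>i. i < n \<Longrightarrow> snd (S i) = f (fst (S i))"
  shows "0 < nrm2 (d + 1) (zp d {..<n} S)"
proof -
  let ?z = "zp d {..<n} S" and ?a = "\<lambda>i. avec d (S i)"
  obtain w b where wb: "f = halfspace d w b" using f(1) by (auto simp: halfspaces_def)
  let ?v = "\<lambda>i. (\<Sum>j<d. w j * fst (S i) j) + b"
  have "\<exists>eta>0. \<forall>i<n. ?v i < 0 \<longrightarrow> ?v i + eta < 0"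
  proof -
    have "\<exists>eta>0. \<forall>i<k. ?v i < 0 \<longrightarrow> ?v i + eta < 0" for k
    proof (induction k)
      case (Suc k)
      then obtain eta where eta: "eta > 0" "\<And>i. i < k \<Longrightarrow> ?v i < 0 \<Longrightarrow> ?v i + eta < 0" by blast
      define e where "e = (if ?v k < 0 then min eta (- ?v k / 2) else eta)"
      have e: "0 < e" "e \<le> eta" "?v k < 0 \<Longrightarrow> e \<le> - ?v k / 2"
        using eta(1) min.cobounded2[of eta "- ?v k / 2"] by (auto simp: e_def simp del: min.cobounded2)
      have "?v i + e < 0" if i: "i < Suc k" "?v i < 0" for i
      proof (cases "i = k")
        case True thus ?thesis using e(3) i(2) by simp
      next
        case False thus ?thesis using eta(2)[of i] i e(2) by linarith
      qed
      with e(1) show ?case by blast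
    qed (auto intro: exI[of _ 1])
    thus ?thesis .
  qed
  then obtain eta where eta: "eta > 0" "\<And>i. i < n \<Longrightarrow> ?v i < 0 \<Longrightarrow> ?v i + eta < 0" by blast
  define u where "u j = (if j < d then w j else b + eta)" for j
  have pos: "0 < ip (d + 1) (?a i) u" if i: "i < n" for i
  proof -
    have "(\<Sum>j<d. u j * fst (S i) j) + u d = ?v i + eta" by (simp add: u_def)
    moreover have "0 < real_of_int (snd (S i)) * (?v i + eta)"
      using f(2)[OF i] eta(2)[OF i] eta(1) by (cases "?v i < 0") (auto simp: wb halfspace_def)
    ultimately show ?thesis unfolding ip_avec using avec_denom_pos[where d = d and x = "fst (S i)"] by simp
  qed
  have "mnp (d + 1) {..<n} ?a ?z" using n by (intro zp_mnp) auto
  then obtain l where l: "\<forall>i\<in>{..<n}. 0 \<le> l i" "sum l {..<n} = 1"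
    and z: "?z = (\<lambda>j. if j < d + 1 then \<Sum>i\<in>{..<n}. l i * ?a i j else 0)" unfolding mnp_def by blast
  have "\<exists>i\<in>{..<n}. l i \<noteq> 0" using l(2) by (metis sum.neutral zero_neq_one)
  then obtain i0 where i0: "i0 < n" "l i0 \<noteq> 0" by auto
  have "0 < (\<Sum>i<n. l i * ip (d + 1) (?a i) u)"
  proof (rule sum_pos2)
    show "0 < l i0 * ip (d + 1) (?a i0) u" using i0 l(1) pos[OF i0(1)] by (simp add: less_le)
    show "0 \<le> l i * ip (d + 1) (?a i) u" if "i \<in> {..<n}" for i
      using l(1) pos[of i] that by (intro mult_nonneg_nonneg) auto
  qed (use i0 in auto)
  hence ipos: "0 < ip (d + 1) u ?z" unfolding ip_comb[OF z] .
  show ?thesis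
  proof (rule ccontr)
    assume "\<not> 0 < nrm2 (d + 1) ?z"
    hence "nrm2 (d + 1) ?z = 0" using nrm2_nonneg[of "d + 1" ?z] by linarith
    hence z0: "\<forall>j<d + 1. ?z j = 0" by (simp only: nrm2_eq_0)
    have "ip (d + 1) u ?z = 0" unfolding ip_def
    proof (rule sum.neutral, rule ballI)
      fix j assume "j \<in> {..<d + 1}"
      hence "?z j = 0" using z0 by blast
      thus "u j * ?z j = 0" by (simp only: mult_zero_right)
    qed
    thus False using ipos by linarith
  qed
qed

text \<open>At least \<open>m\<close> classes avoid \<open>U\<close>, each with at least
  \<open>n div (2 * m)\<close> indices, and this integer quotient is at least half of the real one
  because it is positive.\<close>

lemma card_blocks:
  assumes U: "U \<subseteq> {..<2 * m}" "card U \<le> m" and n: "2 * m \<le> n" "0 < m"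
  shows "real n / 4 \<le> real (card {i. i < n \<and> i mod (2 * m) \<notin> U})"
proof -
  let ?T = "{i. i < n \<and> i mod (2 * m) \<notin> U}" and ?k = "n div (2 * m)"
  let ?g = "\<lambda>(q, r). q * (2 * m) + r"
  have "inj_on ?g ({..<?k} \<times> ({..<2 * m} - U))"
  proof (rule inj_onI, clarify)
    fix q r q' r' assume h: "r < 2 * m" "r' < 2 * m" "q * (2 * m) + r = q' * (2 * m) + r'"
    have "r = r'" using arg_cong[OF h(3), of "\<lambda>x. x mod (2 * m)"]
      unfolding mod_mult_self3 mod_less[OF h(1)] mod_less[OF h(2)] .
    thus "q = q' \<and> r = r'" using h n by simp
  qed
  moreover have "?g ` ({..<?k} \<times> ({..<2 * m} - U)) \<subseteq> ?T"
  proof clarify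
    fix q r assume h: "q < ?k" "r < 2 * m" "r \<notin> U"
    have "Suc q * (2 * m) \<le> ?k * (2 * m)" using h by (intro mult_le_mono1) auto
    also have "\<dots> \<le> n" by (metis div_times_less_eq_dividend)
    finally show "q * (2 * m) + r < n \<and> (q * (2 * m) + r) mod (2 * m) \<notin> U" using h by simp
  qed
  ultimately have "card ({..<?k} \<times> ({..<2 * m} - U)) \<le> card ?T"
    by (rule card_inj_on_le) auto
  moreover have "card ({..<?k} \<times> ({..<2 * m} - U)) = ?k * (2 * m - card U)"
    using U by (simp add: card_cartesian_product card_Diff_subset finite_subset)
  moreover have "?k * m \<le> ?k * (2 * m - card U)" using U by (intro mult_le_mono2) auto
  ultimately have "?k * m \<le> card ?T" by linarith
  moreover have "n \<le> 4 * (?k * m)"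
  proof -
    have "1 \<le> ?k" using n by (simp add: div_greater_zero_iff Suc_le_eq)
    have "?k * (2 * m) + n mod (2 * m) = n" by (rule div_mult_mod_eq)
    hence "n = ?k * (2 * m) + n mod (2 * m)" by (rule sym)
    also have "\<dots> \<le> ?k * (2 * m) + 2 * m" using n by (intro add_left_mono less_imp_le) simp
    also have "\<dots> \<le> ?k * (2 * m) + ?k * (2 * m)" using \<open>1 \<le> ?k\<close> by (intro add_left_mono) simp
    finally show ?thesis by (simp add: mult_ac)
  qed
  ultimately show ?thesis by linarith
qed


text \<open>The exceptional event ranges over all pairs of a set of classes and a code, fixed before
  the sample is seen; the pair that matters for a given sample is identified only afterwards, from
  the basis of its \<open>z\<close>.\<close>

theorem stable_risk_bound:
  assumes d: "1 \<le> d" and n: "2 * (d + 1) \<le> n"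
    and f: "f \<in> halfspaces d" and real: "realizable_by d P f" and dl: "0 < dl" "dl < 1"
  shows "\<exists>E\<in>sets (Pi\<^sub>M {..<n} (\<lambda>_. P)). measure (Pi\<^sub>M {..<n} (\<lambda>_. P)) E \<ge> 1 - dl \<and>
    (\<forall>S\<in>E. (\<forall>i<n. snd (S i) = f (fst (S i))) \<and>
      (\<forall>W c. c \<in> codes (d + 1) \<longrightarrow> (\<forall>j<d + 1. W j = cnd (d + 1) c (zp d {..<n} S) j) \<longrightarrow>
        (\<forall>i<n. halfspace d W (W d) (fst (S i)) = snd (S i)) \<longrightarrow>
        risk P (halfspace d W (W d)) \<le> 4 * (5 * real (d + 1) + ln (1 / dl)) / real n))"
proof -
  let ?m = "d + 1" and ?M = "Pi\<^sub>M {..<n} (\<lambda>_. P)"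
  have pP: "prob_space P" and P: "sets P = sets (example_space d)" and ae: "AE z in P. snd z = f (fst z)"
    using real by (auto simp: realizable_by_def)
  interpret P: prob_space P by (rule pP)
  interpret pp: product_prob_space "\<lambda>_. P" UNIV by unfold_locales
  interpret M: prob_space ?M by (rule prob_space_PiM) (rule pP)
  \<comment> \<open>The factor 4 corresponds to the quarter of the sample that is left for testing,
    and 5 m dominates the logarithm of the number of pairs.\<close>
  define ep where "ep = 4 * (5 * real ?m + ln (1 / dl)) / real n"
  define I where "I U = {i. i < n \<and> i mod (2 * ?m) \<in> U}" for U
  define T where "T U = {i. i < n \<and> i mod (2 * ?m) \<notin> U}" for U
  define UU where "UU = {U. U \<subseteq> {..<2 * ?m} \<and> card U \<le> ?m \<and> I U \<noteq> {}}"
  define Bd where "Bd = (\<Union>(U, c)\<in>UU \<times> codes ?m. bad d P (I U) (T U) c ep)"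
  define G where "G = {z \<in> space P. f (fst z) = snd z}"
  have IT: "I U \<union> T U = {..<n}" "I U \<inter> T U = {}" "finite (I U)" "finite (T U)" for U
    by (auto simp: I_def T_def)
  obtain w b where wb: "f = halfspace d w b" using f by (auto simp: halfspaces_def)
  have Gc: "G = space P - {z \<in> space P. f (fst z) \<noteq> snd z}" by (auto simp: G_def)
  have Gs: "G \<in> sets P" unfolding Gc wb using sets_halfspace_error[OF P] by auto
  have "emeasure P G = 1"
    by (rule P.emeasure_eq_1_AE[OF Gs]) (use ae AE_space in \<open>eventually_elim, auto simp: G_def\<close>)
  hence "emeasure ?M (\<Pi>\<^sub>E i\<in>{..<n}. G) = 1" using Gs by (subst pp.emeasure_PiM) auto
  hence G1: "measure ?M (\<Pi>\<^sub>E i\<in>{..<n}. G) = 1" by (simp add: M.emeasure_eq_measure)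
  have GS: "(\<Pi>\<^sub>E i\<in>{..<n}. G) \<in> sets ?M" using Gs by (intro sets_PiM_I_finite) auto
  have finU: "finite UU" unfolding UU_def by (rule finite_subset[of _ "Pow {..<2 * ?m}"]) auto
  have bs: "bad d P (I U) (T U) c ep \<in> sets ?M"
    and be: "measure ?M (bad d P (I U) (T U) c ep) \<le> exp (- ep * real (card (T U)))" if "U \<in> UU" for U c
    using bad_measure[OF pP P IT(3) _ IT(4) IT(2), of U c ep] that unfolding IT(1)
    by (auto simp: UU_def M.emeasure_eq_measure)
  have Bs: "Bd \<in> sets ?M" unfolding Bd_def using finU codes_card bs by (intro sets.finite_UN) auto
  have cardU: "card UU \<le> 4 ^ ?m"
  proof -
    have "card UU \<le> card (Pow {..<2 * ?m})" by (intro card_mono) (auto simp: UU_def)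
    thus ?thesis by (simp add: card_Pow power_mult)
  qed
  have "measure ?M Bd \<le> (\<Sum>(U, c)\<in>UU \<times> codes ?m. measure ?M (bad d P (I U) (T U) c ep))"
    unfolding Bd_def using finU codes_card bs by (intro order_trans[OF measure_UNION_le]) (auto simp: case_prod_beta)
  also have "\<dots> \<le> (\<Sum>(U, c)\<in>UU \<times> codes ?m. exp (- 5 * real ?m) * dl)"
  proof (intro sum_mono, clarify)
    fix U e g assume U: "U \<in> UU"
    have l0: "0 \<le> ln (1 / dl)" using dl by simp
    have "real n / 4 \<le> real (card (T U))" unfolding T_def using U n by (intro card_blocks) (auto simp: UU_def)
    hence "ep * (real n / 4) \<le> ep * real (card (T U))" using l0 by (intro mult_left_mono) (auto simp: ep_def)
    moreover have "ep * (real n / 4) = 5 * real ?m + ln (1 / dl)" using n by (simp add: ep_def)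
    ultimately have "- ep * real (card (T U)) \<le> - 5 * real ?m + ln dl" using dl by (simp add: ln_div)
    hence "exp (- ep * real (card (T U))) \<le> exp (- 5 * real ?m + ln dl)" by simp
    also have "\<dots> = exp (- 5 * real ?m) * dl" using dl by (simp only: exp_add exp_ln)
    finally show "measure ?M (bad d P (I U) (T U) (e, g) ep) \<le> exp (- 5 * real ?m) * dl" using be[OF U] by (meson order_trans)
  qed
  also have "\<dots> = real (card UU) * (5 * 3 ^ ?m) * (exp (- 5 * real ?m) * dl)"
    using codes_card by (simp add: card_cartesian_product case_prod_beta)
  also have "\<dots> \<le> 4 ^ ?m * (5 * 3 ^ ?m) * (exp (- 5 * real ?m) * dl)"
    using cardU dl by (intro mult_right_mono) (auto simp: of_nat_le_iff[symmetric, where 'a = real] simp del: of_nat_le_iff)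
  also have "\<dots> \<le> dl"
  proof -
    have "(2::real) ^ 5 \<le> exp 1 ^ 5" using exp_ge_add_one_self[of 1] by (intro power_mono) auto
    hence e5: "32 \<le> exp (5::real)" by (simp add: exp_of_nat_mult[symmetric])
    \<comment> \<open>There are at most 4^m sets and 5 * 3^m codes. The inequality needs
      \<open>m\<close> at least 2, that is \<open>d\<close> at least 1: for m = 2 it reads 720 \<le>
      1024.\<close>
    have "5 * 12 ^ ?m \<le> (32::real) ^ ?m"
    proof -
      obtain k where k: "?m = k + 2" using d by (metis add.commute add_2_eq_Suc' le_Suc_ex Suc_eq_plus1 add_Suc plus_1_eq_Suc)
      have "(12::real) ^ k \<le> 32 ^ k" by (intro power_mono) auto
      moreover have "(0::real) \<le> 32 ^ k" by simp
      ultimately have "5 * (12 ^ k * 144) \<le> (32::real) ^ k * 1024" by linarith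
      thus ?thesis unfolding k power_add by simp
    qed
    also have "\<dots> \<le> exp 5 ^ ?m" using e5 by (intro power_mono) auto
    also have "\<dots> = exp (5 * real ?m)" by (simp only: exp_of_nat2_mult)
    finally have "5 * 12 ^ ?m \<le> exp (5 * real ?m)" .
    moreover have "4 ^ k * (5 * 3 ^ k) = 5 * (12::real) ^ k" for k
      using power_mult_distrib[of "4::real" 3 k] by simp
    moreover have "exp (- 5 * real ?m) = 1 / exp (5 * real ?m)"
      by (simp only: mult_minus_left exp_minus inverse_eq_divide)
    ultimately have "4 ^ ?m * (5 * 3 ^ ?m) * exp (- 5 * real ?m) \<le> 1"
      by (simp only: times_divide_eq_right mult_1_right pos_divide_le_eq exp_gt_zero mult_1)
    thus ?thesis using dl mult_right_mono[of "4 ^ ?m * (5 * 3 ^ ?m) * exp (- 5 * real ?m)" 1 dl] by (simp add: mult.assoc)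
  qed
  finally have Bm: "measure ?M Bd \<le> dl" .
  define E where "E = (\<Pi>\<^sub>E i\<in>{..<n}. G) - Bd"
  have "1 - dl \<le> measure ?M E"
  proof -
    have "1 = measure ?M (\<Pi>\<^sub>E i\<in>{..<n}. G)" using G1 by simp
    also have "\<dots> \<le> measure ?M (E \<union> Bd)" using GS Bs by (intro M.finite_measure_mono) (auto simp: E_def)
    also have "\<dots> \<le> measure ?M E + measure ?M Bd" using GS Bs by (intro measure_Un_le) (auto simp: E_def)
    finally show ?thesis using Bm by linarith
  qed
  moreover have "risk P (halfspace d W (W d)) \<le> ep"
    if S: "S \<in> E" and c: "c \<in> codes ?m" and W: "\<forall>j<?m. W j = cnd ?m c (zp d {..<n} S) j"
      and cons: "\<forall>i<n. halfspace d W (W d) (fst (S i)) = snd (S i)" for S W c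
  proof -
    let ?a = "\<lambda>i. avec d (S i)"
    have SG: "S i \<in> G" if "i < n" for i using S that by (auto simp: E_def PiE_iff)
    have "space P = space (example_space d)" by (rule sets_eq_imp_space_eq[OF P])
    hence "S i \<in> space (Rd d) \<times> labels" if "i < n" for i
      using SG[OF that] unfolding G_def example_space_def space_pair_measure space_count_space by blast
    hence lab: "snd (S i) \<in> labels" if "i < n" for i using that unfolding mem_Times_iff by blast
    have fS: "snd (S i) = f (fst (S i))" if "i < n" for i using SG[OF that] by (simp add: G_def)
    have n0: "0 < n" using n by simp
    let ?z = "zp d {..<n} S"
    have g: "0 < nrm2 ?m ?z" by (rule realizable_margin[OF n0 lab f fS])
    have mz: "mnp ?m {..<n} ?a ?z" using n0 by (intro zp_mnp) auto
    obtain B l where B: "B \<subseteq> {..<n}" "mnp ?m B ?a ?z" "\<forall>i\<in>B. ip ?m (?a i) ?z = nrm2 ?m ?z"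
      "sum l B = 1" "?z = (\<lambda>j. if j < ?m then \<Sum>i\<in>B. l i * ?a i j else 0)"
      and indep: "\<And>\<mu>. (\<And>j. j < ?m \<Longrightarrow> (\<Sum>i\<in>B. \<mu> i * ?a i j) = 0) \<Longrightarrow> \<forall>i\<in>B. \<mu> i = 0"
    proof (rule mnp_basis[OF mz finite_lessThan g], goal_cases)
      case (1 B l)
      show ?case by (rule 1(1)[OF 1(2-6)]) (rule 1(7), blast)
    qed
    have finB: "finite B" using B(1) finite_subset by blast
    have "card B \<le> ?m"
    proof (rule mnp_basis_gram(1)[OF finB B(3,4,5) indep])
      fix i assume "i \<in> B"
      hence "i < n" using B(1) by blast
      thus "(\<Sum>j<?m. \<bar>?a i j\<bar>) \<le> 1" by (intro avec_l1 lab)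
    qed
    \<comment> \<open>At most \<open>m\<close> basis indices have at most \<open>m\<close> residues.
      The block \<open>I U\<close> contains the basis, so by \<open>mnp_superset\<close> it has the
      same minimum-norm point as the whole sample.\<close>
    define U where "U = (\<lambda>i. i mod (2 * ?m)) ` B"
    have BI: "B \<subseteq> I U" using B(1) by (auto simp: U_def I_def)
    have "B \<noteq> {}" using B(4) by auto
    hence UU: "U \<in> UU" using BI \<open>card B \<le> ?m\<close> card_image_le[OF finB, of "\<lambda>i. i mod (2 * ?m)"]
      by (auto simp: UU_def U_def)
    have "mnp ?m (I U) ?a ?z"
      by (rule mnp_superset[OF B(2) BI IT(3)]) (use mz in \<open>auto simp: mnp_def I_def\<close>)
    hence zI: "zp d (I U) S = ?z" by (rule zp_eqI)
    have hW: "halfspace d W (W d) = halfspace d (cnd ?m c ?z) (cnd ?m c ?z d)"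
    proof -
      have "W d = cnd ?m c ?z d" using W[rule_format, of d] by simp
      moreover have "halfspace d W b = halfspace d (cnd ?m c ?z) b" for b
        by (rule halfspace_cong) (use W in simp)
      ultimately show ?thesis by (simp only:)
    qed
    have "S \<notin> bad d P (I U) (T U) c ep" using S UU c by (auto simp: E_def Bd_def)
    moreover have "S \<in> space ?M" using S GS sets.sets_into_space by (auto simp: E_def)
    ultimately show ?thesis
      using cons unfolding bad_def Let_def unfolding IT(1) hW by (auto simp: T_def not_less zI)
  qed
  moreover have "E \<in> sets ?M" using GS Bs by (auto simp: E_def)
  moreover have "\<forall>S\<in>E. \<forall>i<n. snd (S i) = f (fst (S i))" by (auto simp: E_def G_def PiE_iff)
  ultimately show ?thesis unfolding ep_def by (intro bexI[of _ E]) auto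
qed

section \<open>The ellipsoid method\<close>

text \<open>The ellipsoid with centre \<open>c\<close> and shape \<open>P\<close>, described by its support function so that
  \<open>P\<close> need not be invertible.\<close>

definition inE :: "nat \<Rightarrow> (nat \<Rightarrow> nat \<Rightarrow> real) \<Rightarrow> (nat \<Rightarrow> real) \<Rightarrow> (nat \<Rightarrow> real) \<Rightarrow> bool" where
  "inE m P c w \<longleftrightarrow> (\<forall>u. (ip m u (\<lambda>j. w j - c j))\<^sup>2 \<le> qf m P u)"

definition mulv :: "nat \<Rightarrow> (nat \<Rightarrow> nat \<Rightarrow> real) \<Rightarrow> (nat \<Rightarrow> real) \<Rightarrow> nat \<Rightarrow> real" where
  "mulv m P g i = (\<Sum>j<m. P i j * g j)"

lemma qf_mulv: "qf m P u = ip m u (mulv m P u)"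
  by (simp add: qf_def ip_def mulv_def sum_distrib_left mult_ac)

lemma qf_line:
  assumes sym: "\<forall>i<m. \<forall>j<m. P i j = P j i"
  shows "qf m P (\<lambda>j. u j + t * g j) = qf m P u + 2 * t * ip m u (mulv m P g) + t\<^sup>2 * ip m g (mulv m P g)"
proof -
  have swap: "ip m g (mulv m P u) = ip m u (mulv m P g)"
  proof -
    have "ip m g (mulv m P u) = (\<Sum>i<m. \<Sum>j<m. g i * (P i j * u j))"
      by (simp add: ip_def mulv_def sum_distrib_left)
    also have "\<dots> = (\<Sum>j<m. \<Sum>i<m. g i * (P i j * u j))" by (rule sum.swap)
    also have "\<dots> = (\<Sum>j<m. \<Sum>i<m. u j * (P j i * g i))"
      by (intro sum.cong refl) (auto simp: sym)
    also have "\<dots> = ip m u (mulv m P g)"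
      by (simp add: ip_def mulv_def sum_distrib_left)
    finally show ?thesis .
  qed
  have "mulv m P (\<lambda>j. u j + t * g j) = (\<lambda>i. mulv m P u i + t * mulv m P g i)"
    by (rule ext) (simp add: mulv_def sum.distrib sum_distrib_left algebra_simps)
  thus ?thesis unfolding qf_mulv by (simp add: ip_linear swap power2_eq_square algebra_simps)
qed

text \<open>The form is nonnegative along the line u + t g; minimise over t. If the form vanishes at
  \<open>g\<close>, it is affine along the line, so its slope must be 0.\<close>

lemma qf_cauchy_schwarz:
  assumes sym: "\<forall>i<m. \<forall>j<m. P i j = P j i"
    and psd: "\<forall>u. 0 \<le> qf m P u"
  shows "(ip m u (mulv m P g))\<^sup>2 \<le> qf m P u * ip m g (mulv m P g)"
proof -
  let ?b = "ip m u (mulv m P g)" and ?q = "ip m g (mulv m P g)" and ?U = "qf m P u"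
  have q: "0 \<le> ?q" using psd[rule_format, of g] by (simp add: qf_mulv)
  have L: "0 \<le> ?U + 2 * t * ?b + t\<^sup>2 * ?q" for t
    using psd[rule_format, of "\<lambda>j. u j + t * g j"] unfolding qf_line[OF sym] .
  show ?thesis
  proof (cases "?q = 0")
    case True
    have "?b = 0"
    proof (rule ccontr)
      assume b: "?b \<noteq> 0"
      have "0 \<le> ?U + 2 * (- (?U + 1) / (2 * ?b)) * ?b" using L[of "- (?U + 1) / (2 * ?b)"] True by simp
      also have "\<dots> = -1" using b by (simp add: field_simps)
      finally show False by simp
    qed
    thus ?thesis using True by simp
  next
    case False
    hence q: "0 < ?q" using q by simp
    have "0 \<le> ?q * (?U + 2 * (- ?b / ?q) * ?b + (- ?b / ?q)\<^sup>2 * ?q)"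
      by (rule mult_nonneg_nonneg[OF less_imp_le[OF q] L])
    also have "\<dots> = ?U * ?q - ?b\<^sup>2" using q by (simp add: power2_eq_square field_simps)
    finally show ?thesis by simp
  qed
qed

lemma qf_rank_one: "qf m (\<lambda>i j. b * (P i j - k * p i * p j)) u = b * (qf m P u - k * (ip m u p)\<^sup>2)"
proof -
  have "qf m (\<lambda>i j. b * (P i j - k * p i * p j)) u =
      (\<Sum>i<m. \<Sum>j<m. b * (u i * P i j * u j) - b * (k * ((u i * p i) * (u j * p j))))"
    unfolding qf_def by (intro sum.cong refl) (simp add: algebra_simps)
  also have "\<dots> = b * qf m P u - b * (k * ((\<Sum>i<m. u i * p i) * (\<Sum>j<m. u j * p j)))"
    unfolding sum_product by (simp add: qf_def sum_subtractf sum_distrib_left)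
  finally show ?thesis by (simp add: ip_def power2_eq_square right_diff_distrib)
qed

text \<open>With |X| at most sqrt (al U) and |Y| at most sqrt (be V), this is Cauchy-Schwarz in the
  plane; comparing squares of the mixed term keeps roots out.\<close>

lemma weighted_cauchy:
  fixes X Y U V al be :: real
  assumes "X\<^sup>2 \<le> al * U" "Y\<^sup>2 \<le> be * V" "0 \<le> al" "0 \<le> be" "0 \<le> U" "0 \<le> V"
  shows "(X + Y)\<^sup>2 \<le> (al + be) * (U + V)"
proof -
  have "(2 * (X * Y))\<^sup>2 \<le> (al * V + be * U)\<^sup>2"
  proof -
    have "X\<^sup>2 * Y\<^sup>2 \<le> (al * U) * (be * V)" using assms by (intro mult_mono) auto
    moreover have "4 * ((al * U) * (be * V)) \<le> (al * V + be * U)\<^sup>2"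
      using zero_le_power2[of "al * V - be * U"] by (simp add: power2_eq_square algebra_simps)
    ultimately show ?thesis by (simp add: power_mult_distrib)
  qed
  hence "2 * (X * Y) \<le> al * V + be * U"
    using assms by (intro power2_le_imp_le[of "2 * (X * Y)"]) auto
  thus ?thesis using assms(1,2) by (simp add: power2_eq_square algebra_simps)
qed

text \<open>In coordinates where the old ellipsoid is the unit ball and \<open>g\<close> points along the first axis,
  the cut gives \<open>\<ell>\<^sup>2 \<le> s \<ell>\<close>; adding \<open>l (\<ell>\<^sup>2/s\<^sup>2 - \<ell>/s) \<le> 0\<close> to the quadratic form and completing
  the square yields the new ellipsoid.  The argument only needs \<open>s\<^sup>2 \<ge> q\<close>, not equality, so square
  roots are avoided.\<close>

lemma ellipsoid_cut:
  assumes sym: "\<forall>i<m. \<forall>j<m. P i j = P j i"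
    and w: "inE m P c w"
    and cut: "0 \<le> ip m g (\<lambda>j. w j - c j)"
    and q: "q = ip m g (mulv m P g)" "0 < q" "q \<le> s\<^sup>2" and s: "0 < s" and l: "0 < l"
    and D: "D = s\<^sup>2 + l * q"
  shows "(ip m u (\<lambda>j. w j - (c j + l * s * mulv m P g j / (2 * D))))\<^sup>2 \<le>
    (1 + l\<^sup>2 / 4) * (qf m P u - l / D * (ip m u (mulv m P g))\<^sup>2)"
proof -
  define x where "x j = w j - c j" for j
  define L where "L = ip m g x"
  \<comment> \<open>u - k g is the part of \<open>u\<close> orthogonal to \<open>g\<close> in the
    form of \<open>P\<close>; \<open>U\<close> is its quadratic form and \<open>X\<close> its
    pairing with \<open>x\<close>.\<close>
  define k where "k = ip m u (mulv m P g) / q"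
  define U where "U = qf m P (\<lambda>j. u j + (- k) * g j)"
  define X where "X = ip m u x - k * L"
  have Dpos: "0 < D" using D s l q by (simp add: add_pos_pos)
  have inE: "(ip m v x)\<^sup>2 \<le> qf m P v" for v using w by (simp add: inE_def x_def[abs_def])
  have U: "U = qf m P u - k\<^sup>2 * q"
    unfolding U_def qf_line[OF sym] q(1)[symmetric] using q(2)
    by (simp add: k_def power2_eq_square field_simps)
  have U0: "0 \<le> U" unfolding U_def using inE order_trans zero_le_power2 by blast
  have line: "(X + t * L)\<^sup>2 \<le> U + t\<^sup>2 * q" for t
  proof -
    have "(ip m (\<lambda>j. u j + (t - k) * g j) x)\<^sup>2 \<le> qf m P (\<lambda>j. u j + (t - k) * g j)" by (rule inE)
    moreover have "ip m (\<lambda>j. u j + (t - k) * g j) x = X + t * L"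
      by (simp add: ip_linear X_def L_def algebra_simps)
    moreover have "qf m P (\<lambda>j. u j + (t - k) * g j) = U + t\<^sup>2 * q"
      unfolding U qf_line[OF sym] q(1)[symmetric] using q(2)
      by (simp add: k_def power2_eq_square field_simps)
    ultimately show ?thesis by simp
  qed
  have L0: "0 \<le> L" using cut by (simp add: L_def x_def[abs_def])
  have Lq: "L\<^sup>2 \<le> q" using inE[of g] q by (simp add: L_def qf_mulv)
  hence "L\<^sup>2 \<le> s\<^sup>2" using q by simp
  hence Ls: "L \<le> s" using s by (rule power2_le_imp_le[OF _ less_imp_le])
  have Xq: "X\<^sup>2 * q \<le> U * (q - L\<^sup>2)"
  proof (cases "L\<^sup>2 = q")
    case False
    hence d: "0 < q - L\<^sup>2" using Lq by simp
    \<comment> \<open>This value of \<open>t\<close> makes the inequality \<open>line\<close>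
      sharpest.\<close>
    have "(X + X * L / (q - L\<^sup>2) * L)\<^sup>2 \<le> U + (X * L / (q - L\<^sup>2))\<^sup>2 * q" by (rule line)
    moreover have "X + X * L / (q - L\<^sup>2) * L = X * q / (q - L\<^sup>2)"
      using d by (simp add: field_simps power2_eq_square)
    ultimately have "(X * q)\<^sup>2 / (q - L\<^sup>2)\<^sup>2 \<le> U + (X * L)\<^sup>2 * q / (q - L\<^sup>2)\<^sup>2"
      by (simp add: power_divide)
    hence "(X * q)\<^sup>2 / (q - L\<^sup>2)\<^sup>2 - (X * L)\<^sup>2 * q / (q - L\<^sup>2)\<^sup>2 \<le> U" by simp
    also have "(X * q)\<^sup>2 / (q - L\<^sup>2)\<^sup>2 - (X * L)\<^sup>2 * q / (q - L\<^sup>2)\<^sup>2 = X\<^sup>2 * q * (q - L\<^sup>2) / (q - L\<^sup>2)\<^sup>2"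
      by (simp add: diff_divide_distrib[symmetric] power_mult_distrib power2_eq_square algebra_simps)
    also have "\<dots> = X\<^sup>2 * q / (q - L\<^sup>2)" using d by (simp add: power2_eq_square)
    finally show ?thesis using d by (simp add: field_simps)
  next
    case True
    \<comment> \<open>When L^2 = q, the quadratic terms in \<open>t\<close> cancel from
      \<open>line\<close>, and an affine inequality valid for all \<open>t\<close> forces X =
      0.\<close>
    have "X = 0"
    proof (rule ccontr)
      assume X: "X \<noteq> 0"
      have L: "L \<noteq> 0" using True q by auto
      have "(X + (U / (2 * X * L)) * L)\<^sup>2 \<le> U + (U / (2 * X * L))\<^sup>2 * q" by (rule line)
      moreover have "(U / (2 * X * L)) * L = U / (2 * X)" using L X by simp
      moreover have "(U / (2 * X * L))\<^sup>2 * q = (U / (2 * X))\<^sup>2"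
        using L X True[symmetric] by (simp add: power_divide power_mult_distrib)
      ultimately have "X\<^sup>2 + 2 * X * (U / (2 * X)) \<le> U" by (simp add: power2_sum)
      moreover have "2 * X * (U / (2 * X)) = U" using X by simp
      ultimately show False using X by simp
    qed
    thus ?thesis using True by simp
  qed
  \<comment> \<open>Weights for \<open>weighted_cauchy\<close>: \<open>al\<close> is what a
    displacement \<open>L\<close> along \<open>g\<close> leaves for the orthogonal part, and
    \<open>be\<close> makes the bound for the shifted part along \<open>g\<close> an
    equality.\<close>
  define be where "be = (L - l * s * q / (2 * D))\<^sup>2 * D / (q * s\<^sup>2)"
  define al where "al = 1 - L\<^sup>2 / q"
  have al0: "0 \<le> al" using Lq q by (simp add: al_def)
  have be0: "0 \<le> be" using Dpos q by (simp add: be_def)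
  have "al + be \<le> 1 + l\<^sup>2 / 4"
  proof -
    have "be = (L\<^sup>2 - L * l * s * q / D + l\<^sup>2 * s\<^sup>2 * q\<^sup>2 / (4 * D\<^sup>2)) * (D / (q * s\<^sup>2))"
      unfolding be_def power2_diff by (simp add: power_divide power_mult_distrib)
    also have "\<dots> = L\<^sup>2 * D / (q * s\<^sup>2) - L * l / s + l\<^sup>2 * q / (4 * D)"
      using Dpos q s by (simp add: power2_eq_square field_simps)
    also have "L\<^sup>2 * D / (q * s\<^sup>2) = L\<^sup>2 / q + l * L\<^sup>2 / s\<^sup>2"
      using q s unfolding D by (simp add: field_simps)
    finally have "al + be = 1 + l * (L\<^sup>2 / s\<^sup>2 - L / s) + l\<^sup>2 * q / (4 * D)"
      by (simp add: al_def algebra_simps)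
    moreover have "L\<^sup>2 / s\<^sup>2 \<le> L / s"
      using mult_left_mono[OF Ls L0] s by (simp add: power2_eq_square field_simps)
    hence "l * (L\<^sup>2 / s\<^sup>2 - L / s) \<le> 0" using l by (simp add: mult_nonneg_nonpos)
    moreover have "q \<le> D" using q l D by (simp add: add_increasing2)
    hence "l\<^sup>2 * q / (4 * D) \<le> l\<^sup>2 / 4"
      using Dpos mult_left_mono[of q D "l\<^sup>2"] by (simp add: field_simps)
    ultimately show ?thesis by linarith
  qed
  define V where "V = k\<^sup>2 * q * s\<^sup>2 / D"
  have V0: "0 \<le> V" using q Dpos by (simp add: V_def)
  have "(X + k * (L - l * s * q / (2 * D)))\<^sup>2 \<le> (al + be) * (U + V)"
  proof (rule weighted_cauchy)
    show "X\<^sup>2 \<le> al * U" using Xq q by (simp add: al_def field_simps)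
    define Y where "Y = L - l * s * q / (2 * D)"
    have "be = Y\<^sup>2 * D / (q * s\<^sup>2)" by (simp add: be_def Y_def)
    hence "(k * Y)\<^sup>2 = be * V" using q s Dpos by (simp add: V_def power_mult_distrib)
    hence "(k * (L - l * s * q / (2 * D)))\<^sup>2 = be * V" by (simp only: Y_def)
    thus "(k * (L - l * s * q / (2 * D)))\<^sup>2 \<le> be * V" by simp
  qed (use al0 be0 U0 V0 in auto)
  also have "\<dots> \<le> (1 + l\<^sup>2 / 4) * (U + V)"
    using \<open>al + be \<le> 1 + l\<^sup>2 / 4\<close> U0 V0 by (intro mult_right_mono) auto
  also have "U + V = qf m P u - l / D * (ip m u (mulv m P g))\<^sup>2"
  proof -
    have "V = k\<^sup>2 * q - l / D * (k * q)\<^sup>2"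
      unfolding V_def using Dpos D by (simp add: field_simps power2_eq_square)
    thus ?thesis unfolding U using q by (simp add: k_def)
  qed
  also have "X + k * (L - l * s * q / (2 * D)) = ip m u (\<lambda>j. w j - (c j + l * s * mulv m P g j / (2 * D)))"
  proof -
    have "(\<lambda>j. w j - (c j + l * s * mulv m P g j / (2 * D))) = (\<lambda>j. x j - (l * s / (2 * D)) * mulv m P g j)"
      by (simp add: x_def fun_eq_iff)
    hence "ip m u (\<lambda>j. w j - (c j + l * s * mulv m P g j / (2 * D))) = ip m u x - (l * s / (2 * D)) * ip m u (mulv m P g)"
      by (simp only: ip_linear)
    also have "ip m u (mulv m P g) = k * q" using q by (simp add: k_def)
    finally have "ip m u (\<lambda>j. w j - (c j + l * s * mulv m P g j / (2 * D))) = ip m u x - (l * s / (2 * D)) * (k * q)" .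
    thus ?thesis by (simp add: X_def algebra_simps)
  qed
  finally show ?thesis .
qed

section \<open>Rounded ellipsoid steps\<close>

definition rnd :: "nat \<Rightarrow> real \<Rightarrow> real" where
  "rnd J x = of_int \<lfloor>x * 2 ^ J\<rfloor> / 2 ^ J"

lemma rnd_le: "rnd J x \<le> x" and rnd_gt: "x - 1 / 2 ^ J < rnd J x"
proof -
  have "of_int \<lfloor>x * 2 ^ J\<rfloor> \<le> x * 2 ^ J" "x * 2 ^ J - 1 < of_int \<lfloor>x * 2 ^ J\<rfloor>" by linarith+
  thus "rnd J x \<le> x" "x - 1 / 2 ^ J < rnd J x"
    using divide_strict_right_mono[of "x * 2 ^ J - 1" "of_int \<lfloor>x * 2 ^ J\<rfloor>" "2 ^ J :: real"]
    by (simp_all add: rnd_def divide_le_eq diff_divide_distrib)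
qed

lemma rnd_abs: "\<bar>rnd J x - x\<bar> \<le> 1 / 2 ^ J"
  using rnd_le[of J x] rnd_gt[of x J] by linarith

lemma abs_sum_square: "(\<Sum>j<m. \<bar>u j\<bar>)\<^sup>2 \<le> real m * nrm2 m u"
  using Cauchy_Schwarz_ineq_sum[of "\<lambda>j. \<bar>u j\<bar>" "\<lambda>_. 1" "{..<m}"]
  by (simp add: ip_def power2_eq_square mult_ac)

lemma qf_perturb:
  assumes "\<And>i j. i < m \<Longrightarrow> j < m \<Longrightarrow> \<bar>R i j - P i j\<bar> \<le> e"
  shows "qf m P u - e * (real m * nrm2 m u) \<le> qf m R u"
proof (cases "m = 0")
  case False
  have e: "0 \<le> e" using assms[of 0 0] False by linarith
  have "qf m P u - qf m R u = (\<Sum>i<m. \<Sum>j<m. u i * (P i j - R i j) * u j)"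
    by (simp add: qf_def sum_subtractf[symmetric] algebra_simps)
  also have "\<dots> \<le> (\<Sum>i<m. \<Sum>j<m. e * (\<bar>u i\<bar> * \<bar>u j\<bar>))"
  proof (intro sum_mono)
    fix i j assume "i \<in> {..<m}" "j \<in> {..<m}"
    hence "\<bar>P i j - R i j\<bar> \<le> e" using assms[of i j] by (simp add: abs_minus_commute)
    hence "\<bar>P i j - R i j\<bar> * (\<bar>u i\<bar> * \<bar>u j\<bar>) \<le> e * (\<bar>u i\<bar> * \<bar>u j\<bar>)" by (intro mult_right_mono) auto
    moreover have "u i * (P i j - R i j) * u j \<le> \<bar>u i * (P i j - R i j) * u j\<bar>" by simp
    ultimately show "u i * (P i j - R i j) * u j \<le> e * (\<bar>u i\<bar> * \<bar>u j\<bar>)"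
      by (simp add: abs_mult mult_ac)
  qed
  also have "\<dots> = e * (\<Sum>j<m. \<bar>u j\<bar>)\<^sup>2"
    unfolding power2_eq_square sum_product by (simp add: sum_distrib_left)
  also have "\<dots> \<le> e * (real m * nrm2 m u)" using e abs_sum_square by (intro mult_left_mono)
  finally show ?thesis by simp
qed (simp add: qf_def ip_def)


text \<open>A linear scan that changes the index only on strict improvement, as the program does;
  ties go to the earliest index.\<close>

fun amin :: "nat \<Rightarrow> (nat \<Rightarrow> real) \<Rightarrow> nat" where
  "amin 0 f = 0"
| "amin (Suc i) f = (if f i < f (amin i f) then i else amin i f)"

lemma amin_less: "0 < n \<Longrightarrow> amin n f < n"
proof (induction n)
  case (Suc n) then show ?case by (cases n) (auto simp: less_Suc_eq)
qed simp

lemma amin_le: "i < n \<Longrightarrow> f (amin n f) \<le> f i"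
  by (induction n) (auto simp: less_Suc_eq intro: order_trans less_imp_le)

text \<open>The method maximises the concave function min_i a_i . c - |c|^2 / 2, whose maximiser is
  the minimum-norm point. Strong concavity turns an error \<open>ep\<close> in value into a distance
  of at most sqrt (2 ep) = 1 / 2 ^ K.\<close>

locale ellipsoid =
  fixes m n :: nat and a :: "nat \<Rightarrow> nat \<Rightarrow> real" and K :: nat
begin

text \<open>Rounding errors are compared with a ball of squared radius 1 / 2 ^ (4 K + 6), and 5 m
  absorbs a factor m^5 in \<open>det_move\<close>.\<close>

definition "J = 4 * K + 5 * m + 20"
text \<open>The determinant starts at 4^m and falls by a factor exp (- 1 / (256 m)) per round;
  \<open>T\<close> rounds would take it below the bound of \<open>det_lower_bound\<close>, see
  \<open>traj_close\<close>.\<close>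

definition "T = 256 * m * m * (m + 4 * K + 8)"
definition ep :: real where "ep = 1 / 2 ^ (2 * K + 1)"
text \<open>The gain of a cut is of order \<open>la\<close>, while inflating the matrix costs order
  m la^2 in the determinant; hence a small multiple of 1 / m.\<close>

definition la :: real where "la = 1 / (8 * real m)"
definition "kk c = amin n (\<lambda>i. ip m (a i) c)"
definition "val c = ip m (a (kk c)) c - nrm2 m c / 2"
definition "grad c j = a (kk c) j - c j"
definition "pp P c = mulv m P (grad c)"
definition "qq P c = ip m (grad c) (pp P c)"
text \<open>Replaces the square root of \<open>q\<close>: for q above ep^2 it lies between sqrt q
  and 2 sqrt q and is found by doubling.\<close>

definition "ss q = ep * 2 ^ (LEAST k. q \<le> (ep * 2 ^ k)\<^sup>2)"
definition "dd q = (ss q)\<^sup>2 + la * q"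
definition "ncen P c j = c j + la * ss (qq P c) * pp P c j / (2 * dd (qq P c))"
text \<open>\<open>ellipsoid_cut\<close> asks for the inflation 1 + la^2 / 4; the surplus is kept
  for rounding the centre.\<close>

definition "nsh P c i j = (1 + la\<^sup>2 / 2) * (P i j - la / dd (qq P c) * pp P c i * pp P c j)"
text \<open>Half of the added diagonal compensates for rounding the entries of the matrix, the other
  half for rounding the centre.\<close>

definition "rsh P c i j = rnd J (nsh P c i j) + (if i = j then 2 * real m / 2 ^ J else 0)"

definition best :: "(nat \<Rightarrow> real) \<Rightarrow> (nat \<Rightarrow> real) \<times> real \<Rightarrow> (nat \<Rightarrow> real) \<times> real" where
  "best c b = (if snd b < val c then (c, val c) else b)"

text \<open>Standing still is harmless: if \<open>z\<close> lies in the ellipsoid and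
  \<open>qq\<close> is at most ep^2, the centre is already nearly optimal by
  \<open>near_optimal\<close>.\<close>

definition move :: "(nat \<Rightarrow> nat \<Rightarrow> real) \<times> (nat \<Rightarrow> real) \<Rightarrow> (nat \<Rightarrow> nat \<Rightarrow> real) \<times> (nat \<Rightarrow> real)" where
  "move = (\<lambda>(P, c). if ep\<^sup>2 < qq P c then (rsh P c, \<lambda>j. rnd J (ncen P c j)) else (P, c))"

fun traj :: "nat \<Rightarrow> ((nat \<Rightarrow> nat \<Rightarrow> real) \<times> (nat \<Rightarrow> real)) \<times> ((nat \<Rightarrow> real) \<times> real)" where
  "traj 0 = ((\<lambda>i j. if i = j then 4 else 0, \<lambda>_. 0), (\<lambda>_. 0, 0))"
| "traj (Suc t) = (case traj t of (Pc, b) \<Rightarrow> (move Pc, best (snd Pc) b))"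

definition grid :: "real \<Rightarrow> bool" where "grid x \<longleftrightarrow> x * 2 ^ J \<in> \<int>"

lemma grid_rnd: "grid (rnd J x)" and grid_of_nat: "grid (of_nat k)" and grid_div: "grid (of_nat k / 2 ^ J)"
  and grid_add: "grid x \<Longrightarrow> grid y \<Longrightarrow> grid (x + y)"
  by (auto simp: grid_def rnd_def distrib_right)

text \<open>Size control of every run, for arbitrary vectors \<open>a\<close>: bounds that at most
  double per round, on a fixed grid. The bit lengths follow from this.\<close>

definition msr :: "nat \<Rightarrow> (nat \<Rightarrow> nat \<Rightarrow> real) \<Rightarrow> (nat \<Rightarrow> real) \<Rightarrow> bool" where
  "msr t P c \<longleftrightarrow> (\<forall>i<m. \<forall>j<m. P i j = P j i) \<and> (\<forall>u. 0 \<le> qf m P u) \<and>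
    (\<forall>i<m. P i i \<le> 2 ^ (t + 2)) \<and> (\<forall>j<m. \<bar>c j\<bar> \<le> 2 ^ (t + 2)) \<and>
    (\<forall>i<m. \<forall>j<m. grid (P i j)) \<and> (\<forall>j<m. grid (c j))"

lemma ep_pos: "0 < ep" by (simp add: ep_def)

lemma ss_props:
  assumes "ep\<^sup>2 < q"
  shows "q \<le> (ss q)\<^sup>2" "(ss q)\<^sup>2 < 4 * q" "0 < ss q"
proof -
  define k where "k = (LEAST k. q \<le> (ep * 2 ^ k)\<^sup>2)"
  obtain k0 where "q / ep\<^sup>2 < 2 ^ k0" using real_arch_pow[of 2 "q / ep\<^sup>2"] by auto
  hence "q < 2 ^ k0 * ep\<^sup>2" using ep_pos by (simp add: pos_divide_less_eq)
  also have "\<dots> \<le> (2 ^ k0)\<^sup>2 * ep\<^sup>2" by (intro mult_right_mono) (simp_all add: power2_eq_square)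
  also have "\<dots> = (ep * 2 ^ k0)\<^sup>2" by (simp only: power_mult_distrib mult.commute)
  finally have "q \<le> (ep * 2 ^ k0)\<^sup>2" by simp
  hence k: "q \<le> (ep * 2 ^ k)\<^sup>2" unfolding k_def by (rule LeastI)
  thus "q \<le> (ss q)\<^sup>2" "0 < ss q" using ep_pos by (simp_all add: ss_def k_def)
  \<comment> \<open>The exponent is positive because ep^2 < q, so its predecessor fails the
    test.\<close>
  obtain k' where k': "k = Suc k'" using k assms by (cases k) auto
  have "\<not> q \<le> (ep * 2 ^ k')\<^sup>2" using not_less_Least[of k' "\<lambda>k. q \<le> (ep * 2 ^ k)\<^sup>2"] k' by (simp add: k_def)
  moreover have "ss q = 2 * (ep * 2 ^ k')" by (simp add: ss_def k_def[symmetric] k')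
  ultimately show "(ss q)\<^sup>2 < 4 * q" by (simp add: power_mult_distrib)
qed

lemma ss_exponent:
  assumes "ep\<^sup>2 < q" "q \<le> 2 ^ N"
  shows "(LEAST k. q \<le> (ep * 2 ^ k)\<^sup>2) \<le> 2 * K + 1 + N"
proof (rule Least_le)
  have "q \<le> 2 ^ N" by fact
  also have "(2::real) ^ N \<le> (2 ^ N)\<^sup>2" by (simp add: power2_eq_square)
  also have "\<dots> = (ep * 2 ^ (2 * K + 1 + N))\<^sup>2" by (simp add: ep_def power_add)
  finally show "q \<le> (ep * 2 ^ (2 * K + 1 + N))\<^sup>2" .
qed

text \<open>Cauchy-Schwarz at unit vectors: a semidefinite matrix is dominated by its diagonal, so
  \<open>msr\<close> bounds only the diagonal.\<close>

lemma psd_entry: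
  assumes "\<forall>i<m. \<forall>j<m. P i j = P j i" "\<forall>u. 0 \<le> qf m P u" "i < m" "j < m" "P i i \<le> x" "P j j \<le> x"
  shows "\<bar>P i j\<bar> \<le> x"
proof -
  let ?e = "\<lambda>i j. if j = i then 1 else (0::real)"
  have mul: "mulv m P (?e j) i' = P i' j" if "j < m" for i' j
    using that by (simp add: mulv_def if_distrib[of "\<lambda>x. _ * x"] cong: if_cong)
  have ipe: "ip m (?e i) v = v i" if "i < m" for i v
    using that by (simp add: ip_def if_distrib[of "\<lambda>x. x * _"] cong: if_cong)
  have "(P i j)\<^sup>2 \<le> P i i * P j j"
    using qf_cauchy_schwarz[of m P "?e i" "?e j"] assms
    by (simp add: qf_mulv ipe mul)
  moreover have nn: "0 \<le> P i i" "0 \<le> P j j"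
    using assms(2)[rule_format, of "?e i"] assms(2)[rule_format, of "?e j"] assms
    by (simp_all add: qf_mulv ipe mul)
  hence "P i i * P j j \<le> x * x" using assms by (intro mult_mono) auto
  ultimately have "(P i j)\<^sup>2 \<le> x\<^sup>2" by (simp add: power2_eq_square)
  hence "\<bar>P i j\<bar> \<le> \<bar>x\<bar>" by (simp only: abs_le_square_iff)
  thus ?thesis using nn assms(5) by linarith
qed

lemma la_props: "0 < m \<Longrightarrow> 0 < la" "0 < m \<Longrightarrow> la \<le> 1 / 8" "0 < m \<Longrightarrow> la * real m = 1 / 8"
  by (auto simp: la_def field_simps)

lemma dd_pos: "0 < m \<Longrightarrow> ep\<^sup>2 < q \<Longrightarrow> (ss q)\<^sup>2 \<le> dd q \<and> 0 < dd q \<and> la * q \<le> dd q \<and> 0 < q"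
proof -
  assume "0 < m" "ep\<^sup>2 < q"
  moreover from this have "0 < q" by (smt (verit) zero_le_power2)
  ultimately show ?thesis using la_props(1) ss_props[of q] unfolding dd_def
    by (auto intro!: add_pos_pos)
qed

lemma pp_square:
  assumes "\<forall>i<m. \<forall>j<m. P i j = P j i" "\<forall>u. 0 \<le> qf m P u"
  shows "(ip m u (pp P c))\<^sup>2 \<le> qf m P u * qq P c"
  using qf_cauchy_schwarz[of m P u "grad c"] assms by (simp add: qq_def pp_def)

text \<open>The update removes at most the fraction \<open>la\<close> of the form, since q is at
  most \<open>D\<close>. So the matrix stays semidefinite, and a ball inside the ellipsoid costs at
  most a factor 2.\<close>

lemma nsh_qf:
  assumes "\<forall>i<m. \<forall>j<m. P i j = P j i" "\<forall>u. 0 \<le> qf m P u" "0 < m" "ep\<^sup>2 < qq P c"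
  shows "qf m P u / 2 \<le> qf m (nsh P c) u"
    and "qf m (nsh P c) u = (1 + la\<^sup>2 / 2) * (qf m P u - la / dd (qq P c) * (ip m u (pp P c))\<^sup>2)"
proof -
  let ?q = "qq P c" and ?D = "dd (qq P c)"
  have D: "0 < ?D" "0 < ?q" "(ss ?q)\<^sup>2 \<le> ?D" "?q \<le> (ss ?q)\<^sup>2" using dd_pos[OF assms(3,4)] ss_props[OF assms(4)] by auto
  show eq: "qf m (nsh P c) u = (1 + la\<^sup>2 / 2) * (qf m P u - la / ?D * (ip m u (pp P c))\<^sup>2)"
    using qf_rank_one[of m "1 + la\<^sup>2 / 2" P "la / ?D" "pp P c" u] by (simp add: nsh_def[abs_def])
  have "la / ?D * (ip m u (pp P c))\<^sup>2 \<le> la / ?D * (qf m P u * ?q)"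
    using D la_props(1)[OF assms(3)] pp_square[OF assms(1,2)] by (intro mult_left_mono) auto
  also have "\<dots> = qf m P u * (la * (?q / ?D))" by simp
  also have "\<dots> \<le> qf m P u * (1 / 2 * 1)"
    using D la_props[OF assms(3)] assms(2) by (intro mult_left_mono mult_mono) auto
  finally have 1: "qf m P u / 2 \<le> qf m P u - la / ?D * (ip m u (pp P c))\<^sup>2" by simp
  also have "\<dots> \<le> (1 + la\<^sup>2 / 2) * (qf m P u - la / ?D * (ip m u (pp P c))\<^sup>2)"
  proof -
    have "0 \<le> qf m P u - la / ?D * (ip m u (pp P c))\<^sup>2" using 1 assms(2)[rule_format, of u] by linarith
    from mult_right_mono[OF _ this, of 1 "1 + la\<^sup>2 / 2"] show ?thesis by simp
  qed
  finally show "qf m P u / 2 \<le> qf m (nsh P c) u" unfolding eq .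
qed

lemma twoJ: "513 * (real m)\<^sup>2 \<le> 2 ^ J" "real m / 2 ^ J \<le> 1 / 4" "1 \<le> (2::real) ^ J"
proof -
  have "real m < 2 ^ m" by simp
  hence "(real m)\<^sup>2 \<le> (2 ^ m)\<^sup>2" by (intro power_mono) auto
  also have "(2 ^ m)\<^sup>2 = (2::real) ^ (2 * m)" by (simp add: power_mult[symmetric] mult.commute)
  finally have "513 * (real m)\<^sup>2 \<le> 2 ^ 20 * 2 ^ (2 * m)" by (intro mult_mono) auto
  also have "\<dots> = 2 ^ (20 + 2 * m)" by (simp only: power_add)
  also have "\<dots> \<le> 2 ^ J" by (intro power_increasing) (auto simp: J_def)
  finally show "513 * (real m)\<^sup>2 \<le> 2 ^ J" .
  have "4 * real m \<le> 2 ^ 2 * 2 ^ m" using \<open>real m < 2 ^ m\<close> by simp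
  also have "\<dots> = 2 ^ (2 + m)" by (simp only: power_add)
  also have "\<dots> \<le> 2 ^ J" by (intro power_increasing) (auto simp: J_def)
  finally show "real m / 2 ^ J \<le> 1 / 4" by (simp add: field_simps)
qed simp

lemma rsh_close: "i < m \<Longrightarrow> j < m \<Longrightarrow> \<bar>rsh P c i j - (nsh P c i j + (if i = j then 2 * real m / 2 ^ J else 0))\<bar> \<le> 1 / 2 ^ J"
  using rnd_abs[of J "nsh P c i j"] by (simp add: rsh_def)

lemma qf_diag: "qf m (\<lambda>i j. P i j + (if i = j then x else 0)) u = qf m P u + x * nrm2 m u"
proof -
  have "qf m (\<lambda>i j. P i j + (if i = j then x else 0)) u = qf m P u + (\<Sum>i<m. \<Sum>j<m. if i = j then u i * x * u j else 0)"
    unfolding qf_def sum.distrib[symmetric] by (intro sum.cong refl) (simp add: algebra_simps)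
  also have "(\<Sum>i<m. \<Sum>j<m. if i = j then u i * x * u j else 0) = (\<Sum>i<m. u i * x * u i)"
    by (intro sum.cong refl) simp
  finally show ?thesis by (simp add: ip_def sum_distrib_left mult_ac)
qed

lemma rsh_qf: "qf m (nsh P c) u + real m / 2 ^ J * nrm2 m u \<le> qf m (rsh P c) u"
proof -
  have "qf m (\<lambda>i j. nsh P c i j + (if i = j then 2 * real m / 2 ^ J else 0)) u - 1 / 2 ^ J * (real m * nrm2 m u)
    \<le> qf m (rsh P c) u"
    by (rule qf_perturb) (rule rsh_close)
  thus ?thesis unfolding qf_diag by (simp add: algebra_simps)
qed

lemma msr_move:
  assumes "msr t P c" "0 < m" "move (P, c) = (P', c')"
  shows "msr (Suc t) P' c'"
proof (cases "ep\<^sup>2 < qq P c")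
  case False
  have "(2::real) ^ (t + 2) \<le> 2 ^ (Suc t + 2)" by (intro power_increasing) auto
  hence le: "y \<le> 2 ^ (Suc t + 2)" if "y \<le> 2 ^ (t + 2)" for y :: real using that by linarith
  have "P' = P" "c' = c" using assms(3) False by (auto simp: move_def)
  thus ?thesis using assms(1) le unfolding msr_def by blast
next
  case True
  let ?q = "qq P c" and ?D = "dd (qq P c)" and ?X = "2 ^ (t + 2) :: real"
  have sym: "\<forall>i<m. \<forall>j<m. P i j = P j i" and psd: "\<forall>u. 0 \<le> qf m P u"
    and diag: "\<And>i. i < m \<Longrightarrow> P i i \<le> ?X" and cb: "\<And>j. j < m \<Longrightarrow> \<bar>c j\<bar> \<le> ?X"
    using assms(1) by (auto simp: msr_def)
  have X: "4 \<le> ?X" using power_increasing[of 2 "t + 2" "2::real"] by simp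
  have D: "0 < ?D" "0 < ?q" "(ss ?q)\<^sup>2 \<le> ?D" "?q \<le> (ss ?q)\<^sup>2" "0 < ss ?q"
    using dd_pos[OF assms(2) True] ss_props[OF True] by auto
  have P': "P' = rsh P c" and c': "c' = (\<lambda>j. rnd J (ncen P c j))"
    using assms(3) True by (simp_all add: move_def)
  have "rsh P c i j = rsh P c j i" if "i < m" "j < m" for i j
    using sym that by (simp add: rsh_def nsh_def mult_ac)
  moreover have "0 \<le> qf m (rsh P c) u" for u
    using rsh_qf[of P c u] nsh_qf(1)[OF sym psd assms(2) True, of u] psd[rule_format, of u]
    by (smt (verit) divide_nonneg_nonneg mult_nonneg_nonneg nrm2_nonneg of_nat_0_le_iff zero_le_power)
  moreover have "rsh P c i i \<le> 2 ^ (Suc t + 2)" if i: "i < m" for i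
  proof -
    have "P i i - la / ?D * pp P c i * pp P c i \<le> P i i"
      using D la_props(1)[OF assms(2)] by (simp add: mult.assoc)
    hence "P i i - la / ?D * pp P c i * pp P c i \<le> ?X" using diag[OF i] by linarith
    hence "nsh P c i i \<le> (1 + la\<^sup>2 / 2) * ?X" unfolding nsh_def by (intro mult_left_mono) auto
    also have "\<dots> \<le> (3 / 2) * ?X"
    proof -
      have "la\<^sup>2 \<le> 1" using la_props[OF assms(2)] by (intro power_le_one) auto
      thus ?thesis by (intro mult_right_mono) auto
    qed
    finally have nb: "nsh P c i i \<le> (3 / 2) * ?X" .
    \<comment> \<open>Inflation contributes the factor 3/2 and the added diagonal at most 1/2; as
      the old bound is at least 4, this stays within a doubling.\<close>
    have "rsh P c i i \<le> (3 / 2) * ?X + 1 / 2"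
    proof -
      have "2 * real m / 2 ^ J = 2 * (real m / 2 ^ J)" by simp
      moreover have "rsh P c i i = rnd J (nsh P c i i) + 2 * real m / 2 ^ J" by (simp add: rsh_def)
      ultimately show ?thesis using rnd_le[of J "nsh P c i i"] twoJ(2) nb by linarith
    qed
    also have "\<dots> \<le> 2 * ?X" using X by linarith
    finally show ?thesis by simp
  qed
  moreover have "\<bar>rnd J (ncen P c j)\<bar> \<le> 2 ^ (Suc t + 2)" if j: "j < m" for j
  proof -
    let ?e = "\<lambda>i. if i = j then 1 else (0::real)"
    have ipe: "ip m ?e v = v j" for v
      using j by (simp add: ip_def if_distrib[of "\<lambda>x. x * _"] cong: if_cong)
    have "mulv m P ?e j = P j j" using j by (simp add: mulv_def if_distrib[of "\<lambda>x. _ * x"] cong: if_cong)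
    hence "qf m P ?e = P j j" by (simp add: qf_mulv ipe)
    \<comment> \<open>The step is bounded by a diagonal entry of \<open>P\<close> times
      \<open>q\<close>, independently of the size of the gradient.\<close>
    hence "(pp P c j)\<^sup>2 \<le> P j j * ?q" using pp_square[OF sym psd, of ?e c] by (simp add: ipe)
    also have "\<dots> \<le> ?X * (ss ?q)\<^sup>2" using diag[OF j] D by (intro mult_mono) auto
    also have "\<dots> \<le> ?X\<^sup>2 * (ss ?q)\<^sup>2"
    proof (rule mult_right_mono)
      have "?X * 1 \<le> ?X * ?X" using X by (intro mult_left_mono) linarith+
      thus "?X \<le> ?X\<^sup>2" by (simp only: power2_eq_square mult_1_right)
    qed simp
    finally have "(pp P c j)\<^sup>2 \<le> (?X * ss ?q)\<^sup>2" by (simp only: power_mult_distrib)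
    hence "\<bar>pp P c j\<bar> \<le> \<bar>?X * ss ?q\<bar>" by (simp only: abs_le_square_iff)
    moreover have "0 \<le> ?X * ss ?q" using X D by (intro mult_nonneg_nonneg) linarith+
    ultimately have "\<bar>pp P c j\<bar> \<le> ?X * ss ?q" by linarith
    hence "la * ss ?q * \<bar>pp P c j\<bar> / (2 * ?D) \<le> la * ss ?q * (?X * ss ?q) / (2 * ?D)"
      using D la_props(1)[OF assms(2)] by (intro divide_right_mono mult_left_mono) auto
    moreover have "\<bar>la * ss ?q * pp P c j / (2 * ?D)\<bar> = la * ss ?q * \<bar>pp P c j\<bar> / (2 * ?D)"
      using D la_props(1)[OF assms(2)] by (simp add: abs_mult)
    ultimately have "\<bar>la * ss ?q * pp P c j / (2 * ?D)\<bar> \<le> la * ss ?q * (?X * ss ?q) / (2 * ?D)"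
      by linarith
    also have "\<dots> = ?X * (la / 2) * ((ss ?q)\<^sup>2 / ?D)" by (simp add: power2_eq_square)
    also have "\<dots> \<le> ?X * (1 / 2) * 1"
      using D la_props[OF assms(2)] X by (intro mult_mono) auto
    finally have "\<bar>ncen P c j\<bar> \<le> ?X + ?X / 2" using cb[OF j] unfolding ncen_def by linarith
    moreover have "1 / 2 ^ J \<le> (1::real)" using twoJ(3) by (simp add: field_simps)
    ultimately have "\<bar>rnd J (ncen P c j)\<bar> \<le> ?X + ?X / 2 + 1"
      using rnd_abs[of J "ncen P c j"] by linarith
    also have "\<dots> \<le> 2 * ?X" using X by linarith
    finally show ?thesis by simp
  qed
  moreover have "grid (2 * real m / 2 ^ J)" "grid 0"
    using grid_div[of "2 * m"] grid_of_nat[of 0] by simp_all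
  hence "grid (rsh P c i j)" for i j
    unfolding rsh_def by (intro grid_add grid_rnd) auto
  ultimately show ?thesis unfolding msr_def P' c' by (auto intro: grid_rnd)
qed

lemma msr_traj:
  assumes "0 < m" "traj t = ((P, c), (B, bv))"
  shows "msr t P c \<and> bv = val B \<and> (\<forall>j<m. \<bar>B j\<bar> \<le> 2 ^ (t + 2)) \<and> (\<forall>j<m. grid (B j))"
  using assms(2)
proof (induction t arbitrary: P c B bv)
  case 0
  have "0 \<le> qf m (\<lambda>i j. if i = j then 4 else 0) u" for u
    using qf_diag[of "\<lambda>_ _. 0" 4 u] by (simp add: qf_def[of m "\<lambda>_ _. 0"])
  moreover have "val (\<lambda>_. 0) = 0" by (simp add: val_def ip_def)
  ultimately show ?case using 0 grid_of_nat[of 0] grid_of_nat[of 4] by (auto simp: msr_def)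
next
  case (Suc t)
  obtain P0 c0 B0 bv0 where t: "traj t = ((P0, c0), (B0, bv0))" by (metis surj_pair)
  note IH = Suc.IH[OF t]
  have mv: "move (P0, c0) = (P, c)" and be: "best c0 (B0, bv0) = (B, bv)"
    using Suc.prems t by auto
  have le: "(2::real) ^ (t + 2) \<le> 2 ^ (Suc t + 2)" by (intro power_increasing) auto
  have "msr (Suc t) P c" using IH msr_move[OF _ assms(1) mv] by blast
  moreover have "bv = val B \<and> (\<forall>j<m. \<bar>B j\<bar> \<le> 2 ^ (t + 2)) \<and> (\<forall>j<m. grid (B j))"
    using IH be by (auto simp: best_def msr_def split: if_splits)
  ultimately show ?case using le by (meson order_trans)
qed

end

section \<open>Convergence to the minimum-norm point\<close>

locale ellipsoid_conv = ellipsoid +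
  fixes z :: "nat \<Rightarrow> real"
  assumes m0: "0 < m" and n0: "0 < n"
    and a1: "\<And>i. i < n \<Longrightarrow> (\<Sum>j<m. \<bar>a i j\<bar>) \<le> 1"
    and z: "mnp m {..<n} a z"
begin

text \<open>On the ball of radius \<open>rr\<close> around \<open>z\<close> the objective is at
  least \<open>G - ep\<close>, where \<open>G\<close> is its maximum; see
  \<open>ball_value\<close>.\<close>

definition rr :: real where "rr = 1 / 2 ^ (2 * K + 3)"
definition "G = nrm2 m z / 2"

lemma rr_props: "0 < rr" "rr \<le> 1" "ep = 4 * rr"
proof -
  have "(1::real) \<le> 2 ^ (2 * K + 3)" by (rule one_le_power) simp
  thus "rr \<le> 1" unfolding rr_def by (subst divide_le_eq_1_pos) (simp_all only: zero_less_power zero_less_numeral)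
qed (simp_all add: rr_def ep_def power_add)

lemma kk_less: "kk c < n"
  unfolding kk_def by (rule amin_less[OF n0])

lemma a_nrm: "i < n \<Longrightarrow> nrm2 m (a i) \<le> 1"
proof -
  assume i: "i < n"
  have "\<bar>a i j\<bar> \<le> 1" if "j < m" for j
    using member_le_sum[of j "{..<m}" "\<lambda>j. \<bar>a i j\<bar>"] a1[OF i] that by auto
  hence "\<bar>nrm2 m (a i)\<bar> \<le> 1 * (\<Sum>j<m. \<bar>a i j\<bar>)" by (rule ip_bound1)
  thus ?thesis using a1[OF i] by simp
qed

lemma z_nrm: "nrm2 m z \<le> 1"
proof -
  have "nrm2 m z \<le> ip m (a 0) z" using z n0 by (auto simp: mnp_def)
  hence "(nrm2 m z)\<^sup>2 \<le> (ip m (a 0) z)\<^sup>2" by (intro power_mono) auto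
  also have "\<dots> \<le> nrm2 m (a 0) * nrm2 m z" by (rule ip_cauchy_schwarz)
  also have "\<dots> \<le> 1 * nrm2 m z" using a_nrm[OF n0] by (intro mult_right_mono) auto
  finally have "nrm2 m z * nrm2 m z \<le> nrm2 m z * 1" by (simp add: power2_eq_square)
  thus ?thesis using nrm2_nonneg[of m z] mult_le_cancel_left_pos[of "nrm2 m z" "nrm2 m z" 1] by fastforce
qed

text \<open>The least inner product is at most the average with the weights of \<open>z\<close>,
  which is c . z; completing the square leaves the strong concavity term.\<close>

lemma val_le: "val c \<le> G - nrm2 m (\<lambda>j. c j - z j) / 2"
proof -
  from z obtain l where l: "\<forall>i\<in>{..<n}. 0 \<le> l i" "sum l {..<n} = 1"
    and zl: "z = (\<lambda>j. if j < m then \<Sum>i\<in>{..<n}. l i * a i j else 0)" unfolding mnp_def by blast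
  have "ip m (a (kk c)) c = (\<Sum>i<n. l i * ip m (a (kk c)) c)"
    using l by (simp flip: sum_distrib_right)
  also have "\<dots> \<le> (\<Sum>i<n. l i * ip m (a i) c)"
    using l unfolding kk_def by (intro sum_mono mult_left_mono amin_le) auto
  also have "\<dots> = ip m c z" unfolding ip_comb[OF zl] ..
  finally have "ip m (a (kk c)) c \<le> ip m c z" .
  moreover have "nrm2 m (\<lambda>j. c j - z j) = nrm2 m c - 2 * ip m c z + nrm2 m z"
    by (simp add: ip_linear ip_commute[of m z c])
  ultimately show ?thesis unfolding val_def G_def by linarith
qed

text \<open>\<open>grad c\<close> is the gradient at \<open>c\<close> of the quadratic piece active
  there, and this is the exact expansion of that piece. Points of larger value thus lie on the
  positive side of the cut.\<close>

lemma value_gap: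
  "ip m (a (kk c)) w - nrm2 m w / 2 - val c = ip m (grad c) (\<lambda>j. w j - c j) - nrm2 m (\<lambda>j. w j - c j) / 2"
proof -
  have g: "grad c = (\<lambda>j. a (kk c) j - c j)" by (simp add: grad_def fun_eq_iff)
  have "ip m (grad c) (\<lambda>j. w j - c j) = ip m (a (kk c)) w - ip m c w - (ip m (a (kk c)) c - nrm2 m c)"
    unfolding g by (simp add: ip_linear)
  moreover have "nrm2 m (\<lambda>j. w j - c j) = nrm2 m w - 2 * ip m c w + nrm2 m c"
    by (simp add: ip_linear ip_commute[of m w c])
  ultimately show ?thesis unfolding val_def by linarith
qed

lemma ball_value:
  assumes w: "nrm2 m (\<lambda>j. w j - z j) \<le> rr\<^sup>2" and i: "i < n"
  shows "G - ep \<le> ip m (a i) w - nrm2 m w / 2"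
proof -
  define e where "e j = w j - z j" for j
  have e: "nrm2 m e \<le> rr\<^sup>2" using w by (simp add: e_def[abs_def])
  have we: "w = (\<lambda>j. z j + e j)" by (simp add: e_def fun_eq_iff)
  have b: "\<bar>ip m v e\<bar> \<le> rr" if "nrm2 m v \<le> 1" for v
  proof -
    have "(ip m v e)\<^sup>2 \<le> nrm2 m v * nrm2 m e" by (rule ip_cauchy_schwarz)
    also have "\<dots> \<le> 1 * rr\<^sup>2" using that e by (intro mult_mono) auto
    finally have "\<bar>ip m v e\<bar>\<^sup>2 \<le> rr\<^sup>2" by simp
    thus ?thesis using rr_props by (intro power2_le_imp_le[of "\<bar>_\<bar>"]) auto
  qed
  have "nrm2 m z \<le> ip m (a i) z" using z i by (auto simp: mnp_def)
  moreover have "\<bar>ip m (a i) e\<bar> \<le> rr" "\<bar>ip m z e\<bar> \<le> rr" using b a_nrm[OF i] z_nrm by auto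
  moreover have "rr\<^sup>2 \<le> rr" using rr_props by (simp add: power2_eq_square mult_le_cancel_left1)
  moreover have "nrm2 m w = nrm2 m z + 2 * ip m z e + nrm2 m e" "ip m (a i) w = ip m (a i) z + ip m (a i) e"
    unfolding we by (simp_all add: ip_linear ip_commute[of m e z])
  ultimately show ?thesis using e rr_props unfolding G_def by linarith
qed

text \<open>While the centre is worse than \<open>G - ep\<close>, the gradient grows by more than
  \<open>ep\<close> towards \<open>z\<close>, so an ellipsoid containing \<open>z\<close> is wider
  than \<open>ep\<close> in that direction.\<close>

lemma near_optimal:
  assumes "inE m P c z" "val c < G - ep"
  shows "ep\<^sup>2 < qq P c"
proof -
  have "nrm2 m z \<le> ip m (a (kk c)) z" using z kk_less by (auto simp: mnp_def)
  hence "ep < ip m (grad c) (\<lambda>j. z j - c j)"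
    using value_gap[of c z] assms(2) nrm2_nonneg[of m "\<lambda>j. z j - c j"] unfolding G_def by linarith
  hence "ep\<^sup>2 < (ip m (grad c) (\<lambda>j. z j - c j))\<^sup>2" using ep_pos by (intro power_strict_mono) auto
  also have "\<dots> \<le> qq P c" using assms(1) by (simp add: inE_def qf_mulv qq_def pp_def)
  finally show ?thesis .
qed

lemma square_add_le:
  fixes y d eta :: real
  assumes "0 < eta"
  shows "(y + d)\<^sup>2 \<le> (1 + eta) * y\<^sup>2 + (1 + 1 / eta) * d\<^sup>2"
proof -
  have "0 \<le> (eta * y - d)\<^sup>2 / eta" using assms by simp
  also have "\<dots> = eta * y\<^sup>2 - 2 * y * d + d\<^sup>2 / eta" using assms by (simp add: power2_eq_square field_simps)
  finally show ?thesis by (simp add: power2_eq_square algebra_simps)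
qed

lemma move_contains:
  assumes P: "msr t P c" and q: "ep\<^sup>2 < qq P c" and w: "inE m P c w"
    and cut: "0 \<le> ip m (grad c) (\<lambda>j. w j - c j)"
  shows "inE m (rsh P c) (\<lambda>j. rnd J (ncen P c j)) w"
  unfolding inE_def
proof
  fix u
  have sym: "\<forall>i<m. \<forall>j<m. P i j = P j i" and psd: "\<forall>u. 0 \<le> qf m P u" using P by (auto simp: msr_def)
  let ?q = "qq P c" and ?D = "dd (qq P c)"
  note l = la_props[OF m0]
  define X where "X = qf m P u - la / ?D * (ip m u (pp P c))\<^sup>2"
  define y where "y = ip m u (\<lambda>j. w j - ncen P c j)"
  define d where "d = ip m u (\<lambda>j. ncen P c j - rnd J (ncen P c j))"
  have y: "y\<^sup>2 \<le> (1 + la\<^sup>2 / 4) * X"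
    unfolding y_def X_def ncen_def pp_def
    by (rule ellipsoid_cut[OF sym w cut]) (use ss_props[OF q] dd_pos[OF m0 q] l in \<open>auto simp: qq_def pp_def dd_def\<close>)
  have "0 < 1 + la\<^sup>2 / 4" by (simp add: add_pos_nonneg)
  with order_trans[OF zero_le_power2 y] have "0 \<le> X" by (simp only: zero_le_mult_iff) linarith
  moreover have "qf m (nsh P c) u = (1 + la\<^sup>2 / 2) * X"
    unfolding X_def by (rule nsh_qf(2)[OF sym psd m0 q])
  ultimately have X: "0 \<le> X" "qf m (nsh P c) u = (1 + la\<^sup>2 / 2) * X" .
  have "(\<Sum>j<m. (ncen P c j - rnd J (ncen P c j)) * (ncen P c j - rnd J (ncen P c j))) \<le> (\<Sum>j<m. (1 / 2 ^ J)\<^sup>2)"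
  proof (rule sum_mono)
    fix j
    have "\<bar>ncen P c j - rnd J (ncen P c j)\<bar> \<le> 1 / 2 ^ J" using rnd_abs[of J "ncen P c j"] by (simp add: abs_minus_commute)
    hence "\<bar>ncen P c j - rnd J (ncen P c j)\<bar>\<^sup>2 \<le> (1 / 2 ^ J)\<^sup>2" by (rule power_mono) simp
    thus "(ncen P c j - rnd J (ncen P c j)) * (ncen P c j - rnd J (ncen P c j)) \<le> (1 / 2 ^ J)\<^sup>2"
      by (simp add: power2_eq_square)
  qed
  hence "nrm2 m (\<lambda>j. ncen P c j - rnd J (ncen P c j)) \<le> real m * (1 / 2 ^ J)\<^sup>2" by (simp add: ip_def)
  hence d: "d\<^sup>2 \<le> nrm2 m u * (real m * (1 / 2 ^ J)\<^sup>2)"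
    unfolding d_def by (intro order_trans[OF ip_cauchy_schwarz] mult_left_mono) auto
  \<comment> \<open>Small enough for (1 + eta) (1 + la^2 / 4) to stay below 1 + la^2 / 2, and large
    enough for 1 + 1 / eta to stay below \<open>2 ^ J\<close>.\<close>
  define eta where "eta = la\<^sup>2 / 8"
  have eta: "0 < eta" using l by (simp add: eta_def)
  have yd: "ip m u (\<lambda>j. w j - rnd J (ncen P c j)) = y + d"
    by (simp add: y_def d_def ip_linear)
  have "(y + d)\<^sup>2 \<le> (1 + eta) * y\<^sup>2 + (1 + 1 / eta) * d\<^sup>2" by (rule square_add_le[OF eta])
  also have "(1 + eta) * y\<^sup>2 \<le> (1 + eta) * ((1 + la\<^sup>2 / 4) * X)" using y eta by (intro mult_left_mono) auto
  also have "\<dots> = ((1 + eta) * (1 + la\<^sup>2 / 4)) * X" by simp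
  also have "\<dots> \<le> (1 + la\<^sup>2 / 2) * X"
  proof (rule mult_right_mono[OF _ X(1)])
    have "la\<^sup>2 \<le> 1" using l by (simp add: power_le_one)
    hence "eta * la\<^sup>2 \<le> eta * 1" using eta by (intro mult_left_mono) auto
    hence "eta * (la\<^sup>2 / 4) \<le> la\<^sup>2 / 8" unfolding eta_def using zero_le_power2[of la] by linarith
    thus "(1 + eta) * (1 + la\<^sup>2 / 4) \<le> 1 + la\<^sup>2 / 2" unfolding eta_def by (simp add: algebra_simps)
  qed
  also have "(1 + 1 / eta) * d\<^sup>2 \<le> 2 ^ J * (nrm2 m u * (real m * (1 / 2 ^ J)\<^sup>2))"
  proof (intro mult_mono d)
    have "1 / eta = 512 * (real m)\<^sup>2" unfolding eta_def la_def by (simp add: field_simps power2_eq_square)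
    moreover have "1 \<le> (real m)\<^sup>2" using m0 by simp
    ultimately show "1 + 1 / eta \<le> 2 ^ J" using twoJ(1) by linarith
  qed auto
  also have "\<dots> = real m / 2 ^ J * nrm2 m u" by (simp add: power2_eq_square field_simps)
  finally show "(ip m u (\<lambda>j. w j - rnd J (ncen P c j)))\<^sup>2 \<le> qf m (rsh P c) u"
    using rsh_qf[of P c u] unfolding yd X(2) by simp
qed

text \<open>Both ends of the diameter in direction \<open>u\<close> obey the support inequality;
  adding the two, the position of the centre drops out.\<close>

lemma ball_qf:
  assumes "\<And>w. nrm2 m (\<lambda>j. w j - z j) \<le> rr\<^sup>2 \<Longrightarrow> inE m P c w"
  shows "rr\<^sup>2 * nrm2 m u \<le> qf m P u"
proof -
  have zE: "inE m P c z" by (rule assms) (simp add: ip_def)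
  have q0: "0 \<le> qf m P u" using zE by (meson inE_def order_trans zero_le_power2)
  show ?thesis
  proof (cases "nrm2 m u = 0")
    case False
    define N where "N = sqrt (nrm2 m u)"
    have N: "0 < N" "N\<^sup>2 = nrm2 m u" using False nrm2_nonneg[of m u] by (auto simp: N_def less_le)
    define t where "t = rr / N"
    have tN: "t * N = rr" using N by (simp add: t_def)
    define x where "x = ip m u (\<lambda>j. z j - c j)"
    have "(x + r * (t * N\<^sup>2))\<^sup>2 \<le> qf m P u" if r: "r = 1 \<or> r = -1" for r :: real
    proof -
      have "nrm2 m (\<lambda>j. (z j + (r * t) * u j) - z j) = (t * N)\<^sup>2"
        using r by (auto simp: ip_linear N(2)[symmetric] power2_eq_square)
      hence "inE m P c (\<lambda>j. z j + (r * t) * u j)" by (intro assms) (simp add: tN)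
      hence "(ip m u (\<lambda>j. z j + (r * t) * u j - c j))\<^sup>2 \<le> qf m P u" unfolding inE_def by blast
      moreover have "ip m u (\<lambda>j. z j + (r * t) * u j - c j) = x + r * (t * N\<^sup>2)"
        by (simp add: x_def ip_linear N(2))
      ultimately show ?thesis by simp
    qed
    from this[of 1] this[of "-1"] have "(x + t * N\<^sup>2)\<^sup>2 \<le> qf m P u" "(x - t * N\<^sup>2)\<^sup>2 \<le> qf m P u" by simp_all
    hence "(t * N\<^sup>2)\<^sup>2 \<le> qf m P u"
      using zero_le_power2[of x] unfolding power2_sum power2_diff by linarith
    moreover have "(t * N\<^sup>2)\<^sup>2 = rr\<^sup>2 * nrm2 m u"
      unfolding N(2)[symmetric] tN[symmetric] by (simp add: power2_eq_square)
    ultimately show ?thesis by simp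
  qed (use q0 in simp)
qed

lemma exp_half_le: "0 \<le> x \<Longrightarrow> x \<le> 1 \<Longrightarrow> exp (x / 2) \<le> 1 + (x :: real)"
proof -
  assume x: "0 \<le> x" "x \<le> 1"
  have "exp (x / 2) \<le> 1 + x / 2 + (x / 2)\<^sup>2" using x by (intro exp_bound) auto
  moreover have "(x / 2)\<^sup>2 \<le> x / 2" using x by (simp add: power2_eq_square) (metis (no_types, opaque_lifting) mult_le_cancel_left1 mult_left_mono one_le_numeral order_trans)
  ultimately show ?thesis by simp
qed

text \<open>Inflation contributes at most exp (la / 16), the cut at most exp (- la / 8) and rounding
  at most exp (la / 32); the net exponent is - la / 32 = - 1 / (256 m).\<close>

lemma det_move:
  assumes P: "msr t P c" and q: "ep\<^sup>2 < qq P c" and r: "\<And>u. rr\<^sup>2 * nrm2 m u \<le> qf m P u"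
  shows "\<bar>Determinant.det (fmat m (rsh P c))\<bar> \<le> \<bar>Determinant.det (fmat m P)\<bar> * exp (- 1 / (256 * real m))"
proof -
  have sym: "\<forall>i<m. \<forall>j<m. P i j = P j i" and psd: "\<forall>u. 0 \<le> qf m P u" using P by (auto simp: msr_def)
  let ?q = "qq P c" and ?D = "dd (qq P c)" and ?d = "\<lambda>P. \<bar>Determinant.det (fmat m P)\<bar>"
  note l = la_props[OF m0] and D = dd_pos[OF m0 q] and s = ss_props[OF q]
  have N: "rr\<^sup>2 / 2 * nrm2 m u \<le> qf m (nsh P c) u" for u
    using nsh_qf(1)[OF sym psd m0 q, of u] r[of u] by linarith
  have s1: "?d (rsh P c) \<le> ?d (nsh P c) * (1 + real m * real m * (3 * real m / 2 ^ J) / (rr\<^sup>2 / 2)) ^ m"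
  proof (rule det_perturbation[OF _ N])
    show "0 < rr\<^sup>2 / 2" using rr_props by simp
    fix i j assume ij: "i < m" "j < m"
    have 1: "1 / 2 ^ J \<le> real m / 2 ^ J" using m0 by (intro divide_right_mono) auto
    have 0: "0 \<le> real m / 2 ^ J" by simp
    have e: "3 * real m / 2 ^ J = 3 * (real m / 2 ^ J)" "2 * real m / 2 ^ J = 2 * (real m / 2 ^ J)" by simp_all
    show "\<bar>rsh P c i j - nsh P c i j\<bar> \<le> 3 * real m / 2 ^ J"
    proof (cases "i = j")
      case True
      with rsh_close[OF ij, of P c] have "\<bar>rsh P c i j - (nsh P c i j + 2 * (real m / 2 ^ J))\<bar> \<le> 1 / 2 ^ J"
        unfolding e by simp
      with 0 1 show ?thesis unfolding e by linarith
    next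
      case False
      with rsh_close[OF ij, of P c] have "\<bar>rsh P c i j - nsh P c i j\<bar> \<le> 1 / 2 ^ J" by simp
      with 0 1 show ?thesis unfolding e by linarith
    qed
  qed
  have s2: "(1 + real m * real m * (3 * real m / 2 ^ J) / (rr\<^sup>2 / 2)) ^ m \<le> exp (la / 32)"
  proof -
    let ?x = "real m * real m * (3 * real m / 2 ^ J) / (rr\<^sup>2 / 2)"
    have "(1 + ?x) ^ m \<le> exp ?x ^ m" by (intro power_mono exp_ge_add_one_self) auto
    also have "\<dots> = exp (real m * ?x)" by (rule exp_of_nat_mult[symmetric])
    also have "exp (real m * ?x) \<le> exp (la / 32)"
      unfolding exp_le_cancel_iff
    proof -
      have "real m * ?x = 6 * real m ^ 4 * 2 ^ (4 * K + 6) / 2 ^ J"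
        by (simp add: rr_def power_divide power_mult[symmetric] eval_nat_numeral power_add mult_ac)
      also have "\<dots> = 6 * real m ^ 4 / 2 ^ (5 * m + 14)"
      proof -
        have "(2::real) ^ J = 2 ^ (4 * K + 6) * 2 ^ (5 * m + 14)" by (simp add: J_def power_add[symmetric])
        thus ?thesis by simp
      qed
      also have "\<dots> \<le> 1 / (256 * real m)"
      proof -
        have "real m < 2 ^ m" by simp
        hence "real m ^ 5 \<le> (2 ^ m) ^ 5" by (intro power_mono) auto
        hence "real m ^ 5 \<le> 2 ^ (5 * m)" by (simp add: power_mult[symmetric] mult.commute)
        hence "6 * 256 * real m ^ 5 \<le> 2 ^ 14 * 2 ^ (5 * m)" by (intro mult_mono) auto
        hence "6 * 256 * real m ^ 5 \<le> 2 ^ (5 * m + 14)" by (simp only: power_add mult.commute)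
        thus ?thesis using m0 by (simp add: field_simps eval_nat_numeral)
      qed
      also have "\<dots> = la / 32" by (simp add: la_def)
      finally show "real m * ?x \<le> la / 32" .
    qed
    finally show ?thesis .
  qed
  have s3: "?d (nsh P c) = (1 + la\<^sup>2 / 2) ^ m * (?d P * (1 - la / ?D * ?q))"
  proof -
    have "fmat m (nsh P c) = (1 + la\<^sup>2 / 2) \<cdot>\<^sub>m fmat m (\<lambda>i j. P i j - la / ?D * pp P c i * pp P c j)"
      by (rule eq_matI) (auto simp: fmat_def nsh_def)
    moreover have "Determinant.det (fmat m (\<lambda>i j. P i j - la / ?D * pp P c i * pp P c j)) =
        Determinant.det (fmat m P) * (1 - la / ?D * ?q)"
      unfolding qq_def by (rule det_rank_one_downdate) (use sym in \<open>auto simp: pp_def mulv_def\<close>)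
    moreover have "la / ?D * ?q \<le> 1" using D by (simp add: field_simps)
    moreover have "0 \<le> 1 + la\<^sup>2 / 2" by simp
    ultimately show ?thesis by (simp add: abs_mult power_abs fmat_def)
  qed
  have s4: "(1 + la\<^sup>2 / 2) ^ m \<le> exp (la / 16)"
  proof -
    have "(1 + la\<^sup>2 / 2) ^ m \<le> exp (la\<^sup>2 / 2) ^ m" by (intro power_mono exp_ge_add_one_self) auto
    also have "\<dots> = exp (real m * (la\<^sup>2 / 2))" by (rule exp_of_nat_mult[symmetric])
    also have "real m * (la\<^sup>2 / 2) = la / 16" using m0 by (simp add: la_def power2_eq_square)
    finally show ?thesis .
  qed
  have s5: "1 - la / ?D * ?q \<le> exp (- (la / 8))"
  proof -
    \<comment> \<open>Here the quality of \<open>ss\<close> as a root enters: s^2 < 4 q makes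
      \<open>D\<close> at least s^2 (1 + la / 4).\<close>
    have "1 - la / ?D * ?q = (ss ?q)\<^sup>2 / ?D" using D unfolding dd_def by (simp add: field_simps)
    also have "\<dots> \<le> 1 / (1 + la / 4)"
    proof -
      have "(ss ?q)\<^sup>2 * (1 + la / 4) \<le> ?D"
        unfolding dd_def using s(2) mult_left_mono[of "(ss ?q)\<^sup>2" "4 * ?q" la] l(1) by (simp add: algebra_simps)
      thus ?thesis using D l(1) by (simp add: field_simps)
    qed
    also have "\<dots> \<le> 1 / exp (la / 4 / 2)"
      using exp_half_le[of "la / 4"] l by (intro divide_left_mono) auto
    finally show ?thesis by (simp add: exp_minus inverse_eq_divide)
  qed
  have s6: "0 \<le> 1 - la / ?D * ?q" using D by (simp add: field_simps)
  have "?d (rsh P c) \<le> ?d (nsh P c) * exp (la / 32)"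
    by (rule order_trans[OF s1 mult_left_mono[OF s2]]) simp
  also have "\<dots> \<le> exp (la / 16) * (?d P * exp (- (la / 8))) * exp (la / 32)"
    unfolding s3 using s4 s5 s6 by (intro mult_right_mono mult_mono mult_left_mono) auto
  also have "\<dots> = ?d P * exp (la / 16 + - (la / 8) + la / 32)" by (simp only: exp_add mult_ac)
  also have "la / 16 + - (la / 8) + la / 32 = - 1 / (256 * real m)" by (simp add: la_def field_simps)
  finally show ?thesis .
qed

text \<open>A good best value is never lost. Until one occurs, every centre is worse than all points
  of the ball, so the cuts keep the whole ball while the determinant falls.\<close>

lemma traj_invariant:
  assumes "traj t = ((P, c), (B, bv))"
  shows "G - ep \<le> bv \<or> (\<forall>w. nrm2 m (\<lambda>j. w j - z j) \<le> rr\<^sup>2 \<longrightarrow> inE m P c w) \<and>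
    \<bar>Determinant.det (fmat m P)\<bar> \<le> 4 ^ m * exp (- real t / (256 * real m))"
  using assms
proof (induction t arbitrary: P c B bv)
  case 0
  \<comment> \<open>The initial ellipsoid is the ball of radius 2 about 0, and |z| and
    \<open>rr\<close> are at most 1.\<close>
  have "inE m P c w" if w: "nrm2 m (\<lambda>j. w j - z j) \<le> rr\<^sup>2" for w
    unfolding inE_def
  proof
    fix u
    have "nrm2 m w \<le> 2 * nrm2 m (\<lambda>j. w j - z j) + 2 * nrm2 m z"
      using nrm2_nonneg[of m "\<lambda>j. w j - 2 * z j"] by (simp add: ip_linear ip_commute[of m z w])
    also have "\<dots> \<le> 4" using w z_nrm power_le_one[of rr 2] rr_props by linarith
    finally have "(ip m u w)\<^sup>2 \<le> nrm2 m u * 4"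
      by (intro order_trans[OF ip_cauchy_schwarz] mult_left_mono) auto
    moreover have "qf m P u = 4 * nrm2 m u" using qf_diag[of "\<lambda>_ _. 0" 4 u] 0 by (simp add: qf_def[of m "\<lambda>_ _. 0"])
    moreover have "c = (\<lambda>_. 0)" using 0 by auto
    ultimately show "(ip m u (\<lambda>j. w j - c j))\<^sup>2 \<le> qf m P u" by simp
  qed
  moreover have "fmat m P = 4 \<cdot>\<^sub>m 1\<^sub>m m" using 0 by (intro eq_matI) (auto simp: fmat_def)
  hence "Determinant.det (fmat m P) = 4 ^ m" by simp
  ultimately show ?case by simp
next
  case (Suc t)
  obtain P0 c0 B0 bv0 where t: "traj t = ((P0, c0), (B0, bv0))" by (metis surj_pair)
  have mv: "move (P0, c0) = (P, c)" and be: "best c0 (B0, bv0) = (B, bv)"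
    using Suc.prems t by auto
  have ms: "msr t P0 c0" using msr_traj[OF m0 t] by blast
  show ?case
  proof (cases "G - ep \<le> bv")
    case False
    hence v: "val c0 < G - ep" "bv0 < G - ep" using be by (auto simp: best_def split: if_splits)
    with Suc.IH[OF t] have ball: "\<And>w. nrm2 m (\<lambda>j. w j - z j) \<le> rr\<^sup>2 \<Longrightarrow> inE m P0 c0 w"
      and dt: "\<bar>Determinant.det (fmat m P0)\<bar> \<le> 4 ^ m * exp (- real t / (256 * real m))" by auto
    have q: "ep\<^sup>2 < qq P0 c0" by (rule near_optimal[OF ball v(1)]) (simp add: ip_def)
    have P: "P = rsh P0 c0" and c: "c = (\<lambda>j. rnd J (ncen P0 c0 j))" using mv q by (simp_all add: move_def)
    have in_E: "inE m P c w" if w: "nrm2 m (\<lambda>j. w j - z j) \<le> rr\<^sup>2" for w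
      unfolding P c
    proof (rule move_contains[OF ms q ball[OF w]])
      show "0 \<le> ip m (grad c0) (\<lambda>j. w j - c0 j)"
        using value_gap[of c0 w] ball_value[OF w kk_less, of c0] v(1) nrm2_nonneg[of m "\<lambda>j. w j - c0 j"] by linarith
    qed
    have "\<bar>Determinant.det (fmat m P)\<bar> \<le> \<bar>Determinant.det (fmat m P0)\<bar> * exp (- 1 / (256 * real m))"
      unfolding P by (rule det_move[OF ms q ball_qf[OF ball]])
    also have "\<dots> \<le> 4 ^ m * exp (- real t / (256 * real m)) * exp (- 1 / (256 * real m))"
      using dt by (intro mult_right_mono) auto
    also have "\<dots> = 4 ^ m * exp (- real t / (256 * real m) + - 1 / (256 * real m))"
      by (simp only: exp_add mult.assoc)
    also have "- real t / (256 * real m) + - 1 / (256 * real m) = - real (Suc t) / (256 * real m)"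
      by (simp add: diff_divide_distrib)
    finally show ?thesis using in_E by blast
  qed simp
qed

lemma traj_close:
  assumes "traj T = ((P, c), (B, bv))"
  shows "nrm2 m (\<lambda>j. B j - z j) \<le> (1 / 2 ^ K)\<^sup>2"
proof -
  have "G - ep \<le> bv"
  proof (rule ccontr)
    assume "\<not> G - ep \<le> bv"
    with traj_invariant[OF assms] have ball: "\<And>w. nrm2 m (\<lambda>j. w j - z j) \<le> rr\<^sup>2 \<Longrightarrow> inE m P c w"
      and dt: "\<bar>Determinant.det (fmat m P)\<bar> \<le> 4 ^ m * exp (- real T / (256 * real m))" by auto
    have "1 \<le> \<bar>Determinant.det (fmat m P)\<bar> * (real m / rr\<^sup>2) ^ m"
      using rr_props by (intro det_lower_bound ball_qf[OF ball]) auto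
    also have "\<dots> \<le> 4 ^ m * exp (- real T / (256 * real m)) * (real m / rr\<^sup>2) ^ m"
      using dt by (intro mult_right_mono) auto
    also have "\<dots> = (4 * (real m / rr\<^sup>2)) ^ m * exp (- real T / (256 * real m))"
      by (simp only: power_mult_distrib mult_ac)
    \<comment> \<open>By the choice of \<open>T\<close>, each of the \<open>m\<close> factors 4 m /
      rr^2 meets an exponential of its own that beats it.\<close>
    also have "- real T / (256 * real m) = real m * - (real m + 4 * real K + 8)"
      using m0 by (simp add: T_def field_simps)
    also have "exp (real m * - (real m + 4 * real K + 8)) = exp (- (real m + 4 * real K + 8)) ^ m"
      by (rule exp_of_nat_mult)
    also have "(4 * (real m / rr\<^sup>2)) ^ m * exp (- (real m + 4 * real K + 8)) ^ m =
       (4 * (real m / rr\<^sup>2) * exp (- (real m + 4 * real K + 8))) ^ m" by (simp only: power_mult_distrib)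
    finally have "1 \<le> (4 * (real m / rr\<^sup>2) * exp (- (real m + 4 * real K + 8))) ^ m" .
    moreover have "4 * (real m / rr\<^sup>2) * exp (- (real m + 4 * real K + 8)) < 1"
    proof -
      have two: "(2::real) ^ k \<le> exp (real k)" for k
        using exp_ge_add_one_self[of "1::real"] power_mono[of "2::real" "exp 1" k] exp_of_nat_mult[of k "1::real"] by simp
      have "real m < exp (real m)" using exp_ge_add_one_self[of "real m"] by linarith
      moreover have "4 * (1 / rr\<^sup>2) = 2 ^ (4 * K + 8)"
        by (simp add: rr_def power_divide power_mult[symmetric] power_add mult_ac)
      moreover have "(2::real) ^ (4 * K + 8) \<le> exp (4 * real K + 8)" using two[of "4 * K + 8"] by simp
      ultimately have "(4 * (1 / rr\<^sup>2)) * real m < exp (4 * real K + 8) * exp (real m)"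
        by (intro mult_le_less_imp_less) auto
      also have "\<dots> = exp (real m + 4 * real K + 8)" by (simp add: exp_add[symmetric] add_ac)
      finally have lt: "4 * (1 / rr\<^sup>2) * real m < exp (real m + 4 * real K + 8)" .
      have "4 * (real m / rr\<^sup>2) * exp (- (real m + 4 * real K + 8)) = 4 * (1 / rr\<^sup>2) * real m / exp (real m + 4 * real K + 8)"
        unfolding exp_minus by (simp add: divide_inverse)
      also have "\<dots> < 1" using lt by (subst divide_less_eq_1_pos) simp_all
      finally show ?thesis .
    qed
    moreover have "0 \<le> 4 * (real m / rr\<^sup>2) * exp (- (real m + 4 * real K + 8))" by simp
    ultimately show False using m0 power_strict_mono[of "4 * (real m / rr\<^sup>2) * exp (- (real m + 4 * real K + 8))" 1 m] by simp
  qed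
  moreover have "bv = val B" using msr_traj[OF m0 assms] by blast
  ultimately have "nrm2 m (\<lambda>j. B j - z j) \<le> 2 * ep" using val_le[of B] by linarith
  also have "2 * ep = (1 / 2 ^ K)\<^sup>2" by (simp add: ep_def power_divide power_mult[symmetric] mult.commute)
  finally show ?thesis .
qed

end

section \<open>The training and prediction programs\<close>

text \<open>No time is claimed on irrational data, so costs are compared only when the flag is
  set.\<close>

lemma runs_weaken':
  assumes "runs fl b c s n Q" "\<And>s'. frame c s s' \<Longrightarrow> Q s' \<Longrightarrow> Q' s'" "fl \<Longrightarrow> n \<le> n'"
  shows "runs fl b c s n' Q'"
proof (cases fl)
  case True
  show ?thesis by (rule runs_weaken[OF assms(1)]) (use assms(2,3) True in auto)
next
  case False
  from assms(1) have "runs fl b c s n' Q" using False unfolding runs_def by blast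
  thus ?thesis by (rule runs_weaken) (use assms(2) in auto)
qed

lemma frame_refl [simp]: "frame c s s"
  by (simp add: frame_def)

lemma frame_counter: "frame c s s' \<Longrightarrow> v \<notin> cvars c \<Longrightarrow> counter s' v = counter s v"
  and frame_cell: "frame c s s' \<Longrightarrow> v \<notin> rvars c \<Longrightarrow> cell s' v = cell s v"
  by (simp_all add: frame_def)

abbreviation R0 :: "string \<Rightarrow> rexp" where "R0 v \<equiv> RCell v (NConst 0)"

definition Sum :: "string \<Rightarrow> string \<Rightarrow> string \<Rightarrow> rexp \<Rightarrow> com" where
  "Sum x i v e = Seq (RAssign x (NConst 0) (RConst 0))
     (For i v (RAssign x (NConst 0) (RPlus (R0 x) e)))"

lemma cvars_Sum [simp]: "cvars (Sum x i v e) = {i}"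
  and rvars_Sum [simp]: "rvars (Sum x i v e) = {x}"
  by (auto simp: Sum_def)

text \<open>The accumulator is stored after each addition, so all partial sums have to fit.\<close>

lemma runs_Sum:
  assumes N: "counter s v = N" and iv: "i \<noteq> v"
    and e: "\<And>k s'. k < N \<Longrightarrow> counter s' i = k \<Longrightarrow> (\<And>w. w \<noteq> i \<Longrightarrow> counter s' w = counter s w) \<Longrightarrow>
      (\<And>w. w \<noteq> x \<Longrightarrow> cell s' w = cell s w) \<Longrightarrow> rval s' e = f k"
    and fit: "\<And>k. fl \<Longrightarrow> k \<le> N \<Longrightarrow> fits b (\<Sum>j<k. f j)"
    and Q: "\<And>s'. cell s' x 0 = (\<Sum>j<N. f j) \<Longrightarrow> frame (Sum x i v e) s s' \<Longrightarrow> Q s'"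
  shows "runs fl b (Sum x i v e) s (N * (rwt e + 2 * rsz e + 30) + 20) Q"
proof -
  define I where "I k s' \<longleftrightarrow> cell s' x 0 = (\<Sum>j<k. f j)" for k and s' :: state
  have "runs fl b (For i v (RAssign x (NConst 0) (RPlus (R0 x) e))) (set_cell x 0 0 s)
    (N * ((1 + nwt (NConst 0) + rwt (RPlus (R0 x) e)) + 11) + 6)
    (\<lambda>s'. I N s' \<and> frame (Sum x i v e) s s')"
  proof (rule runs_For[where I = I])
    fix k s' assume k: "k < N" and I: "I k s'" and i: "counter s' i = k"
      and fr: "frame (For i v (RAssign x (NConst 0) (RPlus (R0 x) e))) (set_cell x 0 0 s) s'"
    have ev: "rval s' e = f k"
      by (rule e[OF k i]) (use fr in \<open>auto simp: frame_def\<close>)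
    show "runs fl b (RAssign x (NConst 0) (RPlus (R0 x) e)) s' (1 + nwt (NConst 0) + rwt (RPlus (R0 x) e)) (I (Suc k))"
      using I fit[of "Suc k"] k by (intro runs_RAssign) (auto simp: I_def ev)
  next
    fix s' assume "I N s'" "frame (For i v (RAssign x (NConst 0) (RPlus (R0 x) e))) (set_cell x 0 0 s) s'"
    thus "I N s' \<and> frame (Sum x i v e) s s'" by (auto simp: frame_def)
  qed (use N iv in \<open>auto simp: I_def\<close>)
  hence "runs fl b (For i v (RAssign x (NConst 0) (RPlus (R0 x) e))) (set_cell x 0 0 s)
    (N * ((1 + nwt (NConst 0) + rwt (RPlus (R0 x) e)) + 11) + 6) Q"
    by (rule runs_weaken) (auto simp: I_def intro: Q)
  hence "runs fl b (Sum x i v e) s ((1 + nwt (NConst 0) + rwt (RConst 0)) +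
    (N * ((1 + nwt (NConst 0) + rwt (RPlus (R0 x) e)) + 11) + 6)) Q"
    unfolding Sum_def by (intro runs_Seq runs_RAssign) auto
  thus ?thesis by (rule runs_time) (simp add: algebra_simps)
qed

definition Fill :: "string \<Rightarrow> string \<Rightarrow> string \<Rightarrow> nexp \<Rightarrow> rexp \<Rightarrow> com" where
  "Fill x i v ix e = For i v (RAssign x ix e)"

lemma cvars_Fill [simp]: "cvars (Fill x i v ix e) = {i}"
  and rvars_Fill [simp]: "rvars (Fill x i v ix e) = {x}"
  by (auto simp: Fill_def)

text \<open>The offset \<open>o0\<close> permits filling one row of a matrix while the other cells
  keep their values.\<close>

lemma runs_Fill:
  assumes N: "counter s v = N" and iv: "i \<noteq> v"
    and e: "\<And>k s'. k < N \<Longrightarrow> counter s' i = k \<Longrightarrow> (\<And>w. w \<noteq> i \<Longrightarrow> counter s' w = counter s w) \<Longrightarrow>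
      (\<And>w. w \<noteq> x \<Longrightarrow> cell s' w = cell s w) \<Longrightarrow> rval s' e = f k \<and> nval s' ix = o0 + k"
    and fit: "\<And>k. fl \<Longrightarrow> k < N \<Longrightarrow> fits b (f k)"
    and Q: "\<And>s'. (\<And>k. k < N \<Longrightarrow> cell s' x (o0 + k) = f k) \<Longrightarrow>
      (\<And>l. l < o0 \<or> o0 + N \<le> l \<Longrightarrow> cell s' x l = cell s x l) \<Longrightarrow> frame (Fill x i v ix e) s s' \<Longrightarrow> Q s'"
  shows "runs fl b (Fill x i v ix e) s (N * (nwt ix + rwt e + 12) + 6) Q"
proof -
  define I where "I k s' \<longleftrightarrow> (\<forall>j<k. cell s' x (o0 + j) = f j) \<and> (\<forall>l. l < o0 \<or> o0 + N \<le> l \<longrightarrow> cell s' x l = cell s x l)" for k and s' :: state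
  have "runs fl b (For i v (RAssign x ix e)) s (N * ((1 + nwt ix + rwt e) + 11) + 6) Q"
  proof (rule runs_For[where I = I])
    fix k s' assume k: "k < N" and I: "I k s'" and i: "counter s' i = k"
      and fr: "frame (For i v (RAssign x ix e)) s s'"
    have ev: "rval s' e = f k" "nval s' ix = o0 + k"
      using e[OF k i] fr by (auto simp: frame_def)
    show "runs fl b (RAssign x ix e) s' (1 + nwt ix + rwt e) (I (Suc k))"
      using I fit[of k] k by (intro runs_RAssign) (auto simp: I_def ev less_Suc_eq)
  next
    fix s' assume I: "I N s'" and fr: "frame (For i v (RAssign x ix e)) s s'"
    show "Q s'"
    proof (rule Q)
      show "cell s' x (o0 + k) = f k" if "k < N" for k using I that by (simp add: I_def)
      show "cell s' x l = cell s x l" if "l < o0 \<or> o0 + N \<le> l" for l using I that unfolding I_def by blast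
      show "frame (Fill x i v ix e) s s'" using fr by (simp add: Fill_def)
    qed
  next
    show "I k (set_counter i y s')" if "I k s'" for k s' y
      using that unfolding I_def cell_set_counter .
    show "I 0 s" unfolding I_def by simp
    show "counter s v = N" by (rule N)
    show "i \<noteq> v" by (rule iv)
    show "i \<notin> cvars (RAssign x ix e)" "v \<notin> cvars (RAssign x ix e)" by simp_all
  qed
  thus ?thesis unfolding Fill_def by (rule runs_time) (simp add: add_mult_distrib2)
qed

text \<open>Rounds the cell \<open>r\<close> down to a multiple of \<open>2 ^ M / 2 ^ R\<close> by binary search, where
  \<open>H = 2 ^ M\<close> exceeds its absolute value.\<close>

definition Round :: com where
  "Round = Seq (If (RLess (R0 ''r'') (RConst 0)) (RAssign ''y'' (NConst 0) (RMinus (RConst 0) (R0 ''H'')))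
       (RAssign ''y'' (NConst 0) (RConst 0)))
     (Seq (RAssign ''h'' (NConst 0) (RDivide (R0 ''H'') (RConst 2)))
       (For ''l'' ''R'' (Seq
         (If (RLess (R0 ''r'') (RPlus (R0 ''y'') (R0 ''h''))) Skip
           (RAssign ''y'' (NConst 0) (RPlus (R0 ''y'') (R0 ''h''))))
         (RAssign ''h'' (NConst 0) (RDivide (R0 ''h'') (RConst 2))))))"

lemma cvars_Round [simp]: "cvars Round = {''l''}"
  and rvars_Round [simp]: "rvars Round = {''y'', ''h''}"
  by (auto simp: Round_def)

lemma nat_bits_eqI:
  assumes "2 ^ k \<le> m" "m < 2 ^ (k + 1)"
  shows "nat_bits m = k + 2"
proof -
  have "floorlog 2 m = k + 1"
    using floorlog_leI[OF assms(2)] floorlog_ge_SucI[OF assms(1)] by (intro antisym) simp_all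
  thus ?thesis unfolding nat_bits_def by simp
qed

lemma nat_bits_num: "nat_bits 2 = 3" "nat_bits 4 = 4" "nat_bits 5 = 4" "nat_bits 6 = 4"
  "nat_bits 8 = 5" "nat_bits 16 = 6" "nat_bits 20 = 6" "nat_bits 256 = 10"
proof -
  have "nat_bits 2 = 1 + 2" "nat_bits 4 = 2 + 2" "nat_bits 5 = 2 + 2" "nat_bits 6 = 2 + 2"
    "nat_bits 8 = 3 + 2" "nat_bits 16 = 4 + 2" "nat_bits 20 = 4 + 2" "nat_bits 256 = 8 + 2"
    by (rule nat_bits_eqI; simp)+
  thus "nat_bits 2 = 3" "nat_bits 4 = 4" "nat_bits 5 = 4" "nat_bits 6 = 4"
    "nat_bits 8 = 5" "nat_bits 16 = 6" "nat_bits 20 = 6" "nat_bits 256 = 10"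
    by simp_all
qed

text \<open>The next binary digit, decided by one comparison; this is one round of
  \<open>Round\<close>.\<close>

lemma floor_double:
  fixes x :: real
  shows "\<lfloor>2 * x\<rfloor> = (if 2 * x < 2 * of_int \<lfloor>x\<rfloor> + 1 then 2 * \<lfloor>x\<rfloor> else 2 * \<lfloor>x\<rfloor> + 1)"
proof -
  have "of_int \<lfloor>x\<rfloor> \<le> x" "x < of_int \<lfloor>x\<rfloor> + 1" by linarith+
  hence "\<lfloor>2 * x\<rfloor> = 2 * \<lfloor>x\<rfloor>" if "2 * x < 2 * of_int \<lfloor>x\<rfloor> + 1"
    using that by (intro floor_unique) simp_all
  moreover have "\<lfloor>2 * x\<rfloor> = 2 * \<lfloor>x\<rfloor> + 1" if "\<not> 2 * x < 2 * of_int \<lfloor>x\<rfloor> + 1"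
  proof (rule floor_unique)
    show "of_int (2 * \<lfloor>x\<rfloor> + 1) \<le> 2 * x" using that by simp
    have "x < of_int \<lfloor>x\<rfloor> + 1" by linarith
    thus "2 * x < of_int (2 * \<lfloor>x\<rfloor> + 1) + 1"
      by (simp only: of_int_add of_int_mult of_int_numeral of_int_1)
  qed
  ultimately show ?thesis by simp
qed

text \<open>After \<open>k\<close> halvings, \<open>y\<close> is \<open>x\<close> rounded down to a
  multiple of \<open>2 ^ M / 2 ^ k\<close>, and \<open>M + J\<close> halvings reach the mesh
  \<open>1 / 2 ^ J\<close>. Negative numbers start from \<open>- (2 ^ M)\<close>, so that they are
  rounded down as well, in agreement with \<open>rnd\<close>.\<close>

lemma runs_Round:
  assumes x: "cell s ''r'' 0 = x" "\<bar>x\<bar> < 2 ^ M" and H: "cell s ''H'' 0 = 2 ^ M"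
    and R: "counter s ''R'' = M + J" and b: "fl \<Longrightarrow> 2 * M + J + 2 \<le> b"
    and Q: "\<And>s'. cell s' ''y'' 0 = of_int \<lfloor>x * 2 ^ J\<rfloor> / 2 ^ J \<Longrightarrow> frame Round s s' \<Longrightarrow> Q s'"
  shows "runs fl b Round s ((M + J) * 200 + 200) Q"
proof -
  define F :: "nat \<Rightarrow> real" where "F k = of_int \<lfloor>x * 2 ^ k / 2 ^ M\<rfloor> * 2 ^ M / 2 ^ k" for k
  define I where "I k s' \<longleftrightarrow> cell s' ''y'' 0 = F k \<and> cell s' ''h'' 0 = 2 ^ M / 2 ^ (k + 1)" for k and s' :: state
  have F0: "F 0 = (if x < 0 then - (2 ^ M) else 0)"
  proof -
    have "\<lfloor>x / 2 ^ M\<rfloor> = (if x < 0 then -1 else 0)"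
      using x(2) by (auto simp: floor_eq_iff field_simps abs_if split: if_splits)
    thus ?thesis by (simp add: F_def)
  qed
  have FS: "F (Suc k) = (if x < F k + 2 ^ M / 2 ^ (k + 1) then F k else F k + 2 ^ M / 2 ^ (k + 1))" for k
  proof -
    define v where "v = x * 2 ^ k / 2 ^ M"
    have v: "x * 2 ^ Suc k / 2 ^ M = 2 * v" "x = v * 2 ^ M / 2 ^ k" by (simp_all add: v_def)
    have "x < F k + 2 ^ M / 2 ^ (k + 1) \<longleftrightarrow> v * 2 ^ M / 2 ^ k < (of_int \<lfloor>v\<rfloor> + 1 / 2) * 2 ^ M / 2 ^ k"
      unfolding F_def v_def[symmetric] v(2)[symmetric] by (simp add: field_simps)
    also have "\<dots> \<longleftrightarrow> v < of_int \<lfloor>v\<rfloor> + 1 / 2" by (simp add: divide_less_cancel)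
    also have "\<dots> \<longleftrightarrow> 2 * v < 2 * of_int \<lfloor>v\<rfloor> + 1" by linarith
    finally show ?thesis unfolding F_def v(1) floor_double
      by (auto simp: v_def[symmetric] field_simps)
  qed
  have fitF: "fits b (F k)" if "k \<le> M + J" fl for k
  proof -
    have p: "0 < (2::real) ^ k" by simp
    have "\<bar>x * 2 ^ k / 2 ^ M\<bar> \<le> 1 * 2 ^ k"
      using x(2) by (simp add: abs_mult divide_le_eq)
    hence "\<bar>\<lfloor>x * 2 ^ k / 2 ^ M\<rfloor>\<bar> \<le> 2 ^ k"
    proof -
      assume a: "\<bar>x * 2 ^ k / 2 ^ M\<bar> \<le> 1 * 2 ^ k"
      hence "x * 2 ^ k / 2 ^ M \<le> of_int (2 ^ k)" "of_int (- (2 ^ k)) \<le> x * 2 ^ k / 2 ^ M"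
        unfolding abs_le_iff by simp_all
      hence "\<lfloor>x * 2 ^ k / 2 ^ M\<rfloor> \<le> 2 ^ k" "- (2 ^ k) \<le> \<lfloor>x * 2 ^ k / 2 ^ M\<rfloor>"
        using floor_mono[of "x * 2 ^ k / 2 ^ M" "of_int (2 ^ k)"] unfolding le_floor_iff by simp_all
      thus ?thesis by linarith
    qed
    hence "\<bar>\<lfloor>x * 2 ^ k / 2 ^ M\<rfloor> * 2 ^ M\<bar> \<le> 2 ^ k * 2 ^ M" by (simp add: abs_mult)
    also have "\<dots> < (2::int) ^ (2 * M + J + 2)"
      using that unfolding power_add[symmetric] by (intro power_strict_increasing) auto
    finally have p: "\<bar>\<lfloor>x * 2 ^ k / 2 ^ M\<rfloor> * 2 ^ M\<bar> < 2 ^ (2 * M + J + 2)" .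
    have "(2::int) ^ k \<le> 2 ^ (2 * M + J + 2)" by (rule power_increasing) (use that in auto)
    with p have "fits (2 * M + J + 2) (F k)" unfolding F_def
      by (intro fitsI[where p = "\<lfloor>x * 2 ^ k / 2 ^ M\<rfloor> * 2 ^ M" and q = "2 ^ k"]) simp_all
    thus ?thesis using b that by (auto intro: fits_mono)
  qed
  have fith: "fits b (2 ^ M / 2 ^ k)" if "k \<le> M + J + 1" fl for k
  proof -
    have "(2::int) ^ k \<le> 2 ^ (2 * M + J + 2)" by (rule power_increasing) (use that in auto)
    moreover have "(2::int) ^ M < 2 ^ (2 * M + J + 2)" by (rule power_strict_increasing) auto
    ultimately have "fits (2 * M + J + 2) (2 ^ M / 2 ^ k)"
      by (intro fitsI[where p = "2 ^ M" and q = "2 ^ k"]) simp_all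
    thus ?thesis using b that by (auto intro: fits_mono)
  qed
  let ?body = "Seq (If (RLess (R0 ''r'') (RPlus (R0 ''y'') (R0 ''h''))) Skip
           (RAssign ''y'' (NConst 0) (RPlus (R0 ''y'') (R0 ''h''))))
         (RAssign ''h'' (NConst 0) (RDivide (R0 ''h'') (RConst 2)))"
  have loop: "runs fl b (For ''l'' ''R'' ?body) s1 ((M + J) * (180 + 11) + 6) Q"
    if s1: "counter s1 = counter s" "\<forall>v. v \<noteq> ''y'' \<and> v \<noteq> ''h'' \<longrightarrow> cell s1 v = cell s v" "I 0 s1" for s1
  proof (rule runs_For[where I = I])
    fix k s' assume k: "k < M + J" and I: "I k s'" and fr: "frame (For ''l'' ''R'' ?body) s1 s'"
    have r: "cell s' ''r'' 0 = x" using fr s1(2) x by (simp add: frame_def)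
    have 1: "runs fl b (RAssign ''h'' (NConst 0) (RDivide (R0 ''h'') (RConst 2))) s''
      (1 + nwt (NConst 0) + rwt (RDivide (R0 ''h'') (RConst 2))) (I (Suc k))"
      if "cell s'' ''y'' 0 = F (Suc k)" "cell s'' ''h'' 0 = 2 ^ M / 2 ^ (k + 1)" for s''
      using that k fith[of "k + 2"] by (intro runs_RAssign) (auto simp: I_def)
    have "runs fl b ?body s' (1 + bwt (RLess (R0 ''r'') (RPlus (R0 ''y'') (R0 ''h''))) +
        (1 + nwt (NConst 0) + rwt (RPlus (R0 ''y'') (R0 ''h''))) + (1 + nwt (NConst 0) + rwt (RDivide (R0 ''h'') (RConst 2)))) (I (Suc k))"
    proof (rule runs_Seq, rule runs_If)
      assume "bval s' (RLess (R0 ''r'') (RPlus (R0 ''y'') (R0 ''h'')))"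
      hence "F (Suc k) = F k" using I r FS[of k] by (auto simp: I_def)
      thus "runs fl b Skip s' (1 + nwt (NConst 0) + rwt (RPlus (R0 ''y'') (R0 ''h'')))
        (\<lambda>s'. runs fl b (RAssign ''h'' (NConst 0) (RDivide (R0 ''h'') (RConst 2))) s'
          (1 + nwt (NConst 0) + rwt (RDivide (R0 ''h'') (RConst 2))) (I (Suc k)))"
        using I by (intro runs_time[OF runs_Skip] 1) (auto simp: I_def)
    next
      assume "\<not> bval s' (RLess (R0 ''r'') (RPlus (R0 ''y'') (R0 ''h'')))"
      hence F: "F (Suc k) = F k + 2 ^ M / 2 ^ (k + 1)" using I r FS[of k] by (auto simp: I_def)
      show "runs fl b (RAssign ''y'' (NConst 0) (RPlus (R0 ''y'') (R0 ''h''))) s'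
         (1 + nwt (NConst 0) + rwt (RPlus (R0 ''y'') (R0 ''h'')))
        (\<lambda>s'. runs fl b (RAssign ''h'' (NConst 0) (RDivide (R0 ''h'') (RConst 2))) s'
          (1 + nwt (NConst 0) + rwt (RDivide (R0 ''h'') (RConst 2))) (I (Suc k)))"
        using I F fitF[of "Suc k"] k by (intro runs_RAssign 1) (auto simp: I_def)
    qed
    thus "runs fl b ?body s' 180 (I (Suc k))"
      by (rule runs_time) (simp add: nat_bits_num)
  next
    fix s' assume I: "I (M + J) s'" and fr: "frame (For ''l'' ''R'' ?body) s1 s'"
    show "Q s'"
    proof (rule Q)
      have "F (M + J) = of_int \<lfloor>x * 2 ^ J\<rfloor> / 2 ^ J" by (simp add: F_def power_add)
      thus "cell s' ''y'' 0 = of_int \<lfloor>x * 2 ^ J\<rfloor> / 2 ^ J" using I by (simp add: I_def)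
      show "frame Round s s'" using fr s1 by (auto simp: frame_def)
    qed
  qed (use s1 R in \<open>auto simp: I_def\<close>)
  have mid: "runs fl b (Seq (RAssign ''h'' (NConst 0) (RDivide (R0 ''H'') (RConst 2))) (For ''l'' ''R'' ?body)) s1
      (1 + nwt (NConst 0) + rwt (RDivide (R0 ''H'') (RConst 2)) + ((M + J) * (180 + 11) + 6)) Q"
    if s1: "counter s1 = counter s" "\<forall>v. v \<noteq> ''y'' \<longrightarrow> cell s1 v = cell s v" "cell s1 ''y'' 0 = F 0" for s1
    using s1 H fith[of 1] by (intro runs_Seq runs_RAssign loop) (auto simp: I_def)
  have "runs fl b Round s (1 + bwt (RLess (R0 ''r'') (RConst 0)) + 60 +
     (1 + nwt (NConst 0) + rwt (RDivide (R0 ''H'') (RConst 2)) + ((M + J) * (180 + 11) + 6))) Q"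
    unfolding Round_def
  proof (rule runs_Seq, rule runs_If)
    assume "bval s (RLess (R0 ''r'') (RConst 0))"
    hence F: "F 0 = - (2 ^ M)" using F0 x by simp
    have "runs fl b (RAssign ''y'' (NConst 0) (RMinus (RConst 0) (R0 ''H''))) s
      (1 + nwt (NConst 0) + rwt (RMinus (RConst 0) (R0 ''H'')))
      (\<lambda>s1. runs fl b (Seq (RAssign ''h'' (NConst 0) (RDivide (R0 ''H'') (RConst 2))) (For ''l'' ''R'' ?body)) s1
      (1 + nwt (NConst 0) + rwt (RDivide (R0 ''H'') (RConst 2)) + ((M + J) * (180 + 11) + 6)) Q)"
      using H F fitF[of 0] by (intro runs_RAssign mid) auto
    thus "runs fl b (RAssign ''y'' (NConst 0) (RMinus (RConst 0) (R0 ''H''))) s 60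
      (\<lambda>s1. runs fl b (Seq (RAssign ''h'' (NConst 0) (RDivide (R0 ''H'') (RConst 2))) (For ''l'' ''R'' ?body)) s1
      (1 + nwt (NConst 0) + rwt (RDivide (R0 ''H'') (RConst 2)) + ((M + J) * (180 + 11) + 6)) Q)"
      by (rule runs_time) simp
  next
    assume "\<not> bval s (RLess (R0 ''r'') (RConst 0))"
    hence F: "F 0 = 0" using F0 x by simp
    have "runs fl b (RAssign ''y'' (NConst 0) (RConst 0)) s
      (1 + nwt (NConst 0) + rwt (RConst 0))
      (\<lambda>s1. runs fl b (Seq (RAssign ''h'' (NConst 0) (RDivide (R0 ''H'') (RConst 2))) (For ''l'' ''R'' ?body)) s1
      (1 + nwt (NConst 0) + rwt (RDivide (R0 ''H'') (RConst 2)) + ((M + J) * (180 + 11) + 6)) Q)"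
      using H F by (intro runs_RAssign mid) auto
    thus "runs fl b (RAssign ''y'' (NConst 0) (RConst 0)) s 60
      (\<lambda>s1. runs fl b (Seq (RAssign ''h'' (NConst 0) (RDivide (R0 ''H'') (RConst 2))) (For ''l'' ''R'' ?body)) s1
      (1 + nwt (NConst 0) + rwt (RDivide (R0 ''H'') (RConst 2)) + ((M + J) * (180 + 11) + 6)) Q)"
      by (rule runs_time) simp
  qed
  thus ?thesis by (rule runs_time) (simp add: nat_bits_num)
qed

section \<open>One round of the ellipsoid method as a program\<close>

abbreviation ixm :: "string \<Rightarrow> string \<Rightarrow> nexp" where
  "ixm i j \<equiv> NPlus (NTimes (NVar i) (NVar ''m'')) (NVar j)"
abbreviation Rc :: "string \<Rightarrow> string \<Rightarrow> rexp" where "Rc x i \<equiv> RCell x (NVar i)"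

definition Dot :: "string \<Rightarrow> string \<Rightarrow> com" where
  "Dot x i = Sum x ''j'' ''m'' (RTimes (RCell ''A'' (ixm i ''j'')) (Rc ''c'' ''j''))"

definition Argmin :: com where
  "Argmin = Seq (NAssign ''k'' (NConst 0)) (Seq (Dot ''w'' ''k'')
     (For ''i'' ''n'' (Seq (Dot ''t'' ''i'')
       (If (RLess (R0 ''t'') (R0 ''w'')) (Seq (NAssign ''k'' (NVar ''i'')) (RAssign ''w'' (NConst 0) (R0 ''t''))) Skip))))"

definition Value :: com where
  "Value = Seq (Sum ''v'' ''j'' ''m'' (RTimes (Rc ''c'' ''j'') (Rc ''c'' ''j'')))
     (RAssign ''v'' (NConst 0) (RMinus (R0 ''w'') (RDivide (R0 ''v'') (RConst 2))))"

definition Best :: com where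
  "Best = If (RLess (R0 ''b'') (R0 ''v''))
     (Seq (RAssign ''b'' (NConst 0) (R0 ''v'')) (Fill ''B'' ''j'' ''m'' (NVar ''j'') (Rc ''c'' ''j''))) Skip"

definition Grad :: com where
  "Grad = Fill ''g'' ''j'' ''m'' (NVar ''j'') (RMinus (RCell ''A'' (ixm ''k'' ''j'')) (Rc ''c'' ''j''))"

definition MulP :: com where
  "MulP = For ''i'' ''m'' (Seq (Sum ''t'' ''j'' ''m'' (RTimes (RCell ''P'' (ixm ''i'' ''j'')) (Rc ''g'' ''j'')))
     (RAssign ''p'' (NVar ''i'') (R0 ''t'')))"

definition Quad :: com where
  "Quad = Sum ''q'' ''j'' ''m'' (RTimes (Rc ''g'' ''j'') (Rc ''p'' ''j''))"

definition Scale :: com where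
  "Scale = Seq (RAssign ''s'' (NConst 0) (R0 ''e''))
     (Seq (While (RLess (RTimes (R0 ''s'') (R0 ''s'')) (R0 ''q'')) (RAssign ''s'' (NConst 0) (RTimes (R0 ''s'') (RConst 2))))
       (RAssign ''D'' (NConst 0) (RPlus (RTimes (R0 ''s'') (R0 ''s'')) (RTimes (R0 ''a'') (R0 ''q'')))))"

definition Center :: com where
  "Center = For ''i'' ''m'' (Seq
     (RAssign ''r'' (NConst 0) (RPlus (Rc ''c'' ''i'')
        (RDivide (RTimes (RTimes (R0 ''a'') (R0 ''s'')) (Rc ''p'' ''i'')) (RTimes (RConst 2) (R0 ''D'')))))
     (Seq Round (RAssign ''c'' (NVar ''i'') (R0 ''y''))))"

text \<open>Equality of indices is expressed by two negated strict comparisons. Updating in place is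
  safe: apart from data that stay fixed meanwhile, an entry depends only on its own old
  value.\<close>

definition Shape :: com where
  "Shape = For ''i'' ''m'' (For ''j'' ''m'' (Seq
     (RAssign ''r'' (NConst 0) (RTimes
        (RPlus (RConst 1) (RDivide (RTimes (R0 ''a'') (R0 ''a'')) (RConst 2)))
        (RMinus (RCell ''P'' (ixm ''i'' ''j''))
          (RTimes (RTimes (RDivide (R0 ''a'') (R0 ''D'')) (Rc ''p'' ''i'')) (Rc ''p'' ''j'')))))
     (Seq Round
       (If (BAnd (BNot (NLess (NVar ''i'') (NVar ''j''))) (BNot (NLess (NVar ''j'') (NVar ''i''))))
         (RAssign ''P'' (ixm ''i'' ''j'') (RPlus (R0 ''y'') (R0 ''z'')))
         (RAssign ''P'' (ixm ''i'' ''j'') (R0 ''y''))))))"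

definition Move :: com where
  "Move = If (RLess (RTimes (R0 ''e'') (R0 ''e'')) (R0 ''q'')) (Seq Scale (Seq Center Shape)) Skip"

definition Step :: com where
  "Step = Seq Argmin (Seq Value (Seq Best (Seq Grad (Seq MulP (Seq Quad Move)))))"

lemma vars_Dot [simp]: "cvars (Dot x i) = {''j''}" "rvars (Dot x i) = {x}"
  by (simp_all add: Dot_def)
lemma vars_Argmin [simp]: "cvars Argmin = {''i'', ''j'', ''k''}" "rvars Argmin = {''t'', ''w''}"
  by (auto simp: Argmin_def)
lemma vars_Value [simp]: "cvars Value = {''j''}" "rvars Value = {''v''}"
  by (auto simp: Value_def)
lemma vars_Best [simp]: "cvars Best = {''j''}" "rvars Best = {''b'', ''B''}"
  by (auto simp: Best_def)
lemma vars_Grad [simp]: "cvars Grad = {''j''}" "rvars Grad = {''g''}"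
  by (auto simp: Grad_def)
lemma vars_MulP [simp]: "cvars MulP = {''i'', ''j''}" "rvars MulP = {''t'', ''p''}"
  by (auto simp: MulP_def)
lemma vars_Quad [simp]: "cvars Quad = {''j''}" "rvars Quad = {''q''}"
  by (auto simp: Quad_def)
lemma vars_Scale [simp]: "cvars Scale = {}" "rvars Scale = {''s'', ''D''}"
  by (auto simp: Scale_def)
lemma vars_Center [simp]: "cvars Center = {''i'', ''l''}" "rvars Center = {''r'', ''y'', ''h'', ''c''}"
  by (auto simp: Center_def)
lemma vars_Shape [simp]: "cvars Shape = {''i'', ''j'', ''l''}" "rvars Shape = {''r'', ''y'', ''h'', ''P''}"
  by (auto simp: Shape_def)
lemma vars_Move [simp]: "cvars Move = {''i'', ''j'', ''l''}"
  "rvars Move = {''s'', ''D'', ''r'', ''y'', ''h'', ''c'', ''P''}"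
  by (auto simp: Move_def)
lemma vars_Step [simp]: "cvars Step = {''i'', ''j'', ''k'', ''l''}"
  "rvars Step = {''t'', ''w'', ''v'', ''b'', ''B'', ''g'', ''p'', ''q'', ''s'', ''D'', ''r'', ''y'', ''h'', ''c'', ''P''}"
  by (auto simp: Step_def)

section \<open>Correctness and cost of one round\<close>

lemma fits_sum_le: "(\<And>j. j < N \<Longrightarrow> fits r (f j)) \<Longrightarrow> k \<le> N \<Longrightarrow> N * (r + 1) \<le> b \<Longrightarrow> fits b (\<Sum>j<k. f j)"
proof -
  assume a: "\<And>j. j < N \<Longrightarrow> fits r (f j)" "k \<le> N" "N * (r + 1) \<le> b"
  have "fits (k * (r + 1)) (\<Sum>j<k. f j)" using a by (intro fits_sum) auto
  moreover have "k * (r + 1) \<le> b" using a mult_le_mono1[of k N "r + 1"] by linarith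
  ultimately show ?thesis by (rule fits_mono)
qed

text \<open>\<open>N0\<close> bounds the bit length of examples, centres and matrix entries. The
  factor m^2 in the bound for \<open>b\<close> comes from nested sums of m terms: first P g, then g
  . P g.\<close>

locale ellipsoid_run = ellipsoid +
  fixes fl :: bool and b N0 :: nat
  assumes m0: "0 < m" and n0: "0 < n"
    and N0: "fl \<Longrightarrow> T + J + 10 \<le> N0" and b: "fl \<Longrightarrow> 100 * (m * (m * N0)) \<le> b"
    and a_fits: "\<And>i j. fl \<Longrightarrow> i < n \<Longrightarrow> j < m \<Longrightarrow> fits N0 (a i j)"
begin

text \<open>Large enough for \<open>2 ^ M\<close> to exceed every number handed to
  \<open>Round\<close>, by \<open>msr_bounds\<close> and \<open>best_bounds\<close>.\<close>

definition "M = T + 6"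

definition base :: "state \<Rightarrow> bool" where
  "base s \<longleftrightarrow> counter s ''m'' = m \<and> counter s ''n'' = n \<and> counter s ''R'' = M + J \<and>
    (\<forall>i<n. \<forall>j<m. cell s ''A'' (i * m + j) = a i j) \<and>
    cell s ''H'' 0 = 2 ^ M \<and> cell s ''e'' 0 = ep \<and> cell s ''z'' 0 = 2 * real m / 2 ^ J \<and> cell s ''a'' 0 = la"

definition vec :: "string \<Rightarrow> state \<Rightarrow> (nat \<Rightarrow> real) \<Rightarrow> bool" where
  "vec x s v \<longleftrightarrow> (\<forall>j<m. cell s x j = v j)"

definition matP :: "state \<Rightarrow> (nat \<Rightarrow> nat \<Rightarrow> real) \<Rightarrow> bool" where
  "matP s P \<longleftrightarrow> (\<forall>i<m. \<forall>j<m. cell s ''P'' (i * m + j) = P i j)"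

lemma base_frame:
  "base s \<Longrightarrow> frame c s s' \<Longrightarrow> cvars c \<inter> {''m'', ''n'', ''R''} = {} \<Longrightarrow>
    rvars c \<inter> {''A'', ''H'', ''e'', ''z'', ''a''} = {} \<Longrightarrow> base s'"
  unfolding base_def frame_def by (auto simp: disjoint_iff)

lemma vec_frame: "vec x s v \<Longrightarrow> frame c s s' \<Longrightarrow> x \<notin> rvars c \<Longrightarrow> vec x s' v"
  and matP_frame: "matP s P \<Longrightarrow> frame c s s' \<Longrightarrow> ''P'' \<notin> rvars c \<Longrightarrow> matP s' P"
  by (simp_all add: vec_def matP_def frame_def)

lemma m_le: "fl \<Longrightarrow> m \<le> N0" "fl \<Longrightarrow> N0 \<le> m * N0" "fl \<Longrightarrow> m * N0 \<le> m * (m * N0)"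
  "fl \<Longrightarrow> 4 * K + m + 30 \<le> N0"
  using N0 m0 by (auto simp: J_def)

abbreviation "X \<equiv> m * (m * N0)"

lemma fitsX: "fits k x \<Longrightarrow> fl \<Longrightarrow> k \<le> 100 * X \<Longrightarrow> fits b x"
  using b by (auto intro: fits_mono)

lemma fits_vec_prod:
  assumes fl "\<And>j. j < m \<Longrightarrow> fits r (u j)" "\<And>j. j < m \<Longrightarrow> fits r' (v j)" "k \<le> m" "m * (r + r' + 1) \<le> N"
  shows "fits N (\<Sum>j<k. u j * v j)"
  by (rule fits_sum_le[where N = m and r = "r + r'"]) (use assms in \<open>auto intro: fits_mult\<close>)

lemma runs_Dot:
  assumes "base s" "vec ''c'' s c" "\<And>j. fl \<Longrightarrow> j < m \<Longrightarrow> fits N0 (c j)"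
    and i: "counter s i = i0" "i0 < n" "i \<noteq> ''j''" and x: "x \<noteq> ''A''" "x \<noteq> ''c''"
    and Q: "\<And>s'. cell s' x 0 = ip m (a i0) c \<Longrightarrow> frame (Dot x i) s s' \<Longrightarrow> Q s'"
  shows "runs fl b (Dot x i) s (m * 70 + 20) Q"
proof -
  have "runs fl b (Dot x i) s (m * (rwt (RTimes (RCell ''A'' (ixm i ''j'')) (Rc ''c'' ''j'')) +
      2 * rsz (RTimes (RCell ''A'' (ixm i ''j'')) (Rc ''c'' ''j'')) + 30) + 20) Q"
    unfolding Dot_def
  proof (rule runs_Sum[where f = "\<lambda>j. a i0 j * c j"])
    fix k and s' :: state assume k: "k < m" "counter s' ''j'' = k" "\<And>w. w \<noteq> ''j'' \<Longrightarrow> counter s' w = counter s w"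
      "\<And>w. w \<noteq> x \<Longrightarrow> cell s' w = cell s w"
    thus "rval s' (RTimes (RCell ''A'' (ixm i ''j'')) (Rc ''c'' ''j'')) = a i0 k * c k"
      using assms by (simp add: base_def vec_def)
  next
    fix k assume k: fl "k \<le> m"
    have "fits (3 * (m * N0)) (\<Sum>j<k. a i0 j * c j)"
      by (rule fits_vec_prod[OF k(1) a_fits assms(3) k(2)]) (use k i m_le[OF k(1)] in \<open>auto simp: algebra_simps\<close>)
    thus "fits b (\<Sum>j<k. a i0 j * c j)" by (rule fitsX) (use k m_le[OF k(1)] in auto)
  next
    fix s' assume "cell s' x 0 = (\<Sum>j<m. a i0 j * c j)" "frame (Sum x ''j'' ''m'' (RTimes (RCell ''A'' (ixm i ''j'')) (Rc ''c'' ''j''))) s s'"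
    thus "Q s'" by (intro Q) (simp_all add: ip_def Dot_def)
  qed (use assms in \<open>auto simp: base_def\<close>)
  thus ?thesis by (rule runs_time) simp
qed

lemma ip_fits: "fl \<Longrightarrow> (\<And>j. j < m \<Longrightarrow> fits N0 (c j)) \<Longrightarrow> i < n \<Longrightarrow> fits (3 * (m * N0)) (ip m (a i) c)"
  unfolding ip_def
  by (rule fits_vec_prod[OF _ a_fits]) (use m_le in \<open>auto simp: algebra_simps\<close>)

lemma runs_Argmin:
  assumes s: "base s" "vec ''c'' s c" and c: "\<And>j. fl \<Longrightarrow> j < m \<Longrightarrow> fits N0 (c j)"
    and Q: "\<And>s'. counter s' ''k'' = kk c \<Longrightarrow> cell s' ''w'' 0 = ip m (a (kk c)) c \<Longrightarrow> frame Argmin s s' \<Longrightarrow> Q s'"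
  shows "runs fl b Argmin s (n * (m * 70 + 100) + m * 70 + 50) Q"
proof (rule runs_fits)
  assume sf: "fl \<Longrightarrow> state_fits b s"
  let ?f = "\<lambda>i. ip m (a i) c"
  let ?body = "Seq (Dot ''t'' ''i'')
       (If (RLess (R0 ''t'') (R0 ''w'')) (Seq (NAssign ''k'' (NVar ''i'')) (RAssign ''w'' (NConst 0) (R0 ''t''))) Skip)"
  define I where "I i s' \<longleftrightarrow> counter s' ''k'' = amin i ?f \<and> cell s' ''w'' 0 = ?f (amin i ?f)" for i and s' :: state
  have am: "amin i ?f < n" if "i \<le> n" for i
    using amin_less[of i ?f] that n0 by (cases "i = 0") auto
  have nb: "fl \<Longrightarrow> n < 2 ^ b" using sf s by (auto simp: state_fits_def base_def)
  have loop: "runs fl b (For ''i'' ''n'' ?body) s1 (n * ((m * 70 + 20 + (1 + bwt (RLess (R0 ''t'') (R0 ''w'')) +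
      ((1 + nwt (NVar ''i'')) + (1 + nwt (NConst 0) + rwt (R0 ''t''))))) + 11) + 6) Q"
    if s1: "base s1" "vec ''c'' s1 c" "I 0 s1" "frame Argmin s s1" for s1
  proof (rule runs_For[where I = I])
    fix i s' assume i: "i < n" "I i s'" "counter s' ''i'' = i" "frame (For ''i'' ''n'' ?body) s1 s'"
    have s': "base s'" "vec ''c'' s' c" using s1 base_frame[OF _ i(4)] vec_frame[OF _ i(4)] by auto
    show "runs fl b ?body s' (m * 70 + 20 + (1 + bwt (RLess (R0 ''t'') (R0 ''w'')) +
      ((1 + nwt (NVar ''i'')) + (1 + nwt (NConst 0) + rwt (R0 ''t''))))) (I (Suc i))"
    proof (rule runs_Seq, rule runs_Dot[OF s' c i(3,1)])
      fix s2 assume t: "cell s2 ''t'' 0 = ip m (a i) c" and fr: "frame (Dot ''t'' ''i'') s' s2"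
      have 2: "counter s2 ''k'' = amin i ?f" "cell s2 ''w'' 0 = ?f (amin i ?f)" "counter s2 ''i'' = i"
        using i fr by (simp_all add: I_def frame_def)
      show "runs fl b (If (RLess (R0 ''t'') (R0 ''w'')) (Seq (NAssign ''k'' (NVar ''i'')) (RAssign ''w'' (NConst 0) (R0 ''t''))) Skip) s2
       (1 + bwt (RLess (R0 ''t'') (R0 ''w'')) + ((1 + nwt (NVar ''i'')) + (1 + nwt (NConst 0) + rwt (R0 ''t'')))) (I (Suc i))"
      proof (rule runs_If)
        assume "bval s2 (RLess (R0 ''t'') (R0 ''w''))"
        thus "runs fl b (Seq (NAssign ''k'' (NVar ''i'')) (RAssign ''w'' (NConst 0) (R0 ''t''))) s2
         ((1 + nwt (NVar ''i'')) + (1 + nwt (NConst 0) + rwt (R0 ''t''))) (I (Suc i))"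
          using t 2 i nb fitsX[OF ip_fits[OF _ c i(1)]] m_le
          by (intro runs_Seq runs_NAssign runs_RAssign) (auto simp: I_def intro: less_trans)
      next
        assume "\<not> bval s2 (RLess (R0 ''t'') (R0 ''w''))"
        thus "runs fl b Skip s2 ((1 + nwt (NVar ''i'')) + (1 + nwt (NConst 0) + rwt (R0 ''t''))) (I (Suc i))"
          using t 2 by (intro runs_time[OF runs_Skip]) (auto simp: I_def)
      qed
    qed auto
  next
    fix s' assume i: "I n s'" and fr: "frame (For ''i'' ''n'' ?body) s1 s'"
    show "Q s'" by (rule Q) (use i fr s1(4) in \<open>auto simp: I_def kk_def frame_def\<close>)
  qed (use s1 in \<open>auto simp: I_def base_def\<close>)
  have "runs fl b Argmin s ((1 + nwt (NConst 0)) + ((m * 70 + 20) + (n * ((m * 70 + 20 + (1 + bwt (RLess (R0 ''t'') (R0 ''w'')) +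
      ((1 + nwt (NVar ''i'')) + (1 + nwt (NConst 0) + rwt (R0 ''t''))))) + 11) + 6))) Q"
    unfolding Argmin_def
  proof (rule runs_Seq, rule runs_NAssign)
    let ?s = "set_counter ''k'' (nval s (NConst 0)) s"
    have s0: "base ?s" "vec ''c'' ?s c" using s by (simp_all add: base_def vec_def)
    show "runs fl b (Seq (Dot ''w'' ''k'') (For ''i'' ''n'' ?body)) ?s ((m * 70 + 20) + (n * ((m * 70 + 20 + (1 + bwt (RLess (R0 ''t'') (R0 ''w'')) +
      ((1 + nwt (NVar ''i'')) + (1 + nwt (NConst 0) + rwt (R0 ''t''))))) + 11) + 6)) Q"
    proof (rule runs_Seq, rule runs_Dot[OF s0 c _ n0])
      fix s1 assume w: "cell s1 ''w'' 0 = ip m (a 0) c" and fr: "frame (Dot ''w'' ''k'') ?s s1"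
      show "runs fl b (For ''i'' ''n'' ?body) s1 (n * ((m * 70 + 20 + (1 + bwt (RLess (R0 ''t'') (R0 ''w'')) +
      ((1 + nwt (NVar ''i'')) + (1 + nwt (NConst 0) + rwt (R0 ''t''))))) + 11) + 6) Q"
        by (rule loop) (use s0 fr w base_frame[OF s0(1) fr] vec_frame[OF s0(2) fr] in \<open>auto simp: I_def frame_def\<close>)
    qed auto
  qed simp
  thus ?thesis by (rule runs_time) (simp add: algebra_simps)
qed

lemma val_fits: "fl \<Longrightarrow> (\<And>j. j < m \<Longrightarrow> fits N0 (c j)) \<Longrightarrow> fits (9 * (m * N0)) (val c)"
proof -
  assume f: fl and c: "\<And>j. j < m \<Longrightarrow> fits N0 (c j)"
  have 1: "fits (3 * (m * N0)) (ip m (a (kk c)) c)"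
    by (rule ip_fits[OF f c]) (auto simp: kk_def intro: amin_less n0)
  have "fits (3 * (m * N0)) (nrm2 m c)" unfolding ip_def
    by (rule fits_vec_prod[OF f c c]) (use m_le[OF f] in \<open>auto simp: algebra_simps\<close>)
  hence "fits (3 * (m * N0) + 2) (nrm2 m c / 2)" by (rule fits_divide) (simp add: fits_numeral)
  with 1 have "fits (3 * (m * N0) + (3 * (m * N0) + 2) + 1) (val c)" unfolding val_def by (rule fits_diff)
  thus ?thesis by (rule fits_mono) (use m_le[OF f] in linarith)
qed

lemma runs_Value:
  assumes s: "base s" "vec ''c'' s c" "cell s ''w'' 0 = ip m (a (kk c)) c" and c: "\<And>j. fl \<Longrightarrow> j < m \<Longrightarrow> fits N0 (c j)"
    and Q: "\<And>s'. cell s' ''v'' 0 = val c \<Longrightarrow> frame Value s s' \<Longrightarrow> Q s'"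
  shows "runs fl b Value s (m * 60 + 80) Q"
proof -
  have fitc: "fits b (\<Sum>j<k. c j * c j)" if "fl" "k \<le> m" for k
  proof -
    have "fits (3 * (m * N0)) (\<Sum>j<k. c j * c j)"
      by (rule fits_vec_prod[OF that(1) c c that(2)]) (use that m_le[OF that(1)] in \<open>auto simp: algebra_simps\<close>)
    thus ?thesis by (rule fitsX) (use that m_le in auto)
  qed
  have "runs fl b Value s ((m * (rwt (RTimes (Rc ''c'' ''j'') (Rc ''c'' ''j'')) + 2 * rsz (RTimes (Rc ''c'' ''j'') (Rc ''c'' ''j'')) + 30) + 20)
     + (1 + nwt (NConst 0) + rwt (RMinus (R0 ''w'') (RDivide (R0 ''v'') (RConst 2))))) Q"
    unfolding Value_def
  proof (rule runs_Seq, rule runs_Sum[where f = "\<lambda>j. c j * c j"])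
    fix s' assume v: "cell s' ''v'' 0 = (\<Sum>j<m. c j * c j)" and fr: "frame (Sum ''v'' ''j'' ''m'' (RTimes (Rc ''c'' ''j'') (Rc ''c'' ''j''))) s s'"
    have w: "cell s' ''w'' 0 = ip m (a (kk c)) c" using s fr by (simp add: frame_def)
    have e: "rval s' (RMinus (R0 ''w'') (RDivide (R0 ''v'') (RConst 2))) = val c"
      by (simp add: v w val_def) (simp add: ip_def)
    show "runs fl b (RAssign ''v'' (NConst 0) (RMinus (R0 ''w'') (RDivide (R0 ''v'') (RConst 2)))) s'
      (1 + nwt (NConst 0) + rwt (RMinus (R0 ''w'') (RDivide (R0 ''v'') (RConst 2)))) Q"
    proof (rule runs_RAssign)
      show "fl \<Longrightarrow> fits b (rval s' (RMinus (R0 ''w'') (RDivide (R0 ''v'') (RConst 2))))"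
        unfolding e by (rule fitsX[OF val_fits[OF _ c]]) (use m_le in auto)
      show "Q (set_cell ''v'' (nval s' (NConst 0)) (rval s' (RMinus (R0 ''w'') (RDivide (R0 ''v'') (RConst 2)))) s')"
        unfolding e by (rule Q) (use fr in \<open>auto simp: frame_def\<close>)
    qed
  qed (use s fitc in \<open>auto simp: base_def vec_def\<close>)
  thus ?thesis by (rule runs_time) (simp add: nat_bits_num)
qed

lemma runs_Best:
  assumes s: "base s" "vec ''c'' s c" "cell s ''v'' 0 = val c" "vec ''B'' s (fst B)" "cell s ''b'' 0 = snd B"
    and c: "\<And>j. fl \<Longrightarrow> j < m \<Longrightarrow> fits N0 (c j)"
    and Q: "\<And>s'. vec ''B'' s' (fst (best c B)) \<Longrightarrow> cell s' ''b'' 0 = snd (best c B) \<Longrightarrow> frame Best s s' \<Longrightarrow> Q s'"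
  shows "runs fl b Best s (m * 20 + 50) Q"
proof -
  let ?A = "RAssign ''b'' (NConst 0) (R0 ''v'')" and ?F = "Fill ''B'' ''j'' ''m'' (NVar ''j'') (Rc ''c'' ''j'')"
  have "runs fl b Best s (1 + bwt (RLess (R0 ''b'') (R0 ''v'')) + ((1 + nwt (NConst 0) + rwt (R0 ''v'')) +
     (m * (nwt (NVar ''j'') + rwt (Rc ''c'' ''j'') + 12) + 6))) Q"
    unfolding Best_def
  proof (rule runs_If)
    assume "bval s (RLess (R0 ''b'') (R0 ''v''))"
    hence be: "best c B = (c, val c)" using s by (simp add: best_def)
    show "runs fl b (Seq ?A ?F) s ((1 + nwt (NConst 0) + rwt (R0 ''v'')) + (m * (nwt (NVar ''j'') + rwt (Rc ''c'' ''j'') + 12) + 6)) Q"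
    proof (rule runs_Seq, rule runs_RAssign)
      show "fl \<Longrightarrow> fits b (rval s (R0 ''v''))"
        using fitsX[OF val_fits[OF _ c]] m_le s(3) by auto
      show "runs fl b ?F (set_cell ''b'' (nval s (NConst 0)) (rval s (R0 ''v'')) s) (m * (nwt (NVar ''j'') + rwt (Rc ''c'' ''j'') + 12) + 6) Q"
      proof (rule runs_Fill[where f = c and ?o0.0 = 0])
        fix s' assume s': "\<And>k. k < m \<Longrightarrow> cell s' ''B'' (0 + k) = c k" "frame ?F (set_cell ''b'' (nval s (NConst 0)) (rval s (R0 ''v'')) s) s'"
        show "Q s'" by (rule Q) (use s' s in \<open>auto simp: be vec_def frame_def\<close>)
      next
        show "fits b (c k)" if "fl" "k < m" for k using fitsX[OF c] that m_le[OF that(1)] by simp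
      qed (use s in \<open>auto simp: base_def vec_def\<close>)
    qed
  next
    assume "\<not> bval s (RLess (R0 ''b'') (R0 ''v''))"
    hence be: "best c B = B" using s by (simp add: best_def)
    show "runs fl b Skip s ((1 + nwt (NConst 0) + rwt (R0 ''v'')) + (m * (nwt (NVar ''j'') + rwt (Rc ''c'' ''j'') + 12) + 6)) Q"
      by (rule runs_time[OF runs_Skip]) (use Q[of s] s be in auto)
  qed
  thus ?thesis by (rule runs_time) simp
qed

lemma grad_fits: "fl \<Longrightarrow> (\<And>j. j < m \<Longrightarrow> fits N0 (c j)) \<Longrightarrow> j < m \<Longrightarrow> fits (2 * N0 + 1) (grad c j)"
  using fits_diff[OF a_fits, of "kk c" j N0 "c j"] amin_less[OF n0, of "\<lambda>i. ip m (a i) c"]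
  by (simp add: grad_def kk_def mult_2)

lemma runs_Grad:
  assumes s: "base s" "vec ''c'' s c" "counter s ''k'' = kk c" and c: "\<And>j. fl \<Longrightarrow> j < m \<Longrightarrow> fits N0 (c j)"
    and Q: "\<And>s'. vec ''g'' s' (grad c) \<Longrightarrow> frame Grad s s' \<Longrightarrow> Q s'"
  shows "runs fl b Grad s (m * 60 + 6) Q"
proof -
  have k: "kk c < n" by (auto simp: kk_def intro: amin_less n0)
  let ?e = "RMinus (RCell ''A'' (ixm ''k'' ''j'')) (Rc ''c'' ''j'')"
  have "runs fl b Grad s (m * (nwt (NVar ''j'') + rwt ?e + 12) + 6) Q"
    unfolding Grad_def
  proof (rule runs_Fill[where f = "grad c" and ?o0.0 = 0])
    show "fits b (grad c k)" if "fl" "k < m" for k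
      using fitsX[OF grad_fits[OF that(1) c that(2)]] that m_le[OF that(1)] by simp
    show "Q s'" if "\<And>k. k < m \<Longrightarrow> cell s' ''g'' (0 + k) = grad c k" "frame (Fill ''g'' ''j'' ''m'' (NVar ''j'') ?e) s s'" for s'
      by (rule Q) (use that in \<open>auto simp: vec_def Grad_def\<close>)
  qed (use s k in \<open>auto simp: base_def vec_def grad_def\<close>)
  thus ?thesis by (rule runs_time) simp
qed

lemma pp_fits:
  assumes fl "\<And>j. j < m \<Longrightarrow> fits N0 (c j)" "\<And>i j. i < m \<Longrightarrow> j < m \<Longrightarrow> fits N0 (P i j)" "i < m" "k \<le> m"
  shows "fits (5 * (m * N0)) (\<Sum>j<k. P i j * grad c j)"
  by (rule fits_vec_prod[OF assms(1) assms(3)[OF assms(4)] grad_fits[OF assms(1,2)] assms(5)])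
    (use m_le[OF assms(1)] in \<open>auto simp: algebra_simps\<close>)

lemma runs_MulP:
  assumes s: "base s" "vec ''g'' s (grad c)" "matP s P" and c: "\<And>j. fl \<Longrightarrow> j < m \<Longrightarrow> fits N0 (c j)"
    and P: "\<And>i j. fl \<Longrightarrow> i < m \<Longrightarrow> j < m \<Longrightarrow> fits N0 (P i j)"
    and Q: "\<And>s'. vec ''p'' s' (pp P c) \<Longrightarrow> frame MulP s s' \<Longrightarrow> Q s'"
  shows "runs fl b MulP s (m * (m * 70 + 60) + 6) Q"
proof -
  let ?e = "RTimes (RCell ''P'' (ixm ''i'' ''j'')) (Rc ''g'' ''j'')"
  let ?body = "Seq (Sum ''t'' ''j'' ''m'' ?e) (RAssign ''p'' (NVar ''i'') (R0 ''t''))"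
  define I where "I i s' \<longleftrightarrow> (\<forall>j<i. cell s' ''p'' j = pp P c j)" for i and s' :: state
  have "runs fl b MulP s (m * (((m * (rwt ?e + 2 * rsz ?e + 30) + 20) + (1 + nwt (NVar ''i'') + rwt (R0 ''t''))) + 11) + 6) Q"
    unfolding MulP_def
  proof (rule runs_For[where I = I])
    fix i s' assume i: "i < m" "I i s'" "counter s' ''i'' = i" "frame (For ''i'' ''m'' ?body) s s'"
    have s': "base s'" "vec ''g'' s' (grad c)" "matP s' P"
      using s base_frame[OF _ i(4)] vec_frame[OF _ i(4)] matP_frame[OF _ i(4)] by auto
    show "runs fl b ?body s' ((m * (rwt ?e + 2 * rsz ?e + 30) + 20) + (1 + nwt (NVar ''i'') + rwt (R0 ''t''))) (I (Suc i))"
    proof (rule runs_Seq, rule runs_Sum[where f = "\<lambda>j. P i j * grad c j"])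
      show "fits b (\<Sum>j<k. P i j * grad c j)" if "fl" "k \<le> m" for k
        by (rule fitsX[OF pp_fits[OF that(1) c P i(1) that(2)]]) (use that m_le in auto)
      fix s2 assume t: "cell s2 ''t'' 0 = (\<Sum>j<m. P i j * grad c j)" and fr: "frame (Sum ''t'' ''j'' ''m'' ?e) s' s2"
      have p: "cell s2 ''t'' 0 = pp P c i" using t by (simp add: pp_def mulv_def)
      have "fl \<Longrightarrow> fits b (pp P c i)"
        using fitsX[OF pp_fits[OF _ c P i(1), where k = m]] m_le by (auto simp: pp_def mulv_def)
      moreover have "\<forall>j<i. cell s2 ''p'' j = pp P c j" "counter s2 ''i'' = i"
        using i fr by (auto simp: I_def frame_def)
      ultimately show "runs fl b (RAssign ''p'' (NVar ''i'') (R0 ''t'')) s2 (1 + nwt (NVar ''i'') + rwt (R0 ''t'')) (I (Suc i))"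
        using p by (intro runs_RAssign) (auto simp: I_def less_Suc_eq)
    qed (use s' i in \<open>auto simp: base_def vec_def matP_def\<close>)
  next
    fix s' assume "I m s'" "frame (For ''i'' ''m'' ?body) s s'"
    thus "Q s'" by (intro Q) (auto simp: I_def vec_def MulP_def)
  qed (use s in \<open>auto simp: I_def base_def\<close>)
  thus ?thesis by (rule runs_time) (simp add: algebra_simps)
qed

lemma qq_fits:
  assumes fl "\<And>j. j < m \<Longrightarrow> fits N0 (c j)" "\<And>i j. i < m \<Longrightarrow> j < m \<Longrightarrow> fits N0 (P i j)" "k \<le> m"
  shows "fits (9 * X) (\<Sum>j<k. grad c j * pp P c j)"
proof (rule fits_vec_prod[OF assms(1) grad_fits[OF assms(1,2)] _ assms(4)])
  show "fits (5 * (m * N0)) (pp P c j)" if "j < m" for j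
    using pp_fits[OF assms(1-3) that, where k = m] by (simp add: pp_def mulv_def)
  have "m * (2 * N0 + 1 + 5 * (m * N0) + 1) = 2 * (m * N0) + 2 * m + 5 * X" by (simp add: algebra_simps)
  moreover have "m \<le> m * N0" using m_le[OF assms(1)] by simp
  ultimately show "m * (2 * N0 + 1 + 5 * (m * N0) + 1) \<le> 9 * X"
    using m_le(3)[OF assms(1)] by linarith
qed auto

lemma runs_Quad:
  assumes s: "base s" "vec ''g'' s (grad c)" "vec ''p'' s (pp P c)" and c: "\<And>j. fl \<Longrightarrow> j < m \<Longrightarrow> fits N0 (c j)"
    and P: "\<And>i j. fl \<Longrightarrow> i < m \<Longrightarrow> j < m \<Longrightarrow> fits N0 (P i j)"
    and Q: "\<And>s'. cell s' ''q'' 0 = qq P c \<Longrightarrow> frame Quad s s' \<Longrightarrow> Q s'"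
  shows "runs fl b Quad s (m * 70 + 20) Q"
proof -
  let ?e = "RTimes (Rc ''g'' ''j'') (Rc ''p'' ''j'')"
  have "runs fl b Quad s (m * (rwt ?e + 2 * rsz ?e + 30) + 20) Q"
    unfolding Quad_def
  proof (rule runs_Sum[where f = "\<lambda>j. grad c j * pp P c j"])
    show "fits b (\<Sum>j<k. grad c j * pp P c j)" if "fl" "k \<le> m" for k
      by (rule fitsX[OF qq_fits[OF that(1) c P that(2)]]) (use that in auto)
    show "Q s'" if "cell s' ''q'' 0 = (\<Sum>j<m. grad c j * pp P c j)" "frame (Sum ''q'' ''j'' ''m'' ?e) s s'" for s'
      by (rule Q) (use that in \<open>auto simp: qq_def ip_def Quad_def\<close>)
  qed (use s in \<open>auto simp: base_def vec_def\<close>)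
  thus ?thesis by (rule runs_time) simp
qed

end


context ellipsoid_run
begin

lemma grid_fits:
  assumes "grid x" "\<bar>x\<bar> \<le> 2 ^ k" "k + J + 1 \<le> N"
  shows "fits N x"
proof -
  obtain p where p: "x * 2 ^ J = of_int p" using assms(1) unfolding grid_def by (metis Ints_cases)
  have "\<bar>x * 2 ^ J\<bar> \<le> 2 ^ k * 2 ^ J" unfolding abs_mult using assms(2) by (intro mult_mono) auto
  hence "real_of_int \<bar>p\<bar> \<le> real_of_int (2 ^ (k + J))" unfolding p by (simp add: power_add)
  hence "\<bar>p\<bar> \<le> 2 ^ (k + J)" by (simp only: of_int_le_iff)
  also have "(2::int) ^ (k + J) < 2 ^ (k + J + 1)" by (rule power_strict_increasing) auto
  finally have "\<bar>p\<bar> < 2 ^ (k + J + 1)" .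
  moreover have "(2::int) ^ J \<le> 2 ^ (k + J + 1)" by (rule power_increasing) auto
  moreover have "x = of_int p / of_int (2 ^ J)" using p by (simp add: field_simps)
  ultimately have "fits (k + J + 1) x" by (intro fitsI[where p = p and q = "2 ^ J"]) auto
  thus ?thesis using assms(3) by (rule fits_mono)
qed

lemma fits_abs: "fits k x \<Longrightarrow> \<bar>x\<bar> \<le> 2 ^ k"
proof -
  assume "fits k x"
  then obtain p q :: int where x: "x = of_int p / of_int q" "0 < q" "\<bar>p\<bar> < 2 ^ k" unfolding fits_def by auto
  have "\<bar>x\<bar> = of_int \<bar>p\<bar> / of_int q" using x by simp
  also have "\<dots> \<le> of_int \<bar>p\<bar> / 1" using x by (intro divide_left_mono) auto
  also have "\<dots> \<le> of_int (2 ^ k)" using x(3) by (simp only: div_by_1 of_int_le_iff)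
  finally show ?thesis by simp
qed

lemma la_fits: "fits (m + 4) la"
proof (rule fitsI[where p = 1 and q = "8 * int m"])
  have "int m < 2 ^ m" by (metis of_nat_less_two_power)
  hence "8 * int m \<le> 16 * 2 ^ m" by linarith
  moreover have "(2::int) ^ 4 = 16" by simp
  ultimately have "8 * int m \<le> 2 ^ 4 * 2 ^ m" by (simp only:)
  thus "8 * int m \<le> 2 ^ (m + 4)" by (simp only: power_add mult.commute)
qed (use m0 in \<open>auto simp: la_def\<close>)

text \<open>On rational data the bit length of \<open>q\<close> bounds its size and thereby, through
  \<open>ss_exponent\<close>, the number of doublings.\<close>

lemma runs_Scale:
  assumes s: "base s" "cell s ''q'' 0 = q" and q: "ep\<^sup>2 < q" and qf: "fl \<Longrightarrow> fits (9 * X) q"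
    and Q: "\<And>s'. cell s' ''s'' 0 = ss q \<Longrightarrow> cell s' ''D'' 0 = dd q \<Longrightarrow> frame Scale s s' \<Longrightarrow>
      (fl \<Longrightarrow> fits (10 * X) (ss q)) \<Longrightarrow> (fl \<Longrightarrow> fits (31 * X) (dd q)) \<Longrightarrow> Q s'"
  shows "runs fl b Scale s ((2 * K + 1 + 9 * X) * 100 + 200) Q"
proof -
  define k where "k = (LEAST k. q \<le> (ep * 2 ^ k)\<^sup>2)"
  have ssk: "ss q = ep * 2 ^ k" by (simp add: ss_def k_def)
  have kb: "k \<le> 2 * K + 1 + 9 * X" if fl
    unfolding k_def by (rule ss_exponent[OF q]) (use fits_abs[OF qf[OF that]] in linarith)
  have sf: "fits (10 * X) (ep * 2 ^ j)" if fl "j \<le> k" for j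
  proof -
    have "(2::int) ^ j < 2 ^ (2 * K + 1 + k + 1)" by (rule power_strict_increasing) (use that in auto)
    moreover have "(2::int) ^ (2 * K + 1) \<le> 2 ^ (2 * K + 1 + k + 1)" by (rule power_increasing) auto
    ultimately have "fits (2 * K + 1 + k + 1) (ep * 2 ^ j)"
      by (intro fitsI[where p = "2 ^ j" and q = "2 ^ (2 * K + 1)"]) (auto simp: ep_def)
    thus ?thesis by (rule fits_mono) (use that kb m_le[OF that(1)] in linarith)
  qed
  have Df: "fits (31 * X) (dd q)" if fl
  proof -
    have "fits ((10 * X + 10 * X) + ((m + 4) + 9 * X) + 1) (dd q)"
      unfolding dd_def power2_eq_square ssk
      by (intro fits_add fits_mult sf la_fits qf) (use that in auto)
    thus ?thesis by (rule fits_mono) (use m_le[OF that] in linarith)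
  qed
  define I where "I j s' \<longleftrightarrow> cell s' ''s'' 0 = ep * 2 ^ j \<and> j \<le> k" for j and s' :: state
  let ?A = "RAssign ''s'' (NConst 0) (RTimes (R0 ''s'') (RConst 2))"
  let ?e = "RLess (RTimes (R0 ''s'') (R0 ''s'')) (R0 ''q'')"
  let ?d = "RPlus (RTimes (R0 ''s'') (R0 ''s'')) (RTimes (R0 ''a'') (R0 ''q''))"
  have fin: "runs fl b (RAssign ''D'' (NConst 0) ?d) s1 (1 + nwt (NConst 0) + rwt ?d) Q"
    if s1: "cell s1 ''s'' 0 = ss q" "frame Scale s s1" for s1
  proof -
    have v: "rval s1 ?d = dd q"
      using s s1 by (simp add: base_def frame_def dd_def power2_eq_square)
    show ?thesis
    proof (rule runs_RAssign)
      show "fl \<Longrightarrow> fits b (rval s1 ?d)" unfolding v by (rule fitsX[OF Df]) auto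
      show "Q (set_cell ''D'' (nval s1 (NConst 0)) (rval s1 ?d) s1)"
        unfolding v by (rule Q) (use s1 sf[of k] Df in \<open>auto simp: frame_def ssk\<close>)
    qed
  qed
  have loop: "runs fl b (While ?e ?A) s1 (k * (1 + bwt ?e + (1 + nwt (NConst 0) + rwt (RTimes (R0 ''s'') (RConst 2)))) + 1 + bwt ?e)
      (\<lambda>s2. runs fl b (RAssign ''D'' (NConst 0) ?d) s2 (1 + nwt (NConst 0) + rwt ?d) Q)"
    if s1: "I 0 s1" "frame Scale s s1" for s1
  proof (rule runs_While[where I = I])
    show "I 0 s1" by fact
    fix j s' assume I: "I j s'" and fr: "frame (While ?e ?A) s1 s'"
    have q': "cell s' ''q'' 0 = q" using s s1 fr by (simp add: frame_def)
    {
      assume "bval s' ?e"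
      hence lt: "(ep * 2 ^ j)\<^sup>2 < q" using I q' by (simp add: I_def power2_eq_square)
      have "j < k"
      proof (rule ccontr)
        assume "\<not> j < k"
        hence "j = k" using I by (simp add: I_def)
        thus False using lt ss_props(1)[OF q] by (simp add: ssk)
      qed
      moreover have "runs fl b ?A s' (1 + nwt (NConst 0) + rwt (RTimes (R0 ''s'') (RConst 2))) (I (Suc j))"
        using I \<open>j < k\<close> fitsX[OF sf[of "Suc j"]] by (intro runs_RAssign) (auto simp: I_def mult_ac)
      ultimately show "j < k \<and> runs fl b ?A s' (1 + nwt (NConst 0) + rwt (RTimes (R0 ''s'') (RConst 2))) (I (Suc j))" by blast
    }
    {
      assume "\<not> bval s' ?e"
      hence "q \<le> (ep * 2 ^ j)\<^sup>2" using I q' by (simp add: I_def power2_eq_square)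
      hence "k \<le> j" unfolding k_def by (rule Least_le)
      hence "cell s' ''s'' 0 = ss q" using I by (simp add: I_def ssk)
      moreover have "frame Scale s s'" using s1(2) fr by (simp add: frame_def)
      ultimately show "runs fl b (RAssign ''D'' (NConst 0) ?d) s' (1 + nwt (NConst 0) + rwt ?d) Q" by (rule fin)
    }
  qed
  have "runs fl b Scale s ((1 + nwt (NConst 0) + rwt (R0 ''e'')) + ((k * (1 + bwt ?e + (1 + nwt (NConst 0) + rwt (RTimes (R0 ''s'') (RConst 2)))) + 1 + bwt ?e)
     + (1 + nwt (NConst 0) + rwt ?d))) Q"
    unfolding Scale_def
  proof (rule runs_Seq, rule runs_RAssign)
    have e: "rval s (R0 ''e'') = ep * 2 ^ 0" using s by (simp add: base_def)
    show "fl \<Longrightarrow> fits b (rval s (R0 ''e''))" unfolding e by (rule fitsX[OF sf]) auto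
    show "runs fl b (Seq (While ?e ?A) (RAssign ''D'' (NConst 0) ?d)) (set_cell ''s'' (nval s (NConst 0)) (rval s (R0 ''e'')) s)
      ((k * (1 + bwt ?e + (1 + nwt (NConst 0) + rwt (RTimes (R0 ''s'') (RConst 2)))) + 1 + bwt ?e) + (1 + nwt (NConst 0) + rwt ?d)) Q"
      unfolding e by (rule runs_Seq, rule loop) (auto simp: I_def frame_def)
  qed
  thus ?thesis by (rule runs_weaken') (use kb in \<open>auto simp: nat_bits_num\<close>)
qed

text \<open>\<open>Round\<close> requires a bound on its argument before rounding; it is recovered
  from the bound on the rounded value, which differs by at most the mesh and the added
  diagonal.\<close>

lemma msr_bounds:
  assumes P: "msr t P c" and q: "ep\<^sup>2 < qq P c"
  shows "\<And>j. j < m \<Longrightarrow> \<bar>ncen P c j\<bar> \<le> 2 ^ (t + 4)" "\<And>i j. i < m \<Longrightarrow> j < m \<Longrightarrow> \<bar>nsh P c i j\<bar> \<le> 2 ^ (t + 5)"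
    "msr (Suc t) (rsh P c) (\<lambda>j. rnd J (ncen P c j))"
proof -
  show ms: "msr (Suc t) (rsh P c) (\<lambda>j. rnd J (ncen P c j))"
    by (rule msr_move[OF P m0]) (simp add: move_def q)
  have X: "(4::real) \<le> 2 ^ (t + 2)" using power_increasing[of 2 "t + 2" "2::real"] by simp
  have J1: "1 / 2 ^ J \<le> (1::real)" using twoJ(3) by (simp add: field_simps)
  have p: "(2::real) ^ (Suc t + 2) = 2 * 2 ^ (t + 2)" "(2::real) ^ (t + 4) = 4 * 2 ^ (t + 2)" "(2::real) ^ (t + 5) = 8 * 2 ^ (t + 2)"
    by (simp_all add: power_add)
  show "\<bar>ncen P c j\<bar> \<le> 2 ^ (t + 4)" if "j < m" for j
  proof -
    have "\<bar>rnd J (ncen P c j)\<bar> \<le> 2 ^ (Suc t + 2)" using ms that by (auto simp: msr_def)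
    thus ?thesis using rnd_abs[of J "ncen P c j"] J1 X unfolding p by linarith
  qed
  show "\<bar>nsh P c i j\<bar> \<le> 2 ^ (t + 5)" if "i < m" "j < m" for i j
  proof -
    have "\<bar>rsh P c i j\<bar> \<le> 2 ^ (Suc t + 2)"
      by (rule psd_entry[of "rsh P c"]) (use ms that in \<open>auto simp: msr_def\<close>)
    moreover have "2 * real m / 2 ^ J = 2 * (real m / 2 ^ J)" "0 \<le> real m / 2 ^ J" by simp_all
    hence "0 \<le> (if i = j then 2 * real m / 2 ^ J else 0)" "(if i = j then 2 * real m / 2 ^ J else 0) \<le> 1"
      using twoJ(2) by auto
    ultimately show ?thesis using rsh_close[OF that, of P c] J1 X unfolding p by linarith
  qed
qed

text \<open>The purpose of rounding: with bounds that double per round but a fixed mesh,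
  \<open>T\<close> rounds lead to about T + J bits, whereas exact iterates could grow geometrically
  in length.\<close>

lemma msr_fits:
  assumes "msr t P c" "t \<le> T"
  shows "fl \<Longrightarrow> j < m \<Longrightarrow> fits N0 (c j)" "fl \<Longrightarrow> i < m \<Longrightarrow> j < m \<Longrightarrow> fits N0 (P i j)"
proof -
  show "fits N0 (c j)" if fl "j < m"
    by (rule grid_fits[where k = "t + 2"]) (use assms that N0 in \<open>auto simp: msr_def\<close>)
  show "fits N0 (P i j)" if fl "i < m" "j < m"
  proof (rule grid_fits[where k = "t + 2"])
    show "\<bar>P i j\<bar> \<le> 2 ^ (t + 2)" by (rule psd_entry[of P]) (use assms that in \<open>auto simp: msr_def\<close>)
  qed (use assms that N0 in \<open>auto simp: msr_def\<close>)
qed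

lemma round_bits: "fl \<Longrightarrow> 2 * M + J + 2 \<le> b"
proof -
  assume f: fl
  have "100 * N0 \<le> 100 * X" by (intro mult_le_mono order_trans[OF m_le(2,3)] f order_refl)
  hence "100 * N0 \<le> b" using b[OF f] by (rule order_trans)
  hence "2 * N0 \<le> b" by (rule order_trans[rotated]) simp
  moreover have "2 * M + J + 2 \<le> 2 * (T + J + 10)" by (simp add: M_def)
  ultimately show "2 * M + J + 2 \<le> b" using mult_le_mono2[OF N0[OF f], of 2] by (meson order_trans)
qed

lemma runs_Center:
  assumes s: "base s" "vec ''c'' s c" "vec ''p'' s (pp P c)" "cell s ''s'' 0 = ss (qq P c)" "cell s ''D'' 0 = dd (qq P c)"
    and P: "msr t P c" "t < T" and q: "ep\<^sup>2 < qq P c"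
    and f: "fl \<Longrightarrow> fits (10 * X) (ss (qq P c))" "fl \<Longrightarrow> fits (31 * X) (dd (qq P c))"
    and Q: "\<And>s'. vec ''c'' s' (\<lambda>j. rnd J (ncen P c j)) \<Longrightarrow> frame Center s s' \<Longrightarrow> Q s'"
  shows "runs fl b Center s (m * ((M + J) * 200 + 500) + 6) Q"
proof -
  let ?e = "RPlus (Rc ''c'' ''i'') (RDivide (RTimes (RTimes (R0 ''a'') (R0 ''s'')) (Rc ''p'' ''i'')) (RTimes (RConst 2) (R0 ''D'')))"
  let ?body = "Seq (RAssign ''r'' (NConst 0) ?e) (Seq Round (RAssign ''c'' (NVar ''i'') (R0 ''y'')))"
  define I where "I i s' \<longleftrightarrow> (\<forall>j<i. cell s' ''c'' j = rnd J (ncen P c j)) \<and> (\<forall>j<m. i \<le> j \<longrightarrow> cell s' ''c'' j = c j)" for i and s' :: state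
  note mb = msr_bounds[OF P(1) q] and mf = msr_fits[OF P(1) less_imp_le[OF P(2)]]
  have ppf: "fits (5 * (m * N0)) (pp P c i)" if fl "i < m" for i
    using pp_fits[OF that(1) mf(1)[OF that(1)] mf(2)[OF that(1)] that(2), where k = m] by (simp add: pp_def mulv_def)
  have nf: "fits b (ncen P c i)" if fl "i < m" for i
  proof -
    have "fits (N0 + (((m + 4) + 10 * X + 5 * (m * N0)) + (2 + 31 * X)) + 1) (ncen P c i)"
      unfolding ncen_def by (intro fits_add fits_divide fits_mult mf(1) la_fits f ppf) (use that in \<open>auto simp: fits_numeral\<close>)
    thus ?thesis by (rule fitsX) (use that m_le[OF that(1)] in linarith)+
  qed
  have rf: "fits b (rnd J (ncen P c i))" if fl "i < m" for i
    by (rule fitsX[OF msr_fits(1)[OF mb(3)]]) (use that P(2) m_le[OF that(1)] in auto)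
  have "runs fl b Center s (m * (((1 + nwt (NConst 0) + rwt ?e) + (((M + J) * 200 + 200) + (1 + nwt (NVar ''i'') + rwt (R0 ''y'')))) + 11) + 6) Q"
    unfolding Center_def
  proof (rule runs_For[where I = I])
    fix i s' assume i: "i < m" "I i s'" "counter s' ''i'' = i" "frame (For ''i'' ''m'' ?body) s s'"
    have bs: "base s'" using s base_frame[OF _ i(4)] by auto
    have pv: "vec ''p'' s' (pp P c)" using s vec_frame[OF _ i(4)] by auto
    have sd: "cell s' ''s'' 0 = ss (qq P c)" "cell s' ''D'' 0 = dd (qq P c)" using s i(4) by (simp_all add: frame_def)
    have ev: "rval s' ?e = ncen P c i"
      using i bs pv sd by (simp add: I_def base_def vec_def ncen_def)
    show "runs fl b ?body s' ((1 + nwt (NConst 0) + rwt ?e) + (((M + J) * 200 + 200) + (1 + nwt (NVar ''i'') + rwt (R0 ''y'')))) (I (Suc i))"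
    proof (rule runs_Seq, rule runs_RAssign)
      show "fl \<Longrightarrow> fits b (rval s' ?e)" unfolding ev using nf i by blast
      let ?s = "set_cell ''r'' (nval s' (NConst 0)) (rval s' ?e) s'"
      show "runs fl b (Seq Round (RAssign ''c'' (NVar ''i'') (R0 ''y''))) ?s (((M + J) * 200 + 200) + (1 + nwt (NVar ''i'') + rwt (R0 ''y''))) (I (Suc i))"
      proof (rule runs_Seq, rule runs_Round[where x = "ncen P c i"])
        show "cell ?s ''r'' 0 = ncen P c i" by (simp add: ev del: rval.simps)
        have "(2::real) ^ (t + 4) < 2 ^ M" by (rule power_strict_increasing) (use P(2) in \<open>auto simp: M_def\<close>)
        thus "\<bar>ncen P c i\<bar> < 2 ^ M" using mb(1)[OF i(1)] by linarith
        show "cell ?s ''H'' 0 = 2 ^ M" "counter ?s ''R'' = M + J" using bs by (simp_all add: base_def)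
        fix s2 assume y: "cell s2 ''y'' 0 = of_int \<lfloor>ncen P c i * 2 ^ J\<rfloor> / 2 ^ J" and fr: "frame Round ?s s2"
        have y': "cell s2 ''y'' 0 = rnd J (ncen P c i)" using y by (simp add: rnd_def)
        have c2: "cell s2 ''c'' = cell s' ''c''" "counter s2 ''i'' = i" using fr i by (simp_all add: frame_def)
        show "runs fl b (RAssign ''c'' (NVar ''i'') (R0 ''y'')) s2 (1 + nwt (NVar ''i'') + rwt (R0 ''y'')) (I (Suc i))"
          using i rf y' c2 by (intro runs_RAssign) (auto simp: I_def less_Suc_eq)
      qed (rule round_bits)
    qed
  next
    fix s' assume "I m s'" "frame (For ''i'' ''m'' ?body) s s'"
    thus "Q s'" by (intro Q) (auto simp: I_def vec_def Center_def)
  qed (use s in \<open>auto simp: I_def base_def vec_def\<close>)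
  thus ?thesis by (rule runs_time) (simp add: nat_bits_num algebra_simps)
qed

lemma index_eq_iff: "j < m \<Longrightarrow> j' < m \<Longrightarrow> i * m + j = i' * m + j' \<longleftrightarrow> i = i' \<and> j = j'"
proof
  assume h: "j < m" "j' < m" "i * m + j = i' * m + j'"
  have "j = j'" using arg_cong[OF h(3), of "\<lambda>x. x mod m"] unfolding mod_mult_self3 mod_less[OF h(1)] mod_less[OF h(2)] .
  thus "i = i' \<and> j = j'" using h m0 by simp
qed auto

lemma runs_Shape:
  assumes s: "base s" "matP s P" "vec ''p'' s (pp P c)" "cell s ''D'' 0 = dd (qq P c)"
    and P: "msr t P c" "t < T" and q: "ep\<^sup>2 < qq P c"
    and f: "fl \<Longrightarrow> fits (31 * X) (dd (qq P c))"
    and Q: "\<And>s'. matP s' (rsh P c) \<Longrightarrow> frame Shape s s' \<Longrightarrow> Q s'"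
  shows "runs fl b Shape s (m * (m * ((M + J) * 200 + 700) + 30) + 6) Q"
proof -
  let ?e = "RTimes (RPlus (RConst 1) (RDivide (RTimes (R0 ''a'') (R0 ''a'')) (RConst 2)))
        (RMinus (RCell ''P'' (ixm ''i'' ''j'')) (RTimes (RTimes (RDivide (R0 ''a'') (R0 ''D'')) (Rc ''p'' ''i'')) (Rc ''p'' ''j'')))"
  let ?eq = "BAnd (BNot (NLess (NVar ''i'') (NVar ''j''))) (BNot (NLess (NVar ''j'') (NVar ''i'')))"
  let ?if = "If ?eq (RAssign ''P'' (ixm ''i'' ''j'') (RPlus (R0 ''y'') (R0 ''z''))) (RAssign ''P'' (ixm ''i'' ''j'') (R0 ''y''))"
  let ?in = "Seq (RAssign ''r'' (NConst 0) ?e) (Seq Round ?if)"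
  let ?inc = "(1 + nwt (NConst 0) + rwt ?e) + (((M + J) * 200 + 200) + (1 + bwt ?eq + (1 + nwt (ixm ''i'' ''j'') + rwt (RPlus (R0 ''y'') (R0 ''z'')))))"
  \<comment> \<open>Entries before position \<open>(i, j)\<close> in row-major order are new, all
    others still old.\<close>
  define I where "I i j s' \<longleftrightarrow> (\<forall>i'<m. \<forall>j'<m. cell s' ''P'' (i' * m + j') = (if i' < i \<or> i' = i \<and> j' < j then rsh P c i' j' else P i' j'))" for i j and s' :: state
  note mb = msr_bounds[OF P(1) q] and mf = msr_fits[OF P(1) less_imp_le[OF P(2)]]
  have ppf: "fits (5 * (m * N0)) (pp P c i)" if fl "i < m" for i
    using pp_fits[OF that(1) mf(1)[OF that(1)] mf(2)[OF that(1)] that(2), where k = m] by (simp add: pp_def mulv_def)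
  have nf: "fits b (nsh P c i j)" if fl "i < m" "j < m" for i j
  proof -
    have "fits ((1 + (((m + 4) + (m + 4)) + 2) + 1) + (N0 + ((((m + 4) + 31 * X) + 5 * (m * N0)) + 5 * (m * N0)) + 1)) (nsh P c i j)"
      unfolding nsh_def power2_eq_square
      by (intro fits_add fits_diff fits_divide fits_mult mf(2) la_fits f ppf) (use that in \<open>auto simp: fits_numeral intro: fits_1\<close>)
    thus ?thesis by (rule fitsX) (use that m_le[OF that(1)] in linarith)+
  qed
  have rf: "fits b (rsh P c i j)" if fl "i < m" "j < m" for i j
    by (rule fitsX[OF msr_fits(2)[OF mb(3)]]) (use that P(2) m_le[OF that(1)] in auto)
  have inner: "runs fl b (For ''j'' ''m'' ?in) s1 (m * (?inc + 11) + 6) (I (Suc i) 0)"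
    if i: "i < m" "I i 0 s1" "counter s1 ''i'' = i" "frame Shape s s1" for i s1
  proof (rule runs_For[where I = "I i"])
    fix j s' assume j: "j < m" "I i j s'" "counter s' ''j'' = j" "frame (For ''j'' ''m'' ?in) s1 s'"
    have bs: "base s'" using base_frame[OF base_frame[OF s(1) i(4)] j(4)] by auto
    have pv: "vec ''p'' s' (pp P c)" using vec_frame[OF vec_frame[OF s(3) i(4)] j(4)] by auto
    have D: "cell s' ''D'' 0 = dd (qq P c)" "counter s' ''i'' = i" using s i j(4) by (simp_all add: frame_def)
    have ev: "rval s' ?e = nsh P c i j"
      using i j bs pv D by (simp add: I_def base_def vec_def nsh_def power2_eq_square)
    show "runs fl b ?in s' ?inc (I i (Suc j))"
    proof (rule runs_Seq, rule runs_RAssign)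
      show "fl \<Longrightarrow> fits b (rval s' ?e)" unfolding ev using nf i j by blast
      let ?s = "set_cell ''r'' (nval s' (NConst 0)) (rval s' ?e) s'"
      show "runs fl b (Seq Round ?if) ?s (((M + J) * 200 + 200) + (1 + bwt ?eq + (1 + nwt (ixm ''i'' ''j'') + rwt (RPlus (R0 ''y'') (R0 ''z''))))) (I i (Suc j))"
      proof (rule runs_Seq, rule runs_Round[where x = "nsh P c i j"])
        show "cell ?s ''r'' 0 = nsh P c i j" by (simp add: ev del: rval.simps)
        have "(2::real) ^ (t + 5) < 2 ^ M" by (rule power_strict_increasing) (use P(2) in \<open>auto simp: M_def\<close>)
        thus "\<bar>nsh P c i j\<bar> < 2 ^ M" using mb(2)[OF i(1) j(1)] by linarith
        show "cell ?s ''H'' 0 = 2 ^ M" "counter ?s ''R'' = M + J" using bs by (simp_all add: base_def)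
        fix s2 assume y: "cell s2 ''y'' 0 = of_int \<lfloor>nsh P c i j * 2 ^ J\<rfloor> / 2 ^ J" and fr: "frame Round ?s s2"
        have y': "cell s2 ''y'' 0 = rnd J (nsh P c i j)" using y by (simp add: rnd_def)
        have c2: "cell s2 ''P'' = cell s' ''P''" "counter s2 ''i'' = i" "counter s2 ''j'' = j" "counter s2 ''m'' = m"
          "cell s2 ''z'' 0 = 2 * real m / 2 ^ J"
          using fr i j D bs by (simp_all add: frame_def base_def)
        have upd: "I i (Suc j) (set_cell ''P'' (i * m + j) (rsh P c i j) s2)"
          using j i c2(1) index_eq_iff[of _ j _ i] by (auto simp: I_def less_Suc_eq)
        show "runs fl b ?if s2 (1 + bwt ?eq + (1 + nwt (ixm ''i'' ''j'') + rwt (RPlus (R0 ''y'') (R0 ''z'')))) (I i (Suc j))"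
        proof (rule runs_If)
          assume "bval s2 ?eq"
          hence v: "rval s2 (RPlus (R0 ''y'') (R0 ''z'')) = rsh P c i j" "nval s2 (ixm ''i'' ''j'') = i * m + j"
            using c2 y' by (simp_all add: rsh_def)
          show "runs fl b (RAssign ''P'' (ixm ''i'' ''j'') (RPlus (R0 ''y'') (R0 ''z''))) s2 (1 + nwt (ixm ''i'' ''j'') + rwt (RPlus (R0 ''y'') (R0 ''z''))) (I i (Suc j))"
            by (rule runs_RAssign; unfold v) (use upd rf i j in auto)
        next
          assume "\<not> bval s2 ?eq"
          hence v: "rval s2 (R0 ''y'') = rsh P c i j" "nval s2 (ixm ''i'' ''j'') = i * m + j"
            using c2 y' by (auto simp: rsh_def)
          have "runs fl b (RAssign ''P'' (ixm ''i'' ''j'') (R0 ''y'')) s2 (1 + nwt (ixm ''i'' ''j'') + rwt (R0 ''y'')) (I i (Suc j))"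
            by (rule runs_RAssign; unfold v) (use upd rf i j in auto)
          thus "runs fl b (RAssign ''P'' (ixm ''i'' ''j'') (R0 ''y'')) s2 (1 + nwt (ixm ''i'' ''j'') + rwt (RPlus (R0 ''y'') (R0 ''z''))) (I i (Suc j))"
            by (rule runs_time) simp
        qed
      qed (rule round_bits)
    qed
  next
    fix s' assume "I i m s'"
    thus "I (Suc i) 0 s'" by (auto simp: I_def less_Suc_eq)
  qed (use i base_frame[OF s(1) i(4)] in \<open>auto simp: I_def base_def\<close>)
  have "runs fl b Shape s (m * ((m * (?inc + 11) + 6) + 11) + 6) Q"
    unfolding Shape_def
  proof (rule runs_For[where I = "\<lambda>i. I i 0"])
    fix i s' assume i: "i < m" "I i 0 s'" "counter s' ''i'' = i" "frame (For ''i'' ''m'' (For ''j'' ''m'' ?in)) s s'"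
    show "runs fl b (For ''j'' ''m'' ?in) s' (m * (?inc + 11) + 6) (I (Suc i) 0)"
      by (rule inner[OF i(1-3)]) (use i(4) in \<open>simp add: Shape_def\<close>)
  next
    fix s' assume "I m 0 s'" "frame (For ''i'' ''m'' (For ''j'' ''m'' ?in)) s s'"
    thus "Q s'" by (intro Q) (auto simp: I_def matP_def Shape_def)
  qed (use s in \<open>auto simp: I_def base_def matP_def\<close>)
  thus ?thesis by (rule runs_time) (simp add: nat_bits_num algebra_simps)
qed

definition "movecost = (2 * K + 1 + 9 * X) * 100 + m * ((M + J) * 200 + 500) + m * (m * ((M + J) * 200 + 700) + 30) + 300"

lemma runs_Move:
  assumes s: "base s" "matP s P" "vec ''c'' s c" "vec ''p'' s (pp P c)" "cell s ''q'' 0 = qq P c"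
    and P: "msr t P c" "t < T"
    and Q: "\<And>s'. matP s' (fst (move (P, c))) \<Longrightarrow> vec ''c'' s' (snd (move (P, c))) \<Longrightarrow> frame Move s s' \<Longrightarrow> Q s'"
  shows "runs fl b Move s movecost Q"
proof -
  note mf = msr_fits[OF P(1) less_imp_le[OF P(2)]]
  let ?e = "RLess (RTimes (R0 ''e'') (R0 ''e'')) (R0 ''q'')"
  let ?n = "((2 * K + 1 + 9 * X) * 100 + 200) + ((m * ((M + J) * 200 + 500) + 6) + (m * (m * ((M + J) * 200 + 700) + 30) + 6))"
  have "runs fl b Move s (1 + bwt ?e + ?n) Q"
    unfolding Move_def
  proof (rule runs_If)
    assume "bval s ?e"
    hence q: "ep\<^sup>2 < qq P c" using s by (simp add: base_def power2_eq_square)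
    have mv: "move (P, c) = (rsh P c, \<lambda>j. rnd J (ncen P c j))" using q by (simp add: move_def)
    have qf: "fl \<Longrightarrow> fits (9 * X) (qq P c)"
      using qq_fits[OF _ mf, where k = m] by (simp add: qq_def ip_def)
    show "runs fl b (Seq Scale (Seq Center Shape)) s ?n Q"
    proof (rule runs_Seq, rule runs_Scale[OF s(1,5) q qf])
      fix s1 assume 1: "cell s1 ''s'' 0 = ss (qq P c)" "cell s1 ''D'' 0 = dd (qq P c)" "frame Scale s s1"
        "fl \<Longrightarrow> fits (10 * X) (ss (qq P c))" "fl \<Longrightarrow> fits (31 * X) (dd (qq P c))"
      have b1: "base s1" "matP s1 P" "vec ''c'' s1 c" "vec ''p'' s1 (pp P c)"
        using base_frame[OF s(1) 1(3)] matP_frame[OF s(2) 1(3)] vec_frame[OF s(3) 1(3)] vec_frame[OF s(4) 1(3)] by auto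
      show "runs fl b (Seq Center Shape) s1 ((m * ((M + J) * 200 + 500) + 6) + (m * (m * ((M + J) * 200 + 700) + 30) + 6)) Q"
      proof (rule runs_Seq, rule runs_Center[OF b1(1,3,4) 1(1,2) P q 1(4,5)])
        fix s2 assume 2: "vec ''c'' s2 (\<lambda>j. rnd J (ncen P c j))" "frame Center s1 s2"
        have b2: "base s2" "matP s2 P" "vec ''p'' s2 (pp P c)" "cell s2 ''D'' 0 = dd (qq P c)"
          using base_frame[OF b1(1) 2(2)] matP_frame[OF b1(2) 2(2)] vec_frame[OF b1(4) 2(2)] 1(2) 2(2) by (auto simp: frame_def)
        show "runs fl b Shape s2 (m * (m * ((M + J) * 200 + 700) + 30) + 6) Q"
        proof (rule runs_Shape[OF b2 P q 1(5)])
          fix s3 assume 3: "matP s3 (rsh P c)" "frame Shape s2 s3"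
          show "Q s3" unfolding mv
            by (rule Q) (use 3 vec_frame[OF 2(1) 3(2)] 1(3) 2(2) in \<open>auto simp: mv frame_def\<close>)
        qed
      qed
    qed
  next
    assume "\<not> bval s ?e"
    hence "\<not> ep\<^sup>2 < qq P c" using s by (simp add: base_def power2_eq_square)
    hence mv: "move (P, c) = (P, c)" by (simp add: move_def)
    show "runs fl b Skip s ?n Q"
      by (rule runs_time[OF runs_Skip]) (use Q[of s] s mv in auto)
  qed
  thus ?thesis by (rule runs_time) (simp add: movecost_def)
qed

definition "stepcost = n * (m * 70 + 100) + m * (m * 70 + 60) + m * 500 + 500 + movecost"

text \<open>The simulation relation between program states and \<open>traj\<close>; scratch
  variables are left free.\<close>

definition holds :: "nat \<Rightarrow> state \<Rightarrow> bool" where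
  "holds t s \<longleftrightarrow> base s \<and> matP s (fst (fst (traj t))) \<and> vec ''c'' s (snd (fst (traj t))) \<and>
     vec ''B'' s (fst (snd (traj t))) \<and> cell s ''b'' 0 = snd (snd (traj t))"

lemma runs_Step:
  assumes h: "holds t s" and t: "t < T"
  shows "runs fl b Step s stepcost (holds (Suc t))"
proof -
  obtain P c B where tr: "traj t = ((P, c), B)" by (metis surj_pair)
  have ms: "msr t P c" using msr_traj[OF m0, of t P c "fst B" "snd B"] tr by simp
  note mf = msr_fits[OF ms less_imp_le[OF t]]
  have s: "base s" "matP s P" "vec ''c'' s c" "vec ''B'' s (fst B)" "cell s ''b'' 0 = snd B"
    using h by (simp_all add: holds_def tr)
  have tr': "traj (Suc t) = (move (P, c), best c B)" by (simp add: tr)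
  have "runs fl b Step s ((n * (m * 70 + 100) + m * 70 + 50) + ((m * 60 + 80) + ((m * 20 + 50) + ((m * 60 + 6) +
      ((m * (m * 70 + 60) + 6) + ((m * 70 + 20) + movecost)))))) (holds (Suc t))"
    unfolding Step_def
  proof (rule runs_Seq, rule runs_Argmin[OF s(1,3) mf(1)])
    fix s1 assume 1: "counter s1 ''k'' = kk c" "cell s1 ''w'' 0 = ip m (a (kk c)) c" "frame Argmin s s1"
    have b1: "base s1" "matP s1 P" "vec ''c'' s1 c" "vec ''B'' s1 (fst B)" "cell s1 ''b'' 0 = snd B"
      using base_frame[OF s(1) 1(3)] matP_frame[OF s(2) 1(3)] vec_frame[OF s(3) 1(3)] vec_frame[OF s(4) 1(3)] s(5) 1(3)
      by (auto simp: frame_def)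
    show "runs fl b (Seq Value (Seq Best (Seq Grad (Seq MulP (Seq Quad Move))))) s1 ((m * 60 + 80) + ((m * 20 + 50) + ((m * 60 + 6) +
      ((m * (m * 70 + 60) + 6) + ((m * 70 + 20) + movecost))))) (holds (Suc t))"
    proof (rule runs_Seq, rule runs_Value[OF b1(1,3) 1(2) mf(1)])
      fix s2 assume 2: "cell s2 ''v'' 0 = val c" "frame Value s1 s2"
      have b2: "base s2" "matP s2 P" "vec ''c'' s2 c" "vec ''B'' s2 (fst B)" "cell s2 ''b'' 0 = snd B" "counter s2 ''k'' = kk c"
        using base_frame[OF b1(1) 2(2)] matP_frame[OF b1(2) 2(2)] vec_frame[OF b1(3) 2(2)] vec_frame[OF b1(4) 2(2)] b1(5) 1(1) 2(2)
        by (auto simp: frame_def)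
      show "runs fl b (Seq Best (Seq Grad (Seq MulP (Seq Quad Move)))) s2 ((m * 20 + 50) + ((m * 60 + 6) +
        ((m * (m * 70 + 60) + 6) + ((m * 70 + 20) + movecost)))) (holds (Suc t))"
      proof (rule runs_Seq, rule runs_Best[OF b2(1,3) 2(1) b2(4,5) mf(1)])
        fix s3 assume 3: "vec ''B'' s3 (fst (best c B))" "cell s3 ''b'' 0 = snd (best c B)" "frame Best s2 s3"
        have b3: "base s3" "matP s3 P" "vec ''c'' s3 c" "counter s3 ''k'' = kk c"
          using base_frame[OF b2(1) 3(3)] matP_frame[OF b2(2) 3(3)] vec_frame[OF b2(3) 3(3)] b2(6) 3(3)
          by (auto simp: frame_def)
        show "runs fl b (Seq Grad (Seq MulP (Seq Quad Move))) s3 ((m * 60 + 6) +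
          ((m * (m * 70 + 60) + 6) + ((m * 70 + 20) + movecost))) (holds (Suc t))"
        proof (rule runs_Seq, rule runs_Grad[OF b3(1,3,4) mf(1)])
          fix s4 assume 4: "vec ''g'' s4 (grad c)" "frame Grad s3 s4"
          have b4: "base s4" "matP s4 P" "vec ''c'' s4 c" "vec ''B'' s4 (fst (best c B))" "cell s4 ''b'' 0 = snd (best c B)"
            using base_frame[OF b3(1) 4(2)] matP_frame[OF b3(2) 4(2)] vec_frame[OF b3(3) 4(2)] vec_frame[OF 3(1) 4(2)] 3(2) 4(2)
            by (auto simp: frame_def)
          show "runs fl b (Seq MulP (Seq Quad Move)) s4 ((m * (m * 70 + 60) + 6) + ((m * 70 + 20) + movecost)) (holds (Suc t))"
          proof (rule runs_Seq, rule runs_MulP[OF b4(1) 4(1) b4(2) mf])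
            fix s5 assume 5: "vec ''p'' s5 (pp P c)" "frame MulP s4 s5"
            have b5: "base s5" "matP s5 P" "vec ''c'' s5 c" "vec ''B'' s5 (fst (best c B))" "cell s5 ''b'' 0 = snd (best c B)" "vec ''g'' s5 (grad c)"
              using base_frame[OF b4(1) 5(2)] matP_frame[OF b4(2) 5(2)] vec_frame[OF b4(3) 5(2)] vec_frame[OF b4(4) 5(2)] vec_frame[OF 4(1) 5(2)] b4(5) 5(2)
              by (auto simp: frame_def)
            show "runs fl b (Seq Quad Move) s5 ((m * 70 + 20) + movecost) (holds (Suc t))"
            proof (rule runs_Seq, rule runs_Quad[OF b5(1,6) 5(1) mf])
              fix s6 assume 6: "cell s6 ''q'' 0 = qq P c" "frame Quad s5 s6"
              have b6: "base s6" "matP s6 P" "vec ''c'' s6 c" "vec ''B'' s6 (fst (best c B))" "cell s6 ''b'' 0 = snd (best c B)" "vec ''p'' s6 (pp P c)"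
                using base_frame[OF b5(1) 6(2)] matP_frame[OF b5(2) 6(2)] vec_frame[OF b5(3) 6(2)] vec_frame[OF b5(4) 6(2)] vec_frame[OF 5(1) 6(2)] b5(5) 6(2)
                by (auto simp: frame_def)
              show "runs fl b Move s6 movecost (holds (Suc t))"
              proof (rule runs_Move[OF b6(1,2,3,6) 6(1) ms t])
                fix s7 assume 7: "matP s7 (fst (move (P, c)))" "vec ''c'' s7 (snd (move (P, c)))" "frame Move s6 s7"
                show "holds (Suc t) s7"
                  using 7 base_frame[OF b6(1) 7(3)] vec_frame[OF b6(4) 7(3)] b6(5)
                  unfolding holds_def tr' by (auto simp: frame_def)
              qed
            qed
          qed
        qed
      qed
    qed
  qed
  thus ?thesis by (rule runs_time) (simp add: stepcost_def algebra_simps)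
qed

lemma runs_Steps:
  assumes h: "holds 0 s" and T: "counter s ''T'' = T"
  shows "runs fl b (For ''u'' ''T'' Step) s (T * (stepcost + 11) + 6) (holds T)"
proof (rule runs_For[where I = holds])
  show "holds k (set_counter ''u'' x s)" if "holds k s" for k s x
    using that by (simp add: holds_def base_def vec_def matP_def)
qed (use assms in \<open>auto intro: runs_Step\<close>)

end

section \<open>Initialisation of the method\<close>

lemma runs_NAssign_Seq:
  assumes "runs fl b c (set_counter v (nval s a) s) n Q" "fl \<Longrightarrow> nval s a < 2 ^ b"
  shows "runs fl b (Seq (NAssign v a) c) s (1 + nwt a + n) Q"
  by (rule runs_Seq, rule runs_NAssign) (use assms in auto)

lemma runs_RAssign_Seq:
  assumes "runs fl b c (set_cell v (nval s a) (rval s e) s) n Q" "fl \<Longrightarrow> fits b (rval s e)"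
  shows "runs fl b (Seq (RAssign v a e) c) s (1 + nwt a + rwt e + n) Q"
  by (rule runs_Seq, rule runs_RAssign) (use assms in auto)

lemma fits_power2: "k < b \<Longrightarrow> fits b (2 ^ k)"
  using fits_of_nat[of "2 ^ k" b] by simp

text \<open>Repeated doubling takes linearly many steps in the exponent; on rational data the
  exponents in use are polynomial in the bit length of the input.\<close>

definition Pow :: "string \<Rightarrow> string \<Rightarrow> com" where
  "Pow x v = Seq (RAssign x (NConst 0) (RConst 1)) (For ''l'' v (RAssign x (NConst 0) (RPlus (R0 x) (R0 x))))"

lemma vars_Pow [simp]: "cvars (Pow x v) = {''l''}" "rvars (Pow x v) = {x}"
  by (auto simp: Pow_def)

lemma runs_Pow:
  assumes N: "counter s v = N" "v \<noteq> ''l''" and b: "fl \<Longrightarrow> N < b"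
    and Q: "\<And>s'. cell s' x 0 = 2 ^ N \<Longrightarrow> frame (Pow x v) s s' \<Longrightarrow> Q s'"
  shows "runs fl b (Pow x v) s (N * 40 + 20) Q"
proof -
  let ?c = "RAssign x (NConst 0) (RPlus (R0 x) (R0 x))"
  define I where "I k s' \<longleftrightarrow> cell s' x 0 = 2 ^ k" for k and s' :: state
  have fr: "Q s'" if "cell s' x 0 = 2 ^ N" "frame (For ''l'' v ?c) (set_cell x 0 1 s) s'" for s'
    by (rule Q) (use that in \<open>auto simp: frame_def\<close>)
  have "runs fl b (Pow x v) s (1 + nwt (NConst 0) + rwt (RConst 1) + (N * ((1 + nwt (NConst 0) + rwt (RPlus (R0 x) (R0 x))) + 11) + 6)) Q"
    unfolding Pow_def
  proof (rule runs_RAssign_Seq)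
    show "runs fl b (For ''l'' v ?c) (set_cell x (nval s (NConst 0)) (rval s (RConst 1)) s)
        (N * ((1 + nwt (NConst 0) + rwt (RPlus (R0 x) (R0 x))) + 11) + 6) Q"
    proof (rule runs_For[where I = I])
      fix k s' assume k: "k < N" "I k s'"
      have "fl \<Longrightarrow> fits b ((2::real) ^ Suc k)" using k b by (intro fits_power2) linarith
      thus "runs fl b ?c s' (1 + nwt (NConst 0) + rwt (RPlus (R0 x) (R0 x))) (I (Suc k))"
        using k by (intro runs_RAssign) (auto simp: I_def)
    next
      fix s' assume "I N s'" "frame (For ''l'' v ?c) (set_cell x (nval s (NConst 0)) (rval s (RConst 1)) s) s'"
      thus "Q s'" by (intro fr) (simp_all add: I_def)
    qed (use N in \<open>auto simp: I_def\<close>)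
    show "fits b (rval s (RConst 1))" if fl using b[OF that] by (simp add: fits_1)
  qed
  thus ?thesis by (rule runs_time) simp
qed

definition Params :: com where
  "Params =
     Seq (NAssign ''T'' (NTimes (NTimes (NTimes (NConst 256) (NVar ''m'')) (NVar ''m''))
       (NPlus (NPlus (NVar ''m'') (NTimes (NConst 4) (NVar ''K''))) (NConst 8))))
    (Seq (NAssign ''J'' (NPlus (NPlus (NTimes (NConst 4) (NVar ''K'')) (NTimes (NConst 5) (NVar ''m''))) (NConst 20)))
    (Seq (NAssign ''M'' (NPlus (NVar ''T'') (NConst 6)))
    (Seq (NAssign ''R'' (NPlus (NVar ''M'') (NVar ''J'')))
    (Seq (NAssign ''E'' (NPlus (NTimes (NConst 2) (NVar ''K'')) (NConst 1)))
    (NAssign ''Q'' (NTimes (NVar ''m'') (NVar ''m'')))))))"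

definition Consts :: com where
  "Consts = Seq (Pow ''H'' ''M'') (Seq (Pow ''e'' ''E'') (Seq (Pow ''z'' ''J'')
    (Seq (RAssign ''e'' (NConst 0) (RDivide (RConst 1) (R0 ''e'')))
    (Seq (RAssign ''z'' (NConst 0) (RDivide (RTimes (RConst 2) (RNat (NVar ''m''))) (R0 ''z'')))
    (RAssign ''a'' (NConst 0) (RDivide (RConst 1) (RTimes (RConst 8) (RNat (NVar ''m'')))))))))"

definition Diag :: com where
  "Diag = Seq (Fill ''P'' ''i'' ''Q'' (NVar ''i'') (RConst 0))
     (For ''i'' ''m'' (RAssign ''P'' (ixm ''i'' ''i'') (RConst 4)))"

definition Zeros :: com where
  "Zeros = Seq (Fill ''c'' ''j'' ''m'' (NVar ''j'') (RConst 0)) (Seq (Fill ''B'' ''j'' ''m'' (NVar ''j'') (RConst 0))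
     (RAssign ''b'' (NConst 0) (RConst 0)))"

definition Setup :: com where
  "Setup = Seq Params (Seq Consts (Seq Diag Zeros))"

lemma vars_Params [simp]: "cvars Params = {''T'', ''J'', ''M'', ''R'', ''E'', ''Q''}" "rvars Params = {}"
  by (auto simp: Params_def)
lemma vars_Consts [simp]: "cvars Consts = {''l''}" "rvars Consts = {''H'', ''e'', ''z'', ''a''}"
  by (auto simp: Consts_def)
lemma vars_Diag [simp]: "cvars Diag = {''i''}" "rvars Diag = {''P''}"
  by (auto simp: Diag_def)
lemma vars_Zeros [simp]: "cvars Zeros = {''j''}" "rvars Zeros = {''c'', ''B'', ''b''}"
  by (auto simp: Zeros_def)
lemma vars_Setup [simp]: "cvars Setup = {''T'', ''J'', ''M'', ''R'', ''E'', ''Q'', ''l'', ''i'', ''j''}"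
  "rvars Setup = {''H'', ''e'', ''z'', ''a'', ''P'', ''c'', ''B'', ''b''}"
  by (auto simp: Setup_def)

context ellipsoid_run
begin

lemma N0_le_b: "fl \<Longrightarrow> 100 * N0 \<le> b"
proof -
  assume f: fl
  have "100 * N0 \<le> 100 * X" by (intro mult_le_mono order_trans[OF m_le(2,3)] f order_refl)
  thus ?thesis using b[OF f] by (rule order_trans)
qed

lemma small_counter: "fl \<Longrightarrow> k \<le> N0 \<Longrightarrow> k < 2 ^ b"
  using less_exp[of b] N0_le_b by linarith

lemma runs_Params:
  assumes s: "counter s ''m'' = m" "counter s ''K'' = K"
    and Q: "\<And>s'. counter s' ''T'' = T \<Longrightarrow> counter s' ''J'' = J \<Longrightarrow> counter s' ''M'' = M \<Longrightarrow> counter s' ''R'' = M + J \<Longrightarrow>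
      counter s' ''E'' = 2 * K + 1 \<Longrightarrow> counter s' ''Q'' = m * m \<Longrightarrow> frame Params s s' \<Longrightarrow> Q s'"
  shows "runs fl b Params s 300 Q"
proof -
  have N: "T + (4 * K + 5 * m) + 30 \<le> N0" if fl using N0[OF that] by (simp add: J_def)
  have mm: "m * m \<le> N0" if fl
  proof -
    have "m * m * 1 \<le> 256 * m * m * (m + 4 * K + 8)" by (intro mult_le_mono) auto
    also have "\<dots> = T" by (simp only: T_def)
    finally show ?thesis using N[OF that] by linarith
  qed
  have "runs fl b Params s 300 (\<lambda>s'. counter s' ''T'' = T \<and> counter s' ''J'' = J \<and> counter s' ''M'' = M \<and> counter s' ''R'' = M + J \<and>
      counter s' ''E'' = 2 * K + 1 \<and> counter s' ''Q'' = m * m)"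
    unfolding Params_def
  proof (rule runs_time, (rule runs_NAssign_Seq)+, rule runs_NAssign, goal_cases)
    case 1 thus ?case using mm by (intro small_counter) (simp_all add: s)
  next
    case 2 thus ?case by (simp add: s T_def J_def M_def)
  next
    case 3 thus ?case by (intro small_counter) (use N in \<open>simp_all add: s\<close>)
  next
    case 4 thus ?case by (intro small_counter) (use N in \<open>simp_all add: s T_def[symmetric]\<close>)
  next
    case 5 thus ?case by (intro small_counter) (use N in \<open>simp_all add: s T_def[symmetric]\<close>)
  next
    case 6 thus ?case by (intro small_counter) (use N in \<open>simp_all add: s T_def[symmetric]\<close>)
  next
    case 7 thus ?case by (intro small_counter) (use N in \<open>simp_all add: s T_def[symmetric]\<close>)
  qed (simp add: nat_bits_num)
  thus ?thesis by (rule runs_weaken) (use Q in auto)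
qed

lemma runs_Consts:
  assumes s: "counter s ''m'' = m" "counter s ''J'' = J" "counter s ''M'' = M" "counter s ''E'' = 2 * K + 1"
    and Q: "\<And>s'. cell s' ''H'' 0 = 2 ^ M \<Longrightarrow> cell s' ''e'' 0 = ep \<Longrightarrow> cell s' ''z'' 0 = 2 * real m / 2 ^ J \<Longrightarrow>
      cell s' ''a'' 0 = la \<Longrightarrow> frame Consts s s' \<Longrightarrow> Q s'"
  shows "runs fl b Consts s ((M + J + 2 * K) * 40 + 300) Q"
proof -
  have b': "k < b" if fl "k \<le> N0" for k using N0_le_b[OF that(1)] m_le(4)[OF that(1)] that(2) by linarith
  have M: "M \<le> N0" "J \<le> N0" "2 * K + 1 \<le> N0" if fl using N0[OF that] m_le(4)[OF that] by (auto simp: M_def)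
  have fm: "fits (m + 4) (real m)"
    using fits_mono[OF fits_of_nat[of m m], of "m + 4"] less_exp[of m] by simp
  have big: "m + J + 10 \<le> b" "2 * K + 4 \<le> b" if fl
    using N0_le_b[OF that] N0[OF that] m_le(4)[OF that] by auto
  have fz: "fits b (2 * real m / 2 ^ J)" if fl
  proof -
    have "fits ((2 + (m + 4)) + (J + 1)) (2 * real m / 2 ^ J)"
      by (intro fits_divide fits_mult fm fits_power2) (auto simp: fits_numeral)
    thus ?thesis by (rule fits_mono) (use big[OF that] in simp)
  qed
  have fe: "fits b (1 / 2 ^ (2 * K + 1) :: real)" if fl
  proof -
    have "fits (1 + (2 * K + 2)) (1 / 2 ^ (2 * K + 1) :: real)" by (intro fits_divide fits_power2 fits_1) auto
    thus ?thesis by (rule fits_mono) (use big[OF that] in simp)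
  qed
  have fa: "fits b la" if fl by (rule fits_mono[OF la_fits]) (use big[OF that] in simp)
  have "runs fl b Consts s ((M * 40 + 20) + (((2 * K + 1) * 40 + 20) + ((J * 40 + 20) + 150)))
    (\<lambda>s'. cell s' ''H'' 0 = 2 ^ M \<and> cell s' ''e'' 0 = ep \<and> cell s' ''z'' 0 = 2 * real m / 2 ^ J \<and> cell s' ''a'' 0 = la)" (is "runs _ _ _ _ _ ?Q")
    unfolding Consts_def
  proof (rule runs_Seq, rule runs_Pow[OF s(3)])
    fix s1 assume 1: "cell s1 ''H'' 0 = 2 ^ M" "frame (Pow ''H'' ''M'') s s1"
    have c1: "counter s1 ''m'' = m" "counter s1 ''J'' = J" "counter s1 ''E'' = 2 * K + 1" using s 1(2) by (simp_all add: frame_def)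
    let ?c = "Seq (RAssign ''e'' (NConst 0) (RDivide (RConst 1) (R0 ''e'')))
      (Seq (RAssign ''z'' (NConst 0) (RDivide (RTimes (RConst 2) (RNat (NVar ''m''))) (R0 ''z'')))
      (RAssign ''a'' (NConst 0) (RDivide (RConst 1) (RTimes (RConst 8) (RNat (NVar ''m''))))))"
    show "runs fl b (Seq (Pow ''e'' ''E'') (Seq (Pow ''z'' ''J'') ?c)) s1 (((2 * K + 1) * 40 + 20) + ((J * 40 + 20) + 150)) ?Q"
    proof (rule runs_Seq, rule runs_Pow[OF c1(3)])
      fix s2 assume 2: "cell s2 ''e'' 0 = 2 ^ (2 * K + 1)" "frame (Pow ''e'' ''E'') s1 s2"
      have c2: "counter s2 ''m'' = m" "counter s2 ''J'' = J" "cell s2 ''H'' 0 = 2 ^ M" using c1 1 2(2) by (simp_all add: frame_def)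
      show "runs fl b (Seq (Pow ''z'' ''J'') ?c) s2 ((J * 40 + 20) + 150) ?Q"
      proof (rule runs_Seq, rule runs_Pow[OF c2(2)])
        fix s3 assume 3: "cell s3 ''z'' 0 = 2 ^ J" "frame (Pow ''z'' ''J'') s2 s3"
        have c3: "counter s3 ''m'' = m" "cell s3 ''H'' 0 = 2 ^ M" "cell s3 ''e'' 0 = 2 ^ (2 * K + 1)"
          using c2 2 3(2) by (simp_all add: frame_def)
        show "runs fl b ?c s3 150 ?Q"
        proof (rule runs_time, rule runs_RAssign_Seq, rule runs_RAssign_Seq, rule runs_RAssign, goal_cases)
          case 1 thus ?case using fa by (simp add: c3 la_def)
        next
          case 2 thus ?case using c3 3(1) by (simp add: ep_def la_def)
        next
          case 3 thus ?case using fz c3 \<open>cell s3 ''z'' 0 = 2 ^ J\<close> by simp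
        next
          case 4 thus ?case using fe c3 by simp
        qed (simp add: nat_bits_num)
      qed (use M b' in auto)
    qed (use M b' in auto)
  qed (use M b' in auto)
  hence "runs fl b Consts s ((M + J + 2 * K) * 40 + 300) ?Q" by (rule runs_time) simp
  thus ?thesis by (rule runs_weaken) (use Q in auto)
qed

lemma runs_Diag:
  assumes s: "counter s ''m'' = m" "counter s ''Q'' = m * m"
    and Q: "\<And>s'. matP s' (\<lambda>i j. if i = j then 4 else 0) \<Longrightarrow> frame Diag s s' \<Longrightarrow> Q s'"
  shows "runs fl b Diag s (m * m * 60 + m * 60 + 20) Q"
proof -
  let ?l = "RAssign ''P'' (ixm ''i'' ''i'') (RConst 4)"
  define I where "I k s' \<longleftrightarrow> (\<forall>i<m. \<forall>j<m. cell s' ''P'' (i * m + j) = (if i = j \<and> i < k then 4 else 0))" for k and s' :: state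
  have "runs fl b Diag s ((m * m * (nwt (NVar ''i'') + rwt (RConst 0) + 12) + 6) +
      (m * ((1 + nwt (ixm ''i'' ''i'') + rwt (RConst 4)) + 11) + 6)) (\<lambda>s'. matP s' (\<lambda>i j. if i = j then 4 else 0))"
    unfolding Diag_def
  proof (rule runs_Seq, rule runs_Fill[where f = "\<lambda>_. 0" and ?o0.0 = 0])
    fix s1 assume 1: "\<And>k. k < m * m \<Longrightarrow> cell s1 ''P'' (0 + k) = 0" "frame (Fill ''P'' ''i'' ''Q'' (NVar ''i'') (RConst 0)) s s1"
    have z: "cell s1 ''P'' (i * m + j) = 0" if "i < m" "j < m" for i j
    proof -
      have "i * m + j < Suc i * m" using that by simp
      also have "\<dots> \<le> m * m" using that by (intro mult_le_mono1) auto
      finally show ?thesis using 1(1) by simp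
    qed
    show "runs fl b (For ''i'' ''m'' ?l) s1 (m * ((1 + nwt (ixm ''i'' ''i'') + rwt (RConst 4)) + 11) + 6) (\<lambda>s'. matP s' (\<lambda>i j. if i = j then 4 else 0))"
    proof (rule runs_For[where I = I])
      fix k s' assume k: "k < m" "I k s'" "counter s' ''i'' = k" "frame (For ''i'' ''m'' ?l) s1 s'"
      have m': "counter s' ''m'' = m" using s(1) 1(2) k(4) by (simp add: frame_def)
      have "I (Suc k) (set_cell ''P'' (nval s' (ixm ''i'' ''i'')) (rval s' (RConst 4)) s')"
        using k m' by (auto simp: I_def index_eq_iff less_Suc_eq)
      moreover have "fits b 4" if fl using N0_le_b[OF that] m_le(4)[OF that] by (intro fits_mono[of 3 4 b] fits_numeral) auto
      ultimately show "runs fl b ?l s' (1 + nwt (ixm ''i'' ''i'') + rwt (RConst 4)) (I (Suc k))"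
        by (intro runs_RAssign) simp_all
    next
      fix s' assume "I m s'"
      thus "matP s' (\<lambda>i j. if i = j then 4 else 0)" by (auto simp: I_def matP_def)
    qed (use s 1(2) z in \<open>auto simp: I_def frame_def\<close>)
  qed (use s in auto)
  hence "runs fl b Diag s (m * m * 60 + m * 60 + 20) (\<lambda>s'. matP s' (\<lambda>i j. if i = j then 4 else 0))"
    by (rule runs_time) (simp add: nat_bits_num algebra_simps)
  thus ?thesis by (rule runs_weaken) (use Q in auto)
qed

lemma runs_Zeros:
  assumes s: "counter s ''m'' = m"
    and Q: "\<And>s'. vec ''c'' s' (\<lambda>_. 0) \<Longrightarrow> vec ''B'' s' (\<lambda>_. 0) \<Longrightarrow> cell s' ''b'' 0 = 0 \<Longrightarrow> frame Zeros s s' \<Longrightarrow> Q s'"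
  shows "runs fl b Zeros s (m * 60 + 40) Q"
proof -
  let ?n = "nwt (NVar ''j'') + rwt (RConst 0) + 12"
  have "runs fl b Zeros s ((m * ?n + 6) + ((m * ?n + 6) + (1 + nwt (NConst 0) + rwt (RConst 0))))
      (\<lambda>s'. vec ''c'' s' (\<lambda>_. 0) \<and> vec ''B'' s' (\<lambda>_. 0) \<and> cell s' ''b'' 0 = 0)" (is "runs _ _ _ _ _ ?Q")
    unfolding Zeros_def
  proof (rule runs_Seq, rule runs_Fill[where f = "\<lambda>_. 0" and ?o0.0 = 0])
    fix s1 assume 1: "\<And>k. k < m \<Longrightarrow> cell s1 ''c'' (0 + k) = 0" "frame (Fill ''c'' ''j'' ''m'' (NVar ''j'') (RConst 0)) s s1"
    show "runs fl b (Seq (Fill ''B'' ''j'' ''m'' (NVar ''j'') (RConst 0)) (RAssign ''b'' (NConst 0) (RConst 0))) s1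
      ((m * ?n + 6) + (1 + nwt (NConst 0) + rwt (RConst 0))) ?Q"
    proof (rule runs_Seq, rule runs_Fill[where f = "\<lambda>_. 0" and ?o0.0 = 0])
      fix s2 assume 2: "\<And>k. k < m \<Longrightarrow> cell s2 ''B'' (0 + k) = 0" "frame (Fill ''B'' ''j'' ''m'' (NVar ''j'') (RConst 0)) s1 s2"
      have "vec ''c'' s2 (\<lambda>_. 0)" by (rule vec_frame[OF _ 2(2)]) (use 1(1) in \<open>auto simp: vec_def\<close>)
      thus "runs fl b (RAssign ''b'' (NConst 0) (RConst 0)) s2 (1 + nwt (NConst 0) + rwt (RConst 0)) ?Q"
        using 2(1) by (intro runs_RAssign) (auto simp: vec_def)
    qed (use s 1(2) in \<open>auto simp: frame_def\<close>)
  qed (use s in auto)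
  hence "runs fl b Zeros s (m * 60 + 40) ?Q" by (rule runs_time) (simp add: algebra_simps)
  thus ?thesis by (rule runs_weaken) (use Q in auto)
qed

lemma runs_Setup:
  assumes s: "counter s ''m'' = m" "counter s ''n'' = n" "counter s ''K'' = K" "\<And>i j. i < n \<Longrightarrow> j < m \<Longrightarrow> cell s ''A'' (i * m + j) = a i j"
    and Q: "\<And>s'. holds 0 s' \<Longrightarrow> counter s' ''T'' = T \<Longrightarrow> counter s' ''M'' = M \<Longrightarrow> frame Setup s s' \<Longrightarrow> Q s'"
  shows "runs fl b Setup s (300 + (((M + J + 2 * K) * 40 + 300) + ((m * m * 60 + m * 60 + 20) + (m * 60 + 40)))) Q"
  unfolding Setup_def
proof (rule runs_Seq, rule runs_Params[OF s(1,3)])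
  fix s1 assume 1: "counter s1 ''T'' = T" "counter s1 ''J'' = J" "counter s1 ''M'' = M" "counter s1 ''R'' = M + J"
      "counter s1 ''E'' = 2 * K + 1" "counter s1 ''Q'' = m * m" "frame Params s s1"
  have c1: "counter s1 ''m'' = m" "counter s1 ''n'' = n" "\<And>i j. i < n \<Longrightarrow> j < m \<Longrightarrow> cell s1 ''A'' (i * m + j) = a i j"
    using s 1(7) by (simp_all add: frame_def)
  show "runs fl b (Seq Consts (Seq Diag Zeros)) s1 (((M + J + 2 * K) * 40 + 300) + ((m * m * 60 + m * 60 + 20) + (m * 60 + 40))) Q"
  proof (rule runs_Seq, rule runs_Consts[OF c1(1) 1(2,3,5)])
    fix s2 assume 2: "cell s2 ''H'' 0 = 2 ^ M" "cell s2 ''e'' 0 = ep" "cell s2 ''z'' 0 = 2 * real m / 2 ^ J" "cell s2 ''a'' 0 = la" "frame Consts s1 s2"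
    have b2: "base s2" unfolding base_def using c1 1(4) 2 by (simp add: frame_def)
    have c2: "counter s2 ''m'' = m" "counter s2 ''Q'' = m * m" "counter s2 ''T'' = T" "counter s2 ''M'' = M" using c1 1 2(5) by (simp_all add: frame_def)
    show "runs fl b (Seq Diag Zeros) s2 ((m * m * 60 + m * 60 + 20) + (m * 60 + 40)) Q"
    proof (rule runs_Seq, rule runs_Diag[OF c2(1,2)])
      fix s3 assume 3: "matP s3 (\<lambda>i j. if i = j then 4 else 0)" "frame Diag s2 s3"
      have m3: "counter s3 ''m'' = m" using c2 3(2) by (simp add: frame_def)
      show "runs fl b Zeros s3 (m * 60 + 40) Q"
      proof (rule runs_Zeros[OF m3])
        fix s4 assume 4: "vec ''c'' s4 (\<lambda>_. 0)" "vec ''B'' s4 (\<lambda>_. 0)" "cell s4 ''b'' 0 = 0" "frame Zeros s3 s4"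
        have "base s4" by (rule base_frame[OF base_frame[OF b2 3(2)] 4(4)]) auto
        moreover have "matP s4 (\<lambda>i j. if i = j then 4 else 0)" by (rule matP_frame[OF 3(1) 4(4)]) simp
        ultimately show "Q s4" using 4 c2 1(7) 2(5) 3(2)
          by (intro Q) (auto simp: holds_def frame_def Setup_def)
      qed
    qed
  qed
qed

end

section \<open>The search for the precision\<close>

definition Body :: com where
  "Body = Seq Setup (Seq (For ''u'' ''T'' Step)
     (Seq (Sum ''N'' ''j'' ''m'' (RTimes (Rc ''B'' ''j'') (Rc ''B'' ''j''))) (Seq (Pow ''o'' ''K'')
       (If (RLess (RTimes (R0 ''N'') (R0 ''o'')) (RConst 16)) (NAssign ''K'' (NPlus (NVar ''K'') (NConst 1)))
         (NAssign ''F'' (NConst 1))))))"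

text \<open>\<open>F\<close> is the flag that ends the search. A failed precision restarts the
  method from scratch with the next exponent.\<close>

definition Search :: com where
  "Search = Seq (NAssign ''K'' (NConst 0)) (Seq (NAssign ''F'' (NConst 0)) (While (NLess (NVar ''F'') (NConst 1)) Body))"

text \<open>The best centre is rounded to the mesh of the accuracy reached, far coarser than the
  working mesh; this leaves only few candidates around \<open>z\<close>.\<close>

definition Output :: com where
  "Output = Seq (NAssign ''R'' (NPlus (NVar ''M'') (NVar ''K'')))
     (For ''i'' ''m'' (Seq (RAssign ''r'' (NConst 0) (Rc ''B'' ''i'')) (Seq Round (RAssign ''W'' (NVar ''i'') (R0 ''y'')))))"

lemma vars_Body [simp]: "cvars Body = {''T'', ''J'', ''M'', ''R'', ''E'', ''Q'', ''l'', ''i'', ''j'', ''k'', ''u'', ''K'', ''F''}"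
  "rvars Body = {''H'', ''e'', ''z'', ''a'', ''P'', ''c'', ''B'', ''b'', ''t'', ''w'', ''v'', ''g'', ''p'', ''q'', ''s'', ''D'', ''r'', ''y'', ''h'', ''N'', ''o''}"
  by (auto simp: Body_def)
lemma vars_Search [simp]: "cvars Search = cvars Body" "rvars Search = rvars Body"
  by (auto simp: Search_def)
lemma vars_Output [simp]: "cvars Output = {''R'', ''i'', ''l''}" "rvars Output = {''r'', ''y'', ''h'', ''W''}"
  by (auto simp: Output_def)

context ellipsoid_run
begin

definition found :: "(nat \<Rightarrow> real) \<Rightarrow> state \<Rightarrow> bool" where
  "found B s \<longleftrightarrow> counter s ''m'' = m \<and> counter s ''K'' = K \<and> counter s ''M'' = M \<and> cell s ''H'' 0 = 2 ^ M \<and> vec ''B'' s B"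

lemma best_bounds:
  assumes "traj T = ((P, c), (B, bv))" "j < m"
  shows "\<bar>B j\<bar> < 2 ^ M" "fl \<Longrightarrow> fits N0 (B j)"
proof -
  have B: "\<bar>B j\<bar> \<le> 2 ^ (T + 2)" "grid (B j)" using msr_traj[OF m0 assms(1)] assms(2) by auto
  have "(2::real) ^ (T + 2) < 2 ^ M" by (rule power_strict_increasing) (auto simp: M_def)
  with B show "\<bar>B j\<bar> < 2 ^ M" by linarith
  show "fits N0 (B j)" if fl
    by (rule grid_fits[OF B(2,1)]) (use N0[OF that] in simp)
qed

text \<open>All terms are dominated by n m^2 N0, and the \<open>T\<close> rounds contribute one
  further factor \<open>N0\<close>.\<close>

lemma bodycost:
  assumes fl
  shows "(300 + (((M + J + 2 * K) * 40 + 300) + ((m * m * 60 + m * 60 + 20) + (m * 60 + 40)))) + ((T * (stepcost + 11) + 6) +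
    ((m * 100 + 20) + ((K * 40 + 20) + 100))) \<le> n * X * N0 * 10000"
proof -
  define Y where "Y = n * X"
  have N: "T \<le> N0" "M + J \<le> N0" "K \<le> N0" "m \<le> N0" "1 \<le> N0"
    using N0[OF assms] m_le(4)[OF assms] by (auto simp: M_def)
  have XY: "X \<le> Y" unfolding Y_def using n0 by simp
  have Y: "N0 \<le> Y" "m * N0 \<le> Y"
    using order_trans[OF order_trans[OF m_le(2,3)] XY] order_trans[OF m_le(3) XY] assms by auto
  have nm: "n * m \<le> Y" unfolding Y_def using m0 N by (intro mult_le_mono2) simp
  have n1: "n \<le> Y" using nm m0 by (auto intro: order_trans[of n "n * m"])
  have mm: "m * m \<le> Y" using mult_le_mono2[OF N(4), of m] Y(2) by (rule order_trans)
  have m1: "m \<le> Y" and K1: "K \<le> Y" and one: "1 \<le> Y" using N Y(1) by linarith+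
  have mMJ: "m * (M + J) \<le> Y" using mult_le_mono2[OF N(2), of m] Y(2) by (rule order_trans)
  have mmMJ: "m * (m * (M + J)) \<le> Y" using mult_le_mono2[OF mult_le_mono2[OF N(2), of m], of m] XY by (rule order_trans)
  have "stepcost = n * m * 70 + n * 100 + (m * m * 70 + m * 60) + m * 500 + 1 * 500 +
      (K * 200 + 1 * 100 + X * 900 + (m * (M + J) * 200 + m * 500) + (m * (m * (M + J)) * 200 + m * m * 700 + m * 30) + 1 * 300)"
    unfolding stepcost_def movecost_def by (simp add: distrib_left distrib_right)
  also have "\<dots> \<le> Y * 70 + Y * 100 + (Y * 70 + Y * 60) + Y * 500 + Y * 500 +
      (Y * 200 + Y * 100 + Y * 900 + (Y * 200 + Y * 500) + (Y * 200 + Y * 700 + Y * 30) + Y * 300)"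
    by (intro add_mono mult_le_mono1 nm n1 mm m1 K1 one XY mMJ mmMJ)
  finally have "stepcost \<le> Y * 4430" by simp
  hence "T * (stepcost + 11) \<le> N0 * (Y * 4430 + Y * 11)" using one by (intro mult_le_mono N(1) add_mono) simp_all
  also have "\<dots> = Y * N0 * 4441" by simp
  finally have 1: "T * (stepcost + 11) \<le> Y * N0 * 4441" .
  have YN: "Y \<le> Y * N0" using N(5) by simp
  note le = order_trans[OF mm YN] order_trans[OF m1 YN] order_trans[OF K1 YN] order_trans[OF one YN]
  have MJ: "M + J \<le> Y * N0" using N(2) Y(1) YN by linarith
  have "(300 + (((M + J + 2 * K) * 40 + 300) + ((m * m * 60 + m * 60 + 20) + (m * 60 + 40)))) + ((T * (stepcost + 11) + 6) +
    ((m * 100 + 20) + ((K * 40 + 20) + 100))) = (1 * 300 + (((M + J) * 40 + K * 80 + 1 * 300) + ((m * m * 60 + m * 60 + 1 * 20) + (m * 60 + 1 * 40)))) +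
    ((T * (stepcost + 11) + 1 * 6) + ((m * 100 + 1 * 20) + ((K * 40 + 1 * 20) + 1 * 100)))" by simp
  also have "\<dots> \<le> (Y * N0 * 300 + ((Y * N0 * 40 + Y * N0 * 80 + Y * N0 * 300) + ((Y * N0 * 60 + Y * N0 * 60 + Y * N0 * 20) + (Y * N0 * 60 + Y * N0 * 40)))) +
    ((Y * N0 * 4441 + Y * N0 * 6) + ((Y * N0 * 100 + Y * N0 * 20) + ((Y * N0 * 40 + Y * N0 * 20) + Y * N0 * 100)))"
    by (intro add_mono 1 mult_le_mono1 MJ le)
  also have "\<dots> \<le> Y * N0 * 10000" by simp
  finally show ?thesis by (simp only: Y_def)
qed

lemma runs_Body:
  fixes z
  assumes a1: "\<And>i. i < n \<Longrightarrow> (\<Sum>j<m. \<bar>a i j\<bar>) \<le> 1" and z: "mnp m {..<n} a z"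
    and s: "counter s ''m'' = m" "counter s ''n'' = n" "counter s ''K'' = K" "\<And>i j. i < n \<Longrightarrow> j < m \<Longrightarrow> cell s ''A'' (i * m + j) = a i j"
    and fail: "\<And>s' B. nrm2 m (\<lambda>j. B j - z j) \<le> (1 / 2 ^ K)\<^sup>2 \<Longrightarrow> nrm2 m B * 2 ^ K < 16 \<Longrightarrow>
      counter s' ''F'' = counter s ''F'' \<Longrightarrow> counter s' ''K'' = K + 1 \<Longrightarrow> Q s'"
    and pass: "\<And>s' B. nrm2 m (\<lambda>j. B j - z j) \<le> (1 / 2 ^ K)\<^sup>2 \<Longrightarrow> 16 \<le> nrm2 m B * 2 ^ K \<Longrightarrow>
      (\<And>j. j < m \<Longrightarrow> \<bar>B j\<bar> < 2 ^ M \<and> (fl \<longrightarrow> fits N0 (B j))) \<Longrightarrow> found B s' \<Longrightarrow> counter s' ''F'' = 1 \<Longrightarrow> Q s'"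
  shows "runs fl b Body s ((300 + (((M + J + 2 * K) * 40 + 300) + ((m * m * 60 + m * 60 + 20) + (m * 60 + 40)))) + ((T * (stepcost + 11) + 6) +
    ((m * 100 + 20) + ((K * 40 + 20) + 100)))) Q"
proof -
  interpret conv: ellipsoid_conv m n a K z by unfold_locales (use m0 n0 a1 z in auto)
  obtain P c B bv where tr: "traj T = ((P, c), (B, bv))" by (metis surj_pair)
  note close = conv.traj_close[OF tr] and bb = best_bounds[OF tr]
  let ?test = "RLess (RTimes (R0 ''N'') (R0 ''o'')) (RConst 16)"
  let ?if = "If ?test (NAssign ''K'' (NPlus (NVar ''K'') (NConst 1))) (NAssign ''F'' (NConst 1))"
  let ?sum = "Sum ''N'' ''j'' ''m'' (RTimes (Rc ''B'' ''j'') (Rc ''B'' ''j''))"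
  have K: "K + 1 < 2 ^ b" "K < b" "1 < (2::nat) ^ b" if fl
    using N0_le_b[OF that] m_le(4)[OF that] small_counter[OF that, of "K + 1"] small_counter[OF that, of 1] by auto
  show ?thesis
    unfolding Body_def
  proof (rule runs_Seq, rule runs_Setup[OF s])
    fix s1 assume 1: "holds 0 s1" "counter s1 ''T'' = T" "counter s1 ''M'' = M" "frame Setup s s1"
    show "runs fl b (Seq (For ''u'' ''T'' Step) (Seq ?sum (Seq (Pow ''o'' ''K'') ?if))) s1
      ((T * (stepcost + 11) + 6) + ((m * 100 + 20) + ((K * 40 + 20) + 100))) Q"
    proof (rule runs_Seq, rule runs_weaken[OF runs_Steps[OF 1(1,2)] _ order_refl])
      fix s2 assume 2: "frame (For ''u'' ''T'' Step) s1 s2" "holds T s2"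
      have b2: "base s2" "vec ''B'' s2 B" using 2(2) by (simp_all add: holds_def tr)
      have c2: "counter s2 ''m'' = m" "counter s2 ''K'' = K" "counter s2 ''M'' = M" "counter s2 ''F'' = counter s ''F''" "cell s2 ''H'' 0 = 2 ^ M"
        using b2(1) 1 2(1) s by (simp_all add: base_def frame_def)
      show "runs fl b (Seq ?sum (Seq (Pow ''o'' ''K'') ?if)) s2 ((m * 100 + 20) + ((K * 40 + 20) + 100)) Q"
      proof (rule runs_Seq, rule runs_time[OF runs_Sum[where f = "\<lambda>j. B j * B j"]])
        fix s3 assume 3: "cell s3 ''N'' 0 = (\<Sum>j<m. B j * B j)" "frame ?sum s2 s3"
        have n3: "cell s3 ''N'' 0 = nrm2 m B" using 3(1) by (simp add: ip_def)
        have c3: "counter s3 ''m'' = m" "counter s3 ''K'' = K" "counter s3 ''M'' = M" "counter s3 ''F'' = counter s ''F''"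
          "cell s3 ''H'' 0 = 2 ^ M" "vec ''B'' s3 B"
          using c2 3(2) vec_frame[OF b2(2) 3(2)] by (simp_all add: frame_def)
        show "runs fl b (Seq (Pow ''o'' ''K'') ?if) s3 ((K * 40 + 20) + 100) Q"
        proof (rule runs_Seq, rule runs_Pow[OF c3(2)])
          fix s4 assume 4: "cell s4 ''o'' 0 = 2 ^ K" "frame (Pow ''o'' ''K'') s3 s4"
          have n4: "cell s4 ''N'' 0 = nrm2 m B" using n3 4(2) by (simp add: frame_def)
          have c4: "counter s4 ''m'' = m" "counter s4 ''K'' = K" "counter s4 ''M'' = M" "counter s4 ''F'' = counter s ''F''"
            "cell s4 ''H'' 0 = 2 ^ M" "vec ''B'' s4 B"
            using c3 4(2) vec_frame[OF c3(6) 4(2)] by (simp_all add: frame_def)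
          have "runs fl b ?if s4 (1 + bwt ?test + 20) Q"
          proof (rule runs_If)
            assume "bval s4 ?test"
            hence "nrm2 m B * 2 ^ K < 16" using n4 4(1) by simp
            thus "runs fl b (NAssign ''K'' (NPlus (NVar ''K'') (NConst 1))) s4 20 Q"
              by (intro runs_time[OF runs_NAssign] fail[OF close]) (use c4 K in \<open>auto simp: nat_bits_num\<close>)
          next
            assume "\<not> bval s4 ?test"
            hence "16 \<le> nrm2 m B * 2 ^ K" using n4 4(1) by simp
            thus "runs fl b (NAssign ''F'' (NConst 1)) s4 20 Q"
              by (intro runs_time[OF runs_NAssign] pass[OF close]) (use c4 K bb in \<open>auto simp: nat_bits_num found_def vec_def\<close>)
          qed
          thus "runs fl b ?if s4 100 Q" by (rule runs_time) (simp add: nat_bits_num)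
        qed (use K in auto)
      next
        fix k assume k: fl "k \<le> m"
        have "fits (3 * (m * N0)) (\<Sum>j<k. B j * B j)"
          by (rule fits_vec_prod[OF k(1) bb(2) bb(2) k(2)]) (use k m_le[OF k(1)] in \<open>auto simp: algebra_simps\<close>)
        thus "fits b (\<Sum>j<k. B j * B j)" by (rule fitsX) (use k m_le[OF k(1)] in auto)
      qed (use c2 b2 in \<open>auto simp: vec_def\<close>)
    qed
  qed
qed

lemma runs_Output:
  assumes s: "found B s" and B: "\<And>j. j < m \<Longrightarrow> \<bar>B j\<bar> < 2 ^ M \<and> (fl \<longrightarrow> fits N0 (B j))"
    and Q: "\<And>s'. (\<And>j. j < m \<Longrightarrow> cell s' ''W'' j = of_int \<lfloor>B j * 2 ^ K\<rfloor> / 2 ^ K) \<Longrightarrow> frame Output s s' \<Longrightarrow> Q s'"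
  shows "runs fl b Output s (m * ((M + K) * 200 + 300) + 20) Q"
proof -
  let ?c = "Seq (RAssign ''r'' (NConst 0) (Rc ''B'' ''i'')) (Seq Round (RAssign ''W'' (NVar ''i'') (R0 ''y'')))"
  let ?w = "\<lambda>j. of_int \<lfloor>B j * 2 ^ K\<rfloor> / 2 ^ K :: real"
  define I where "I k s' \<longleftrightarrow> (\<forall>j<k. cell s' ''W'' j = ?w j)" for k and s' :: state
  have KJ: "K \<le> J" by (simp add: J_def)
  have rb: "2 * M + K + 2 \<le> b" if fl using round_bits[OF that] KJ by linarith
  have wf: "fits b (?w j)" if fl "j < m" for j
  proof -
    have "\<bar>B j * 2 ^ K\<bar> \<le> 2 ^ M * 2 ^ K" unfolding abs_mult using B[OF that(2)] by (intro mult_mono) auto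
    hence "\<bar>B j * 2 ^ K\<bar> \<le> of_int (2 ^ (M + K))" by (simp add: power_add)
    hence "\<bar>\<lfloor>B j * 2 ^ K\<rfloor>\<bar> \<le> 2 ^ (M + K)" by linarith
    also have "(2::int) ^ (M + K) < 2 ^ (M + K + 1)" by (rule power_strict_increasing) auto
    finally have "\<bar>\<lfloor>B j * 2 ^ K\<rfloor>\<bar> < 2 ^ (M + K + 1)" .
    moreover have "(2::int) ^ K \<le> 2 ^ (M + K + 1)" by (rule power_increasing) auto
    ultimately have "fits (M + K + 1) (?w j)" by (intro fitsI[where q = "2 ^ K"]) auto
    thus ?thesis by (rule fits_mono) (use rb[OF that(1)] in simp)
  qed
  have c: "counter s ''m'' = m" "counter s ''K'' = K" "counter s ''M'' = M" "cell s ''H'' 0 = 2 ^ M" "vec ''B'' s B"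
    using s by (simp_all add: found_def)
  have N0b: "N0 \<le> b" if fl using N0_le_b[OF that] by linarith
  let ?s = "set_counter ''R'' (nval s (NPlus (NVar ''M'') (NVar ''K''))) s"
  have "runs fl b (Seq (NAssign ''R'' (NPlus (NVar ''M'') (NVar ''K''))) (For ''i'' ''m'' ?c)) s
     (1 + nwt (NPlus (NVar ''M'') (NVar ''K'')) + (m * (((1 + nwt (NConst 0) + rwt (Rc ''B'' ''i'')) +
       (((M + K) * 200 + 200) + (1 + nwt (NVar ''i'') + rwt (R0 ''y'')))) + 11) + 6)) (I m)"
  proof (rule runs_NAssign_Seq, rule runs_For[where I = I])
    fix k s' assume k: "k < m" "I k s'" "counter s' ''i'' = k" "frame (For ''i'' ''m'' ?c) ?s s'"
    have c': "counter s' ''R'' = M + K" "cell s' ''H'' 0 = 2 ^ M" "cell s' ''B'' k = B k"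
      using c k by (simp_all add: frame_def vec_def)
    let ?s' = "set_cell ''r'' (nval s' (NConst 0)) (rval s' (Rc ''B'' ''i'')) s'"
    show "runs fl b ?c s' ((1 + nwt (NConst 0) + rwt (Rc ''B'' ''i'')) +
       (((M + K) * 200 + 200) + (1 + nwt (NVar ''i'') + rwt (R0 ''y'')))) (I (Suc k))"
    proof (rule runs_RAssign_Seq, rule runs_Seq, rule runs_Round[where x = "B k" and J = K])
      show "cell ?s' ''r'' 0 = B k" "cell ?s' ''H'' 0 = 2 ^ M" "counter ?s' ''R'' = M + K" using c' k by simp_all
      show "\<bar>B k\<bar> < 2 ^ M" using B[OF k(1)] by blast
      show "2 * M + K + 2 \<le> b" if fl using rb[OF that] .
      show "fits b (rval s' (Rc ''B'' ''i''))" if fl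
        using B[OF k(1)] that c' k fits_mono[OF _ N0b[OF that]] by simp
      fix s2 assume y: "cell s2 ''y'' 0 = ?w k" and fr: "frame Round ?s' s2"
      have c2: "cell s2 ''W'' = cell s' ''W''" "counter s2 ''i'' = k" using fr k by (simp_all add: frame_def)
      show "runs fl b (RAssign ''W'' (NVar ''i'') (R0 ''y'')) s2 (1 + nwt (NVar ''i'') + rwt (R0 ''y'')) (I (Suc k))"
        using k wf y c2 by (intro runs_RAssign) (auto simp: I_def less_Suc_eq)
    qed
  next
    show "nval s (NPlus (NVar ''M'') (NVar ''K'')) < 2 ^ b" if fl
    proof -
      have "M + K \<le> 2 * M + K + 2" by simp
      also have "\<dots> \<le> b" by (rule rb[OF that])
      also have "b < 2 ^ b" by (rule less_exp)
      finally show ?thesis using c by simp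
    qed
  qed (use c in \<open>auto simp: I_def\<close>)
  hence "runs fl b Output s (m * ((M + K) * 200 + 300) + 20) (I m)"
    unfolding Output_def by (rule runs_time) (simp add: algebra_simps)
  thus ?thesis by (rule runs_weaken) (use Q in \<open>auto simp: I_def\<close>)
qed

end

lemma nrm2_le_twice: "nrm2 m u \<le> 2 * nrm2 m v + 2 * nrm2 m (\<lambda>j. u j - v j)"
proof -
  have "u j * u j \<le> 2 * (v j * v j) + 2 * ((u j - v j) * (u j - v j))" for j
    using zero_le_square[of "u j - 2 * v j"] by (simp add: algebra_simps)
  hence "nrm2 m u \<le> (\<Sum>j<m. 2 * (v j * v j) + 2 * ((u j - v j) * (u j - v j)))"
    unfolding ip_def by (intro sum_mono)
  thus ?thesis by (simp add: ip_def sum.distrib sum_distrib_left)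
qed

lemma nrm2_minus_commute: "nrm2 m (\<lambda>j. u j - v j) = nrm2 m (\<lambda>j. v j - u j)"
  by (simp add: ip_def algebra_simps)

text \<open>Let h = 1 / 2 ^ k; the squared distance of \<open>B\<close> from \<open>z\<close> is at
  most h^2, hence at most h. Stopping at |B|^2 \<ge> 16 h gives |z|^2 \<ge> 7 h, and failing gives
  |z|^2 \<le> 34 h. A stop right after a failure thus has |z|^2 < 128 h for its own h, the window of
  \<open>cnd_exists\<close>.\<close>

lemma stopped_precision:
  assumes B: "nrm2 m (\<lambda>j. B j - z j) \<le> (1 / 2 ^ k)\<^sup>2"
  shows "16 \<le> nrm2 m B * 2 ^ k \<Longrightarrow> 1 / 2 ^ k \<le> nrm2 m z / 7"
    and "nrm2 m B * 2 ^ k < 16 \<Longrightarrow> nrm2 m z / 64 < 1 / 2 ^ k"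
proof -
  define h where "h = (1::real) / 2 ^ k"
  have h: "0 < h" "h \<le> 1" by (simp_all add: h_def)
  have "h * h \<le> 1 * h" using h by (intro mult_right_mono) auto
  hence d: "nrm2 m (\<lambda>j. B j - z j) \<le> h" using B by (simp add: h_def[symmetric] power2_eq_square)
  show "1 / 2 ^ k \<le> nrm2 m z / 7" if "16 \<le> nrm2 m B * 2 ^ k"
  proof -
    have "16 * h \<le> nrm2 m B" using that by (simp add: h_def field_simps)
    thus ?thesis using nrm2_le_twice[of m B z] d unfolding h_def[symmetric] by linarith
  qed
  show "nrm2 m z / 64 < 1 / 2 ^ k" if "nrm2 m B * 2 ^ k < 16"
  proof -
    have "nrm2 m B < 16 * h" using that by (simp add: h_def field_simps)
    thus ?thesis using nrm2_le_twice[of m z B] nrm2_minus_commute[of m z B] d h unfolding h_def[symmetric] by linarith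
  qed
qed

text \<open>\<open>Kp\<close> is an exponent by which the search must have stopped. The program does
  not know it; it bounds the number of attempts and, on rational data, the bit length common to all
  of them.\<close>

locale search =
  fixes m n :: nat and a :: "nat \<Rightarrow> nat \<Rightarrow> real" and z :: "nat \<Rightarrow> real" and fl :: bool and b N0 Kp :: nat
  assumes m0: "0 < m" and n0: "0 < n" and a1: "\<And>i. i < n \<Longrightarrow> (\<Sum>j<m. \<bar>a i j\<bar>) \<le> 1"
    and z: "mnp m {..<n} a z" and Kp: "64 / 2 ^ Kp \<le> nrm2 m z"
    and N0: "fl \<Longrightarrow> ellipsoid.T m Kp + ellipsoid.J m Kp + 10 \<le> N0" and b: "fl \<Longrightarrow> 100 * (m * (m * N0)) \<le> b"
    and a_fits: "\<And>i j. fl \<Longrightarrow> i < n \<Longrightarrow> j < m \<Longrightarrow> fits N0 (a i j)"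
begin

lemma run: "k \<le> Kp \<Longrightarrow> ellipsoid_run m n a k fl b N0"
proof
  assume k: "k \<le> Kp"
  show "ellipsoid.T m k + ellipsoid.J m k + 10 \<le> N0" if fl
  proof -
    have "ellipsoid.T m k + ellipsoid.J m k \<le> ellipsoid.T m Kp + ellipsoid.J m Kp"
      unfolding ellipsoid.T_def ellipsoid.J_def using k by (intro add_mono mult_le_mono order_refl)
    thus ?thesis using N0[OF that] by linarith
  qed
qed (use m0 n0 b a_fits in auto)

lemma runs_Search:
  assumes s: "counter s ''m'' = m" "counter s ''n'' = n" "\<And>i j. i < n \<Longrightarrow> j < m \<Longrightarrow> cell s ''A'' (i * m + j) = a i j"
    and Q: "\<And>s' k B. k \<le> Kp \<Longrightarrow> 1 / 2 ^ k \<le> nrm2 m z / 7 \<Longrightarrow> nrm2 m z / 128 < 1 / 2 ^ k \<Longrightarrow>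
      nrm2 m (\<lambda>j. B j - z j) \<le> (1 / 2 ^ k)\<^sup>2 \<Longrightarrow>
      (\<And>j. j < m \<Longrightarrow> \<bar>B j\<bar> < 2 ^ ellipsoid_run.M m k \<and> (fl \<longrightarrow> fits N0 (B j))) \<Longrightarrow>
      ellipsoid_run.found m k B s' \<Longrightarrow> Q s'"
  shows "runs fl b Search s ((Kp + 1) * (n * (m * (m * N0)) * N0 * 10000 + 10) + 20) Q"
proof -
  define D where "D k B s' \<longleftrightarrow> k \<le> Kp \<and> 1 / 2 ^ k \<le> nrm2 m z / 7 \<and> nrm2 m z / 128 < 1 / 2 ^ k \<and>
      nrm2 m (\<lambda>j. B j - z j) \<le> (1 / 2 ^ k)\<^sup>2 \<and>
      (\<forall>j<m. \<bar>B j\<bar> < 2 ^ ellipsoid_run.M m k \<and> (fl \<longrightarrow> fits N0 (B j))) \<and> ellipsoid_run.found m k B s'" for k B s'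
  \<comment> \<open>While the search runs, the inequality with 128 records the failure of the
    preceding exponent; at exponent 0 it holds because |z| is at most 1.\<close>
  define I where "I k s' \<longleftrightarrow> (counter s' ''F'' = 0 \<and> counter s' ''K'' = k \<and> k \<le> Kp \<and> nrm2 m z / 128 < 1 / 2 ^ k) \<or>
      (counter s' ''F'' = 1 \<and> (\<exists>k B. D k B s'))" for k s'
  let ?c = "n * (m * (m * N0)) * N0 * 10000" and ?e = "NLess (NVar ''F'') (NConst 1)"
  let ?s = "set_counter ''F'' 0 (set_counter ''K'' 0 s)"
  have "nrm2 m z \<le> 1" by (rule ellipsoid_conv.z_nrm[of m n a z]) (unfold_locales, use m0 n0 a1 z in auto)
  hence I0: "I 0 ?s" by (simp add: I_def)
  have loop: "runs fl b (While ?e Body) ?s ((Kp + 1) * (1 + bwt ?e + ?c) + 1 + bwt ?e) Q"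
  proof (rule runs_While[where I = I, OF I0])
    fix k s' assume k: "I k s'" "frame (While ?e Body) ?s s'" "bval s' ?e"
    hence F: "counter s' ''F'' = 0" "counter s' ''K'' = k" "k \<le> Kp" "nrm2 m z / 128 < 1 / 2 ^ k" by (auto simp: I_def)
    interpret ellipsoid_run m n a k fl b N0 by (rule run[OF F(3)])
    have s': "counter s' ''m'' = m" "counter s' ''n'' = n" "\<And>i j. i < n \<Longrightarrow> j < m \<Longrightarrow> cell s' ''A'' (i * m + j) = a i j"
      using s k(2) by (simp_all add: frame_def)
    have "runs fl b Body s' ?c (I (Suc k))"
    proof (rule runs_weaken'[OF _ _ bodycost], rule runs_Body[OF a1 z s'(1,2) F(2) s'(3)])
      fix s2 :: state and B assume B: "nrm2 m (\<lambda>j. B j - z j) \<le> (1 / 2 ^ k)\<^sup>2" "nrm2 m B * 2 ^ k < 16"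
        and c: "counter s2 ''F'' = counter s' ''F''" "counter s2 ''K'' = k + 1"
      have "nrm2 m z / 64 < 1 / 2 ^ k" by (rule stopped_precision(2)[OF B])
      moreover have "k \<noteq> Kp" using calculation Kp by auto
      ultimately show "I (Suc k) s2" using c F(1,3) by (simp add: I_def)
    next
      fix s2 B assume B: "nrm2 m (\<lambda>j. B j - z j) \<le> (1 / 2 ^ k)\<^sup>2" "16 \<le> nrm2 m B * 2 ^ k"
        and c: "\<And>j. j < m \<Longrightarrow> \<bar>B j\<bar> < 2 ^ M \<and> (fl \<longrightarrow> fits N0 (B j))" "found B s2" "counter s2 ''F'' = 1"
      have "D k B s2" unfolding D_def using F B(1) c stopped_precision(1)[OF B] by simp
      thus "I (Suc k) s2" using c(3) by (auto simp: I_def)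
    qed
    thus "k < Kp + 1 \<and> runs fl b Body s' ?c (I (Suc k))" using F(3) by simp
  next
    fix k s' assume "I k s'" "\<not> bval s' ?e"
    then obtain k B where "D k B s'" by (auto simp: I_def)
    thus "Q s'" by (intro Q[of k B]) (auto simp: D_def)
  qed
  have "runs fl b Search s ((1 + nwt (NConst 0)) + ((1 + nwt (NConst 0)) + ((Kp + 1) * (1 + bwt ?e + ?c) + 1 + bwt ?e))) Q"
    unfolding Search_def by (rule runs_NAssign_Seq, rule runs_NAssign_Seq) (use loop in simp_all)
  thus ?thesis by (rule runs_time) (simp add: algebra_simps)
qed

end

section \<open>Scaling the input, training and prediction\<close>

abbreviation Xij :: rexp where
  "Xij \<equiv> RCell ''X'' (NPlus (NTimes (NVar ''i'') (NVar ''d'')) (NVar ''j''))"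

definition Row :: com where
  "Row = Seq (Sum ''t'' ''j'' ''d'' (RTimes Xij Xij))
     (Seq (RAssign ''t'' (NConst 0) (RPlus (R0 ''t'') (RNat (NVar ''m''))))
     (Seq (Fill ''A'' ''j'' ''d'' (ixm ''i'' ''j'') (RDivide (RTimes (Rc ''Y'' ''i'') Xij) (R0 ''t'')))
       (RAssign ''A'' (NPlus (NTimes (NVar ''i'') (NVar ''m'')) (NVar ''d'')) (RDivide (Rc ''Y'' ''i'') (R0 ''t'')))))"

definition Norm :: com where
  "Norm = Seq (NAssign ''m'' (NPlus (NVar ''d'') (NConst 1))) (For ''i'' ''n'' Row)"

text \<open>For an empty sample there is no minimum-norm point. The weights then keep their initial
  value 0, and the prediction is constantly 1.\<close>

definition Train :: com where
  "Train = If (NLess (NConst 0) (NVar ''n'')) (Seq Norm (Seq Search Output)) Skip"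

definition Predict :: com where
  "Predict = Seq (Sum ''v'' ''j'' ''d'' (RTimes (Rc ''W'' ''j'') (Rc ''x'' ''j'')))
     (If (RLess (RPlus (R0 ''v'') (RCell ''W'' (NVar ''d''))) (RConst 0))
       (RAssign ''label'' (NConst 0) (RConst (-1))) (RAssign ''label'' (NConst 0) (RConst 1)))"

lemma vars_Row [simp]: "cvars Row = {''j''}" "rvars Row = {''t'', ''A''}"
  by (auto simp: Row_def)
lemma vars_Norm [simp]: "cvars Norm = {''m'', ''i'', ''j''}" "rvars Norm = {''t'', ''A''}"
  by (auto simp: Norm_def)
text \<open>Prediction reads the dimension from the state left by training.\<close>

lemma vars_Train: "''d'' \<notin> cvars Train"
  by (simp add: Train_def)

definition abits :: "nat \<Rightarrow> nat \<Rightarrow> nat" where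
  "abits d L = d * (2 * L + 1) + d + L + 4"

lemma denom_fits:
  assumes x: "\<And>j. j < d \<Longrightarrow> fits L (x j)"
  shows "k \<le> d \<Longrightarrow> fits (d * (2 * L + 1)) (\<Sum>l<k. x l * x l)"
    and "fits (d * (2 * L + 1) + d + 2) ((\<Sum>l<d. x l * x l) + real (d + 1))"
proof -
  show s: "fits (d * (2 * L + 1)) (\<Sum>l<k. x l * x l)" if "k \<le> d" for k
    by (rule fits_sum_le[where N = d and r = "2 * L"])
      (use that x in \<open>auto simp: mult_2 intro!: fits_mult\<close>)
  have "fits (d + 1) (real (d + 1))" by (rule fits_of_nat) (rule less_exp)
  from fits_add[OF s[OF order_refl] this]
  show "fits (d * (2 * L + 1) + d + 2) ((\<Sum>l<d. x l * x l) + real (d + 1))" by (rule fits_mono) simp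
qed

lemma avec_eq:
  "avec d z j = (if j < d then of_int (snd z) * fst z j else of_int (snd z)) / ((\<Sum>l<d. fst z l * fst z l) + real (d + 1))"
  by (simp add: avec_def power2_eq_square add.commute)

lemma avec_fits:
  assumes x: "\<And>j. j < d \<Longrightarrow> fits L (fst z j)" and y: "snd z \<in> labels"
  shows "fits (abits d L) (avec d z j)"
proof -
  have y1: "fits 1 (real_of_int (snd z))" using y by (intro fits_of_int) auto
  have "fits (1 + L) (if j < d then of_int (snd z) * fst z j else of_int (snd z))"
    using fits_mult[OF y1 x] fits_mono[OF y1, of "1 + L"] by auto
  from fits_divide[OF this denom_fits(2)[of d L "fst z", OF x]]
  show ?thesis unfolding avec_eq by (rule fits_mono) (simp_all add: abits_def)
qed

lemma row_index_less: "i < k \<Longrightarrow> j < m \<Longrightarrow> i * m + j < k * (m::nat)"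
proof -
  assume "i < k" "j < m"
  hence "i * m + j < Suc i * m" by simp
  also have "\<dots> \<le> k * m" using \<open>i < k\<close> by (intro mult_le_mono1) auto
  finally show ?thesis .
qed

lemma runs_Row:
  assumes c: "counter s ''d'' = d" "counter s ''m'' = d + 1" "counter s ''i'' = k"
    and X: "\<And>j. j < d \<Longrightarrow> cell s ''X'' (k * d + j) = fst z j" and Y: "cell s ''Y'' k = of_int (snd z)"
    and y: "snd z \<in> labels" and L: "\<And>j. fl \<Longrightarrow> j < d \<Longrightarrow> fits L (fst z j)" and b: "fl \<Longrightarrow> abits d L \<le> b"
    and Q: "\<And>s'. (\<And>j. j < d + 1 \<Longrightarrow> cell s' ''A'' (k * (d + 1) + j) = avec d z j) \<Longrightarrow>
      (\<And>l. l < k * (d + 1) \<Longrightarrow> cell s' ''A'' l = cell s ''A'' l) \<Longrightarrow> Q s'"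
  shows "runs fl b Row s (d * 300 + 200) Q"
proof -
  let ?D = "(\<Sum>l<d. fst z l * fst z l) + real (d + 1)"
  let ?e = "RDivide (RTimes (Rc ''Y'' ''i'') Xij) (R0 ''t'')"
  let ?fill = "Fill ''A'' ''j'' ''d'' (ixm ''i'' ''j'') ?e"
  let ?last = "RAssign ''A'' (NPlus (NTimes (NVar ''i'') (NVar ''m'')) (NVar ''d'')) (RDivide (Rc ''Y'' ''i'') (R0 ''t''))"
  let ?n3 = "d * (nwt (ixm ''i'' ''j'') + rwt ?e + 12) + 6"
  let ?n4 = "1 + nwt (NPlus (NTimes (NVar ''i'') (NVar ''m'')) (NVar ''d'')) + rwt (RDivide (Rc ''Y'' ''i'') (R0 ''t''))"
  let ?n2 = "1 + nwt (NConst 0) + rwt (RPlus (R0 ''t'') (RNat (NVar ''m'')))"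
  have af: "fits b (avec d z j)" if fl for j by (rule fits_mono[OF avec_fits[OF L y] b]) (use that in auto)
  have "runs fl b Row s ((d * (rwt (RTimes Xij Xij) + 2 * rsz (RTimes Xij Xij) + 30) + 20) + (?n2 + (?n3 + ?n4))) Q"
    unfolding Row_def
  proof (rule runs_Seq, rule runs_Sum[where f = "\<lambda>j. fst z j * fst z j"])
    fix s1 assume 1: "cell s1 ''t'' 0 = (\<Sum>j<d. fst z j * fst z j)" "frame (Sum ''t'' ''j'' ''d'' (RTimes Xij Xij)) s s1"
    have c1: "counter s1 ''d'' = d" "counter s1 ''m'' = d + 1" "counter s1 ''i'' = k" "cell s1 ''X'' = cell s ''X''"
      "cell s1 ''Y'' = cell s ''Y''" "cell s1 ''A'' = cell s ''A''"
      using c 1(2) by (simp_all add: frame_def)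
    define s2 where "s2 = set_cell ''t'' (nval s1 (NConst 0)) (rval s1 (RPlus (R0 ''t'') (RNat (NVar ''m'')))) s1"
    have c2: "counter s2 ''d'' = d" "counter s2 ''m'' = d + 1" "counter s2 ''i'' = k" "cell s2 ''X'' = cell s ''X''"
      "cell s2 ''Y'' = cell s ''Y''" "cell s2 ''A'' = cell s ''A''" "cell s2 ''t'' 0 = ?D"
      using c1 1(1) by (simp_all add: s2_def)
    show "runs fl b (Seq (RAssign ''t'' (NConst 0) (RPlus (R0 ''t'') (RNat (NVar ''m'')))) (Seq ?fill ?last)) s1 (?n2 + (?n3 + ?n4)) Q"
    proof (rule runs_RAssign_Seq, fold s2_def)
      show "fits b (rval s1 (RPlus (R0 ''t'') (RNat (NVar ''m''))))" if fl
      proof -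
        have "fits b ?D" by (rule fits_mono[OF denom_fits(2)[of d L "fst z"]]) (use that L b[OF that] in \<open>auto simp: abits_def\<close>)
        thus ?thesis using 1(1) c1 by simp
      qed
      show "runs fl b (Seq ?fill ?last) s2 (?n3 + ?n4) Q"
      proof (rule runs_Seq, rule runs_Fill[where f = "\<lambda>j. avec d z j" and ?o0.0 = "k * (d + 1)"])
        fix s3 assume 3: "\<And>j. j < d \<Longrightarrow> cell s3 ''A'' (k * (d + 1) + j) = avec d z j"
          "\<And>l. l < k * (d + 1) \<or> k * (d + 1) + d \<le> l \<Longrightarrow> cell s3 ''A'' l = cell s2 ''A'' l" "frame ?fill s2 s3"
        have c3: "counter s3 ''d'' = d" "counter s3 ''m'' = d + 1" "counter s3 ''i'' = k" "cell s3 ''Y'' k = of_int (snd z)" "cell s3 ''t'' 0 = ?D"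
          using c2 3(3) Y by (simp_all add: frame_def)
        have v: "rval s3 (RDivide (Rc ''Y'' ''i'') (R0 ''t'')) = avec d z d" "nval s3 (NPlus (NTimes (NVar ''i'') (NVar ''m'')) (NVar ''d'')) = k * (d + 1) + d"
          using c3 by (simp_all add: avec_eq)
        show "runs fl b ?last s3 ?n4 Q"
        proof (rule runs_RAssign, goal_cases)
          case 1 show ?case unfolding v by (rule af[OF 1])
        next
          case 2 show ?case unfolding v
          proof (rule Q)
            fix j assume "j < d + 1"
            thus "cell (set_cell ''A'' (k * (d + 1) + d) (avec d z d) s3) ''A'' (k * (d + 1) + j) = avec d z j"
              using 3(1)[of j] by (cases "j = d") auto
          next
            fix l assume l: "l < k * (d + 1)"
            hence "l \<noteq> k * (d + 1) + d" by linarith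
            thus "cell (set_cell ''A'' (k * (d + 1) + d) (avec d z d) s3) ''A'' l = cell s ''A'' l"
              using 3(2)[of l] l c2 by simp
          qed
        qed
      next
        show "rval s' ?e = avec d z j \<and> nval s' (ixm ''i'' ''j'') = k * (d + 1) + j"
          if "j < d" "counter s' ''j'' = j" "\<And>w. w \<noteq> ''j'' \<Longrightarrow> counter s' w = counter s2 w" "\<And>w. w \<noteq> ''A'' \<Longrightarrow> cell s' w = cell s2 w" for j s'
          using that c2 X Y by (simp add: avec_eq)
      qed (use c2 af in auto)
    qed
  next
    show "fits b (\<Sum>j<k'. fst z j * fst z j)" if fl "k' \<le> d" for k'
      by (rule fits_mono[OF denom_fits(1)[of d L "fst z"]]) (use that L b[OF that(1)] in \<open>auto simp: abits_def\<close>)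
  qed (use c X in auto)
  thus ?thesis by (rule runs_time) (simp add: algebra_simps)
qed

lemma runs_Norm:
  assumes c: "counter s ''d'' = d" "counter s ''n'' = n"
    and X: "\<And>i j. i < n \<Longrightarrow> j < d \<Longrightarrow> cell s ''X'' (i * d + j) = fst (S i) j" and Y: "\<And>i. i < n \<Longrightarrow> cell s ''Y'' i = of_int (snd (S i))"
    and y: "\<And>i. i < n \<Longrightarrow> snd (S i) \<in> labels" and L: "\<And>i j. fl \<Longrightarrow> i < n \<Longrightarrow> j < d \<Longrightarrow> fits L (fst (S i) j)" and b: "fl \<Longrightarrow> abits d L \<le> b"
    and Q: "\<And>s'. counter s' ''m'' = d + 1 \<Longrightarrow> counter s' ''n'' = n \<Longrightarrow>
      (\<And>i j. i < n \<Longrightarrow> j < d + 1 \<Longrightarrow> cell s' ''A'' (i * (d + 1) + j) = avec d (S i) j) \<Longrightarrow> Q s'"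
  shows "runs fl b Norm s (n * (d * 300 + 220) + 20) Q"
proof -
  define I where "I k s' \<longleftrightarrow> (\<forall>i<k. \<forall>j<d + 1. cell s' ''A'' (i * (d + 1) + j) = avec d (S i) j)" for k and s' :: state
  let ?s = "set_counter ''m'' (nval s (NPlus (NVar ''d'') (NConst 1))) s"
  have "runs fl b Norm s (1 + nwt (NPlus (NVar ''d'') (NConst 1)) + (n * ((d * 300 + 200) + 11) + 6)) Q"
    unfolding Norm_def
  proof (rule runs_NAssign_Seq, rule runs_For[where I = I])
    fix k s' assume k: "k < n" "I k s'" "counter s' ''i'' = k" "frame (For ''i'' ''n'' Row) ?s s'"
    have c': "counter s' ''d'' = d" "counter s' ''m'' = d + 1" "cell s' ''X'' = cell s ''X''" "cell s' ''Y'' = cell s ''Y''"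
      using c k(4) by (simp_all add: frame_def)
    show "runs fl b Row s' (d * 300 + 200) (I (Suc k))"
    proof (rule runs_Row[where z = "S k" and L = L, OF c'(1,2) k(3)])
      fix s2 :: state assume 2: "\<And>j. j < d + 1 \<Longrightarrow> cell s2 ''A'' (k * (d + 1) + j) = avec d (S k) j"
        "\<And>l. l < k * (d + 1) \<Longrightarrow> cell s2 ''A'' l = cell s' ''A'' l"
      have "cell s2 ''A'' (i * (d + 1) + j) = avec d (S i) j" if "i < Suc k" "j < d + 1" for i j
      proof (cases "i = k")
        case False
        hence "i < k" using that by simp
        thus ?thesis using 2(2)[OF row_index_less[OF _ that(2)], of i] k(2) that(2) by (simp add: I_def)
      qed (use 2(1) that in blast)
      thus "I (Suc k) s2" by (simp add: I_def)
    qed (use c' X Y y L b k(1) in auto)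
  next
    fix s' assume "I n s'" "frame (For ''i'' ''n'' Row) ?s s'"
    thus "Q s'" using c by (intro Q) (auto simp: I_def frame_def)
  next
    show "nval s (NPlus (NVar ''d'') (NConst 1)) < 2 ^ b" if fl
    proof -
      have "d + 1 \<le> abits d L" by (simp add: abits_def)
      also note b[OF that]
      also have "b < 2 ^ b" by (rule less_exp)
      finally show ?thesis using c by simp
    qed
  qed (use c in \<open>auto simp: I_def\<close>)
  thus ?thesis by (rule runs_time) (simp add: algebra_simps)
qed

lemma runs_Predict:
  assumes c: "counter s ''d'' = d" and x: "\<And>j. j < d \<Longrightarrow> cell s ''x'' j = x j"
    and f: "\<And>j. fl \<Longrightarrow> fits B (cell s ''W'' j)" "\<And>j. fl \<Longrightarrow> j < d \<Longrightarrow> fits B (x j)" and b: "fl \<Longrightarrow> d * (2 * B + 1) + 2 \<le> b"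
  shows "runs fl b Predict s (d * 100 + 100) (\<lambda>s'. cell s' ''label'' 0 = of_int (halfspace d (cell s ''W'') (cell s ''W'' d) x))"
    (is "runs _ _ _ _ _ ?Q")
proof -
  let ?e = "RTimes (Rc ''W'' ''j'') (Rc ''x'' ''j'')" and ?W = "cell s ''W''"
  let ?t = "RLess (RPlus (R0 ''v'') (RCell ''W'' (NVar ''d''))) (RConst 0)"
  let ?if = "If ?t (RAssign ''label'' (NConst 0) (RConst (-1))) (RAssign ''label'' (NConst 0) (RConst 1))"
  have "runs fl b Predict s ((d * (rwt ?e + 2 * rsz ?e + 30) + 20) + (1 + bwt ?t + 20)) ?Q"
    unfolding Predict_def
  proof (rule runs_Seq, rule runs_Sum[where f = "\<lambda>j. ?W j * x j"])
    fix s1 assume 1: "cell s1 ''v'' 0 = (\<Sum>j<d. ?W j * x j)" "frame (Sum ''v'' ''j'' ''d'' ?e) s s1"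
    have c1: "counter s1 ''d'' = d" "cell s1 ''W'' = ?W" using c 1(2) by (simp_all add: frame_def)
    have f1: "fits b 1" if fl using b[OF that] by (intro fits_1) linarith
    hence f2: "fits b (-1)" if fl using fits_uminus[of b 1] that by simp
    show "runs fl b ?if s1 (1 + bwt ?t + 20) ?Q"
    proof (rule runs_If)
      assume "bval s1 ?t"
      hence "(\<Sum>j<d. ?W j * x j) + ?W d < 0" using 1(1) c1 by simp
      thus "runs fl b (RAssign ''label'' (NConst 0) (RConst (-1))) s1 20 ?Q"
        by (intro runs_time[OF runs_RAssign]) (use f1 f2 in \<open>auto simp: halfspace_def\<close>)
    next
      assume "\<not> bval s1 ?t"
      hence "0 \<le> (\<Sum>j<d. ?W j * x j) + ?W d" using 1(1) c1 by simp
      thus "runs fl b (RAssign ''label'' (NConst 0) (RConst 1)) s1 20 ?Q"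
        by (intro runs_time[OF runs_RAssign]) (use f1 f2 in \<open>auto simp: halfspace_def\<close>)
    qed
  next
    fix k assume k: fl "k \<le> d"
    show "fits b (\<Sum>j<k. ?W j * x j)"
    proof (rule fits_sum_le[where N = d and r = "2 * B"])
      show "fits (2 * B) (?W j * x j)" if "j < d" for j using fits_mult[OF f(1)[OF k(1)] f(2)[OF k(1) that]] by (simp add: mult_2)
      show "d * (2 * B + 1) \<le> b" using b[OF k(1)] by linarith
    qed (rule k(2))
  qed (use c x in auto)
  thus ?thesis by (rule runs_time) (simp add: algebra_simps)
qed

section \<open>Polynomial time and risk of the learner\<close>

lemma poly_mono_nat: "x \<le> y \<Longrightarrow> poly p x \<le> poly p (y :: nat)"
  by (induction p) (auto intro!: add_mono mult_mono)

text \<open>Closure under sums and products turns the explicit cost bounds into polynomials without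
  computing coefficients.\<close>

definition poly_bounded :: "(nat \<Rightarrow> nat) \<Rightarrow> bool" where
  "poly_bounded f \<longleftrightarrow> (\<exists>p. \<forall>x. f x \<le> poly p x)"

lemma poly_bounded_poly: "poly_bounded (poly p)"
  unfolding poly_bounded_def by blast

lemma poly_bounded_const: "poly_bounded (\<lambda>_. c)"
  unfolding poly_bounded_def by (rule exI[of _ "[:c:]"]) simp

lemma poly_bounded_id: "poly_bounded (\<lambda>x. x)"
  unfolding poly_bounded_def by (rule exI[of _ "[:0, 1:]"]) simp

lemma poly_bounded_add: "poly_bounded f \<Longrightarrow> poly_bounded g \<Longrightarrow> poly_bounded (\<lambda>x. f x + g x)"
proof -
  assume "poly_bounded f" "poly_bounded g"
  then obtain p q where "\<forall>x. f x \<le> poly p x" "\<forall>x. g x \<le> poly q x" unfolding poly_bounded_def by blast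
  hence "\<forall>x. f x + g x \<le> poly (p + q) x" by (simp add: add_mono)
  thus ?thesis unfolding poly_bounded_def by blast
qed

lemma poly_bounded_mult: "poly_bounded f \<Longrightarrow> poly_bounded g \<Longrightarrow> poly_bounded (\<lambda>x. f x * g x)"
proof -
  assume "poly_bounded f" "poly_bounded g"
  then obtain p q where "\<forall>x. f x \<le> poly p x" "\<forall>x. g x \<le> poly q x" unfolding poly_bounded_def by blast
  hence "\<forall>x. f x * g x \<le> poly (p * q) x" by (simp add: mult_le_mono)
  thus ?thesis unfolding poly_bounded_def by blast
qed

lemmas poly_bounded_intros = poly_bounded_poly poly_bounded_const poly_bounded_id poly_bounded_add poly_bounded_mult

text \<open>Let \<open>v\<close> exceed dimension, sample size and bit length of the data.  The following bound, in this
  order: the bit length of the vector \<open>avec\<close> of an example, the precision exponent at which the search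
  stops (by \<open>rational_margin\<close>), the bit length inside the ellipsoid method, the bit length of every
  stored number, and the number of unit steps.\<close>

definition "aN v = v * (2 * v + 1) + v + v + (4::nat)"
definition "Kv v = v * (v + 2) + 2 * (aN v * v * v * v) + 6"
definition "Nv v = 256 * v * v * (v + 4 * Kv v + 8) + (4 * Kv v + 5 * v + 20) + 10 + aN v"
definition "bv v = 100 * (v * (v * Nv v))"
definition "cv v = 100 + ((v * (v * 300 + 220) + 20) + (((Kv v + 1) * (v * (v * (v * Nv v)) * Nv v * 10000 + 10) + 20) + (v * (Nv v * 200 + 300) + 20)))"

lemma poly_bounded_bv: "poly_bounded (\<lambda>x. bv (x + 1))"
  unfolding bv_def Nv_def Kv_def aN_def by (intro poly_bounded_intros)

lemma poly_bounded_cost: "poly_bounded (\<lambda>x. cv (x + 1) * (bv (x + 1) + 1))"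
  unfolding cv_def bv_def Nv_def Kv_def aN_def by (intro poly_bounded_intros)

text \<open>The product of all denominators is a common denominator of at most
  \<open>2 ^ (A * n * m)\<close>. It enters the Gram determinant bound of
  \<open>mnp_basis_gram\<close>, with \<open>m\<close> bounded by \<open>2 ^ m\<close>; the final 6
  in the exponent provides the factor 64.\<close>

lemma rational_margin:
  assumes g: "0 < nrm2 m z" and z: "mnp m {..<n} a z"
    and a1: "\<And>i. i < n \<Longrightarrow> (\<Sum>j<m. \<bar>a i j\<bar>) \<le> 1" and af: "\<And>i j. i < n \<Longrightarrow> j < m \<Longrightarrow> fits A (a i j)"
  shows "64 / 2 ^ (m * (m + 2) + 2 * (A * n * m * m) + 6) \<le> nrm2 m z"
proof -
  have "\<forall>i j. \<exists>q :: int. i < n \<and> j < m \<longrightarrow> 0 < q \<and> q \<le> 2 ^ A \<and> of_int q * a i j \<in> \<int>"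
  proof (intro allI)
    fix i j
    show "\<exists>q :: int. i < n \<and> j < m \<longrightarrow> 0 < q \<and> q \<le> 2 ^ A \<and> of_int q * a i j \<in> \<int>"
    proof (cases "i < n \<and> j < m")
      case True
      then obtain p q :: int where pq: "a i j = of_int p / of_int q" "0 < q" "q \<le> 2 ^ A" using af[of i j] unfolding fits_def by blast
      hence "of_int q * a i j = of_int p" by simp
      with pq show ?thesis by (intro exI[of _ q]) simp
    qed blast
  qed
  then obtain q :: "nat \<Rightarrow> nat \<Rightarrow> int" where q: "\<And>i j. i < n \<Longrightarrow> j < m \<Longrightarrow> 0 < q i j"
    "\<And>i j. i < n \<Longrightarrow> j < m \<Longrightarrow> q i j \<le> 2 ^ A" "\<And>i j. i < n \<Longrightarrow> j < m \<Longrightarrow> of_int (q i j) * a i j \<in> \<int>" by metis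
  define r where "r = (\<Prod>i<n. \<Prod>j<m. q i j)"
  have r0: "0 < r" unfolding r_def by (intro prod_pos) (use q(1) in auto)
  have "r \<le> (\<Prod>i<n. \<Prod>j<m. 2 ^ A)"
    unfolding r_def by (intro prod_mono conjI prod_nonneg) (use q in \<open>auto intro: less_imp_le\<close>)
  hence r1: "r \<le> 2 ^ (A * n * m)" by (simp add: power_mult[symmetric] mult_ac)
  have ri: "of_int r * a i j \<in> \<int>" if "i < n" "j < m" for i j
  proof -
    have "q i j dvd (\<Prod>j<m. q i j)" using that by (intro dvd_prodI) auto
    also have "\<dots> dvd r" unfolding r_def using that by (intro dvd_prodI) auto
    finally obtain c where c: "r = q i j * c" by (rule dvdE)
    have "of_int r * a i j = of_int c * (of_int (q i j) * a i j)" by (simp add: c)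
    moreover have "of_int c * (of_int (q i j) * a i j) \<in> \<int>" by (rule Ints_mult[OF Ints_of_int q(3)[OF that]])
    ultimately show ?thesis by (simp only:)
  qed
  obtain B l where B: "B \<subseteq> {..<n}" "\<forall>i\<in>B. ip m (a i) z = nrm2 m z" "sum l B = 1"
    "z = (\<lambda>j. if j < m then \<Sum>i\<in>B. l i * a i j else 0)"
    and indep: "\<And>\<mu>. (\<And>j. j < m \<Longrightarrow> (\<Sum>i\<in>B. \<mu> i * a i j) = 0) \<Longrightarrow> \<forall>i\<in>B. \<mu> i = 0"
  proof (rule mnp_basis[OF z finite_lessThan g], goal_cases)
    case (1 B l)
    show ?case by (rule 1(1)[OF 1(2,4-6)]) (rule 1(7), blast)
  qed
  have finB: "finite B" using B(1) finite_subset by blast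
  have "1 \<le> nrm2 m z * real m ^ (m + 2) * of_int r ^ (2 * m)"
  proof (rule mnp_basis_gram(2)[OF finB B(2-4) indep _ r0])
    fix i assume "i \<in> B"
    hence i: "i < n" using B(1) by blast
    show "(\<Sum>j<m. \<bar>a i j\<bar>) \<le> 1" by (rule a1[OF i])
    show "of_int r * a i j \<in> \<int>" if "j < m" for j by (rule ri[OF i that])
  qed
  also have "\<dots> \<le> nrm2 m z * (2 ^ m) ^ (m + 2) * (2 ^ (A * n * m)) ^ (2 * m)"
  proof (rule mult_mono)
    have "m \<le> 2 ^ m" by (rule less_imp_le[OF less_exp])
    hence "real m \<le> real (2 ^ m)" by (simp only: of_nat_le_iff)
    hence "real m \<le> 2 ^ m" by simp
    hence "real m ^ (m + 2) \<le> (2 ^ m) ^ (m + 2)" by (rule power_mono) simp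
    thus "nrm2 m z * real m ^ (m + 2) \<le> nrm2 m z * (2 ^ m) ^ (m + 2)" by (rule mult_left_mono) (rule nrm2_nonneg)
    have "real_of_int r \<le> real_of_int (2 ^ (A * n * m))" using r1 by (simp only: of_int_le_iff)
    hence "real_of_int r \<le> 2 ^ (A * n * m)" by simp
    thus "real_of_int r ^ (2 * m) \<le> (2 ^ (A * n * m)) ^ (2 * m)" by (rule power_mono) (use r0 in simp)
    show "0 \<le> nrm2 m z * (2 ^ m) ^ (m + 2)" by (rule mult_nonneg_nonneg[OF nrm2_nonneg]) simp
    show "0 \<le> real_of_int r ^ (2 * m)" using r0 by simp
  qed
  also have "\<dots> = nrm2 m z * 2 ^ (m * (m + 2) + 2 * (A * n * m * m))"
  proof -
    have h: "A * n * m * (2 * m) = 2 * (A * n * m * m)" by simp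
    have 1: "((2::real) ^ m) ^ (m + 2) = 2 ^ (m * (m + 2))" by (rule power_mult[symmetric])
    have 2: "((2::real) ^ (A * n * m)) ^ (2 * m) = 2 ^ (2 * (A * n * m * m))"
      unfolding power_mult[symmetric] by (simp only: h)
    show ?thesis unfolding 1 2 by (simp only: power_add mult.assoc)
  qed
  finally have "64 * 1 \<le> 64 * (nrm2 m z * 2 ^ (m * (m + 2) + 2 * (A * n * m * m)))" by (rule mult_left_mono) simp
  also have "\<dots> = nrm2 m z * 2 ^ (m * (m + 2) + 2 * (A * n * m * m) + 6)" by (simp only: power_add) simp
  finally show ?thesis by (simp only: pos_divide_le_eq zero_less_power zero_less_numeral mult_1_right)
qed

lemma runs_Train:
  assumes d: "1 \<le> d" and y: "\<And>i. i < n \<Longrightarrow> snd (S i) \<in> labels"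
    and Kp: "0 < n \<Longrightarrow> 64 / 2 ^ Kp \<le> nrm2 (d + 1) (zp d {..<n} S)"
    and L: "\<And>i j. fl \<Longrightarrow> i < n \<Longrightarrow> j < d \<Longrightarrow> fits L (fst (S i) j)"
    and N0: "fl \<Longrightarrow> ellipsoid.T (d + 1) Kp + ellipsoid.J (d + 1) Kp + 10 + abits d L \<le> N0"
    and b: "fl \<Longrightarrow> 100 * ((d + 1) * ((d + 1) * N0)) \<le> b"
  shows "runs fl b Train (load_sample d n S) (100 + ((n * (d * 300 + 220) + 20) +
      (((Kp + 1) * (n * ((d + 1) * ((d + 1) * N0)) * N0 * 10000 + 10) + 20) + ((d + 1) * (N0 * 200 + 300) + 20))))
    (\<lambda>s. 0 < n \<longrightarrow> (\<exists>c\<in>codes (d + 1). \<forall>j<d + 1. cell s ''W'' j = cnd (d + 1) c (zp d {..<n} S) j) \<and>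
      (\<forall>i<n. halfspace d (cell s ''W'') (cell s ''W'' d) (fst (S i)) = snd (S i)))"
    (is "runs _ _ _ ?s (100 + ?n) ?Q")
proof -
  let ?m = "d + 1" and ?a = "\<lambda>i. avec d (S i)" and ?z = "zp d {..<n} S"
  have c: "counter ?s ''d'' = d" "counter ?s ''n'' = n" by (simp_all add: load_sample_def)
  have X: "cell ?s ''X'' (i * d + j) = fst (S i) j" if "i < n" "j < d" for i j
    using row_index_less[OF that] that by (simp add: load_sample_def)
  have Y: "cell ?s ''Y'' i = of_int (snd (S i))" if "i < n" for i using that by (simp add: load_sample_def)
  have "runs fl b Train ?s (1 + bwt (NLess (NConst 0) (NVar ''n'')) + ?n) ?Q"
    unfolding Train_def
  proof (rule runs_If)
    assume "bval ?s (NLess (NConst 0) (NVar ''n''))"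
    hence n: "0 < n" using c by simp
    have zm: "mnp ?m {..<n} ?a ?z" using n by (intro zp_mnp) auto
    have a1: "(\<Sum>j<?m. \<bar>?a i j\<bar>) \<le> 1" if "i < n" for i by (rule avec_l1[OF y[OF that]])
    have loc: "search ?m n ?a ?z fl b N0 Kp"
    proof
      show "fits N0 (?a i j)" if fl "i < n" "j < ?m" for i j
        by (rule fits_mono[OF avec_fits[OF L[OF that(1,2)] y[OF that(2)]]]) (use N0[OF that(1)] in simp_all)
    qed (use n a1 zm Kp N0 b in auto)
    have g: "0 < nrm2 ?m ?z" using Kp[OF n] less_le_trans[of 0 "64 / 2 ^ Kp" "nrm2 ?m ?z"] by simp
    have ab: "abits d L \<le> b" if fl
    proof -
      have "abits d L \<le> 1 * (1 * (1 * N0))" using N0[OF that] by simp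
      also have "\<dots> \<le> 100 * (?m * (?m * N0))" by (intro mult_le_mono) simp_all
      finally show ?thesis using b[OF that] by linarith
    qed
    show "runs fl b (Seq Norm (Seq Search Output)) ?s ?n ?Q"
    proof (rule runs_Seq, rule runs_Norm[where S = S and L = L, OF c X Y y L ab])
      fix s1 :: state assume 1: "counter s1 ''m'' = ?m" "counter s1 ''n'' = n"
        "\<And>i j. i < n \<Longrightarrow> j < ?m \<Longrightarrow> cell s1 ''A'' (i * ?m + j) = avec d (S i) j"
      show "runs fl b (Seq Search Output) s1 (((Kp + 1) * (n * (?m * (?m * N0)) * N0 * 10000 + 10) + 20) + (?m * (N0 * 200 + 300) + 20)) ?Q"
      proof (rule runs_Seq, rule search.runs_Search[OF loc 1])
        fix s2 k B
        assume k: "k \<le> Kp" "1 / 2 ^ k \<le> nrm2 ?m ?z / 7" "nrm2 ?m ?z / 128 < 1 / 2 ^ k"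
          and B: "nrm2 ?m (\<lambda>j. B j - ?z j) \<le> (1 / 2 ^ k)\<^sup>2"
          "\<And>j. j < ?m \<Longrightarrow> \<bar>B j\<bar> < 2 ^ ellipsoid_run.M ?m k \<and> (fl \<longrightarrow> fits N0 (B j))" "ellipsoid_run.found ?m k B s2"
        interpret er: ellipsoid_run ?m n ?a k fl b N0 by (rule search.run[OF loc k(1)])
        have Bz: "\<bar>B j - ?z j\<bar> \<le> 1 / 2 ^ k" if "j < ?m" for j
        proof -
          have "\<bar>B j - ?z j\<bar>\<^sup>2 \<le> (1 / 2 ^ k)\<^sup>2"
            using coord_le_nrm2[OF that, of "\<lambda>j. B j - ?z j"] B(1) unfolding power2_abs by (rule order_trans)
          thus ?thesis by (rule power2_le_imp_le) simp
        qed
        show "runs fl b Output s2 (?m * (N0 * 200 + 300) + 20) ?Q"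
        proof (rule runs_weaken'[OF er.runs_Output[OF B(3,2)]])
          show "?m * ((er.M + k) * 200 + 300) + 20 \<le> ?m * (N0 * 200 + 300) + 20" if fl
          proof -
            have "er.M + k \<le> er.T + er.J + 10" unfolding er.M_def er.J_def by simp
            also have "\<dots> \<le> N0" by (rule er.N0[OF that])
            finally show ?thesis by (intro add_mono mult_le_mono order_refl)
          qed
          fix s3 :: state assume W: "\<forall>j<?m. cell s3 ''W'' j = of_int \<lfloor>B j * 2 ^ k\<rfloor> / 2 ^ k"
          let ?W = "cell s3 ''W''"
          have "\<exists>c\<in>codes ?m. \<forall>j<?m. of_int \<lfloor>B j * 2 ^ k\<rfloor> / 2 ^ k = cnd ?m c ?z j"
            by (rule cnd_exists[OF g _ k(3) Bz]) (use k(2) g in auto)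
          hence "\<exists>c\<in>codes ?m. \<forall>j<?m. ?W j = cnd ?m c ?z j" using W by auto
          moreover have "halfspace d ?W (?W d) (fst (S i)) = snd (S i)" if i: "i < n" for i
          proof (rule halfspace_consistent[OF _ y[OF i]])
            \<comment> \<open>One \<open>1 / 2 ^ k\<close> is due to the method and one to the final
              rounding. Against examples of l1-norm at most 1 the loss is at most 2 / 2 ^ k, less
              than |z|^2, which is at least 7 / 2 ^ k.\<close>
            have "\<bar>?W j - ?z j\<bar> \<le> 2 * (1 / 2 ^ k)" if j: "j < ?m" for j
            proof -
              have "\<bar>of_int \<lfloor>B j * 2 ^ k\<rfloor> - B j * 2 ^ k\<bar> \<le> 1" by linarith
              hence "\<bar>of_int \<lfloor>B j * 2 ^ k\<rfloor> - B j * 2 ^ k\<bar> / 2 ^ k \<le> 1 / 2 ^ k" by (intro divide_right_mono) auto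
              moreover have "\<bar>of_int \<lfloor>B j * 2 ^ k\<rfloor> - B j * 2 ^ k\<bar> / 2 ^ k = \<bar>?W j - B j\<bar>"
              proof -
                have "?W j - B j = (of_int \<lfloor>B j * 2 ^ k\<rfloor> - B j * 2 ^ k) / 2 ^ k" using W j by (simp add: diff_divide_distrib)
                thus ?thesis by simp
              qed
              ultimately show ?thesis using Bz[OF j] by linarith
            qed
            hence "\<bar>ip ?m (\<lambda>j. ?W j - ?z j) (?a i)\<bar> \<le> 2 * (1 / 2 ^ k) * (\<Sum>j<?m. \<bar>?a i j\<bar>)" by (rule ip_bound1)
            also have "\<dots> \<le> 2 * (1 / 2 ^ k) * 1" using a1[OF i] by (intro mult_left_mono) auto
            finally have "\<bar>ip ?m ?W (?a i) - ip ?m ?z (?a i)\<bar> \<le> 2 * (1 / 2 ^ k)" by (simp only: ip_linear mult_1_right)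
            moreover have "nrm2 ?m ?z \<le> ip ?m (?a i) ?z" using zm i by (auto simp: mnp_def)
            ultimately show "0 < ip ?m (?a i) ?W"
              using k(2) g unfolding ip_commute[of ?m "?a i" ?W] ip_commute[of ?m "?a i" ?z] by linarith
          qed
          ultimately show "?Q s3" by blast
        qed auto
      qed
    qed
  next
    assume "\<not> bval ?s (NLess (NConst 0) (NVar ''n''))"
    thus "runs fl b Skip ?s ?n ?Q" using c by (intro runs_time[OF runs_Skip]) auto
  qed
  thus ?thesis by (rule runs_time) simp
qed

section \<open>The learner on arbitrary and on rational data\<close>

definition trained :: "nat \<Rightarrow> nat \<Rightarrow> sample \<Rightarrow> state \<Rightarrow> bool" where
  "trained d n S s \<longleftrightarrow> counter s ''d'' = d \<and> (0 < n \<longrightarrow>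
     (\<exists>c\<in>codes (d + 1). \<forall>j<d + 1. cell s ''W'' j = cnd (d + 1) c (zp d {..<n} S) j) \<and>
     (\<forall>i<n. halfspace d (cell s ''W'') (cell s ''W'' d) (fst (S i)) = snd (S i)))"

lemma trainedI:
  assumes "exec Train (load_sample d n S) t s"
    "0 < n \<longrightarrow> (\<exists>c\<in>codes (d + 1). \<forall>j<d + 1. cell s ''W'' j = cnd (d + 1) c (zp d {..<n} S) j) \<and>
      (\<forall>i<n. halfspace d (cell s ''W'') (cell s ''W'' d) (fst (S i)) = snd (S i))"
  shows "trained d n S s"
proof -
  have "counter s ''d'' = counter (load_sample d n S) ''d''"
    by (rule frame_counter[OF exec_frame[OF assms(1)] vars_Train])
  hence "counter s ''d'' = d" by (simp add: load_sample_def)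
  thus ?thesis using assms(2) by (simp add: trained_def)
qed

lemma halfspaces_labels: "f \<in> halfspaces d \<Longrightarrow> f x \<in> labels"
  by (auto simp: halfspaces_def halfspace_def split: if_splits)

text \<open>On arbitrary real data the margin is positive but has no lower bound in terms of the
  input size, so a stopping exponent comes from the Archimedean property; the flag is off and no
  time is claimed.\<close>

lemma exec_Train:
  assumes d: "1 \<le> d" and f: "f \<in> halfspaces d" "\<And>i. i < n \<Longrightarrow> snd (S i) = f (fst (S i))"
  shows "\<exists>t s. exec Train (load_sample d n S) t s \<and> trained d n S s"
proof -
  have y: "snd (S i) \<in> labels" if "i < n" for i using f(2)[OF that] halfspaces_labels[OF f(1)] by simp
  obtain Kp where Kp: "0 < n \<Longrightarrow> 64 / 2 ^ Kp \<le> nrm2 (d + 1) (zp d {..<n} S)"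
  proof (cases "0 < n")
    case True
    have g: "0 < nrm2 (d + 1) (zp d {..<n} S)" by (rule realizable_margin[OF True y f])
    obtain k where "64 / nrm2 (d + 1) (zp d {..<n} S) < 2 ^ k"
      using real_arch_pow[of 2 "64 / nrm2 (d + 1) (zp d {..<n} S)"] by auto
    hence "64 < 2 ^ k * nrm2 (d + 1) (zp d {..<n} S)" using g by (simp only: pos_divide_less_eq)
    hence "64 / 2 ^ k \<le> nrm2 (d + 1) (zp d {..<n} S)"
      by (subst pos_divide_le_eq) (simp_all add: mult.commute)
    thus ?thesis by (intro that)
  qed (use that in simp)
  have "runs False 0 Train (load_sample d n S) (100 + ((n * (d * 300 + 220) + 20) +
      (((Kp + 1) * (n * ((d + 1) * ((d + 1) * 0)) * 0 * 10000 + 10) + 20) + ((d + 1) * (0 * 200 + 300) + 20))))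
    (\<lambda>s. 0 < n \<longrightarrow> (\<exists>c\<in>codes (d + 1). \<forall>j<d + 1. cell s ''W'' j = cnd (d + 1) c (zp d {..<n} S) j) \<and>
      (\<forall>i<n. halfspace d (cell s ''W'') (cell s ''W'' d) (fst (S i)) = snd (S i)))"
    by (rule runs_Train[OF d y Kp, where L = 0]) simp_all
  then obtain t s where t: "exec Train (load_sample d n S) t s" and
    "0 < n \<longrightarrow> (\<exists>c\<in>codes (d + 1). \<forall>j<d + 1. cell s ''W'' j = cnd (d + 1) c (zp d {..<n} S) j) \<and>
      (\<forall>i<n. halfspace d (cell s ''W'') (cell s ''W'' d) (fst (S i)) = snd (S i))"
    unfolding runs_def by blast
  thus ?thesis using trainedI[OF t] by blast
qed

lemma load_point_simps [simp]:
  "counter (load_point d x s) = counter s" "cell (load_point d x s) ''W'' = cell s ''W''"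
  "cell (load_point d x s) ''x'' = (\<lambda>j. if j < d then x j else 0)"
  by (simp_all add: load_point_def)

lemma exec_Predict:
  assumes "counter s ''d'' = d"
  shows "\<exists>t' s'. exec Predict (load_point d x s) t' s' \<and>
    cell s' ''label'' 0 = of_int (halfspace d (cell s ''W'') (cell s ''W'' d) x)"
proof -
  have "runs False 0 Predict (load_point d x s) (d * 100 + 100) (\<lambda>s'. cell s' ''label'' 0 =
      of_int (halfspace d (cell (load_point d x s) ''W'') (cell (load_point d x s) ''W'' d) x))"
    by (rule runs_Predict[where B = 0]) (use assms in simp_all)
  thus ?thesis unfolding runs_def load_point_simps by blast
qed

definition halfspace_learner :: learner where
  "halfspace_learner = \<lparr>training = Train, prediction = Predict\<rparr>"

lemma outputs_trained:
  assumes "exec Train (load_sample d n S) t s" "trained d n S s"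
  shows "outputs halfspace_learner d n S (halfspace d (cell s ''W'') (cell s ''W'' d))"
proof -
  have "\<forall>x\<in>space (Rd d). \<exists>t' s'. exec Predict (load_point d x s) t' s' \<and>
      cell s' ''label'' 0 = of_int (halfspace d (cell s ''W'') (cell s ''W'' d) x)"
    using exec_Predict assms(2) unfolding trained_def by blast
  thus ?thesis using assms(1) measurable_halfspace
    unfolding outputs_def halfspace_learner_def by auto
qed

lemma realizable_halfspace_learner: "realizable_learner halfspace_learner"
  unfolding realizable_learner_def
proof (intro allI impI)
  fix d n :: nat and S assume d: "1 \<le> d" and r: "realizable_sample d n S"
  then obtain f where "f \<in> halfspaces d" "\<forall>i<n. snd (S i) = f (fst (S i))" unfolding realizable_sample_def by blast
  then obtain t s where "exec Train (load_sample d n S) t s" "trained d n S s" using exec_Train[OF d, of f n S] by blast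
  from outputs_trained[OF this] show "\<exists>f. outputs halfspace_learner d n S f" by blast
qed

lemma coordinate_fits:
  assumes "rational_point d x" "j < d"
  shows "fits (point_size d x) (x j)"
proof -
  have "real_bits (x j) \<le> point_size d x" unfolding point_size_def using assms(2) by (intro member_le_sum) auto
  thus ?thesis using fits_mono[OF fits_real_bits] assms by (auto simp: rational_point_def)
qed

text \<open>A single number \<open>v\<close> dominates the dimension, the sample size and the bit
  length of each coordinate, which reduces all bounds to functions of one variable.\<close>

lemma exec_Train_time:
  assumes d: "1 \<le> d" and f: "f \<in> halfspaces d" "\<And>i. i < n \<Longrightarrow> snd (S i) = f (fst (S i))"
    and rat: "\<And>i. i < n \<Longrightarrow> rational_point d (fst (S i))"
  defines "v \<equiv> sample_size d n S + 1"
  shows "\<exists>t s. exec Train (load_sample d n S) t s \<and> t \<le> cv v * (bv v + 1) \<and> trained d n S s \<and> state_fits (bv v) s"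
proof -
  let ?z = "zp d {..<n} S" and ?m = "d + 1"
  have y: "snd (S i) \<in> labels" if "i < n" for i using f(2)[OF that] halfspaces_labels[OF f(1)] by simp
  have dv: "?m \<le> v" "n \<le> v" "d \<le> v" by (simp_all add: v_def sample_size_def)
  have L: "fits v (fst (S i) j)" if "i < n" "j < d" for i j
  proof (rule fits_mono[OF coordinate_fits[OF rat[OF that(1)] that(2)]])
    have "point_size d (fst (S i)) \<le> (\<Sum>i<n. point_size d (fst (S i)))" using that by (intro member_le_sum) auto
    thus "point_size d (fst (S i)) \<le> v" by (simp add: v_def sample_size_def)
  qed
  have ab: "abits d v \<le> aN v" unfolding abits_def aN_def by (intro add_mono mult_le_mono dv order_refl)
  define E where "E = ?m * (?m + 2) + 2 * (abits d v * n * ?m * ?m) + 6"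
  have E: "E \<le> Kv v" unfolding E_def Kv_def by (intro add_mono mult_le_mono dv ab order_refl)
  have Kp: "64 / 2 ^ Kv v \<le> nrm2 ?m ?z" if n: "0 < n"
  proof -
    have "64 / 2 ^ Kv v \<le> (64::real) / 2 ^ E" using E by (intro divide_left_mono power_increasing) auto
    also have "\<dots> \<le> nrm2 ?m ?z" unfolding E_def
    proof (rule rational_margin)
      show "0 < nrm2 ?m ?z" by (rule realizable_margin[OF n y f])
      show "mnp ?m {..<n} (\<lambda>i. avec d (S i)) ?z" using n by (intro zp_mnp) auto
    qed (use avec_l1 y avec_fits L in blast)+
    finally show ?thesis .
  qed
  have N0: "ellipsoid.T ?m (Kv v) + ellipsoid.J ?m (Kv v) + 10 + abits d v \<le> Nv v"
    unfolding ellipsoid.T_def ellipsoid.J_def Nv_def by (intro add_mono mult_le_mono dv ab order_refl)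
  have b: "100 * (?m * (?m * Nv v)) \<le> bv v" unfolding bv_def by (intro mult_le_mono dv order_refl)
  let ?cost = "100 + ((n * (d * 300 + 220) + 20) +
      (((Kv v + 1) * (n * (?m * (?m * Nv v)) * Nv v * 10000 + 10) + 20) + (?m * (Nv v * 200 + 300) + 20)))"
  have cost: "?cost \<le> cv v" unfolding cv_def by (intro add_mono mult_le_mono dv order_refl)
  have r: "runs True (bv v) Train (load_sample d n S) ?cost
    (\<lambda>s. 0 < n \<longrightarrow> (\<exists>c\<in>codes ?m. \<forall>j<?m. cell s ''W'' j = cnd ?m c ?z j) \<and>
      (\<forall>i<n. halfspace d (cell s ''W'') (cell s ''W'' d) (fst (S i)) = snd (S i)))"
    by (rule runs_Train[OF d y Kp L N0 b])
  have vb: "v \<le> bv v"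
  proof -
    have "1 \<le> Nv v" by (simp add: Nv_def)
    moreover have "1 \<le> v" by (simp add: v_def)
    ultimately have "1 * (v * (1 * 1)) \<le> 100 * (v * (v * Nv v))" by (intro mult_le_mono) simp_all
    thus ?thesis by (simp add: bv_def)
  qed
  have "state_fits (bv v) (load_sample d n S)"
  proof -
    have "fits (bv v) (cell (load_sample d n S) w k)" for w k
    proof -
      have "fits (bv v) (fst (S (k div d)) (k mod d))" if "k < n * d"
      proof (rule fits_mono[OF L vb])
        show "k div d < n" using that by (simp add: less_mult_imp_div_less)
        show "k mod d < d" using d by simp
      qed
      moreover have "fits (bv v) (of_int (snd (S k)))" if "k < n"
      proof (rule fits_of_int)
        have "1 \<le> bv v" using vb by (simp add: v_def)
        hence "(2::int) ^ 1 \<le> 2 ^ bv v" by (intro power_increasing) auto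
        thus "\<bar>snd (S k)\<bar> < 2 ^ bv v" using y[OF that] by auto
      qed
      ultimately show ?thesis by (simp add: load_sample_def)
    qed
    moreover have "counter (load_sample d n S) w < 2 ^ bv v" for w
    proof -
      have "counter (load_sample d n S) w \<le> v" using dv by (simp add: load_sample_def)
      also note vb
      also have "bv v < 2 ^ bv v" by (rule less_exp)
      finally show ?thesis .
    qed
    ultimately show ?thesis by (simp add: state_fits_def)
  qed
  then obtain t s where t: "exec Train (load_sample d n S) t s" "state_fits (bv v) s" "t \<le> ?cost * (bv v + 1)" and
    Q: "0 < n \<longrightarrow> (\<exists>c\<in>codes ?m. \<forall>j<?m. cell s ''W'' j = cnd ?m c ?z j) \<and>
      (\<forall>i<n. halfspace d (cell s ''W'') (cell s ''W'' d) (fst (S i)) = snd (S i))"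
    using r unfolding runs_def by blast
  have "t \<le> cv v * (bv v + 1)" using t(3) mult_le_mono1[OF cost] by (rule order_trans)
  thus ?thesis using t(1,2) trainedI[OF t(1) Q] by blast
qed

text \<open>The weights left by training are input to the prediction, which is why
  \<open>exec_Train_time\<close> also delivers their bit length \<open>B\<close>.\<close>

lemma exec_Predict_time:
  assumes c: "counter s ''d'' = d" and s: "state_fits B s" and x: "rational_point d x"
  defines "p \<equiv> point_size d x"
  shows "\<exists>t' s'. exec Predict (load_point d x s) t' s' \<and>
    cell s' ''label'' 0 = of_int (halfspace d (cell s ''W'') (cell s ''W'' d) x) \<and>
    t' \<le> (d * 100 + 100) * (d * (2 * (B + p) + 1) + 2 + (B + p) + 1)"
proof -
  let ?b = "d * (2 * (B + p) + 1) + 2 + (B + p)"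
  have xf: "fits (B + p) (x j)" if "j < d" for j
    by (rule fits_mono[OF coordinate_fits[OF x that]]) (simp add: p_def)
  have sf: "fits (B + p) (cell s w k)" for w k
    by (rule fits_mono[of B]) (use s in \<open>simp_all add: state_fits_def\<close>)
  have r: "runs True ?b Predict (load_point d x s) (d * 100 + 100) (\<lambda>s'. cell s' ''label'' 0 =
      of_int (halfspace d (cell (load_point d x s) ''W'') (cell (load_point d x s) ''W'' d) x))"
    by (rule runs_Predict[where B = "B + p"]) (use c xf sf in simp_all)
  have "state_fits ?b (load_point d x s)"
  proof -
    have "fits (B + p) (cell (load_point d x s) w k)" for w k
      using xf sf by (simp add: load_point_def)
    hence "fits ?b (cell (load_point d x s) w k)" for w k by (rule fits_mono) simp
    moreover have "counter s w < 2 ^ ?b" for w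
    proof -
      have "counter s w < 2 ^ B" using s by (simp add: state_fits_def)
      also have "(2::nat) ^ B \<le> 2 ^ ?b" by (rule power_increasing) auto
      finally show ?thesis .
    qed
    ultimately show ?thesis by (simp add: state_fits_def)
  qed
  thus ?thesis using r unfolding runs_def load_point_simps by blast
qed

lemma polynomial_time_halfspace_learner: "polynomial_time halfspace_learner"
proof -
  obtain pt where pt: "\<And>x. cv (x + 1) * (bv (x + 1) + 1) \<le> poly pt x"
    using poly_bounded_cost unfolding poly_bounded_def by blast
  obtain pb where pb: "\<And>x. bv (x + 1) \<le> poly pb x" using poly_bounded_bv unfolding poly_bounded_def by blast
  have "poly_bounded (\<lambda>x. (x * 100 + 100) * (x * (2 * (poly pb x + x) + 1) + 2 + (poly pb x + x) + 1))"
    by (intro poly_bounded_intros)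
  then obtain pp where pp: "\<And>x. (x * 100 + 100) * (x * (2 * (poly pb x + x) + 1) + 2 + (poly pb x + x) + 1) \<le> poly pp x"
    unfolding poly_bounded_def by blast
  show ?thesis
    unfolding polynomial_time_def
  \<comment> \<open>With natural coefficients, the sum dominates both summands, one for training and
    one for prediction.\<close>
  proof (intro exI[of _ "pt + pp"] allI impI, elim conjE)
    fix d n :: nat and S assume d: "1 \<le> d" and r: "realizable_sample d n S"
      and rat: "\<forall>i<n. rational_point d (fst (S i))"
    define N where "N = sample_size d n S"
    obtain f where f: "f \<in> halfspaces d" "\<forall>i<n. snd (S i) = f (fst (S i))" using r unfolding realizable_sample_def by blast
    then obtain t s where t: "exec Train (load_sample d n S) t s" "t \<le> cv (N + 1) * (bv (N + 1) + 1)"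
      "trained d n S s" "state_fits (bv (N + 1)) s"
      using exec_Train_time[OF d, of f n S] rat unfolding N_def by blast
    have cd: "counter s ''d'' = d" using t(3) by (simp add: trained_def)
    have "t \<le> poly (pt + pp) N" using order_trans[OF t(2) pt[of N]] by simp
    moreover have "\<exists>t' s'. exec Predict (load_point d x s) t' s' \<and> t' \<le> poly (pt + pp) (N + point_size d x)"
      if x: "rational_point d x" for x
    proof -
      let ?M = "N + point_size d x"
      obtain t' s' where t': "exec Predict (load_point d x s) t' s'"
        "t' \<le> (d * 100 + 100) * (d * (2 * (bv (N + 1) + point_size d x) + 1) + 2 + (bv (N + 1) + point_size d x) + 1)"
        using exec_Predict_time[OF cd t(4) x] by blast
      have "bv (N + 1) \<le> poly pb ?M" using order_trans[OF pb[of N] poly_mono_nat[of N ?M pb]] by simp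
      hence B: "bv (N + 1) + point_size d x \<le> poly pb ?M + ?M" by simp
      have dM: "d \<le> ?M" by (simp add: N_def sample_size_def)
      note t'(2)
      also have "(d * 100 + 100) * (d * (2 * (bv (N + 1) + point_size d x) + 1) + 2 + (bv (N + 1) + point_size d x) + 1)
        \<le> (?M * 100 + 100) * (?M * (2 * (poly pb ?M + ?M) + 1) + 2 + (poly pb ?M + ?M) + 1)"
        by (intro mult_le_mono add_mono B dM order_refl)
      also have "\<dots> \<le> poly pp ?M" by (rule pp)
      also have "\<dots> \<le> poly (pt + pp) ?M" by simp
      finally show ?thesis using t'(1) by blast
    qed
    ultimately show "\<exists>t s. exec (training halfspace_learner) (load_sample d n S) t s \<and> t \<le> poly (pt + pp) (sample_size d n S) \<and>
       (\<forall>x\<in>space (Rd d). rational_point d x \<longrightarrow> (\<exists>t' s'. exec (prediction halfspace_learner) (load_point d x s) t' s' \<and>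
          t' \<le> poly (pt + pp) (sample_size d n S + point_size d x)))"
      using t(1) unfolding halfspace_learner_def learner.simps N_def[symmetric] by blast
  qed
qed

text \<open>Serves small samples: the risk bound is trivial there, but an output is guaranteed only
  on consistent samples, so an event of such samples is still required.\<close>

lemma consistent_event:
  fixes n :: nat
  assumes f: "f \<in> halfspaces d" and real: "realizable_by d P f"
  shows "\<exists>E\<in>sets (Pi\<^sub>M {..<n} (\<lambda>_. P)). measure (Pi\<^sub>M {..<n} (\<lambda>_. P)) E = 1 \<and> (\<forall>S\<in>E. \<forall>i<n. snd (S i) = f (fst (S i)))"
proof -
  have pP: "prob_space P" and P: "sets P = sets (example_space d)" and ae: "AE z in P. snd z = f (fst z)"
    using real by (auto simp: realizable_by_def)
  interpret P: prob_space P by (rule pP)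
  interpret pp: product_prob_space "\<lambda>_. P" UNIV by unfold_locales
  interpret M: prob_space "Pi\<^sub>M {..<n} (\<lambda>_. P)" by (rule prob_space_PiM) (rule pP)
  define G where "G = {z \<in> space P. f (fst z) = snd z}"
  obtain w b where wb: "f = halfspace d w b" using f by (auto simp: halfspaces_def)
  have Gc: "G = space P - {z \<in> space P. f (fst z) \<noteq> snd z}" by (auto simp: G_def)
  have Gs: "G \<in> sets P" unfolding Gc wb using sets_halfspace_error[OF P] by auto
  have "emeasure P G = 1"
    by (rule P.emeasure_eq_1_AE[OF Gs]) (use ae AE_space in \<open>eventually_elim, auto simp: G_def\<close>)
  hence "emeasure (Pi\<^sub>M {..<n} (\<lambda>_. P)) (\<Pi>\<^sub>E i\<in>{..<n}. G) = 1" using Gs by (subst pp.emeasure_PiM) auto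
  hence "measure (Pi\<^sub>M {..<n} (\<lambda>_. P)) (\<Pi>\<^sub>E i\<in>{..<n}. G) = 1" by (simp add: M.emeasure_eq_measure)
  moreover have "(\<Pi>\<^sub>E i\<in>{..<n}. G) \<in> sets (Pi\<^sub>M {..<n} (\<lambda>_. P))" using Gs by (intro sets_PiM_I_finite) auto
  moreover have "\<forall>S\<in>(\<Pi>\<^sub>E i\<in>{..<n}. G). \<forall>i<n. snd (S i) = f (fst (S i))" by (auto simp: G_def PiE_iff)
  ultimately show ?thesis by blast
qed

lemma tlog_ge: "1 \<le> tlog x" "0 < x \<Longrightarrow> ln x \<le> tlog x"
proof -
  have p: "0 < max x (exp 1)" by (rule less_le_trans[OF exp_gt_zero max.cobounded2])
  have "ln (exp 1) \<le> ln (max x (exp 1))" using p by (subst ln_le_cancel_iff) simp_all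
  thus "1 \<le> tlog x" by (simp add: tlog_def)
  show "ln x \<le> tlog x" if "0 < x" unfolding tlog_def using that p by (subst ln_le_cancel_iff) simp_all
qed

theorem corollary18:
  "\<exists>C>0. \<exists>A. realizable_learner A \<and> polynomial_time A \<and>
     (\<forall>d\<ge>1. \<forall>n\<ge>1. \<forall>P. \<forall>f\<in>halfspaces d. realizable_by d P f \<longrightarrow>
        (\<forall>\<delta>::real. 0 < \<delta> \<and> \<delta> < 1 \<longrightarrow>
           (\<exists>E\<in>sets (Pi\<^sub>M {..<n} (\<lambda>_. P)).
              measure (Pi\<^sub>M {..<n} (\<lambda>_. P)) E \<ge> 1 - \<delta> \<and>
              (\<forall>S\<in>E. \<exists>g. outputs A d n S g \<and>
                 risk P g \<le> C * (real d * tlog (real d) / real n + tlog (1 / \<delta>) / real n)))))"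
proof (intro exI[of _ "40::real"] exI[of _ halfspace_learner] conjI allI ballI impI)
  show "realizable_learner halfspace_learner" by (rule realizable_halfspace_learner)
  show "polynomial_time halfspace_learner" by (rule polynomial_time_halfspace_learner)
next
  fix d n :: nat and P f and \<delta> :: real
  assume d: "1 \<le> d" and n: "1 \<le> n" and f: "f \<in> halfspaces d" and real: "realizable_by d P f" and dl: "0 < \<delta> \<and> \<delta> < 1"
  define g :: real where "g = real d * tlog (real d) / real n + tlog (1 / \<delta>) / real n"
  have "real d * 1 \<le> real d * tlog (real d)" by (intro mult_left_mono tlog_ge) auto
  hence dn: "real d / real n \<le> real d * tlog (real d) / real n" by (intro divide_right_mono) auto
  have tl: "0 \<le> tlog (1 / \<delta>) / real n" using tlog_ge(1)[of "1 / \<delta>"] by (intro divide_nonneg_nonneg) auto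
  let ?M = "Pi\<^sub>M {..<n} (\<lambda>_. P)"
  show "\<exists>E\<in>sets ?M. 1 - \<delta> \<le> measure ?M E \<and> (\<forall>S\<in>E. \<exists>h. outputs halfspace_learner d n S h \<and>
      risk P h \<le> 40 * (real d * tlog (real d) / real n + tlog (1 / \<delta>) / real n))"
    unfolding g_def[symmetric]
  proof (cases "2 * (d + 1) \<le> n")
    case False
    obtain E where E: "E \<in> sets ?M" "measure ?M E = 1" "\<forall>S\<in>E. \<forall>i<n. snd (S i) = f (fst (S i))"
      using consistent_event[OF f real, of n] by blast
    \<comment> \<open>For small samples the right-hand side exceeds 1, since d / n is at least 1 /
      4.\<close>
    have "real n \<le> 4 * real d" using False d by simp
    hence "1 / 4 \<le> real d / real n" using n by (simp add: field_simps)
    hence "1 / 4 \<le> real d * tlog (real d) / real n" using dn by (rule order_trans)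
    hence "1 / 4 \<le> g" unfolding g_def by (rule add_increasing2[OF tl])
    hence g: "1 \<le> 40 * g" by simp
    have "prob_space P" using real by (simp add: realizable_by_def)
    hence r1: "risk P h \<le> 1" for h unfolding risk_def by (rule prob_space.prob_le_1)
    have "\<exists>h. outputs halfspace_learner d n S h \<and> risk P h \<le> 40 * g" if "S \<in> E" for S
    proof -
      obtain t s where "exec Train (load_sample d n S) t s" "trained d n S s"
        using exec_Train[OF d f, of n S] E(3) \<open>S \<in> E\<close> by blast
      from outputs_trained[OF this] show ?thesis using order_trans[OF r1 g] by blast
    qed
    thus "\<exists>E\<in>sets ?M. 1 - \<delta> \<le> measure ?M E \<and> (\<forall>S\<in>E. \<exists>h. outputs halfspace_learner d n S h \<and> risk P h \<le> 40 * g)"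
      using E(1,2) dl by (intro bexI[of _ E]) auto
  next
    case True
    from dl have dl': "0 < \<delta>" "\<delta> < 1" by auto
    obtain E where E: "E \<in> sets ?M" "1 - \<delta> \<le> measure ?M E" "\<And>S. S \<in> E \<Longrightarrow> \<forall>i<n. snd (S i) = f (fst (S i))"
      and risk: "\<And>S W c. S \<in> E \<Longrightarrow> c \<in> codes (d + 1) \<Longrightarrow> \<forall>j<d + 1. W j = cnd (d + 1) c (zp d {..<n} S) j \<Longrightarrow>
        \<forall>i<n. halfspace d W (W d) (fst (S i)) = snd (S i) \<Longrightarrow>
        risk P (halfspace d W (W d)) \<le> 4 * (5 * real (d + 1) + ln (1 / \<delta>)) / real n"
      using stable_risk_bound[OF d True f real dl'] by blast
    have "ln (1 / \<delta>) \<le> tlog (1 / \<delta>)" using dl' by (intro tlog_ge) simp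
    \<comment> \<open>The origin of the constant 40: 20 (d + 1) is at most 40 d for \<open>d\<close>
      at least 1.\<close>
    hence "4 * (5 * real (d + 1) + ln (1 / \<delta>)) \<le> 40 * (real d + tlog (1 / \<delta>))"
      using d tlog_ge(1)[of "1 / \<delta>"] by simp
    hence "4 * (5 * real (d + 1) + ln (1 / \<delta>)) / real n \<le> 40 * (real d + tlog (1 / \<delta>)) / real n"
      by (intro divide_right_mono) auto
    also have "\<dots> = 40 * (real d / real n + tlog (1 / \<delta>) / real n)" by (simp add: add_divide_distrib)
    also have "\<dots> \<le> 40 * g" using dn unfolding g_def by simp
    finally have g: "4 * (5 * real (d + 1) + ln (1 / \<delta>)) / real n \<le> 40 * g" .
    have "\<exists>h. outputs halfspace_learner d n S h \<and> risk P h \<le> 40 * g" if S: "S \<in> E" for S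
    proof -
      obtain t s where ts: "exec Train (load_sample d n S) t s" "trained d n S s"
        using exec_Train[OF d f, of n S] E(3)[OF S] by blast
      moreover have "0 < n" using n by simp
      ultimately have "\<exists>c\<in>codes (d + 1). \<forall>j<d + 1. cell s ''W'' j = cnd (d + 1) c (zp d {..<n} S) j"
        and cons: "\<forall>i<n. halfspace d (cell s ''W'') (cell s ''W'' d) (fst (S i)) = snd (S i)"
        unfolding trained_def by blast+
      then obtain c where c: "c \<in> codes (d + 1)" "\<forall>j<d + 1. cell s ''W'' j = cnd (d + 1) c (zp d {..<n} S) j" by blast
      from order_trans[OF risk[OF S c cons] g] show ?thesis using outputs_trained[OF ts] by blast
    qed
    thus "\<exists>E\<in>sets ?M. 1 - \<delta> \<le> measure ?M E \<and> (\<forall>S\<in>E. \<exists>h. outputs halfspace_learner d n S h \<and> risk P h \<le> 40 * g)"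
      using E(1,2) by (intro bexI[of _ E]) auto
  qed
qed simp

end
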